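(* There is $C>0$ such that the following holds. Let $\Lambda$ be a finite set, let $\theta_r\in(0,1)$ for every $r\in\Lambda$, and let $\{I_r\}_{r\in\Lambda}$ be a finite partition of $I=[0,1]$ by intervals satisfying $|I_r|\theta_r^{-1}<1$. If $p>1$ and $\epsilon_0>0$ satisfy $$(\#\Lambda)^{1/p'}\big(\max_r\theta_r\big)^{1/p'+s-\epsilon_0}\le C,$$ then there is $\delta>0$ with the following property. Choose a collection of intervals $\{J_r\}_{r\in\Lambda}$ in $I$ such that $\theta_r=|I_r|/|J_r|<1$ for every $r$; write $I_r=[a_r,b_r]$, $J_r=[c_r,d_r]$. Suppose that $\alpha_r\colon I\to\mathbb{R}$ belongs to $\mathcal{B}^{1/p}_{p,\infty}(I)\cap L^\infty$, $\int\alpha_r\,dm=0$, $|\alpha_r|_\infty<\min\{1-\theta_r,\theta_r\}$ and $\alpha_r(x)=0$ for every $x\notin J_r$. Define the bi-Lipschitz map $h_r\colon J_r\to I_r$ by $h_r(x)=a_r+\int_{[c_r,x]}(\alpha_r+\theta_r)\,dm$, and consider the piecewise expanding map $F\colon\bigcup_rI_r\to I$ defined by $F(x)=h_r^{-1}(x)$ for $x\in I_r$. If $$\max_r\{|\alpha_r|_{\mathcal{B}^{1/p}_{p,\infty}}+|\alpha_r|_\infty\}<\delta,$$ then: (A) the transfer operator $\Phi$ of $F$ is quasi-compact on $\mathcal{B}^s_{p,q}$; (B) $\Phi$ satisfies the Lasota–Yorke inequality for the pair $(\mathcal{B}^s_{p,q},L^1)$; (C) $F$ has an absolutely continuous invariant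 probability $\mu$; (D) every absolutely continuous invariant probability $\mu=\rho\,m$ of $F$ satisfies $\rho\in\mathcal{B}^s_{p,q}$.
   Context: Parameters: $1/p+1/p'=1$; $s$ and $q$ are the parameters of the space $\mathcal{B}^s_{p,q}$, with $0<s<1/p$ and $q\in[1,\infty]$. $I=[0,1]$ carries Lebesgue measure $m$, $|A|=m(A)$, and the dyadic grid $\mathcal{D}=(\mathcal{D}^k)_k$, $\mathcal{D}^k$ being the partition of $[0,1]$ into $2^k$ intervals of equal length (partitions are understood up to endpoints). Besov space. For $\sigma>0$, $p\in[1,\infty)$, $q\in[1,\infty]$ put $a_Q=|Q|^{\sigma-1/p}1_Q$. $\mathcal{B}^\sigma_{p,q}=\mathcal{B}^\sigma_{p,q}(I)=\mathcal{B}^\sigma_{p,q}([0,1],m,\mathcal{D})$ is the space of $\psi\in L^p(m)$ that can be written $\psi=\sum_k\sum_{Q\in\mathcal{D}^k}c_Qa_Q$ (the series in $k$ converging in $L^p$) with $\big(\sum_k(\sum_{Q\in\mathcal{D}^k}|c_Q|^p)^{q/p}\big)^{1/q}<\infty$ (supremum over $k$ if $q=\infty$); its norm is the infimum of this quantity over all representations. Transfer operator: $(\Phi\psi)(x)=\sum_{r:\,x\in J_r}(\alpha_r(x)+\theta_r)\,\psi(h_r(x))$. Lasota–Yorke inequality for the pair $(\mathcal{B}^s_{p,q},L^1)$: there are $n\ge1$, $K>0$ and $\lambda\in(0,1)$ with $|\Phi^n\psi|_{\mathcal{B}^s_{p,q}}\le K|\psi|_{L^1}+\lambda|\psi|_{\mathcal{B}^s_{p,q}}$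 for all $\psi\in\mathcal{B}^s_{p,q}$. *)

theory Defs
  imports "HOL-Probability.Probability"
begin

text \<open>
  Functions on \<open>I = [0,1]\<close> are total functions on the reals, measured by Lebesgue measure on
  \<open>I\<close>, so their values off \<open>I\<close> are irrelevant; the function spaces below are sets of such
  functions, and equality in them is equality almost everywhere.  Scalars are complex.
\<close>

abbreviation leb01 :: "real measure" where
  "leb01 \<equiv> lebesgue_on {0..1}"

section \<open>Lebesgue spaces\<close>

definition Lp_fun :: "real \<Rightarrow> (real \<Rightarrow> complex) \<Rightarrow> bool" where
  "Lp_fun p f \<longleftrightarrow>
     f \<in> borel_measurable leb01 \<and> integrable leb01 (\<lambda>x. cmod (f x) powr p)"

definition Lp_norm :: "real \<Rightarrow> (real \<Rightarrow> complex) \<Rightarrow> real" where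
  "Lp_norm p f = (LINT x|leb01. cmod (f x) powr p) powr (1 / p)"

definition Linf_fun :: "(real \<Rightarrow> complex) \<Rightarrow> bool" where
  "Linf_fun f \<longleftrightarrow>
     f \<in> borel_measurable leb01 \<and> esssup leb01 (\<lambda>x. ereal (cmod (f x))) < \<infinity>"

definition Linf_norm :: "(real \<Rightarrow> complex) \<Rightarrow> real" where
  "Linf_norm f = real_of_ereal (esssup leb01 (\<lambda>x. ereal (cmod (f x))))"

section \<open>Besov spaces by atomic decomposition\<close>

text \<open>\<open>dyadic k j\<close>, \<open>j < 2 ^ k\<close>, are the elements of \<open>\<D>\<^sup>k\<close>.\<close>

definition dyadic :: "nat \<Rightarrow> nat \<Rightarrow> real set" where
  "dyadic k j = {real j / 2 ^ k ..< (real j + 1) / 2 ^ k}"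

definition atom :: "real \<Rightarrow> real \<Rightarrow> real set \<Rightarrow> real \<Rightarrow> complex" where
  "atom \<sigma> p Q x = of_real (measure lebesgue Q powr (\<sigma> - 1 / p)) * indicator Q x"

text \<open>A coefficient family is \<open>c k j = c\<^sub>Q\<close> with \<open>Q = dyadic k j\<close>; its entries with
  \<open>j \<ge> 2 ^ k\<close> are ignored.\<close>

definition besov_rep ::
  "real \<Rightarrow> real \<Rightarrow> (nat \<Rightarrow> nat \<Rightarrow> complex) \<Rightarrow> (real \<Rightarrow> complex) \<Rightarrow> bool" where
  "besov_rep \<sigma> p c f \<longleftrightarrow>
     (\<lambda>n. Lp_norm p (\<lambda>x. f x - (\<Sum>k<n. \<Sum>j<2 ^ k. c k j * atom \<sigma> p (dyadic k j) x)))
       \<longlonglongrightarrow> 0"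

definition coeff_finite :: "real \<Rightarrow> ereal \<Rightarrow> (nat \<Rightarrow> nat \<Rightarrow> complex) \<Rightarrow> bool" where
  "coeff_finite p q c \<longleftrightarrow>
     (if q = \<infinity>
      then bdd_above (range (\<lambda>k. (\<Sum>j<2 ^ k. cmod (c k j) powr p) powr (1 / p)))
      else summable (\<lambda>k. (\<Sum>j<2 ^ k. cmod (c k j) powr p) powr (real_of_ereal q / p)))"

definition coeff_norm :: "real \<Rightarrow> ereal \<Rightarrow> (nat \<Rightarrow> nat \<Rightarrow> complex) \<Rightarrow> real" where
  "coeff_norm p q c =
     (if q = \<infinity>
      then (SUP k. (\<Sum>j<2 ^ k. cmod (c k j) powr p) powr (1 / p))
      else (\<Sum>k. (\<Sum>j<2 ^ k. cmod (c k j) powr p) powr (real_of_ereal q / p))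
             powr (1 / real_of_ereal q))"

definition besov :: "real \<Rightarrow> real \<Rightarrow> ereal \<Rightarrow> (real \<Rightarrow> complex) set" where
  "besov \<sigma> p q = {f. Lp_fun p f \<and> (\<exists>c. besov_rep \<sigma> p c f \<and> coeff_finite p q c)}"

definition besov_norm :: "real \<Rightarrow> real \<Rightarrow> ereal \<Rightarrow> (real \<Rightarrow> complex) \<Rightarrow> real" where
  "besov_norm \<sigma> p q f =
     Inf {coeff_norm p q c | c. besov_rep \<sigma> p c f \<and> coeff_finite p q c}"

section \<open>Quasi-compact operators\<close>

text \<open>
  Here \<open>X\<close> is a set of functions and \<open>N\<close> its norm, functions being identified when they agree
  almost everywhere on \<open>I\<close>.
\<close>

definition bounded_operator_on ::
  "(real \<Rightarrow> complex) set \<Rightarrow> ((real \<Rightarrow> complex) \<Rightarrow> real)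
     \<Rightarrow> ((real \<Rightarrow> complex) \<Rightarrow> real \<Rightarrow> complex) \<Rightarrow> bool" where
  "bounded_operator_on X N T \<longleftrightarrow>
     (\<forall>f\<in>X. T f \<in> X) \<and>
     (\<forall>f\<in>X. \<forall>g\<in>X. (AE x in leb01. f x = g x) \<longrightarrow> (AE x in leb01. T f x = T g x)) \<and>
     (\<forall>f\<in>X. \<forall>g\<in>X. AE x in leb01. T (\<lambda>y. f y + g y) x = T f x + T g x) \<and>
     (\<forall>z. \<forall>f\<in>X. AE x in leb01. T (\<lambda>y. z * f y) x = z * T f x) \<and>
     (\<exists>K. \<forall>f\<in>X. N (T f) \<le> K * N f)"

definition shifted ::
  "complex \<Rightarrow> ((real \<Rightarrow> complex) \<Rightarrow> real \<Rightarrow> complex) \<Rightarrow> (real \<Rightarrow> complex) \<Rightarrow> real \<Rightarrow> complex" where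
  "shifted z T f x = z * f x - T f x"

definition invertible_on ::
  "(real \<Rightarrow> complex) set \<Rightarrow> ((real \<Rightarrow> complex) \<Rightarrow> real)
     \<Rightarrow> ((real \<Rightarrow> complex) \<Rightarrow> real \<Rightarrow> complex) \<Rightarrow> bool" where
  "invertible_on X N S \<longleftrightarrow>
     (\<forall>f\<in>X. (AE x in leb01. S f x = 0) \<longrightarrow> (AE x in leb01. f x = 0)) \<and>
     (\<forall>g\<in>X. \<exists>f\<in>X. AE x in leb01. S f x = g x) \<and>
     (\<exists>K. \<forall>f\<in>X. N f \<le> K * N (S f))"

text \<open>
  Finite-dimensional kernel and range of finite codimension.  The range of a bounded operator
  between Banach spaces is then automatically closed.
\<close>

definition fredholm_on ::
  "(real \<Rightarrow> complex) set \<Rightarrow> ((real \<Rightarrow> complex) \<Rightarrow> real \<Rightarrow> complex) \<Rightarrow> bool" where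
  "fredholm_on X S \<longleftrightarrow>
     (\<exists>B. finite B \<and> B \<subseteq> X \<and>
        (\<forall>f\<in>X. (AE x in leb01. S f x = 0) \<longrightarrow>
           (\<exists>w. AE x in leb01. f x = (\<Sum>e\<in>B. w e * e x)))) \<and>
     (\<exists>B. finite B \<and> B \<subseteq> X \<and>
        (\<forall>g\<in>X. \<exists>f\<in>X. \<exists>w. AE x in leb01. g x = S f x + (\<Sum>e\<in>B. w e * e x)))"

definition spectrum_on ::
  "(real \<Rightarrow> complex) set \<Rightarrow> ((real \<Rightarrow> complex) \<Rightarrow> real)
     \<Rightarrow> ((real \<Rightarrow> complex) \<Rightarrow> real \<Rightarrow> complex) \<Rightarrow> complex set" where
  "spectrum_on X N T = {z. \<not> invertible_on X N (shifted z T)}"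

definition essential_spectrum_on ::
  "(real \<Rightarrow> complex) set \<Rightarrow> ((real \<Rightarrow> complex) \<Rightarrow> real \<Rightarrow> complex) \<Rightarrow> complex set" where
  "essential_spectrum_on X T = {z. \<not> fredholm_on X (shifted z T)}"

text \<open>
  Quasi-compact: the essential spectral radius is strictly smaller than the spectral radius.
  (The usual variants of the essential spectrum all have the same radius.)
\<close>

definition quasi_compact_on ::
  "(real \<Rightarrow> complex) set \<Rightarrow> ((real \<Rightarrow> complex) \<Rightarrow> real)
     \<Rightarrow> ((real \<Rightarrow> complex) \<Rightarrow> real \<Rightarrow> complex) \<Rightarrow> bool" where
  "quasi_compact_on X N T \<longleftrightarrow>
     bounded_operator_on X N T \<and>
     (SUP z\<in>essential_spectrum_on X T. ennreal (cmod z))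
       < (SUP z\<in>spectrum_on X N T. ennreal (cmod z))"

definition lasota_yorke ::
  "(real \<Rightarrow> complex) set \<Rightarrow> ((real \<Rightarrow> complex) \<Rightarrow> real)
     \<Rightarrow> ((real \<Rightarrow> complex) \<Rightarrow> real \<Rightarrow> complex) \<Rightarrow> bool" where
  "lasota_yorke X N T \<longleftrightarrow>
     (\<exists>n\<ge>1. \<exists>K>0. \<exists>l\<in>{0<..<1}. \<forall>f\<in>X.
        (T ^^ n) f \<in> X \<and> N ((T ^^ n) f) \<le> K * Lp_norm 1 f + l * N f)"

section \<open>Piecewise expanding maps\<close>

definition interval_partition :: "nat set \<Rightarrow> (nat \<Rightarrow> real) \<Rightarrow> (nat \<Rightarrow> real) \<Rightarrow> bool" where
  "interval_partition \<Lambda> a b \<longleftrightarrow>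
     finite \<Lambda> \<and> (\<forall>r\<in>\<Lambda>. a r < b r) \<and> (\<Union>r\<in>\<Lambda>. {a r..b r}) = {0..1} \<and>
     disjoint_family_on (\<lambda>r. {a r<..<b r}) \<Lambda>"

definition branch ::
  "(nat \<Rightarrow> real \<Rightarrow> real) \<Rightarrow> (nat \<Rightarrow> real) \<Rightarrow> (nat \<Rightarrow> real) \<Rightarrow> (nat \<Rightarrow> real)
     \<Rightarrow> nat \<Rightarrow> real \<Rightarrow> real" where
  "branch \<alpha> \<theta> a c r x = a r + (LINT t:{c r..x}|leb01. \<alpha> r t + \<theta> r)"

text \<open>
  Neighbouring intervals \<open>I\<^sub>r\<close> share an endpoint, at which \<open>F\<close> may take the value prescribed by
  either of them; elsewhere \<open>F\<close> is determined.
\<close>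

definition is_piecewise_map ::
  "nat set \<Rightarrow> (nat \<Rightarrow> real \<Rightarrow> real) \<Rightarrow> (nat \<Rightarrow> real) \<Rightarrow> (nat \<Rightarrow> real) \<Rightarrow> (nat \<Rightarrow> real)
     \<Rightarrow> (nat \<Rightarrow> real) \<Rightarrow> (nat \<Rightarrow> real) \<Rightarrow> (real \<Rightarrow> real) \<Rightarrow> bool" where
  "is_piecewise_map \<Lambda> \<alpha> \<theta> a b c d F \<longleftrightarrow>
     (\<forall>x\<in>{0..1}. \<exists>r\<in>\<Lambda>. x \<in> {a r..b r} \<and>
        F x = the_inv_into {c r..d r} (branch \<alpha> \<theta> a c r) x)"

definition transfer_op ::
  "nat set \<Rightarrow> (nat \<Rightarrow> real \<Rightarrow> real) \<Rightarrow> (nat \<Rightarrow> real) \<Rightarrow> (nat \<Rightarrow> real) \<Rightarrow> (nat \<Rightarrow> real)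
     \<Rightarrow> (nat \<Rightarrow> real) \<Rightarrow> (real \<Rightarrow> complex) \<Rightarrow> real \<Rightarrow> complex" where
  "transfer_op \<Lambda> \<alpha> \<theta> a c d f x =
     (\<Sum>r\<in>{r\<in>\<Lambda>. x \<in> {c r..d r}}. of_real (\<alpha> r x + \<theta> r) * f (branch \<alpha> \<theta> a c r x))"

definition acip :: "(real \<Rightarrow> real) \<Rightarrow> real measure \<Rightarrow> bool" where
  "acip F \<mu> \<longleftrightarrow>
     sets \<mu> = sets leb01 \<and> prob_space \<mu> \<and> absolutely_continuous leb01 \<mu> \<and>
     F \<in> measurable \<mu> \<mu> \<and> distr \<mu> \<mu> F = \<mu>"

end

theory Submission
  imports Defs "Jordan_Normal_Form.Determinant"
begin

text \<open>
  The coefficients of \<open>f\<close> with respect to the dyadic martingale differences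
  \<open>E\<^sub>k f - E\<^sub>k\<^sub>-\<^sub>1 f\<close> give a norm equivalent to that of \<open>\<B>\<^sup>s\<^sub>p\<^sub>,\<^sub>q\<close> whose balls are closed in
  \<open>L\<^sup>1\<close>.  Split \<open>\<Phi> = A + E\<close>, where \<open>A\<close> has the constant weights \<open>\<theta>\<^sub>r\<close>.  The power \<open>A\<^sup>n\<close> is a sum
  over words of length \<open>n\<close>, and a dyadic interval that is short compared with the cylinders of \<open>F\<^sup>n\<close>
  essentially meets at most two of them; hence on functions with
  \<open>E\<^sub>N f = 0\<close>, \<open>N\<close> large, \<open>A\<^sup>n\<close> has norm at most a constant times \<open>\<kappa>\<^sup>n\<close>, where
  \<open>\<kappa> = (#\<Lambda>)\<^bsup>1/p'\<^esup> (max \<theta>\<^sub>r)\<^bsup>1/p'+s\<^esup> < 1\<close>.  So one may take \<open>C = 1\<close>.  For fixed \<open>n\<close> the difference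
  \<open>\<Phi>\<^sup>n - A\<^sup>n\<close> is small because \<open>\<B>\<^bsup>1/p\<^esup>\<^sub>p\<^sub>,\<^sub>\<infinity> \<inter> L\<^sup>\<infinity>\<close> consists of multipliers of \<open>\<B>\<^sup>s\<^sub>p\<^sub>,\<^sub>q\<close>.
  Thus \<open>\<Phi>\<^sup>n\<close> is a contraction plus a finite rank operator that is bounded on \<open>L\<^sup>1\<close>: this gives the
  Lasota-Yorke inequality and, by Neumann series, the Fredholm property outside a disc of
  radius smaller than 1.  Preservation of integrals yields the eigenvalue 1 of \<open>\<Phi>\<^sup>n\<close>; the modulus of an
  eigenfunction, averaged over \<open>\<Phi>\<close>, is an invariant density.  Conversely, if \<open>\<Phi> \<rho> = \<rho>\<close> in \<open>L\<^sup>1\<close>, then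
  \<open>\<Phi>\<^bsup>in\<^esup> E\<^sub>j \<rho>\<close>, with \<open>i\<close> large depending on \<open>j\<close>, is bounded in \<open>\<B>\<^sup>s\<^sub>p\<^sub>,\<^sub>q\<close> and converges to \<open>\<rho>\<close> in \<open>L\<^sup>1\<close>.
\<close>

section \<open>Power sums and weighted sequence spaces\<close>

text \<open>All estimates compare one dyadic level \<open>i\<close> of the argument with one level
  \<open>k\<close> of the image: a kernel summable in \<open>k - i\<close> gives boundedness by
  Young's inequality. Indicators of intervals have at most two boundary cells per level, hence
  smoothness \<open>1 / p\<close>, and for \<open>0 < s < 1 / p\<close> the kernels are summable on
  both sides. Jensen's inequality over the words of length \<open>n\<close> produces the factor with
  exponent \<open>1 / p'\<close> in \<kappa>, the position of the peak of the kernel the exponent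
  \<open>s\<close>. The obstacle is any further factor growing with \<open>n\<close>. The
  multiplicity two avoids one such factor; the level from which it holds depends on \<open>n\<close>
  and on the \<alpha>_r, but moving it only enlarges the finite rank part. The other one is
  distortion: the constant weights of \<open>A\<close> sit on the perturbed branches h_r, whose
  slopes are only near \<theta>_r, so the ratio per step is kept below \<rho> with
  \<open>\<rho> ^ n = 2\<close>. The order of choices is therefore \<open>n\<close> from \<kappa>,
  then \<rho>, then \<delta>, and the cut-off level last.\<close>

lemma powr_ge_tangent:
  fixes x y p :: real
  assumes "1 \<le> p" "0 < y" "0 \<le> x"
  shows "y powr p + p * y powr (p - 1) * (x - y) \<le> x powr p"
proof (cases "x = 0")
  case True
  have "y powr p = y * y powr (p - 1)"
    using assms by (simp add: powr_diff)
  then have "y powr p + p * y powr (p - 1) * (x - y) = (1 - p) * y powr p"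
    using True by (simp add: algebra_simps)
  also have "\<dots> \<le> 0"
    using assms by (intro mult_nonpos_nonneg) auto
  finally show ?thesis using True by simp
next
  case False
  then have x: "0 < x" using assms by simp
  have "convex_on {0<..} (\<lambda>x. x powr p)"
    using powr_convex assms by blast
  moreover have "((\<lambda>x. x powr p) has_real_derivative p * y powr (p - 1)) (at y within {0<..})"
    using has_real_derivative_powr[OF assms(2)] by (rule has_field_derivative_at_within)
  ultimately have "x powr p - y powr p \<ge> p * y powr (p - 1) * (x - y)"
    using x assms by (intro convex_on_imp_above_tangent[of "{0<..}"]) (auto simp: interior_open is_interval_convex_1)
  then show ?thesis by simp
qed

text \<open>Convexity with weights that need not add up to 1; the power of their total is the price
  of normalising them. This form serves as Hoelder's inequality throughout: the weights are
  coefficients or kernel values, whose total can be controlled.\<close>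

lemma sum_powr_jensen:
  fixes w x :: "'a \<Rightarrow> real"
  assumes "1 \<le> p" "\<And>a. a \<in> S \<Longrightarrow> 0 \<le> w a" "\<And>a. a \<in> S \<Longrightarrow> 0 \<le> x a"
  shows "(\<Sum>a\<in>S. w a * x a) powr p \<le> (\<Sum>a\<in>S. w a) powr (p - 1) * (\<Sum>a\<in>S. w a * x a powr p)"
proof (cases "(\<Sum>a\<in>S. w a * x a) = 0")
  case True
  then show ?thesis using assms by (auto intro!: mult_nonneg_nonneg sum_nonneg)
next
  case False
  let ?W = "\<Sum>a\<in>S. w a" and ?X = "\<Sum>a\<in>S. w a * x a"
  have X: "?X > 0" using False assms by (metis (no_types, lifting) mult_nonneg_nonneg order_less_le sum_nonneg)
  have W: "?W > 0"
  proof (rule ccontr)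
    assume "\<not> ?W > 0"
    then have W0: "?W = 0" using assms(2) sum_nonneg[of S w] by force
    have fin: "finite S" using False by (meson sum.infinite)
    have "\<forall>a\<in>S. w a = 0" using W0 sum_nonneg_eq_0_iff[OF fin, of w] assms(2) by auto
    then show False using False by (simp add: sum.neutral)
  qed
  let ?m = "?X / ?W"
  have m: "?m > 0" using X W by simp
  \<comment> \<open>Tangents are taken at the weighted mean \<open>?m\<close>, so the linear terms
    cancel after summation.\<close>
  have "?W * ?m powr p = (\<Sum>a\<in>S. w a * (?m powr p + p * ?m powr (p - 1) * (x a - ?m)))"
  proof -
    have "(\<Sum>a\<in>S. w a * (s + r * (x a - t))) = ?W * s + r * (?X - ?W * t)" for s r t
      by (simp add: algebra_simps sum.distrib sum_subtractf sum_distrib_left)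
    then have "(\<Sum>a\<in>S. w a * (?m powr p + p * ?m powr (p - 1) * (x a - ?m)))
        = ?W * (?m powr p) + p * ?m powr (p - 1) * (?X - ?W * ?m)" .
    also have "?X - ?W * ?m = 0" using W by simp
    finally show ?thesis by simp
  qed
  also have "\<dots> \<le> (\<Sum>a\<in>S. w a * x a powr p)"
    using assms m by (intro sum_mono mult_left_mono powr_ge_tangent) auto
  finally have "?W * ?m powr p \<le> (\<Sum>a\<in>S. w a * x a powr p)" .
  then have "?W powr (p - 1) * (?W * ?m powr p) \<le> ?W powr (p - 1) * (\<Sum>a\<in>S. w a * x a powr p)"
    by (intro mult_left_mono) auto
  also have "?W powr (p - 1) * (?W * ?m powr p) = ?X powr p"
    using W X by (simp add: powr_diff powr_divide)
  finally show ?thesis .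
qed

text \<open>Upper bounds \<open>X\<close>, \<open>Y\<close> replace the norms, which spares roots.
  For positive bounds, \<open>x a + y a\<close> is \<open>X * (x a / X) + Y * (y a / Y)\<close> and
  Jensen with the two weights \<open>X\<close>, \<open>Y\<close> applies; zero bounds are reached by
  letting \<open>e\<close> tend to 0 in \<open>X + e\<close> and \<open>Y + e\<close>.\<close>

lemma sum_powr_minkowski:
  fixes x y :: "'a \<Rightarrow> real"
  assumes p: "1 \<le> p" and x: "\<And>a. a \<in> S \<Longrightarrow> 0 \<le> x a" and y: "\<And>a. a \<in> S \<Longrightarrow> 0 \<le> y a"
    and X: "(\<Sum>a\<in>S. x a powr p) \<le> X powr p" "0 \<le> X"
    and Y: "(\<Sum>a\<in>S. y a powr p) \<le> Y powr p" "0 \<le> Y"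
  shows "(\<Sum>a\<in>S. (x a + y a) powr p) \<le> (X + Y) powr p"
proof -
  have *: "(\<Sum>a\<in>S. (x a + y a) powr p) \<le> (X + Y) powr p"
    if "(\<Sum>a\<in>S. x a powr p) \<le> X powr p" "0 < X" "(\<Sum>a\<in>S. y a powr p) \<le> Y powr p" "0 < Y" for X Y
  proof -
    have "(x a + y a) powr p \<le> (X + Y) powr (p - 1) * (X * (x a / X) powr p + Y * (y a / Y) powr p)"
      if "a \<in> S" for a
    proof -
      let ?w = "\<lambda>i::bool. if i then X else Y" and ?z = "\<lambda>i. if i then x a / X else y a / Y"
      have "(\<Sum>i\<in>UNIV. ?w i * ?z i) powr p
          \<le> (\<Sum>i\<in>UNIV. ?w i) powr (p - 1) * (\<Sum>i\<in>UNIV. ?w i * ?z i powr p)"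
        using \<open>0 < X\<close> \<open>0 < Y\<close> p x[OF that] y[OF that] by (intro sum_powr_jensen) auto
      then show ?thesis using \<open>0 < X\<close> \<open>0 < Y\<close> by (simp add: UNIV_bool add.commute)
    qed
    then have "(\<Sum>a\<in>S. (x a + y a) powr p)
        \<le> (\<Sum>a\<in>S. (X + Y) powr (p - 1) * (X * (x a / X) powr p + Y * (y a / Y) powr p))"
      by (rule sum_mono)
    also have "\<dots> = (X + Y) powr (p - 1) * (X * ((\<Sum>a\<in>S. x a powr p) / X powr p) + Y * ((\<Sum>a\<in>S. y a powr p) / Y powr p))"
      using that x y by (simp add: powr_divide sum_distrib_left sum.distrib sum_divide_distrib algebra_simps)
    also have "\<dots> \<le> (X + Y) powr (p - 1) * (X * 1 + Y * 1)"
      using that by (intro mult_left_mono add_mono) auto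
    also have "\<dots> = (X + Y) powr p" using that by (simp add: powr_diff)
    finally show ?thesis .
  qed
  have lim: "((\<lambda>e. (X + e + (Y + e)) powr p) \<longlongrightarrow> (X + 0 + (Y + 0)) powr p) (at_right 0)"
    using p X Y by (intro tendsto_powr' tendsto_intros) (auto intro!: eventually_at_rightI[of 0 1])
  have "\<forall>\<^sub>F e in at_right (0::real). (\<Sum>a\<in>S. (x a + y a) powr p) \<le> (X + e + (Y + e)) powr p"
  proof (rule eventually_at_rightI[of 0 1])
    fix e :: real assume "e \<in> {0<..<1}"
    moreover from this have "X powr p \<le> (X + e) powr p" "Y powr p \<le> (Y + e) powr p"
      using X Y p by (auto intro!: powr_mono2)
    ultimately show "(\<Sum>a\<in>S. (x a + y a) powr p) \<le> (X + e + (Y + e)) powr p"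
      using X Y by (intro *) auto
  qed simp
  then show ?thesis using tendsto_lowerbound[OF lim] by simp
qed

text \<open>Bounding every partial sum makes an l^q inequality meaningful without summability,
  treats \<open>q = \<infinity>\<close> on the same footing, and survives coordinatewise
  limits.\<close>

definition lq_le :: "ereal \<Rightarrow> (nat \<Rightarrow> real) \<Rightarrow> real \<Rightarrow> bool" where
  "lq_le q u K \<longleftrightarrow> 0 \<le> K \<and>
     (if q = \<infinity> then \<forall>k. u k \<le> K
      else \<forall>n. (\<Sum>k<n. u k powr real_of_ereal q) \<le> K powr real_of_ereal q)"

lemma real_of_ereal_ge_one: "1 \<le> q \<Longrightarrow> q \<noteq> \<infinity> \<Longrightarrow> 1 \<le> real_of_ereal q"
  by (cases q) auto

lemma lq_le_nonneg: "lq_le q u K \<Longrightarrow> 0 \<le> K"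
  by (simp add: lq_le_def)

lemma lq_le_mono:
  assumes "1 \<le> q" "lq_le q u K" "\<And>k. 0 \<le> v k" "\<And>k. v k \<le> u k" "K \<le> L"
  shows "lq_le q v L"
proof (cases "q = \<infinity>")
  case True
  then show ?thesis using assms by (auto simp: lq_le_def) (meson order_trans)
next
  case False
  note q = real_of_ereal_ge_one[OF assms(1) False]
  have "(\<Sum>k<n. v k powr real_of_ereal q) \<le> L powr real_of_ereal q" for n
  proof -
    have "(\<Sum>k<n. v k powr real_of_ereal q) \<le> (\<Sum>k<n. u k powr real_of_ereal q)"
      using q assms by (intro sum_mono powr_mono2) auto
    also have "\<dots> \<le> K powr real_of_ereal q" using assms False by (simp add: lq_le_def)
    also have "\<dots> \<le> L powr real_of_ereal q" using q assms lq_le_nonneg[OF assms(2)] by (intro powr_mono2) auto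
    finally show ?thesis .
  qed
  then show ?thesis using assms False by (auto simp: lq_le_def)
qed

lemma lq_le_component:
  assumes "1 \<le> q" "lq_le q u K" "\<And>k. 0 \<le> u k"
  shows "u k \<le> K"
proof (cases "q = \<infinity>")
  case True
  then show ?thesis using assms by (auto simp: lq_le_def)
next
  case False
  note q = real_of_ereal_ge_one[OF assms(1) False]
  have "u k powr real_of_ereal q \<le> (\<Sum>k<Suc k. u k powr real_of_ereal q)"
    by (intro member_le_sum) auto
  also have "\<dots> \<le> K powr real_of_ereal q" using assms False by (simp add: lq_le_def del: sum.lessThan_Suc)
  finally show ?thesis
    using powr_less_mono2[of "real_of_ereal q" K "u k"] q lq_le_nonneg[OF assms(2)] by force
qed

lemma lq_le_add:
  assumes "1 \<le> q" "lq_le q u K" "lq_le q v L" "\<And>k. 0 \<le> u k" "\<And>k. 0 \<le> v k"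
  shows "lq_le q (\<lambda>k. u k + v k) (K + L)"
proof (cases "q = \<infinity>")
  case True
  then show ?thesis using assms by (auto simp: lq_le_def intro: add_mono)
next
  case False
  then show ?thesis using assms real_of_ereal_ge_one[OF assms(1) False]
    unfolding lq_le_def by (auto intro!: sum_powr_minkowski)
qed

lemma lq_le_scale:
  assumes "1 \<le> q" "lq_le q u K" "0 \<le> c" "\<And>k. 0 \<le> u k"
  shows "lq_le q (\<lambda>k. c * u k) (c * K)"
proof (cases "q = \<infinity>")
  case True
  then show ?thesis using assms by (auto simp: lq_le_def intro: mult_left_mono)
next
  case False
  then show ?thesis using assms
    by (auto simp: lq_le_def powr_mult simp flip: sum_distrib_left intro: mult_left_mono)
qed

text \<open>Only finitely many coordinates enter each bound, so coordinatewise convergence is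
  enough. This Fatou property is behind the closedness in L^1 of the balls of
  \<open>bl\<close>.\<close>

lemma lq_le_limit:
  assumes q: "1 \<le> q" and lq: "\<And>i. lq_le q (w i) K" and w: "\<And>i k. 0 \<le> w i k"
    and lim: "\<And>k. (\<lambda>i::nat. w i k) \<longlonglongrightarrow> v k"
  shows "lq_le q v K"
proof (cases "q = \<infinity>")
  case True
  then have "v k \<le> K" for k
    using lq by (intro LIMSEQ_le_const2[OF lim[of k]]) (auto simp: lq_le_def)
  then show ?thesis using lq True by (auto simp: lq_le_def)
next
  case False
  note q = real_of_ereal_ge_one[OF q False]
  have "(\<Sum>k<n. v k powr real_of_ereal q) \<le> K powr real_of_ereal q" for n
  proof (rule LIMSEQ_le_const2)
    show "(\<lambda>i. \<Sum>k<n. w i k powr real_of_ereal q) \<longlonglongrightarrow> (\<Sum>k<n. v k powr real_of_ereal q)"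
      using q w lim by (intro tendsto_sum tendsto_powr') auto
    show "\<exists>N. \<forall>i\<ge>N. (\<Sum>k<n. w i k powr real_of_ereal q) \<le> K powr real_of_ereal q"
      using lq False by (auto simp: lq_le_def)
  qed
  then show ?thesis using lq False by (auto simp: lq_le_def)
qed

lemma lq_le_inf:
  assumes "1 \<le> q" "\<And>L. K < L \<Longrightarrow> lq_le q u L" "\<And>k. 0 \<le> u k" "0 \<le> K"
  shows "lq_le q u K"
proof (cases "q = \<infinity>")
  case True
  have "u k \<le> K" for k
    using assms True by (intro dense_ge[of K]) (auto simp: lq_le_def)
  then show ?thesis using True assms by (simp add: lq_le_def)
next
  case False
  note q = real_of_ereal_ge_one[OF assms(1) False]
  have "(\<Sum>k<n. u k powr real_of_ereal q) \<le> K powr real_of_ereal q" for n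
  proof (rule LIMSEQ_le_const)
    show "(\<lambda>i. (K + 1 / real (Suc i)) powr real_of_ereal q) \<longlonglongrightarrow> K powr real_of_ereal q"
    proof (rule tendsto_powr')
      show "(\<lambda>i. K + 1 / real (Suc i)) \<longlonglongrightarrow> K"
        using tendsto_add[OF tendsto_const LIMSEQ_Suc[OF lim_1_over_n], of K] by simp
    qed (use q assms in auto)
    show "\<exists>N. \<forall>i\<ge>N. (\<Sum>k<n. u k powr real_of_ereal q) \<le> (K + 1 / real (Suc i)) powr real_of_ereal q"
      using assms(2) False by (auto simp: lq_le_def)
  qed
  then show ?thesis using False assms by (simp add: lq_le_def)
qed

text \<open>Young's inequality by the Schur test: Jensen with weights \<open>m (k - i)\<close> uses
  the row sums, exchanging the sums uses the column sums. Differences of levels have both signs,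
  hence the integer index; bounds on all finite subsums of \<open>m\<close> stand for its l^1
  norm.\<close>

lemma lq_young_finite:
  fixes m :: "int \<Rightarrow> real"
  assumes q: "1 \<le> q" and u: "\<And>k. 0 \<le> u k" "lq_le q u K"
    and m: "\<And>t. 0 \<le> m t" "\<And>S. finite S \<Longrightarrow> (\<Sum>t\<in>S. m t) \<le> M"
  shows "lq_le q (\<lambda>k. \<Sum>i<I. m (int k - int i) * u i) (M * K)"
proof -
  have M0: "0 \<le> M" using m(2)[of "{}"] by simp
  have K0: "0 \<le> K" using u(2) by (rule lq_le_nonneg)
  have row: "(\<Sum>i<I. m (int k - int i)) \<le> M" for k
  proof -
    have "(\<Sum>i<I. m (int k - int i)) = (\<Sum>t\<in>(\<lambda>i. int k - int i) ` {..<I}. m t)"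
      by (subst sum.reindex) (auto simp: inj_on_def)
    then show ?thesis using m(2) by simp
  qed
  have col: "(\<Sum>k<n. m (int k - int i)) \<le> M" for i n
  proof -
    have "(\<Sum>k<n. m (int k - int i)) = (\<Sum>t\<in>(\<lambda>k. int k - int i) ` {..<n}. m t)"
      by (subst sum.reindex) (auto simp: inj_on_def)
    then show ?thesis using m(2) by simp
  qed
  show ?thesis
  proof (cases "q = \<infinity>")
    case True
    have "(\<Sum>i<I. m (int k - int i) * u i) \<le> M * K" for k
    proof -
      have "(\<Sum>i<I. m (int k - int i) * u i) \<le> (\<Sum>i<I. m (int k - int i) * K)"
        using u True m by (intro sum_mono mult_left_mono) (auto simp: lq_le_def)
      also have "\<dots> \<le> M * K" unfolding sum_distrib_right[symmetric] using row K0 by (intro mult_right_mono) auto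
      finally show ?thesis .
    qed
    then show ?thesis using True M0 K0 by (simp add: lq_le_def)
  next
    case False
    note q1 = real_of_ereal_ge_one[OF q False]
    let ?q = "real_of_ereal q"
    have "(\<Sum>k<n. (\<Sum>i<I. m (int k - int i) * u i) powr ?q) \<le> (M * K) powr ?q" for n
    proof -
      have "(\<Sum>k<n. (\<Sum>i<I. m (int k - int i) * u i) powr ?q)
          \<le> (\<Sum>k<n. M powr (?q - 1) * (\<Sum>i<I. m (int k - int i) * u i powr ?q))"
      proof (rule sum_mono)
        fix k
        have "(\<Sum>i<I. m (int k - int i) * u i) powr ?q
            \<le> (\<Sum>i<I. m (int k - int i)) powr (?q - 1) * (\<Sum>i<I. m (int k - int i) * u i powr ?q)"
          using q1 m u by (intro sum_powr_jensen) auto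
        also have "\<dots> \<le> M powr (?q - 1) * (\<Sum>i<I. m (int k - int i) * u i powr ?q)"
          using row m q1 by (intro mult_right_mono powr_mono2 sum_nonneg) auto
        finally show "(\<Sum>i<I. m (int k - int i) * u i) powr ?q
            \<le> M powr (?q - 1) * (\<Sum>i<I. m (int k - int i) * u i powr ?q)" .
      qed
      also have "\<dots> = M powr (?q - 1) * (\<Sum>i<I. (\<Sum>k<n. m (int k - int i)) * u i powr ?q)"
        unfolding sum_distrib_left[symmetric] sum_distrib_right by (subst sum.swap) simp
      also have "\<dots> \<le> M powr (?q - 1) * (\<Sum>i<I. M * u i powr ?q)"
        using col by (intro mult_left_mono sum_mono mult_right_mono) auto
      also have "\<dots> = M powr (?q - 1) * M * (\<Sum>i<I. u i powr ?q)"
        by (simp add: sum_distrib_left mult.assoc)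
      also have "\<dots> \<le> M powr (?q - 1) * M * K powr ?q"
        using u(2) False M0 by (intro mult_left_mono) (auto simp: lq_le_def)
      also have "\<dots> = (M * K) powr ?q"
        using M0 K0 q1 by (cases "M = 0") (auto simp: powr_mult powr_diff)
      finally show ?thesis .
    qed
    then show ?thesis using False M0 K0 by (simp add: lq_le_def)
  qed
qed

text \<open>\<open>w I\<close> comes from the first \<open>I\<close> levels of a decomposition and
  \<open>v\<close> from its limit, so infinite sums over levels never have to be formed.\<close>

lemma lq_young:
  fixes m :: "int \<Rightarrow> real"
  assumes q: "1 \<le> q" and u: "\<And>k. 0 \<le> u k" "lq_le q u K"
    and m: "\<And>t. 0 \<le> m t" "\<And>S. finite S \<Longrightarrow> (\<Sum>t\<in>S. m t) \<le> M"
    and w: "\<And>I k. 0 \<le> w I k" "\<And>I k. w I k \<le> (\<Sum>i<I. m (int k - int i) * u i)"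
    and lim: "\<And>k. (\<lambda>I. w I k) \<longlonglongrightarrow> v k"
  shows "lq_le q v (M * K)"
proof (rule lq_le_limit[OF q _ w(1) lim])
  show "lq_le q (w I) (M * K)" for I
    by (rule lq_le_mono[OF q lq_young_finite[OF q u m, of I] w(1) w(2) order_refl])
qed

lemma lq_le_finite_support:
  assumes q: "1 \<le> q" and u: "\<And>k. 0 \<le> u k" "\<And>k. k \<le> N \<Longrightarrow> u k \<le> B" "\<And>k. N < k \<Longrightarrow> u k = 0" and B: "0 \<le> B"
  shows "lq_le q u ((real N + 1) * B)"
proof (cases "q = \<infinity>")
  case True
  have "u k \<le> (real N + 1) * B" for k
  proof (cases "k \<le> N")
    case True
    then have "u k \<le> 1 * B" using u by simp
    also have "\<dots> \<le> (real N + 1) * B" using B by (intro mult_right_mono) auto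
    finally show ?thesis .
  qed (use u B in auto)
  then show ?thesis using True B by (simp add: lq_le_def)
next
  case False
  note q1 = real_of_ereal_ge_one[OF q False]
  let ?q = "real_of_ereal q"
  have "(\<Sum>k<n. u k powr ?q) \<le> ((real N + 1) * B) powr ?q" for n
  proof -
    have "(\<Sum>k<n. u k powr ?q) \<le> (\<Sum>k\<le>N. u k powr ?q)"
    proof -
      have "(\<Sum>k<n. u k powr ?q) = (\<Sum>k\<in>{..<n} \<inter> {..N}. u k powr ?q)"
        using u(3) by (intro sum.mono_neutral_right) (auto simp: not_le)
      also have "\<dots> \<le> (\<Sum>k\<le>N. u k powr ?q)" by (intro sum_mono2) auto
      finally show ?thesis .
    qed
    also have "\<dots> \<le> (\<Sum>k\<le>N. B powr ?q)" using u q1 by (intro sum_mono powr_mono2) auto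
    also have "\<dots> = (real N + 1) powr 1 * B powr ?q" by simp
    also have "\<dots> \<le> (real N + 1) powr ?q * B powr ?q"
      using q1 by (intro mult_right_mono powr_mono) auto
    also have "\<dots> = ((real N + 1) * B) powr ?q" using B by (simp add: powr_mult)
    finally show ?thesis .
  qed
  then show ?thesis using False B by (simp add: lq_le_def)
qed

section \<open>Dyadic averages\<close>

lemma space_leb01 [simp]: "space leb01 = {0..1}"
  by (simp add: space_restrict_space)

lemma sets_leb01_iff: "A \<in> sets leb01 \<longleftrightarrow> A \<in> sets lebesgue \<and> A \<subseteq> {0..1}"
  by (auto simp: sets_restrict_space_iff)

interpretation leb01: prob_space leb01
  by (rule prob_spaceI) (simp add: emeasure_restrict_space)

lemma measure_leb01: "A \<subseteq> {0..1} \<Longrightarrow> measure leb01 A = measure lebesgue A"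
  by (simp add: measure_restrict_space)

lemma measurable_leb01_borel: "f \<in> borel_measurable borel \<Longrightarrow> f \<in> borel_measurable leb01"
  by (intro measurable_restrict_space1 measurable_completion) simp

lemma integrable_leb01_bounded:
  fixes f :: "real \<Rightarrow> 'b::{banach, second_countable_topology}"
  assumes "f \<in> borel_measurable leb01" "AE x in leb01. norm (f x) \<le> B"
  shows "integrable leb01 f"
  using leb01.integrable_const_bound[OF assms(2,1)] .

lemma integrable_leb01_indicator:
  "A \<in> sets leb01 \<Longrightarrow> integrable leb01 (\<lambda>x. indicator A x :: 'b::{banach, second_countable_topology, real_normed_algebra_1})"
  by (rule integrable_leb01_bounded[where B = 1]) (auto simp: indicator_def)

lemma integrable_leb01_indicator_mult:
  fixes f :: "real \<Rightarrow> complex"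
  assumes "A \<in> sets leb01" "integrable leb01 f"
  shows "integrable leb01 (\<lambda>x. indicator A x * f x)"
proof -
  have "(\<lambda>x. indicator A x * f x) = (\<lambda>x. indicator A x *\<^sub>R f x)"
    by (auto simp: indicator_def)
  then show ?thesis using integrable_mult_indicator[OF assms] by simp
qed

lemma is_interval_sets_leb01:
  assumes "is_interval J" "J \<subseteq> {0..1::real}"
  shows "J \<in> sets leb01"
  using assms by (simp add: sets_leb01_iff sets_completionI_sets is_interval_convex_1 real_interval_borel_measurable)

section \<open>The L^1 seminorm on the unit interval\<close>

definition L1norm :: "(real \<Rightarrow> complex) \<Rightarrow> real" where
  "L1norm f = (LINT x|leb01. cmod (f x))"

lemma L1norm_nonneg [simp]: "0 \<le> L1norm f"
  by (simp add: L1norm_def)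

lemma L1norm_add:
  assumes "integrable leb01 f" "integrable leb01 g"
  shows "L1norm (\<lambda>x. f x + g x) \<le> L1norm f + L1norm g"
proof -
  have "L1norm (\<lambda>x. f x + g x) \<le> (LINT x|leb01. cmod (f x) + cmod (g x))"
    unfolding L1norm_def using assms by (intro integral_mono norm_triangle_ineq) auto
  then show ?thesis using assms by (simp add: L1norm_def)
qed

lemma L1norm_cong_AE:
  assumes "integrable leb01 f" "integrable leb01 g" "AE x in leb01. f x = g x"
  shows "L1norm f = L1norm g"
  unfolding L1norm_def using assms by (intro integral_cong_AE) auto

lemma L1norm_mult [simp]: "L1norm (\<lambda>x. z * f x) = cmod z * L1norm f"
  by (simp add: L1norm_def norm_mult)

lemma L1norm_minus_commute: "L1norm (\<lambda>x. f x - g x) = L1norm (\<lambda>x. g x - f x)"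
  by (simp add: L1norm_def norm_minus_commute)

lemma L1norm_eq_0:
  assumes "integrable leb01 f" "L1norm f = 0"
  shows "AE x in leb01. f x = 0"
  using assms integral_nonneg_eq_0_iff_AE[of leb01 "\<lambda>x. cmod (f x)"] by (simp add: L1norm_def)

lemma L1norm_mono_AE:
  assumes "integrable leb01 f" "integrable leb01 g" "AE x in leb01. cmod (f x) \<le> cmod (g x)"
  shows "L1norm f \<le> L1norm g"
  unfolding L1norm_def using assms by (intro integral_mono_AE) auto

lemma L1norm_sum:
  assumes "\<And>a. a \<in> S \<Longrightarrow> integrable leb01 (f a)"
  shows "L1norm (\<lambda>x. \<Sum>a\<in>S. f a x) \<le> (\<Sum>a\<in>S. L1norm (f a))"
  using assms
proof (induction S rule: infinite_finite_induct)
  case (insert a S)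
  then have "L1norm (\<lambda>x. f a x + (\<Sum>a\<in>S. f a x)) \<le> L1norm (f a) + L1norm (\<lambda>x. \<Sum>a\<in>S. f a x)"
    by (intro L1norm_add) auto
  also have "\<dots> \<le> L1norm (f a) + (\<Sum>a\<in>S. L1norm (f a))" using insert by auto
  finally show ?case using insert by simp
qed (auto simp: L1norm_def)

section \<open>Combinatorics of the dyadic grid\<close>

lemma dyadic_subset: "j < 2 ^ k \<Longrightarrow> dyadic k j \<subseteq> {0..<1}"
proof -
  assume "j < 2 ^ k"
  then have "real j + 1 \<le> 2 ^ k"
    by (metis Suc_leI add.commute of_nat_Suc of_nat_le_iff of_nat_numeral of_nat_power)
  then have "(real j + 1) / 2 ^ k \<le> 1" by simp
  then show ?thesis unfolding dyadic_def by (auto intro: order_trans[rotated])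
qed

lemma is_interval_dyadic: "is_interval (dyadic k j)"
  by (simp add: dyadic_def is_interval_co)

lemma dyadic_sets [measurable]: "j < 2 ^ k \<Longrightarrow> dyadic k j \<in> sets leb01"
  using dyadic_subset[of j k] by (intro is_interval_sets_leb01 is_interval_dyadic) auto

lemma measure_dyadic: "measure lebesgue (dyadic k j) = 1 / 2 ^ k"
  by (simp add: dyadic_def field_simps divide_right_mono)

lemma measure_leb01_dyadic: "j < 2 ^ k \<Longrightarrow> measure leb01 (dyadic k j) = 1 / 2 ^ k"
  using dyadic_subset[of j k] by (subst measure_leb01) (auto simp: measure_dyadic)

text \<open>Reading the position off the floor turns disjointness, covering and nesting of cells
  into integer arithmetic; the parent of cell \<open>j\<close> is cell
  \<open>j div 2\<close>.\<close>

lemma mem_dyadic_iff: "x \<in> dyadic k j \<longleftrightarrow> 0 \<le> x \<and> \<lfloor>x * 2 ^ k\<rfloor> = int j"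
proof -
  have "x \<in> dyadic k j \<longleftrightarrow> real j \<le> x * 2 ^ k \<and> x * 2 ^ k < real j + 1"
    by (auto simp: dyadic_def field_simps)
  also have "\<dots> \<longleftrightarrow> \<lfloor>x * 2 ^ k\<rfloor> = int j" by (simp add: floor_eq_iff)
  finally show ?thesis
    by (metis dyadic_def atLeastLessThan_iff divide_nonneg_nonneg of_nat_0_le_iff order_trans zero_le_numeral zero_le_power)
qed

lemma dyadic_disjoint: "x \<in> dyadic k i \<Longrightarrow> x \<in> dyadic k j \<Longrightarrow> i = j"
  by (simp add: mem_dyadic_iff)

lemma dyadic_cover:
  assumes "0 \<le> x" "x < 1"
  obtains j where "j < 2 ^ k" "x \<in> dyadic k j"
proof -
  have "x * 2 ^ k < 2 ^ k" "0 \<le> x * 2 ^ k" using assms by auto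
  then have "\<lfloor>x * 2 ^ k\<rfloor> < 2 ^ k" "0 \<le> \<lfloor>x * 2 ^ k\<rfloor>"
    by (auto simp: floor_less_iff)
  then have "nat \<lfloor>x * 2 ^ k\<rfloor> < 2 ^ k" "x \<in> dyadic k (nat \<lfloor>x * 2 ^ k\<rfloor>)"
    using assms by (auto simp: mem_dyadic_iff nat_less_iff)
  then show thesis using that by blast
qed

lemma dyadic_Suc_subset: "dyadic (Suc k) j \<subseteq> dyadic k (j div 2)"
proof
  fix x assume "x \<in> dyadic (Suc k) j"
  then have x: "0 \<le> x" "\<lfloor>x * 2 ^ k * 2\<rfloor> = int j" by (auto simp: mem_dyadic_iff mult_ac)
  have "\<lfloor>x * 2 ^ k\<rfloor> = \<lfloor>x * 2 ^ k * 2\<rfloor> div 2"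
    by (metis floor_divide_real_eq_div nonzero_mult_div_cancel_right of_int_numeral zero_neq_numeral zero_le_numeral)
  then show "x \<in> dyadic k (j div 2)" using x by (simp add: mem_dyadic_iff zdiv_int)
qed

lemma dyadic_refine: "i \<le> k \<Longrightarrow> dyadic k j \<subseteq> dyadic i (j div 2 ^ (k - i))"
proof (induction "k - i" arbitrary: i)
  case (Suc n)
  then have "dyadic k j \<subseteq> dyadic (Suc i) (j div 2 ^ (k - Suc i))" by (metis Suc_diff_Suc Suc_leI diff_Suc_1 zero_less_Suc zero_less_diff)
  also have "\<dots> \<subseteq> dyadic i (j div 2 ^ (k - Suc i) div 2)" by (rule dyadic_Suc_subset)
  also have "j div 2 ^ (k - Suc i) div 2 = j div 2 ^ (k - i)"
    by (metis Suc.hyps(2) Suc_diff_Suc div_mult2_eq power_Suc2 zero_less_Suc zero_less_diff)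
  finally show ?case .
qed simp

lemma sum_div2: "(\<Sum>j<2 * n. g (j div 2)) = (\<Sum>i<n. g i + g i :: 'b::comm_monoid_add)" for n :: nat
  by (induction n) (auto simp: add.assoc)

text \<open>\<open>avg k j f\<close> and \<open>dco k j f\<close> are the values on \<open>dyadic k j\<close> of \<open>E\<^sub>k f\<close> and \<open>E\<^sub>k f - E\<^sub>k\<^sub>-\<^sub>1 f\<close>, and
  \<open>lev p k f\<close> is the \<open>L\<^sup>p\<close> norm of this difference; \<open>cexp n\<close> is \<open>E\<^sub>n\<close>.\<close>

definition avg :: "nat \<Rightarrow> nat \<Rightarrow> (real \<Rightarrow> complex) \<Rightarrow> complex" where
  "avg k j f = 2 ^ k * (LINT x|leb01. indicator (dyadic k j) x * f x)"

definition dco :: "nat \<Rightarrow> nat \<Rightarrow> (real \<Rightarrow> complex) \<Rightarrow> complex" where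
  "dco k j f = (if k = 0 then avg 0 j f else avg k j f - avg (k - 1) (j div 2) f)"

definition lev :: "real \<Rightarrow> nat \<Rightarrow> (real \<Rightarrow> complex) \<Rightarrow> real" where
  "lev p k f = ((\<Sum>j<2 ^ k. cmod (dco k j f) powr p) / 2 ^ k) powr (1 / p)"

definition dpart :: "nat \<Rightarrow> (real \<Rightarrow> complex) \<Rightarrow> real \<Rightarrow> complex" where
  "dpart k f x = (\<Sum>j<2 ^ k. dco k j f * indicator (dyadic k j) x)"

definition cexp :: "nat \<Rightarrow> (real \<Rightarrow> complex) \<Rightarrow> real \<Rightarrow> complex" where
  "cexp n f x = (\<Sum>k\<le>n. dpart k f x)"

section \<open>Linearity and continuity of averages and martingale coefficients\<close>

lemma div2_less_pow: "0 < k \<Longrightarrow> j < 2 ^ k \<Longrightarrow> j div 2 < (2::nat) ^ (k - 1)"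
  by (cases k) auto

lemma avg_sum:
  assumes "j < 2 ^ k" "\<And>a. a \<in> S \<Longrightarrow> integrable leb01 (f a)"
  shows "avg k j (\<lambda>x. \<Sum>a\<in>S. v a * f a x) = (\<Sum>a\<in>S. v a * avg k j (f a))"
proof -
  have "(\<lambda>x. indicator (dyadic k j) x * (\<Sum>a\<in>S. v a * f a x))
      = (\<lambda>x. \<Sum>a\<in>S. v a * (indicator (dyadic k j) x * f a x))"
    by (simp add: sum_distrib_left mult_ac)
  moreover have "(LINT x|leb01. (\<Sum>a\<in>S. v a * (indicator (dyadic k j) x * f a x)))
      = (\<Sum>a\<in>S. v a * (LINT x|leb01. indicator (dyadic k j) x * f a x))"
    using assms by (subst Bochner_Integration.integral_sum) (auto intro!: integrable_leb01_indicator_mult)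
  ultimately show ?thesis
    by (simp add: avg_def sum_distrib_left mult_ac)
qed

lemma dco_sum:
  assumes "j < 2 ^ k" "\<And>a. a \<in> S \<Longrightarrow> integrable leb01 (f a)"
  shows "dco k j (\<lambda>x. \<Sum>a\<in>S. v a * f a x) = (\<Sum>a\<in>S. v a * dco k j (f a))"
  using assms avg_sum[of j k S f v] avg_sum[of "j div 2" "k - 1" S f v] div2_less_pow[of k j]
  by (auto simp: dco_def right_diff_distrib sum_subtractf)

lemma dco_add:
  assumes "j < 2 ^ k" "integrable leb01 f" "integrable leb01 g"
  shows "dco k j (\<lambda>x. f x + g x) = dco k j f + dco k j g"
  using dco_sum[OF assms(1), of "UNIV::bool set" "\<lambda>b. if b then f else g" "\<lambda>_. 1"] assms(2,3)
  by (simp add: UNIV_bool add.commute)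

lemma dco_mult:
  assumes "j < 2 ^ k" "integrable leb01 f"
  shows "dco k j (\<lambda>x. z * f x) = z * dco k j f"
  using dco_sum[OF assms(1), of "{()}" "\<lambda>_. f" "\<lambda>_. z"] assms(2) by simp

lemma dco_diff:
  assumes "j < 2 ^ k" "integrable leb01 f" "integrable leb01 g"
  shows "dco k j (\<lambda>x. f x - g x) = dco k j f - dco k j g"
  using dco_add[OF assms(1,2), of "\<lambda>x. - 1 * g x"] dco_mult[OF assms(1,3), of "-1"] assms(3) by simp

lemma avg_cong_AE:
  assumes "j < 2 ^ k" "integrable leb01 f" "integrable leb01 g" "AE x in leb01. f x = g x"
  shows "avg k j f = avg k j g"
proof -
  have "(LINT x|leb01. indicator (dyadic k j) x * f x) = (LINT x|leb01. indicator (dyadic k j) x * g x)"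
    using assms by (intro integral_cong_AE) (auto intro!: borel_measurable_integrable integrable_leb01_indicator_mult)
  then show ?thesis by (simp add: avg_def)
qed

lemma dco_cong_AE:
  assumes "j < 2 ^ k" "integrable leb01 f" "integrable leb01 g" "AE x in leb01. f x = g x"
  shows "dco k j f = dco k j g"
  using avg_cong_AE[OF assms] avg_cong_AE[OF div2_less_pow _ _ assms(4), of k j] assms
  by (auto simp: dco_def)

lemma lev_cong_AE:
  assumes "integrable leb01 f" "integrable leb01 g" "AE x in leb01. f x = g x"
  shows "lev p k f = lev p k g"
  using dco_cong_AE[OF _ assms] by (simp add: lev_def)

lemma sum_indicator_dyadic:
  fixes v :: "nat \<Rightarrow> 'b::semiring_1"
  assumes "0 \<le> x" "x < 1"
  shows "(\<Sum>j<2 ^ k. v j * indicator (dyadic k j) x) = v (nat \<lfloor>x * 2 ^ k\<rfloor>)"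
proof -
  obtain j where j: "j < 2 ^ k" "x \<in> dyadic k j" using dyadic_cover[OF assms] .
  have "(\<Sum>i<2 ^ k. v i * indicator (dyadic k i) x) = (\<Sum>i<2 ^ k. if i = j then v i else 0)"
    using dyadic_disjoint j by (intro sum.cong) (auto simp: indicator_def)
  also have "\<dots> = v j" using j by simp
  finally show ?thesis using j by (simp add: mem_dyadic_iff)
qed

text \<open>Cells are half open, so the point 1 lies in none of them, and identities that split
  \<open>{0..1}\<close> into cells are available only almost everywhere.\<close>

lemma AE_leb01_less_1: "AE x in leb01. 0 \<le> x \<and> x < 1"
proof -
  have "AE x in lebesgue. x \<noteq> (1::real)"
    using AE_completion[OF AE_lborel_singleton] by blast
  then have "AE x in lebesgue. x \<in> {0..1} \<longrightarrow> 0 \<le> x \<and> x < (1::real)" by eventually_elim auto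
  then show ?thesis by (subst AE_restrict_space_iff) auto
qed

lemma sum_integral_dyadic:
  fixes g :: "real \<Rightarrow> real"
  assumes "integrable leb01 g"
  shows "(\<Sum>j<2 ^ k. (LINT x|leb01. indicator (dyadic k j) x * g x)) = (LINT x|leb01. g x)"
proof -
  have i: "integrable leb01 (\<lambda>x. indicator (dyadic k j) x * g x)" if "j < 2 ^ k" for j
    using integrable_mult_indicator[OF dyadic_sets[OF that] assms] by simp
  have "(\<Sum>j<2 ^ k. (LINT x|leb01. indicator (dyadic k j) x * g x))
      = (LINT x|leb01. (\<Sum>j<2 ^ k. indicator (dyadic k j) x * g x))"
    using i by (subst Bochner_Integration.integral_sum) auto
  also have "\<dots> = (LINT x|leb01. g x)"
  proof (rule integral_cong_AE)
    show "AE x in leb01. (\<Sum>j<2 ^ k. indicator (dyadic k j) x * g x) = g x"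
      using AE_leb01_less_1
    proof eventually_elim
      case (elim x)
      then show ?case using sum_indicator_dyadic[of x "\<lambda>_. g x" k] by (simp add: mult.commute)
    qed
  qed (use i assms in auto)
  finally show ?thesis .
qed

lemma cmod_avg_le:
  assumes "j < 2 ^ k" "integrable leb01 f"
  shows "cmod (avg k j f) \<le> 2 ^ k * (LINT x|leb01. indicator (dyadic k j) x * cmod (f x))"
proof -
  have "cmod (LINT x|leb01. indicator (dyadic k j) x * f x) \<le> (LINT x|leb01. cmod (indicator (dyadic k j) x * f x))"
    by (rule integral_norm_bound)
  also have "\<dots> = (LINT x|leb01. indicator (dyadic k j) x * cmod (f x))"
    by (intro Bochner_Integration.integral_cong) (auto simp: indicator_def)
  finally show ?thesis by (simp add: avg_def norm_mult norm_power)
qed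

lemma sum_cmod_avg_le:
  assumes "integrable leb01 f"
  shows "(\<Sum>j<2 ^ k. cmod (avg k j f)) / 2 ^ k \<le> L1norm f"
proof -
  have "(\<Sum>j<2 ^ k. cmod (avg k j f)) / 2 ^ k
      \<le> (\<Sum>j<2 ^ k. 2 ^ k * (LINT x|leb01. indicator (dyadic k j) x * cmod (f x))) / 2 ^ k"
    using assms by (intro divide_right_mono sum_mono cmod_avg_le) auto
  also have "\<dots> = L1norm f"
    using sum_integral_dyadic[of "\<lambda>x. cmod (f x)" k] assms
    by (simp add: sum_distrib_left[symmetric] L1norm_def)
  finally show ?thesis .
qed

text \<open>The factor 2 counts the two averages in a martingale difference; each parent occurs
  twice, but its cell is twice as large.\<close>

lemma sum_cmod_dco_le:
  assumes "integrable leb01 f"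
  shows "(\<Sum>j<2 ^ k. cmod (dco k j f)) / 2 ^ k \<le> 2 * L1norm f"
proof (cases k)
  case 0
  have "cmod (avg 0 0 f) \<le> L1norm f" using sum_cmod_avg_le[OF assms, of 0] by simp
  then show ?thesis using 0 L1norm_nonneg[of f] unfolding dco_def by (simp del: L1norm_nonneg)
next
  case (Suc k')
  have "(\<Sum>j<2 ^ k. cmod (dco k j f)) / 2 ^ k
      \<le> (\<Sum>j<2 ^ k. cmod (avg k j f) + cmod (avg k' (j div 2) f)) / 2 ^ k"
    unfolding dco_def Suc by (intro divide_right_mono sum_mono) (auto intro: norm_triangle_ineq4)
  also have "\<dots> = (\<Sum>j<2 ^ k. cmod (avg k j f)) / 2 ^ k + (\<Sum>j<2 * 2 ^ k'. cmod (avg k' (j div 2) f)) / 2 ^ k"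
    by (simp add: sum.distrib add_divide_distrib Suc)
  also have "\<dots> = (\<Sum>j<2 ^ k. cmod (avg k j f)) / 2 ^ k + (\<Sum>j<2 ^ k'. cmod (avg k' j f)) / 2 ^ k'"
    by (subst sum_div2) (simp add: Suc sum_divide_distrib[symmetric] mult_2[symmetric] sum_distrib_left[symmetric])
  also have "\<dots> \<le> 2 * L1norm f" using sum_cmod_avg_le[OF assms, of k] sum_cmod_avg_le[OF assms, of k'] by simp
  finally show ?thesis .
qed

lemma cmod_dco_le:
  assumes "j < 2 ^ k" "integrable leb01 f"
  shows "cmod (dco k j f) \<le> 2 * 2 ^ k * L1norm f"
proof -
  have "cmod (dco k j f) \<le> (\<Sum>j<2 ^ k. cmod (dco k j f))"
    using assms by (intro member_le_sum) auto
  then have "cmod (dco k j f) / 2 ^ k \<le> (\<Sum>j<2 ^ k. cmod (dco k j f)) / 2 ^ k"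
    by (intro divide_right_mono) auto
  then have "cmod (dco k j f) / 2 ^ k \<le> 2 * L1norm f" using sum_cmod_dco_le[OF assms(2), of k] by linarith
  then show ?thesis by (simp add: field_simps)
qed

text \<open>A single coefficient is a bounded functional on L^1, with a norm that may grow with the
  level. Hence L^1 convergence controls every fixed level.\<close>

lemma dco_tendsto:
  assumes "j < 2 ^ k" "\<And>n. integrable leb01 (g n)" "integrable leb01 f"
    and "(\<lambda>n. L1norm (\<lambda>x. g n x - f x)) \<longlonglongrightarrow> 0"
  shows "(\<lambda>n. dco k j (g n)) \<longlonglongrightarrow> dco k j f"
proof (rule Lim_transform2[OF tendsto_const])
  have "(\<lambda>n. 2 * 2 ^ k * L1norm (\<lambda>x. g n x - f x)) \<longlonglongrightarrow> 0"
    using tendsto_mult_right_zero[OF assms(4)] .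
  then have "(\<lambda>n. dco k j (\<lambda>x. g n x - f x)) \<longlonglongrightarrow> 0"
    by (rule Lim_null_comparison[OF always_eventually, rotated])
       (use assms in \<open>auto intro!: cmod_dco_le simp del: L1norm_nonneg\<close>)
  then have "(\<lambda>n. dco k j (g n) - dco k j f) \<longlonglongrightarrow> 0"
    using assms by (simp add: dco_diff)
  from tendsto_minus[OF this] show "(\<lambda>n. dco k j f - dco k j (g n)) \<longlonglongrightarrow> 0" by simp
qed

lemma lev_tendsto:
  assumes "1 \<le> p" "\<And>n. integrable leb01 (g n)" "integrable leb01 f"
    and "(\<lambda>n. L1norm (\<lambda>x. g n x - f x)) \<longlonglongrightarrow> 0"
  shows "(\<lambda>n. lev p k (g n)) \<longlonglongrightarrow> lev p k f"
  unfolding lev_def using assms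
  by (intro tendsto_powr' tendsto_divide tendsto_sum tendsto_norm dco_tendsto tendsto_const)
     (auto intro!: always_eventually sum_nonneg divide_nonneg_nonneg)

section \<open>Coefficients of step functions and of indicators of intervals\<close>

lemma avg_const:
  assumes "j < 2 ^ k" "\<And>x. x \<in> dyadic k j \<Longrightarrow> f x = v"
  shows "avg k j f = v"
proof -
  have "(\<lambda>x. indicator (dyadic k j) x * f x) = (\<lambda>x. indicator (dyadic k j) x *\<^sub>R v)"
    using assms(2) by (auto simp: indicator_def)
  moreover have "(LINT x|leb01. indicator (dyadic k j) x *\<^sub>R v) = (1 / 2 ^ k) *\<^sub>R v"
  proof (subst integral_scaleR_left)
    have "dyadic k j \<inter> space leb01 = dyadic k j" using dyadic_subset[OF assms(1)] by auto
    then show "(LINT x|leb01. indicator (dyadic k j) x) *\<^sub>R v = (1 / 2 ^ k) *\<^sub>R v"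
      using measure_leb01_dyadic[OF assms(1)] by (simp del: space_leb01)
  qed (use assms(1) in \<open>auto intro!: integrable_leb01_indicator\<close>)
  ultimately show ?thesis by (simp add: avg_def scaleR_conv_of_real)
qed

text \<open>Both averages equal the constant. The locality of the estimates comes from here: step
  functions of a coarser level, and indicators away from their boundary, have no component at level
  \<open>k\<close>.\<close>

lemma dco_const_on_parent:
  assumes "0 < k" "j < 2 ^ k" "\<And>x. x \<in> dyadic (k - 1) (j div 2) \<Longrightarrow> f x = v"
  shows "dco k j f = 0"
proof -
  have "avg (k - 1) (j div 2) f = v" using assms div2_less_pow by (intro avg_const) auto
  moreover have "avg k j f = v"
    using assms dyadic_Suc_subset[of "k - 1" j] by (intro avg_const) auto
  ultimately show ?thesis using assms(1) by (simp add: dco_def)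
qed

lemma dyadic_less:
  assumes "i < i'" "x \<in> dyadic k i" "y \<in> dyadic k i'"
  shows "x < y"
proof -
  have "real i + 1 \<le> real i'" using assms(1) by simp
  then have "(real i + 1) / 2 ^ k \<le> real i' / 2 ^ k" by (rule divide_right_mono) simp
  then show ?thesis using assms(2,3) by (auto simp: dyadic_def)
qed

text \<open>Moving to the right, an interval is entered at most once and left at most once;
  \<open>L\<close> collects the cells where it is entered, \<open>R\<close> those where it is
  left.\<close>

lemma card_boundary_cells:
  assumes J: "is_interval (J :: real set)"
  shows "card {i. i < 2 ^ k \<and> dyadic k i \<inter> J \<noteq> {} \<and> \<not> dyadic k i \<subseteq> J} \<le> 2"
proof -
  define B where "B = {i. i < 2 ^ k \<and> dyadic k i \<inter> J \<noteq> {} \<and> \<not> dyadic k i \<subseteq> J}"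
  define L where "L = {i. i < 2 ^ k \<and> (\<exists>x\<in>dyadic k i. \<exists>y\<in>dyadic k i. x \<notin> J \<and> y \<in> J \<and> x < y)}"
  define R where "R = {i. i < 2 ^ k \<and> (\<exists>x\<in>dyadic k i. \<exists>y\<in>dyadic k i. x \<notin> J \<and> y \<in> J \<and> y < x)}"
  have J': "z \<in> J" if "x \<in> J" "y \<in> J" "x \<le> z" "z \<le> y" for x y z
    using J that by (meson mem_is_interval_1_I)
  have fin: "finite L" "finite R" by (auto simp: L_def R_def)
  have "\<not> i < i'" if "i \<in> L" "i' \<in> L" for i i'
  proof
    assume "i < i'"
    with that obtain y x' y' where "y \<in> dyadic k i" "y \<in> J" "x' \<in> dyadic k i'" "x' \<notin> J" "y' \<in> J" "x' < y'"
      unfolding L_def by blast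
    then show False using dyadic_less[OF \<open>i < i'\<close>, of y k x'] J'[of y y' x'] by simp
  qed
  then have L: "card L \<le> 1" using fin by (simp add: card_le_Suc0_iff_eq) (meson nat_neq_iff)
  have "\<not> i < i'" if "i \<in> R" "i' \<in> R" for i i'
  proof
    assume "i < i'"
    with that obtain x y y' where "x \<in> dyadic k i" "x \<notin> J" "y \<in> J" "y < x" "y' \<in> dyadic k i'" "y' \<in> J"
      unfolding R_def by blast
    then show False using dyadic_less[OF \<open>i < i'\<close>, of x k y'] J'[of y y' x] by simp
  qed
  then have R: "card R \<le> 1" using fin by (simp add: card_le_Suc0_iff_eq) (meson nat_neq_iff)
  have "B \<subseteq> L \<union> R"
  proof
    fix i assume "i \<in> B"
    then obtain x y where "i < 2 ^ k" "x \<in> dyadic k i" "x \<notin> J" "y \<in> dyadic k i" "y \<in> J" unfolding B_def by blast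
    then show "i \<in> L \<union> R" unfolding L_def R_def by (cases x y rule: linorder_cases) auto
  qed
  then have "card B \<le> card (L \<union> R)" using fin by (intro card_mono) auto
  also have "\<dots> \<le> card L + card R" by (rule card_Un_le)
  finally show ?thesis using L R unfolding B_def by simp
qed

lemma avg_indicator:
  assumes "j < 2 ^ k" "A \<in> sets leb01"
  shows "avg k j (indicator A) = of_real (2 ^ k * measure leb01 (dyadic k j \<inter> A))"
proof -
  have "(\<lambda>x. indicator (dyadic k j) x * indicator A x) = (\<lambda>x. of_real (indicator (dyadic k j \<inter> A) x) :: complex)"
    by (auto simp: indicator_def)
  moreover have "(LINT x|leb01. of_real (indicator (dyadic k j \<inter> A) x) :: complex)
      = of_real (LINT x|leb01. indicator (dyadic k j \<inter> A) x)"
    by (rule integral_complex_of_real)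
  ultimately show ?thesis using assms sets.sets_into_space[OF assms(2)]
    by (simp add: avg_def) (metis inf.absorb1 inf.coboundedI2 space_leb01)
qed

lemma cmod_dco_indicator_le_1:
  assumes "j < 2 ^ k" "A \<in> sets leb01"
  shows "cmod (dco k j (indicator A)) \<le> 1"
proof -
  have *: "0 \<le> 2 ^ k * measure leb01 (dyadic k j \<inter> A) \<and> 2 ^ k * measure leb01 (dyadic k j \<inter> A) \<le> 1"
    if "j < 2 ^ k" for k j
  proof -
    have "measure leb01 (dyadic k j \<inter> A) \<le> measure leb01 (dyadic k j)"
      using that assms(2) by (intro leb01.finite_measure_mono) auto
    then show ?thesis using measure_leb01_dyadic[OF that] by (simp add: field_simps)
  qed
  show ?thesis
  proof (cases "k = 0")
    case True
    then show ?thesis using *[OF assms(1)] avg_indicator[OF assms] by (simp add: dco_def)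
  next
    case False
    have "dco k j (indicator A) = of_real (2 ^ k * measure leb01 (dyadic k j \<inter> A)
        - 2 ^ (k - 1) * measure leb01 (dyadic (k - 1) (j div 2) \<inter> A))"
      using False assms div2_less_pow[of k j] by (simp add: dco_def avg_indicator)
    then show ?thesis using *[OF assms(1)] *[OF div2_less_pow[of k j]] False assms
      by (simp only: norm_of_real) (smt (verit) gr0I)
  qed
qed

lemma sum_cmod_avg_disjoint:
  assumes "j < 2 ^ k" "finite S" "disjoint_family_on A S" "\<And>a. a \<in> S \<Longrightarrow> A a \<in> sets leb01"
  shows "(\<Sum>a\<in>S. cmod (avg k j (indicator (A a)))) \<le> 1"
proof -
  have "(\<Sum>a\<in>S. cmod (avg k j (indicator (A a)))) = 2 ^ k * (\<Sum>a\<in>S. measure leb01 (dyadic k j \<inter> A a))"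
    using assms by (simp add: avg_indicator sum_distrib_left del: of_real_mult)
  also have "(\<Sum>a\<in>S. measure leb01 (dyadic k j \<inter> A a)) = measure leb01 (\<Union>a\<in>S. dyadic k j \<inter> A a)"
    using assms by (intro leb01.finite_measure_finite_Union[symmetric]) (auto simp: disjoint_family_on_def)
  also have "\<dots> \<le> measure leb01 (dyadic k j)"
    using assms by (intro leb01.finite_measure_mono) auto
  also have "\<dots> = 1 / 2 ^ k" using assms(1) by (rule measure_leb01_dyadic)
  finally show ?thesis by simp
qed

text \<open>Disjoint sets share the mass of a cell, so the bound does not grow with the family. It
  supplies the constant \<open>H\<close> of \<open>lev_powr_le\<close>.\<close>

lemma sum_cmod_dco_disjoint:
  assumes "j < 2 ^ k" "finite S" "disjoint_family_on A S" "\<And>a. a \<in> S \<Longrightarrow> A a \<in> sets leb01"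
  shows "(\<Sum>a\<in>S. cmod (dco k j (indicator (A a)))) \<le> 2"
proof (cases "k = 0")
  case True
  then show ?thesis using sum_cmod_avg_disjoint[OF assms] by (simp add: dco_def)
next
  case False
  have "(\<Sum>a\<in>S. cmod (dco k j (indicator (A a))))
      \<le> (\<Sum>a\<in>S. cmod (avg k j (indicator (A a))) + cmod (avg (k - 1) (j div 2) (indicator (A a))))"
    using False unfolding dco_def by (intro sum_mono) (auto intro: norm_triangle_ineq4)
  also have "\<dots> \<le> 1 + 1"
    unfolding sum.distrib using False assms div2_less_pow[of k j]
    by (intro add_mono sum_cmod_avg_disjoint) auto
  finally show ?thesis by simp
qed

text \<open>Cells whose parent is not cut by the boundary contribute nothing; at most two parents
  are cut, each has two children, and coefficients are bounded by 1. Decay like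
  \<open>1 / 2 ^ k\<close> whatever the length of \<open>J\<close> means that indicators of
  intervals have smoothness \<open>1 / p\<close>.\<close>

lemma sum_cmod_dco_interval:
  assumes J: "is_interval J" "J \<subseteq> {0..1}"
  shows "(\<Sum>j<2 ^ k. cmod (dco k j (indicator J))) / 2 ^ k \<le> 4 / 2 ^ k"
proof (cases k)
  case 0
  have "cmod (dco 0 0 (indicator J)) \<le> 1"
    using is_interval_sets_leb01[OF J] by (intro cmod_dco_indicator_le_1) auto
  then show ?thesis using 0 by simp
next
  case (Suc k')
  define B where "B = {i. i < 2 ^ k' \<and> dyadic k' i \<inter> J \<noteq> {} \<and> \<not> dyadic k' i \<subseteq> J}"
  have "(\<Sum>j<2 ^ k. cmod (dco k j (indicator J))) \<le> (\<Sum>j<2 ^ k. if j div 2 \<in> B then 1 else 0)"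
  proof (rule sum_mono)
    fix j assume "j \<in> {..<2 ^ k :: nat}"
    then have j: "j < 2 ^ k" by simp
    then have j2: "j div 2 < 2 ^ k'" using Suc by auto
    show "cmod (dco k j (indicator J)) \<le> (if j div 2 \<in> B then 1 else 0)"
    proof (cases "j div 2 \<in> B")
      case True
      then show ?thesis using j is_interval_sets_leb01[OF J] cmod_dco_indicator_le_1 by simp
    next
      case False
      then consider "dyadic k' (j div 2) \<inter> J = {}" | "dyadic k' (j div 2) \<subseteq> J" using j2 by (auto simp: B_def)
      then have "dco k j (indicator J) = 0"
      proof cases
        case 1
        then show ?thesis using j Suc by (intro dco_const_on_parent[where v = 0]) (auto simp: indicator_def)
      next
        case 2
        then show ?thesis using j Suc by (intro dco_const_on_parent[where v = 1]) (auto simp: indicator_def)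
      qed
      then show ?thesis using False by simp
    qed
  qed
  also have "\<dots> = (\<Sum>j<2 * 2 ^ k'. if j div 2 \<in> B then 1 else 0)" by (simp add: Suc)
  also have "\<dots> = (\<Sum>i<2 ^ k'. (if i \<in> B then 1 else 0) + (if i \<in> B then 1 else 0))" by (rule sum_div2)
  also have "\<dots> = 2 * (\<Sum>i<2 ^ k'. if i \<in> B then 1 else 0)"
    by (simp only: mult_2 sum.distrib)
  also have "(\<Sum>i<2 ^ k'. if i \<in> B then 1 else 0) = real (card B)"
    by (subst sum.If_cases) (auto simp: B_def intro!: arg_cong[where f = card])
  also have "2 * real (card B) \<le> 4" using card_boundary_cells[OF J(1), of k'] by (simp add: B_def)
  finally show ?thesis by (simp add: divide_right_mono)
qed

section \<open>Norms of single levels\<close>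

lemma lev_powr:
  assumes "1 \<le> p"
  shows "lev p k f powr p = (\<Sum>j<2 ^ k. cmod (dco k j f) powr p) / 2 ^ k"
  using assms by (simp add: lev_def powr_powr sum_nonneg)

lemma lev_nonneg [simp]: "0 \<le> lev p k f"
  by (simp add: lev_def)

text \<open>Interpolation between two l^1 bounds for the matrix \<open>dco k j (f a)\<close>:
  \<open>H\<close> along the functions and \<open>G\<close> along the cells. Jensen with these
  coefficients as weights spends \<open>H\<close> with power \<open>p - 1\<close> and
  \<open>G\<close> once.\<close>

lemma lev_powr_le:
  assumes p: "1 \<le> p"
    and f: "\<And>a. a \<in> S \<Longrightarrow> integrable leb01 (f a)"
    and H: "\<And>j. j < 2 ^ k \<Longrightarrow> (\<Sum>a\<in>S. cmod (dco k j (f a))) \<le> H"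
    and G: "\<And>a. a \<in> S \<Longrightarrow> (\<Sum>j<2 ^ k. cmod (dco k j (f a))) / 2 ^ k \<le> G a"
  shows "lev p k (\<lambda>x. \<Sum>a\<in>S. v a * f a x) powr p \<le> H powr (p - 1) * (\<Sum>a\<in>S. cmod (v a) powr p * G a)"
proof -
  have "cmod (dco k j (\<lambda>x. \<Sum>a\<in>S. v a * f a x)) powr p
      \<le> H powr (p - 1) * (\<Sum>a\<in>S. cmod (dco k j (f a)) * cmod (v a) powr p)" if j: "j < 2 ^ k" for j
  proof -
    have "cmod (dco k j (\<lambda>x. \<Sum>a\<in>S. v a * f a x)) \<le> (\<Sum>a\<in>S. cmod (dco k j (f a)) * cmod (v a))"
      using norm_sum[of "\<lambda>a. v a * dco k j (f a)" S] dco_sum[OF j, of S f v] f by (simp add: norm_mult mult.commute)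
    then have "cmod (dco k j (\<lambda>x. \<Sum>a\<in>S. v a * f a x)) powr p \<le> (\<Sum>a\<in>S. cmod (dco k j (f a)) * cmod (v a)) powr p"
      using p by (intro powr_mono2) auto
    also have "\<dots> \<le> (\<Sum>a\<in>S. cmod (dco k j (f a))) powr (p - 1) * (\<Sum>a\<in>S. cmod (dco k j (f a)) * cmod (v a) powr p)"
      using p by (intro sum_powr_jensen) auto
    also have "\<dots> \<le> H powr (p - 1) * (\<Sum>a\<in>S. cmod (dco k j (f a)) * cmod (v a) powr p)"
      using p H[OF j] by (intro mult_right_mono powr_mono2 sum_nonneg mult_nonneg_nonneg) auto
    finally show ?thesis .
  qed
  then have "(\<Sum>j<2 ^ k. cmod (dco k j (\<lambda>x. \<Sum>a\<in>S. v a * f a x)) powr p) / 2 ^ k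
      \<le> (\<Sum>j<2 ^ k. H powr (p - 1) * (\<Sum>a\<in>S. cmod (dco k j (f a)) * cmod (v a) powr p)) / 2 ^ k"
    by (intro divide_right_mono sum_mono) auto
  also have "\<dots> = H powr (p - 1) * (\<Sum>a\<in>S. cmod (v a) powr p * ((\<Sum>j<2 ^ k. cmod (dco k j (f a))) / 2 ^ k))"
    unfolding sum_distrib_left[symmetric]
    by (subst sum.swap) (simp add: sum_distrib_left sum_distrib_right sum_divide_distrib mult_ac)
  also have "\<dots> \<le> H powr (p - 1) * (\<Sum>a\<in>S. cmod (v a) powr p * G a)"
    using G by (intro mult_left_mono sum_mono) auto
  finally show ?thesis using p by (simp add: lev_powr)
qed

lemma lev_add:
  assumes p: "1 \<le> p" and f: "integrable leb01 f" and g: "integrable leb01 g"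
  shows "lev p k (\<lambda>x. f x + g x) \<le> lev p k f + lev p k g"
proof -
  \<comment> \<open>Moving the weight of a cell inside the power reduces the claim to Minkowski's
    inequality for plain sums.\<close>
  let ?s = "(1 / 2 ^ k) powr (1 / p) :: real"
  have s: "(?s * t) powr p = t powr p / 2 ^ k" if "0 \<le> t" for t
  proof -
    have "(?s * t) powr p = ?s powr p * t powr p" using that by (simp add: powr_mult)
    also have "?s powr p = 1 / 2 ^ k" using p by (simp only: powr_powr) simp
    finally show ?thesis by simp
  qed
  have *: "(\<Sum>j<2 ^ k. (?s * cmod (dco k j h)) powr p) = lev p k h powr p" for h
    using p by (simp add: lev_powr s sum_divide_distrib)
  have "lev p k (\<lambda>x. f x + g x) powr p = (\<Sum>j<2 ^ k. (?s * cmod (dco k j f + dco k j g)) powr p)"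
    unfolding *[symmetric] using f g by (intro sum.cong) (auto simp: dco_add)
  also have "\<dots> \<le> (\<Sum>j<2 ^ k. (?s * cmod (dco k j f) + ?s * cmod (dco k j g)) powr p)"
    using p by (intro sum_mono powr_mono2) (auto simp: distrib_left[symmetric] intro!: mult_left_mono norm_triangle_ineq)
  also have "\<dots> \<le> (lev p k f + lev p k g) powr p"
    using p by (intro sum_powr_minkowski) (auto simp: *)
  finally show ?thesis
    using p powr_less_mono2[of p "lev p k f + lev p k g" "lev p k (\<lambda>x. f x + g x)"] by force
qed

lemma lev_mult:
  assumes p: "1 \<le> p" and f: "integrable leb01 f"
  shows "lev p k (\<lambda>x. z * f x) = cmod z * lev p k f"
proof -
  have "(\<Sum>j<2 ^ k. cmod (dco k j (\<lambda>x. z * f x)) powr p) / 2 ^ k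
      = cmod z powr p * ((\<Sum>j<2 ^ k. cmod (dco k j f) powr p) / 2 ^ k)"
    using f by (simp add: dco_mult norm_mult powr_mult sum_distrib_left)
  then have "lev p k (\<lambda>x. z * f x)
      = (cmod z powr p) powr (1 / p) * ((\<Sum>j<2 ^ k. cmod (dco k j f) powr p) / 2 ^ k) powr (1 / p)"
    unfolding lev_def by (simp only:) (intro powr_mult; simp add: sum_nonneg)
  then show ?thesis using p by (simp only: lev_def powr_powr) simp
qed

lemma lev_zero [simp]: "lev p k (\<lambda>_. 0) = 0"
  by (simp add: lev_def dco_def avg_def cong: if_cong)

lemma lev_sum:
  assumes "1 \<le> p" "\<And>a. a \<in> S \<Longrightarrow> integrable leb01 (f a)"
  shows "lev p k (\<lambda>x. \<Sum>a\<in>S. f a x) \<le> (\<Sum>a\<in>S. lev p k (f a))"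
  using assms
proof (induction S rule: infinite_finite_induct)
  case (insert a S)
  then have "lev p k (\<lambda>x. f a x + (\<Sum>a\<in>S. f a x)) \<le> lev p k (f a) + lev p k (\<lambda>x. \<Sum>a\<in>S. f a x)"
    by (intro lev_add) auto
  also have "\<dots> \<le> lev p k (f a) + (\<Sum>a\<in>S. lev p k (f a))" using insert by auto
  finally show ?case using insert by simp
qed simp_all

section \<open>Conditional expectations onto dyadic levels and their convergence in L^1\<close>

lemma floor_div2: "nat \<lfloor>x * 2 ^ Suc n\<rfloor> div 2 = nat \<lfloor>x * 2 ^ n\<rfloor>" if "0 \<le> x" for x :: real
proof -
  have "x \<in> dyadic (Suc n) (nat \<lfloor>x * 2 ^ Suc n\<rfloor>)" using that by (simp add: mem_dyadic_iff)
  then have "x \<in> dyadic n (nat \<lfloor>x * 2 ^ Suc n\<rfloor> div 2)" using dyadic_Suc_subset by blast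
  then show ?thesis by (simp add: mem_dyadic_iff)
qed

lemma cexp_eq: "cexp n f x = (\<Sum>j<2 ^ n. avg n j f * indicator (dyadic n j) x)"
proof (cases "0 \<le> x \<and> x < 1")
  case True
  then have x: "0 \<le> x" "x < 1" by auto
  have "cexp n f x = avg n (nat \<lfloor>x * 2 ^ n\<rfloor>) f"
  proof (induction n)
    case 0
    then show ?case using sum_indicator_dyadic[OF x, of "\<lambda>j. dco 0 j f" 0]
      by (simp only: cexp_def dpart_def atMost_0 sum.insert) (simp add: dco_def)
  next
    case (Suc n)
    have "cexp (Suc n) f x = cexp n f x + dpart (Suc n) f x" by (simp add: cexp_def)
    also have "dpart (Suc n) f x = dco (Suc n) (nat \<lfloor>x * 2 ^ Suc n\<rfloor>) f"
      unfolding dpart_def by (rule sum_indicator_dyadic[OF x])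
    finally show ?case using Suc x by (simp only: dco_def floor_div2 diff_Suc_1) simp
  qed
  then show ?thesis using sum_indicator_dyadic[OF x, of "\<lambda>j. avg n j f" n] by simp
next
  case False
  then have "indicator (dyadic k j) x = (0::complex)" if "j < 2 ^ k" for k j
    using dyadic_subset[OF that] by (auto simp: indicator_def)
  then show ?thesis by (simp add: cexp_def dpart_def)
qed

lemma integrable_dyadic_sum: "integrable leb01 (\<lambda>x. \<Sum>j<2 ^ n. v j * indicator (dyadic n j) x :: complex)"
  by (rule Bochner_Integration.integrable_sum) (auto intro!: integrable_leb01_indicator)

lemma integrable_dpart: "integrable leb01 (dpart n f)"
  unfolding dpart_def[abs_def] by (rule integrable_dyadic_sum)

lemma integrable_cexp: "integrable leb01 (cexp n f)"
  unfolding cexp_eq[abs_def] by (rule integrable_dyadic_sum)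

lemma L1norm_indicator: "A \<in> sets leb01 \<Longrightarrow> L1norm (indicator A) = measure leb01 A"
proof -
  assume A: "A \<in> sets leb01"
  have "L1norm (indicator A) = (LINT x|leb01. indicator A x)"
    unfolding L1norm_def by (intro Bochner_Integration.integral_cong) (auto simp: indicator_def)
  also have "\<dots> = measure leb01 A" using sets.sets_into_space[OF A] by (simp add: inf.absorb1)
  finally show ?thesis .
qed

lemma L1norm_cexp_le:
  assumes "integrable leb01 f"
  shows "L1norm (cexp n f) \<le> L1norm f"
proof -
  have "L1norm (cexp n f) \<le> (\<Sum>j<2 ^ n. L1norm (\<lambda>x. avg n j f * indicator (dyadic n j) x))"
    unfolding cexp_eq[abs_def] by (intro L1norm_sum) (auto intro!: integrable_leb01_indicator)
  also have "\<dots> = (\<Sum>j<2 ^ n. cmod (avg n j f)) / 2 ^ n"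
    by (simp add: L1norm_indicator measure_leb01_dyadic sum_divide_distrib)
  also have "\<dots> \<le> L1norm f" by (rule sum_cmod_avg_le[OF assms])
  finally show ?thesis .
qed

lemma cexp_sum:
  assumes "\<And>a. a \<in> S \<Longrightarrow> integrable leb01 (f a)"
  shows "cexp n (\<lambda>x. \<Sum>a\<in>S. v a * f a x) x = (\<Sum>a\<in>S. v a * cexp n (f a) x)"
proof -
  have "cexp n (\<lambda>x. \<Sum>a\<in>S. v a * f a x) x
      = (\<Sum>j<2 ^ n. \<Sum>a\<in>S. v a * avg n j (f a) * indicator (dyadic n j) x)"
    unfolding cexp_eq using assms by (intro sum.cong) (auto simp: avg_sum sum_distrib_right)
  also have "\<dots> = (\<Sum>a\<in>S. v a * (\<Sum>j<2 ^ n. avg n j (f a) * indicator (dyadic n j) x))"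
    by (subst sum.swap) (simp add: sum_distrib_left mult.assoc del: sum_mult_indicator)
  finally show ?thesis by (simp only: cexp_eq)
qed

lemma cexp_add:
  assumes "integrable leb01 f" "integrable leb01 g"
  shows "cexp n (\<lambda>x. f x + g x) x = cexp n f x + cexp n g x"
  using cexp_sum[of "UNIV::bool set" "\<lambda>b. if b then f else g" n "\<lambda>_. 1" x] assms
  by (simp add: UNIV_bool add.commute)

lemma cexp_mult: "integrable leb01 f \<Longrightarrow> cexp n (\<lambda>x. z * f x) x = z * cexp n f x"
  using cexp_sum[of "{()}" "\<lambda>_. f" n "\<lambda>_. z" x] by simp

lemma cexp_diff:
  assumes "integrable leb01 f" "integrable leb01 g"
  shows "cexp n (\<lambda>x. f x - g x) x = cexp n f x - cexp n g x"
  using cexp_add[OF assms(1), of "\<lambda>x. - 1 * g x"] cexp_mult[OF assms(2), of n "-1"] assms(2) by simp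

text \<open>Stated as a property so that it can be propagated through the generation of integrable
  functions: intervals, Borel sets, Lebesgue sets, simple functions, limits.\<close>

definition cexp_conv :: "(real \<Rightarrow> complex) \<Rightarrow> bool" where
  "cexp_conv f \<longleftrightarrow> (\<lambda>n. L1norm (\<lambda>x. f x - cexp n f x)) \<longlonglongrightarrow> 0"

lemma cexp_cong_AE:
  assumes "integrable leb01 f" "integrable leb01 g" "AE x in leb01. f x = g x"
  shows "cexp n f x = cexp n g x"
  unfolding cexp_eq using avg_cong_AE[OF _ assms] by (intro sum.cong) auto

lemma cexp_conv_cong_AE:
  assumes "integrable leb01 f" "integrable leb01 g" "AE x in leb01. f x = g x" "cexp_conv f"
  shows "cexp_conv g"
proof -
  have "L1norm (\<lambda>x. f x - cexp n f x) = L1norm (\<lambda>x. g x - cexp n g x)" for n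
    using assms(1-3) cexp_cong_AE[OF assms(1-3)]
    by (intro L1norm_cong_AE) (auto intro!: Bochner_Integration.integrable_diff integrable_cexp)
  then show ?thesis using assms(4) by (simp add: cexp_conv_def)
qed

lemma cexp_conv_add:
  assumes "integrable leb01 f" "integrable leb01 g" "cexp_conv f" "cexp_conv g"
  shows "cexp_conv (\<lambda>x. f x + g x)"
  unfolding cexp_conv_def
proof (rule Lim_null_comparison[OF always_eventually, rotated])
  show "(\<lambda>n. L1norm (\<lambda>x. f x - cexp n f x) + L1norm (\<lambda>x. g x - cexp n g x)) \<longlonglongrightarrow> 0"
    using tendsto_add[OF assms(3,4)[unfolded cexp_conv_def]] by simp
  show "\<forall>n. norm (L1norm (\<lambda>x. f x + g x - cexp n (\<lambda>x. f x + g x) x))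
      \<le> L1norm (\<lambda>x. f x - cexp n f x) + L1norm (\<lambda>x. g x - cexp n g x)"
  proof
    fix n
    have "L1norm (\<lambda>x. f x + g x - cexp n (\<lambda>x. f x + g x) x) = L1norm (\<lambda>x. (f x - cexp n f x) + (g x - cexp n g x))"
      using assms by (simp add: cexp_add algebra_simps)
    also have "\<dots> \<le> L1norm (\<lambda>x. f x - cexp n f x) + L1norm (\<lambda>x. g x - cexp n g x)"
      using assms by (intro L1norm_add Bochner_Integration.integrable_diff integrable_cexp)
    finally show "norm (L1norm (\<lambda>x. f x + g x - cexp n (\<lambda>x. f x + g x) x))
      \<le> L1norm (\<lambda>x. f x - cexp n f x) + L1norm (\<lambda>x. g x - cexp n g x)" by simp
  qed
qed

lemma cexp_conv_mult:
  assumes "integrable leb01 f" "cexp_conv f"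
  shows "cexp_conv (\<lambda>x. z * f x)"
proof -
  have "(\<lambda>x. z * f x - cexp n (\<lambda>x. z * f x) x) = (\<lambda>x. z * (f x - cexp n f x))" for n
    using assms(1) by (simp add: cexp_mult algebra_simps)
  then show ?thesis
    using tendsto_mult_right_zero[OF assms(2)[unfolded cexp_conv_def], of "cmod z"]
    by (simp add: cexp_conv_def)
qed

lemma cexp_conv_sum:
  assumes "\<And>a. a \<in> S \<Longrightarrow> integrable leb01 (f a)" "\<And>a. a \<in> S \<Longrightarrow> cexp_conv (f a)"
  shows "cexp_conv (\<lambda>x. \<Sum>a\<in>S. f a x)"
proof -
  have 0: "cexp_conv (\<lambda>x. 0)" by (simp add: cexp_conv_def cexp_eq avg_def L1norm_def)
  show ?thesis using assms
  proof (induction S rule: infinite_finite_induct)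
    case (insert a S)
    then have "cexp_conv (\<lambda>x. f a x + (\<Sum>a\<in>S. f a x))" by (intro cexp_conv_add) auto
    then show ?case using insert by simp
  qed (auto simp: 0)
qed

text \<open>Three-epsilon argument; the third part, the conditional expectation of
  \<open>g - f\<close>, is small uniformly in \<open>n\<close> because conditional expectations
  contract L^1.\<close>

lemma cexp_conv_limit:
  assumes f: "integrable leb01 f"
    and g: "\<And>e. 0 < e \<Longrightarrow> \<exists>g. integrable leb01 g \<and> cexp_conv g \<and> L1norm (\<lambda>x. f x - g x) < e"
  shows "cexp_conv f"
  unfolding cexp_conv_def LIMSEQ_iff
proof (intro allI impI)
  fix e :: real assume e: "0 < e"
  obtain g where g: "integrable leb01 g" "cexp_conv g" "L1norm (\<lambda>x. f x - g x) < e / 3"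
    using g[of "e / 3"] e by auto
  obtain N where N: "\<And>n. n \<ge> N \<Longrightarrow> L1norm (\<lambda>x. g x - cexp n g x) < e / 3"
    using LIMSEQ_D[OF g(2)[unfolded cexp_conv_def], of "e / 3"] e by auto
  have "norm (L1norm (\<lambda>x. f x - cexp n f x) - 0) < e" if "n \<ge> N" for n
  proof -
    have d: "integrable leb01 (\<lambda>x. g x - f x)" using f g by auto
    have "L1norm (\<lambda>x. f x - cexp n f x)
        = L1norm (\<lambda>x. (f x - g x) + ((g x - cexp n g x) + cexp n (\<lambda>x. g x - f x) x))"
      using f g by (simp add: cexp_diff)
    also have "\<dots> \<le> L1norm (\<lambda>x. f x - g x) + L1norm (\<lambda>x. (g x - cexp n g x) + cexp n (\<lambda>x. g x - f x) x)"
      using f g by (intro L1norm_add Bochner_Integration.integrable_diff Bochner_Integration.integrable_add integrable_cexp)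
    also have "L1norm (\<lambda>x. (g x - cexp n g x) + cexp n (\<lambda>x. g x - f x) x)
        \<le> L1norm (\<lambda>x. g x - cexp n g x) + L1norm (cexp n (\<lambda>x. g x - f x))"
      using f g by (intro L1norm_add Bochner_Integration.integrable_diff integrable_cexp)
    also have "L1norm (cexp n (\<lambda>x. g x - f x)) \<le> L1norm (\<lambda>x. g x - f x)"
      by (rule L1norm_cexp_le[OF d])
    finally have "L1norm (\<lambda>x. f x - cexp n f x)
        \<le> L1norm (\<lambda>x. f x - g x) + (L1norm (\<lambda>x. g x - cexp n g x) + L1norm (\<lambda>x. g x - f x))" by simp
    then show ?thesis using N[OF that] g(3) by (simp add: L1norm_minus_commute[of g f])
  qed
  then show "\<exists>no. \<forall>n\<ge>no. norm (L1norm (\<lambda>x. f x - cexp n f x) - 0) < e" by blast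
qed

text \<open>The conditional expectation reproduces the indicator outside the at most two boundary
  cells, and there the error is at most 1.\<close>

lemma cexp_conv_interval:
  assumes J: "is_interval J" "J \<subseteq> {0..1}"
  shows "cexp_conv (indicator J)"
  unfolding cexp_conv_def
proof (rule Lim_null_comparison[OF always_eventually, rotated])
  show "(\<lambda>n. 2 * (1 / 2) ^ n :: real) \<longlonglongrightarrow> 0"
    by (rule tendsto_mult_right_zero) (rule LIMSEQ_power_zero, simp)
  have Js: "J \<in> sets leb01" using is_interval_sets_leb01[OF J] .
  show "\<forall>n. norm (L1norm (\<lambda>x. indicator J x - cexp n (indicator J) x)) \<le> 2 * (1 / 2) ^ n"
  proof
    fix n
    define B where "B = {i. i < 2 ^ n \<and> dyadic n i \<inter> J \<noteq> {} \<and> \<not> dyadic n i \<subseteq> J}"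
    have Bf: "finite B" by (simp add: B_def)
    let ?g = "\<lambda>x. \<Sum>i\<in>B. indicator (dyadic n i) x :: complex"
    have gi: "integrable leb01 (\<lambda>x. indicator (dyadic n i) x :: complex)" if "i \<in> B" for i
      using that by (auto simp: B_def intro!: integrable_leb01_indicator)
    have bd: "cmod (indicator J x - cexp n (indicator J) x) \<le> cmod (?g x)" if x: "0 \<le> x \<and> x < 1" for x
    proof -
      obtain i where i: "i < 2 ^ n" "x \<in> dyadic n i" using dyadic_cover[of x n] x by blast
      have ind: "(\<Sum>j<2 ^ n. avg n j (indicator J) * indicator (dyadic n j) x) = avg n i (indicator J)"
        using sum_indicator_dyadic[of x "\<lambda>j. avg n j (indicator J)" n] x i by (simp add: mem_dyadic_iff del: sum_mult_indicator)
      show ?thesis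
      proof (cases "i \<in> B")
        case True
        have "?g x = (\<Sum>j\<in>B. if j = i then 1 else 0)"
        proof (intro sum.cong refl)
          fix j show "indicator (dyadic n j) x = (if j = i then 1 else (0::complex))"
          proof -
            have "x \<in> dyadic n j \<longleftrightarrow> j = i" using dyadic_disjoint[OF _ i(2), of j] i(2) by metis
            then show ?thesis by (simp add: indicator_def)
          qed
        qed
        then have 1: "?g x = 1" using True Bf by simp
        obtain t where t: "avg n i (indicator J) = of_real t" "0 \<le> t" "t \<le> 1"
        proof -
          have "measure leb01 (dyadic n i \<inter> J) \<le> measure leb01 (dyadic n i)"
            by (rule leb01.finite_measure_mono[OF Int_lower1 dyadic_sets[OF i(1)]])
          then have "2 ^ n * measure leb01 (dyadic n i \<inter> J) \<le> 1"
            using measure_leb01_dyadic[OF i(1)] by (simp add: field_simps)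
          then show thesis using avg_indicator[OF i(1) Js] by (intro that) auto
        qed
        have "cmod (indicator J x - of_real t) = \<bar>indicator J x - t\<bar>"
          by (metis norm_of_real of_real_diff of_real_indicator)
        also have "\<dots> \<le> 1" using t by (auto simp: indicator_def)
        finally show ?thesis unfolding 1 cexp_eq ind t by simp
      next
        case False
        then consider "dyadic n i \<inter> J = {}" | "dyadic n i \<subseteq> J" using i by (auto simp: B_def)
        then have "avg n i (indicator J) = indicator J x"
        proof cases
          case 1
          then show ?thesis using i by (intro avg_const) (auto simp: indicator_def)
        next
          case 2
          then show ?thesis using i by (intro avg_const) (auto simp: indicator_def)
        qed
        then show ?thesis unfolding cexp_eq ind by simp
      qed
    qed
    have "L1norm (\<lambda>x. indicator J x - cexp n (indicator J) x) \<le> L1norm ?g"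
    proof (rule L1norm_mono_AE)
      show "integrable leb01 (\<lambda>x. indicator J x - cexp n (indicator J) x)"
        using Js by (intro Bochner_Integration.integrable_diff integrable_cexp integrable_leb01_indicator)
      show "integrable leb01 ?g" using gi by (rule Bochner_Integration.integrable_sum)
      show "AE x in leb01. cmod (indicator J x - cexp n (indicator J) x) \<le> cmod (?g x)"
        using AE_leb01_less_1 by (rule eventually_mono) (rule bd)
    qed
    also have "\<dots> \<le> (\<Sum>i\<in>B. L1norm (indicator (dyadic n i)))"
      using gi by (intro L1norm_sum) auto
    also have "\<dots> = (\<Sum>i\<in>B. 1 / 2 ^ n)"
      by (intro sum.cong) (auto simp: B_def L1norm_indicator measure_leb01_dyadic)
    also have "\<dots> = real (card B) / 2 ^ n" by simp
    also have "\<dots> \<le> 2 / 2 ^ n"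
      using card_boundary_cells[OF J(1), of n] by (intro divide_right_mono) (auto simp: B_def)
    finally show "norm (L1norm (\<lambda>x. indicator J x - cexp n (indicator J) x)) \<le> 2 * (1 / 2) ^ n"
      by (simp add: power_divide)
  qed
qed

lemma borel_Int_sets_leb01: "A \<in> sets borel \<Longrightarrow> A \<inter> {0..1} \<in> sets leb01"
  by (simp add: sets_leb01_iff)

text \<open>Dynkin's argument from the intersection-stable generator of open half-lines, whose
  traces on \<open>{0..1}\<close> are intervals.\<close>

lemma cexp_conv_borel:
  assumes "A \<in> sets borel"
  shows "cexp_conv (indicator (A \<inter> {0..1}))"
proof -
  have sb: "sets borel = sigma_sets UNIV (range (lessThan :: real \<Rightarrow> _))"
    unfolding borel_Iio by (simp add: sets_measure_of)
  have "A \<in> sigma_sets UNIV (range (lessThan :: real \<Rightarrow> _))" using assms sb by simp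
  then show ?thesis
  proof (rule sigma_sets_induct_disjoint[rotated 2])
    show "Int_stable (range (lessThan :: real \<Rightarrow> _))"
    proof -
      have "{..<a} \<inter> {..<b} = {..<min a b}" for a b :: real by auto
      then show ?thesis unfolding Int_stable_def by auto
    qed
  next
    fix A :: "real set" assume "A \<in> range lessThan"
    then obtain a where "A = {..<a}" by blast
    then have "is_interval (A \<inter> {0..1})"
      by (auto simp: is_interval_1)
    then show "cexp_conv (indicator (A \<inter> {0..1}))" by (intro cexp_conv_interval) auto
  next
    show "cexp_conv (indicator ({} \<inter> {0..1}))" by (intro cexp_conv_interval) auto
  next
    fix A :: "real set" assume compl: "A \<in> sigma_sets UNIV (range lessThan)" "cexp_conv (indicator (A \<inter> {0..1}))"
    then have A: "A \<inter> {0..1} \<in> sets leb01" using sb borel_Int_sets_leb01 by auto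
    have I: "cexp_conv (indicator {0..1})" by (intro cexp_conv_interval) (auto simp: is_interval_cc)
    have "cexp_conv (\<lambda>x. indicator {0..1} x + - 1 * indicator (A \<inter> {0..1}) x)"
      using A by (intro cexp_conv_add[OF _ _ I] cexp_conv_mult[OF _ compl(2)] Bochner_Integration.integrable_mult_right
          integrable_leb01_indicator) (auto simp: sets_leb01_iff)
    also have "(\<lambda>x. indicator {0..1} x + - 1 * indicator (A \<inter> {0..1}) x) = (indicator ((UNIV - A) \<inter> {0..1}) :: real \<Rightarrow> complex)"
      by (auto simp: indicator_def)
    finally show "cexp_conv (indicator ((UNIV - A) \<inter> {0..1}))" .
  next
    fix A :: "nat \<Rightarrow> real set"
    assume union: "disjoint_family A" "range A \<subseteq> sigma_sets UNIV (range lessThan)"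
      "\<And>i. cexp_conv (indicator (A i \<inter> {0..1}))"
    have As: "A i \<inter> {0..1} \<in> sets leb01" for i using union sb borel_Int_sets_leb01 by auto
    \<comment> \<open>Finite disjoint unions follow by additivity; continuity of the measure from
      below makes them L^1 approximations of the full union.\<close>
    define V where "V m = (\<Union>i<m. A i \<inter> {0..1})" for m :: nat
    let ?U = "(\<Union> (range A)) \<inter> {0..1}"
    have Us: "?U \<in> sets leb01" using As by (auto simp: Int_UN_distrib2 UN_extend_simps(4) simp del: UN_simps)
    have Vs: "V m \<in> sets leb01" for m unfolding V_def by (intro sets.finite_UN As) auto
    have lim: "(\<lambda>m. measure leb01 (V m)) \<longlonglongrightarrow> measure leb01 ?U"
    proof -
      have "(\<Union>m. V m) = ?U" by (auto simp: V_def)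
      moreover have "incseq V" by (auto simp: V_def incseq_def) (meson lessThan_iff order_less_le_trans)
      ultimately show ?thesis using leb01.finite_Lim_measure_incseq[of V] Vs by auto
    qed
    show "cexp_conv (indicator ?U)"
    proof (rule cexp_conv_limit)
      show "integrable leb01 (indicator ?U :: real \<Rightarrow> complex)" using Us by (rule integrable_leb01_indicator)
      fix e :: real assume "0 < e"
      then obtain m where m: "\<bar>measure leb01 (V m) - measure leb01 ?U\<bar> < e"
        using LIMSEQ_D[OF lim, of e] by (metis le_refl real_norm_def)
      have sumV: "indicator (V m) x = (\<Sum>i<m. indicator (A i \<inter> {0..1}) x :: complex)" for x
        unfolding V_def using union(1) by (intro indicator_UN_disjoint) (auto simp: disjoint_family_on_def)
      have "cexp_conv (indicator (V m))"
        unfolding sumV using union As by (intro cexp_conv_sum integrable_leb01_indicator) auto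
      moreover have "L1norm (\<lambda>x. indicator ?U x - indicator (V m) x) < e"
      proof -
        have sub: "V m \<subseteq> ?U" by (auto simp: V_def)
        then have "(\<lambda>x. indicator ?U x - indicator (V m) x) = (indicator (?U - V m) :: real \<Rightarrow> complex)"
          by (intro ext) (auto simp: indicator_def)
        moreover have "measure leb01 (?U - V m) = measure leb01 ?U - measure leb01 (V m)"
          using Us Vs sub by (intro leb01.finite_measure_Diff)
        ultimately show ?thesis using m Us Vs by (simp add: L1norm_indicator)
      qed
      ultimately show "\<exists>g. integrable leb01 g \<and> cexp_conv g \<and> L1norm (\<lambda>x. indicator ?U x - g x) < e"
        using integrable_leb01_indicator[OF Vs[of m]] by (intro exI[of _ "indicator (V m)"]) auto
    qed
  qed auto
qed

lemma cexp_conv_sets: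
  assumes "A \<in> sets leb01"
  shows "cexp_conv (indicator A)"
proof -
  have A: "A \<in> sets (completion lborel)" "A \<subseteq> {0..1}" using assms by (auto simp: sets_leb01_iff)
  then obtain S N N' where S: "A = S \<union> N" "N \<subseteq> N'" "N' \<in> null_sets lborel" "S \<in> sets lborel"
    by (elim sets_completionE)
  have "AE x in lborel. x \<notin> N'" using S(3) by (rule AE_not_in)
  then have "AE x in lebesgue. x \<notin> N'" by (rule AE_completion)
  then have "AE x in lebesgue. x \<in> {0..1} \<longrightarrow> indicator (S \<inter> {0..1}) x = (indicator A x :: complex)"
    by eventually_elim (use S in \<open>auto simp: indicator_def\<close>)
  then have "AE x in leb01. indicator (S \<inter> {0..1}) x = (indicator A x :: complex)"
    by (subst AE_restrict_space_iff) auto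
  moreover have "S \<in> sets borel" using S(4) by simp
  ultimately show ?thesis
    using cexp_conv_cong_AE[OF integrable_leb01_indicator[OF borel_Int_sets_leb01]
      integrable_leb01_indicator[OF assms] _ cexp_conv_borel] by blast
qed

lemma cexp_tendsto:
  assumes "integrable leb01 f"
  shows "(\<lambda>n. L1norm (\<lambda>x. f x - cexp n f x)) \<longlonglongrightarrow> 0"
  unfolding cexp_conv_def[symmetric] using assms
proof (induction rule: integrable_induct)
  case (base A c)
  have "cexp_conv (\<lambda>x. c * indicator A x)"
    using base by (intro cexp_conv_mult cexp_conv_sets integrable_leb01_indicator)
  moreover have "(\<lambda>x. c * indicator A x) = (\<lambda>x. indicat_real A x *\<^sub>R c)" by (auto simp: indicator_def)
  ultimately show ?case by simp
next
  case (add f g)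
  then show ?case by (intro cexp_conv_add)
next
  case (lim f s)
  \<comment> \<open>The approximating simple functions obey
    \<open>cmod (s i x) \<le> 2 * cmod (f x)\<close>, hence the dominating function with factor
    3.\<close>
  have "(\<lambda>i. L1norm (\<lambda>x. f x - s i x)) \<longlonglongrightarrow> (LINT x|leb01. 0)"
    unfolding L1norm_def
  proof (rule integral_dominated_convergence[where w = "\<lambda>x. 3 * cmod (f x)"])
    show "AE x in leb01. (\<lambda>i. cmod (f x - s i x)) \<longlonglongrightarrow> 0"
    proof (rule AE_I2)
      fix x :: real assume "x \<in> space leb01"
      then have "(\<lambda>i. f x - s i x) \<longlonglongrightarrow> f x - f x" using lim by (intro tendsto_diff tendsto_const)
      then show "(\<lambda>i. cmod (f x - s i x)) \<longlonglongrightarrow> 0" by (simp add: tendsto_norm_zero_iff)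
    qed
    show "AE x in leb01. norm (cmod (f x - s i x)) \<le> 3 * cmod (f x)" for i
    proof (rule AE_I2)
      fix x :: real assume "x \<in> space leb01"
      then have "cmod (s i x) \<le> 2 * cmod (f x)" using lim by blast
      then show "norm (cmod (f x - s i x)) \<le> 3 * cmod (f x)"
        using norm_triangle_ineq4[of "f x" "s i x"] by simp
    qed
  qed (use lim in auto)
  then have L: "(\<lambda>i. L1norm (\<lambda>x. f x - s i x)) \<longlonglongrightarrow> 0" by simp
  show ?case
  proof (rule cexp_conv_limit)
    fix e :: real assume "0 < e"
    then obtain i where "L1norm (\<lambda>x. f x - s i x) < e" using LIMSEQ_D[OF L, of e] by auto
    then show "\<exists>g. integrable leb01 g \<and> cexp_conv g \<and> L1norm (\<lambda>x. f x - g x) < e" using lim by blast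
  qed (use lim in auto)
qed

section \<open>Geometric sums over integers, Fatou's lemma and tails in L^p\<close>

lemma sum_geometric_int_above:
  fixes a :: real
  assumes "finite S" "0 < a" "a < 1"
  shows "(\<Sum>t\<in>S. if T \<le> t then a powr (of_int t - of_int T) else 0) \<le> 1 / (1 - a)"
proof -
  let ?S = "{t \<in> S. T \<le> t}"
  have "(\<Sum>t\<in>S. if T \<le> t then a powr (of_int t - of_int T) else 0) = (\<Sum>t\<in>?S. a powr (of_int t - of_int T))"
    using assms(1) by (subst sum.inter_filter[symmetric]) auto
  also have "\<dots> = (\<Sum>t\<in>?S. a ^ nat (t - T))"
    using assms by (intro sum.cong) (auto simp: powr_realpow[symmetric] simp flip: of_int_diff)
  also have "\<dots> = (\<Sum>n\<in>(\<lambda>t. nat (t - T)) ` ?S. a ^ n)"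
    by (subst sum.reindex) (auto simp: inj_on_def)
  also have "\<dots> \<le> (\<Sum>n. a ^ n)" using assms by (intro sum_le_suminf) (auto intro!: summable_geometric)
  also have "\<dots> = 1 / (1 - a)" using assms by (simp add: suminf_geometric)
  finally show ?thesis .
qed

lemma sum_geometric_int_below:
  fixes a :: real
  assumes "finite S" "0 < a" "a < 1"
  shows "(\<Sum>t\<in>S. if t \<le> T then a powr (of_int T - of_int t) else 0) \<le> 1 / (1 - a)"
proof -
  have "(\<Sum>t\<in>S. if t \<le> T then a powr (of_int T - of_int t) else 0)
      = (\<Sum>t\<in>uminus ` S. if - T \<le> t then a powr (of_int t - of_int (- T)) else 0)"
    by (subst sum.reindex) (auto simp: inj_on_def intro!: sum.cong)
  also have "\<dots> \<le> 1 / (1 - a)" using assms by (intro sum_geometric_int_above) auto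
  finally show ?thesis .
qed

lemma fatou_bound:
  fixes u :: "nat \<Rightarrow> 'a \<Rightarrow> real"
  assumes u: "\<And>j. integrable M (u j)" "\<And>j x. 0 \<le> u j x" and v: "v \<in> borel_measurable M"
    and lim: "AE x in M. (\<lambda>j. u j x) \<longlonglongrightarrow> v x"
    and B: "\<And>j. j \<ge> N \<Longrightarrow> (LINT x|M. u j x) \<le> B"
  shows "integrable M v" "(LINT x|M. v x) \<le> B"
proof -
  have v0: "AE x in M. 0 \<le> v x"
    using lim by eventually_elim (rule LIMSEQ_le_const, auto simp: u)
  have B0: "0 \<le> B" by (rule order_trans[OF _ B[OF order_refl]]) (simp add: u)
  have "(\<integral>\<^sup>+ x. ennreal (v x) \<partial>M) = (\<integral>\<^sup>+ x. liminf (\<lambda>j. ennreal (u j x)) \<partial>M)"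
  proof (rule nn_integral_cong_AE)
    show "AE x in M. ennreal (v x) = liminf (\<lambda>j. ennreal (u j x))"
      using lim
    proof eventually_elim
      case (elim x)
      then have "(\<lambda>j. ennreal (u j x)) \<longlonglongrightarrow> ennreal (v x)" by (rule tendsto_ennrealI)
      then show ?case by (intro lim_imp_Liminf[symmetric]) auto
    qed
  qed
  also have "\<dots> \<le> liminf (\<lambda>j. \<integral>\<^sup>+ x. ennreal (u j x) \<partial>M)"
    using u by (intro nn_integral_liminf) auto
  also have "\<dots> = liminf (\<lambda>j. ennreal (LINT x|M. u j x))"
    using u by (simp add: nn_integral_eq_integral)
  also have "\<dots> \<le> ennreal B"
    by (rule Liminf_le) (auto simp: eventually_sequentially intro!: exI[of _ N] ennreal_leI B)
  finally have *: "(\<integral>\<^sup>+ x. ennreal (v x) \<partial>M) \<le> ennreal B" .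
  show i: "integrable M v"
    using v v0 * by (intro integrableI_nonneg) (auto intro: le_less_trans)
  then show "(LINT x|M. v x) \<le> B"
    using * v0 B0 by (simp add: nn_integral_eq_integral integral_nonneg_AE)
qed

lemma integral_dpart_powr:
  assumes "1 \<le> p"
  shows "integrable leb01 (\<lambda>x. cmod (dpart k f x) powr p)"
    and "(LINT x|leb01. cmod (dpart k f x) powr p) = lev p k f powr p"
proof -
  let ?g = "\<lambda>x. \<Sum>j<2 ^ k. cmod (dco k j f) powr p * indicator (dyadic k j) x :: real"
  have eq: "cmod (dpart k f x) powr p = ?g x" if "0 \<le> x \<and> x < 1" for x
    using that sum_indicator_dyadic[of x "\<lambda>j. dco k j f" k] sum_indicator_dyadic[of x "\<lambda>j. cmod (dco k j f) powr p" k]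
    by (simp add: dpart_def del: sum_mult_indicator)
  have AE: "AE x in leb01. ?g x = cmod (dpart k f x) powr p"
    using AE_leb01_less_1 by (rule eventually_mono) (rule eq[symmetric])
  have ii: "integrable leb01 (\<lambda>x. cmod (dco k j f) powr p * indicator (dyadic k j) x :: real)" if "j < 2 ^ k" for j
    using that by (intro Bochner_Integration.integrable_mult_right integrable_leb01_indicator dyadic_sets)
  have gi: "integrable leb01 ?g" using ii by (intro Bochner_Integration.integrable_sum) auto
  have m: "(\<lambda>x. cmod (dpart k f x) powr p) \<in> borel_measurable leb01"
    using integrable_dpart[of k f] by measurable
  show "integrable leb01 (\<lambda>x. cmod (dpart k f x) powr p)"
    using integrable_cong_AE_imp[OF gi m] AE by (simp add: eq_commute)
  have "(LINT x|leb01. cmod (dpart k f x) powr p) = (LINT x|leb01. ?g x)"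
    using AE m gi by (intro integral_cong_AE) (auto simp: eq_commute)
  also have "\<dots> = (\<Sum>j<2 ^ k. (LINT x|leb01. cmod (dco k j f) powr p * indicator (dyadic k j) x))"
    using ii by (intro Bochner_Integration.integral_sum) auto
  also have "\<dots> = (\<Sum>j<2 ^ k. cmod (dco k j f) powr p * (1 / 2 ^ k))"
  proof (rule sum.cong[OF refl])
    fix j assume "j \<in> {..<2 ^ k :: nat}"
    then have j: "j < 2 ^ k" by simp
    have "dyadic k j \<inter> space leb01 = dyadic k j" using dyadic_subset[OF j] by auto
    then show "(LINT x|leb01. cmod (dco k j f) powr p * indicator (dyadic k j) x) = cmod (dco k j f) powr p * (1 / 2 ^ k)"
      using measure_leb01_dyadic[OF j] by (simp del: space_leb01)
  qed
  also have "\<dots> = lev p k f powr p" using assms by (simp add: lev_powr sum_divide_distrib)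
  finally show "(LINT x|leb01. cmod (dpart k f x) powr p) = lev p k f powr p" .
qed

text \<open>A norm bound in \<open>\<B>\<^sup>s\<^sub>p\<^sub>,\<^sub>q\<close> in terms of the canonical coefficients; the factor
  \<open>2 powr (k * s)\<close> comes from the normalisation of the atoms.\<close>

definition bl :: "real \<Rightarrow> real \<Rightarrow> ereal \<Rightarrow> (real \<Rightarrow> complex) \<Rightarrow> real \<Rightarrow> bool" where
  "bl s p q f K \<longleftrightarrow> integrable leb01 f \<and> lq_le q (\<lambda>k. 2 powr (real k * s) * lev p k f) K"

lemma bl_lev_le:
  assumes "1 \<le> q" "bl s p q f K"
  shows "lev p k f \<le> K * 2 powr (- (real k * s))"
proof -
  have "2 powr (real k * s) * lev p k f \<le> K"
    using lq_le_component[OF assms(1), of "\<lambda>k. 2 powr (real k * s) * lev p k f"] assms(2) by (auto simp: bl_def)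
  then show ?thesis by (simp add: powr_minus field_simps)
qed

text \<open>Half of the decay \<open>2 powr (- k * s)\<close> of the levels pays for Jensen's
  inequality with geometric weights \<open>?a ^ k\<close>, which takes the place of the triangle
  inequality in L^p; of the p-th power there remains \<open>2 powr (- k * s * (p + 1) / 2)\<close>.
  The partial sums reach \<open>f\<close> along an almost everywhere convergent subsequence of
  \<open>cexp\<close>, and Fatou keeps the bound.\<close>

lemma bl_tail_powr:
  assumes p: "1 \<le> p" and q: "1 \<le> q" and s: "0 < s" and f: "bl s p q f K"
  defines "R \<equiv> (1 / (1 - 2 powr (- s / 2))) powr (p - 1) * K powr p / (1 - 2 powr (- (s * (p + 1) / 2)))"
  shows "integrable leb01 (\<lambda>x. cmod (f x - (\<Sum>k<n. dpart k f x)) powr p)"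
    and "(LINT x|leb01. cmod (f x - (\<Sum>k<n. dpart k f x)) powr p) \<le> R * (2 powr (- (s * (p + 1) / 2))) ^ n"
proof -
  let ?a = "2 powr (- s / 2) :: real" and ?r = "2 powr (- (s * (p + 1) / 2)) :: real"
  have a: "0 < ?a" "?a < 1" using s by (auto simp: powr_less_one)
  have r: "0 < ?r" "?r < 1" using s p by (auto intro!: powr_less_one mult_pos_pos divide_pos_pos)
  have K: "0 \<le> K" using f by (auto simp: bl_def lq_le_def)
  have fi: "integrable leb01 f" using f by (simp add: bl_def)
  define S where "S m x = (\<Sum>k\<in>{n..<m}. dpart k f x)" for m x
  have Si: "integrable leb01 (S m)" for m
    unfolding S_def[abs_def] by (intro Bochner_Integration.integrable_sum integrable_dpart)
  have pt: "cmod (S m x) powr p \<le> (1 / (1 - ?a)) powr (p - 1) * (\<Sum>k\<in>{n..<m}. (?a ^ k) powr (1 - p) * cmod (dpart k f x) powr p)"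
    for m x
  proof -
    have "cmod (S m x) \<le> (\<Sum>k\<in>{n..<m}. ?a ^ k * (cmod (dpart k f x) / ?a ^ k))"
      unfolding S_def using a by (intro order_trans[OF norm_sum]) auto
    then have "cmod (S m x) powr p \<le> (\<Sum>k\<in>{n..<m}. ?a ^ k * (cmod (dpart k f x) / ?a ^ k)) powr p"
      using p by (intro powr_mono2) auto
    also have "\<dots> \<le> (\<Sum>k\<in>{n..<m}. ?a ^ k) powr (p - 1) * (\<Sum>k\<in>{n..<m}. ?a ^ k * (cmod (dpart k f x) / ?a ^ k) powr p)"
      using p by (intro sum_powr_jensen) auto
    also have "(\<Sum>k\<in>{n..<m}. ?a ^ k * (cmod (dpart k f x) / ?a ^ k) powr p)
        = (\<Sum>k\<in>{n..<m}. (?a ^ k) powr (1 - p) * cmod (dpart k f x) powr p)"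
      using a by (intro sum.cong) (auto simp: powr_divide powr_diff)
    also have "(\<Sum>k\<in>{n..<m}. ?a ^ k) powr (p - 1) * (\<Sum>k\<in>{n..<m}. (?a ^ k) powr (1 - p) * cmod (dpart k f x) powr p)
        \<le> (1 / (1 - ?a)) powr (p - 1) * (\<Sum>k\<in>{n..<m}. (?a ^ k) powr (1 - p) * cmod (dpart k f x) powr p)"
    proof (intro mult_right_mono powr_mono2)
      have "(\<Sum>k\<in>{n..<m}. ?a ^ k) \<le> (\<Sum>k. ?a ^ k)" using a by (intro sum_le_suminf) (auto intro!: summable_geometric)
      then show "(\<Sum>k\<in>{n..<m}. ?a ^ k) \<le> 1 / (1 - ?a)" using a by (simp add: suminf_geometric)
    qed (use p in \<open>auto intro!: sum_nonneg\<close>)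
    finally show ?thesis .
  qed
  have di: "integrable leb01 (\<lambda>x. (1 / (1 - ?a)) powr (p - 1) * (\<Sum>k\<in>{n..<m}. (?a ^ k) powr (1 - p) * cmod (dpart k f x) powr p))" for m
    using p by (intro Bochner_Integration.integrable_mult_right Bochner_Integration.integrable_sum integral_dpart_powr)
  have Spi: "integrable leb01 (\<lambda>x. cmod (S m x) powr p)" for m
  proof (rule Bochner_Integration.integrable_bound[OF di[of m]])
    show "(\<lambda>x. cmod (S m x) powr p) \<in> borel_measurable leb01" using Si[of m] by measurable
    show "AE x in leb01. norm (cmod (S m x) powr p) \<le> norm ((1 / (1 - ?a)) powr (p - 1) * (\<Sum>k\<in>{n..<m}. (?a ^ k) powr (1 - p) * cmod (dpart k f x) powr p))"
      using pt by (intro AE_I2) (simp add: order_trans[OF _ abs_ge_self])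
  qed
  have bound: "(LINT x|leb01. cmod (S m x) powr p) \<le> R * ?r ^ n" for m
  proof -
    have "(LINT x|leb01. cmod (S m x) powr p)
        \<le> (LINT x|leb01. (1 / (1 - ?a)) powr (p - 1) * (\<Sum>k\<in>{n..<m}. (?a ^ k) powr (1 - p) * cmod (dpart k f x) powr p))"
      by (intro integral_mono Spi di pt)
    also have "\<dots> = (1 / (1 - ?a)) powr (p - 1) * (\<Sum>k\<in>{n..<m}. (?a ^ k) powr (1 - p) * lev p k f powr p)"
      using p by (simp add: Bochner_Integration.integral_sum integral_dpart_powr)
    also have "\<dots> \<le> (1 / (1 - ?a)) powr (p - 1) * (\<Sum>k\<in>{n..<m}. K powr p * ?r ^ k)"
    proof (intro mult_left_mono sum_mono)
      fix k
      have eq: "(?a ^ k) powr (1 - p) = 2 powr (- s / 2 * real k * (1 - p))"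
        using a by (simp add: powr_realpow[symmetric] powr_powr)
      have "lev p k f powr p \<le> (K * 2 powr (- (real k * s))) powr p"
        using p bl_lev_le[OF q f] by (intro powr_mono2) auto
      also have "\<dots> = K powr p * 2 powr (- (real k * s * p))" using K by (simp add: powr_mult powr_powr)
      finally have "(?a ^ k) powr (1 - p) * lev p k f powr p
          \<le> 2 powr (- s / 2 * real k * (1 - p)) * (K powr p * 2 powr (- (real k * s * p)))"
        unfolding eq by (intro mult_left_mono) auto
      also have "2 powr (- s / 2 * real k * (1 - p)) * (K powr p * 2 powr (- (real k * s * p)))
          = K powr p * 2 powr (- s / 2 * real k * (1 - p) + - (real k * s * p))"
        by (simp only: powr_add mult_ac)
      also have "- s / 2 * real k * (1 - p) + - (real k * s * p) = - (s * (p + 1) / 2) * real k"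
        by (simp add: field_simps)
      also have "2 powr (- (s * (p + 1) / 2) * real k) = ?r ^ k"
        by (simp only: powr_powr[symmetric]) (simp add: powr_realpow)
      finally show "(?a ^ k) powr (1 - p) * lev p k f powr p \<le> K powr p * ?r ^ k" .
    qed auto
    also have "(\<Sum>k\<in>{n..<m}. K powr p * ?r ^ k) \<le> K powr p * (?r ^ n / (1 - ?r))"
    proof -
      have "(\<Sum>k\<in>{n..<m}. ?r ^ k) \<le> ?r ^ n / (1 - ?r)"
      proof (cases "n \<le> m")
        case True
        have "(\<Sum>k\<in>{n..<m}. ?r ^ k) = (\<Sum>k<m - n. ?r ^ (k + n))"
          using sum.shift_bounds_nat_ivl[of "\<lambda>k. ?r ^ k" 0 n "m - n"] True by (simp add: atLeast0LessThan)
        also have "\<dots> = ?r ^ n * (\<Sum>k<m - n. ?r ^ k)" by (simp only: power_add sum_distrib_left mult.commute)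
        also have "\<dots> \<le> ?r ^ n * (\<Sum>k. ?r ^ k)" using r by (intro mult_left_mono sum_le_suminf) (auto intro!: summable_geometric)
        also have "(\<Sum>k. ?r ^ k) = 1 / (1 - ?r)" using r by (simp add: suminf_geometric)
        finally show ?thesis by simp
      qed (use r in auto)
      then have "K powr p * (\<Sum>k\<in>{n..<m}. ?r ^ k) \<le> K powr p * (?r ^ n / (1 - ?r))" by (intro mult_left_mono) auto
      then show ?thesis by (simp only: sum_distrib_left)
    qed
    finally have "(LINT x|leb01. cmod (S m x) powr p)
        \<le> (1 / (1 - ?a)) powr (p - 1) * (K powr p * (?r ^ n / (1 - ?r)))" by (simp add: mult_left_mono)
    then show ?thesis by (simp add: R_def)
  qed
  obtain \<phi> where \<phi>: "strict_mono \<phi>" "AE x in leb01. (\<lambda>i. f x - cexp (\<phi> i) f x) \<longlonglongrightarrow> 0"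
    using tendsto_L1_AE_subseq[of leb01 "\<lambda>n x. f x - cexp n f x"] fi cexp_tendsto[OF fi]
    by (auto simp: L1norm_def integrable_cexp)
  have Sc: "S (Suc (\<phi> j)) x = cexp (\<phi> j) f x - (\<Sum>k<n. dpart k f x)" if "j \<ge> n" for j x
  proof -
    have "n \<le> Suc (\<phi> j)" using that seq_suble[OF \<phi>(1), of j] by linarith
    then have "(\<Sum>k<Suc (\<phi> j). dpart k f x) = (\<Sum>k<n. dpart k f x) + S (Suc (\<phi> j)) x"
      using sum.atLeastLessThan_concat[of 0 n "Suc (\<phi> j)" "\<lambda>k. dpart k f x"] by (simp add: S_def atLeast0LessThan)
    then show ?thesis by (simp add: cexp_def lessThan_Suc_atMost)
  qed
  have lim: "AE x in leb01. (\<lambda>j. cmod (S (Suc (\<phi> j)) x) powr p) \<longlonglongrightarrow> cmod (f x - (\<Sum>k<n. dpart k f x)) powr p"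
    using \<phi>(2)
  proof eventually_elim
    case (elim x)
    have "(\<lambda>j. f x - (f x - cexp (\<phi> j) f x)) \<longlonglongrightarrow> f x - 0" by (intro tendsto_diff tendsto_const elim)
    then have "(\<lambda>j. cexp (\<phi> j) f x - (\<Sum>k<n. dpart k f x)) \<longlonglongrightarrow> f x - (\<Sum>k<n. dpart k f x)"
      by (intro tendsto_diff tendsto_const) simp
    moreover have "\<forall>\<^sub>F j in sequentially. cexp (\<phi> j) f x - (\<Sum>k<n. dpart k f x) = S (Suc (\<phi> j)) x"
      using eventually_ge_at_top[of n] by eventually_elim (simp add: Sc)
    ultimately have "(\<lambda>j. S (Suc (\<phi> j)) x) \<longlonglongrightarrow> f x - (\<Sum>k<n. dpart k f x)"
      by (rule Lim_transform_eventually)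
    then show ?case using p by (intro tendsto_powr' tendsto_norm tendsto_const) auto
  qed
  have m: "(\<lambda>x. cmod (f x - (\<Sum>k<n. dpart k f x)) powr p) \<in> borel_measurable leb01"
  proof -
    have "integrable leb01 (\<lambda>x. f x - (\<Sum>k<n. dpart k f x))"
      by (intro Bochner_Integration.integrable_diff Bochner_Integration.integrable_sum fi integrable_dpart)
    then show ?thesis by measurable
  qed
  show "integrable leb01 (\<lambda>x. cmod (f x - (\<Sum>k<n. dpart k f x)) powr p)"
    by (rule fatou_bound(1)[OF Spi _ m lim bound]) auto
  show "(LINT x|leb01. cmod (f x - (\<Sum>k<n. dpart k f x)) powr p) \<le> R * ?r ^ n"
    by (rule fatou_bound(2)[OF Spi _ m lim bound]) auto
qed

section \<open>Equivalence with the atomic norm\<close>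

lemma prob_leb01_Icc [simp]: "leb01.prob {0..1} = 1"
  using leb01.prob_space by simp

section \<open>Closure properties of the norm bound \<open>bl\<close>\<close>

lemma bl_nonneg: "bl s p q f K \<Longrightarrow> 0 \<le> K"
  by (simp add: bl_def lq_le_def)

lemma bl_cong_AE:
  assumes "bl s p q f K" "integrable leb01 g" "AE x in leb01. f x = g x"
  shows "bl s p q g K"
  using assms lev_cong_AE[of f g p] by (simp add: bl_def)

lemma bl_mono: "1 \<le> q \<Longrightarrow> bl s p q f K \<Longrightarrow> K \<le> L \<Longrightarrow> bl s p q f L"
  unfolding bl_def by (auto intro: lq_le_mono)

lemma bl_add:
  assumes "1 \<le> p" "1 \<le> q" "bl s p q f K" "bl s p q g L"
  shows "bl s p q (\<lambda>x. f x + g x) (K + L)"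
proof -
  have "lq_le q (\<lambda>k. 2 powr (real k * s) * lev p k f + 2 powr (real k * s) * lev p k g) (K + L)"
    using assms by (intro lq_le_add) (auto simp: bl_def)
  then have "lq_le q (\<lambda>k. 2 powr (real k * s) * lev p k (\<lambda>x. f x + g x)) (K + L)"
    using assms lev_add[OF assms(1), of f g]
    by (elim lq_le_mono[rotated]) (auto simp: bl_def distrib_left[symmetric] intro!: mult_left_mono)
  then show ?thesis using assms by (simp add: bl_def)
qed

lemma bl_mult:
  assumes "1 \<le> p" "1 \<le> q" "bl s p q f K"
  shows "bl s p q (\<lambda>x. z * f x) (cmod z * K)"
proof -
  have "lq_le q (\<lambda>k. cmod z * (2 powr (real k * s) * lev p k f)) (cmod z * K)"
    using assms by (intro lq_le_scale) (auto simp: bl_def)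
  then show ?thesis using assms by (simp add: bl_def lev_mult mult_ac)
qed

lemma bl_diff:
  assumes "1 \<le> p" "1 \<le> q" "bl s p q f K" "bl s p q g L"
  shows "bl s p q (\<lambda>x. f x - g x) (K + L)"
  using bl_add[OF assms(1-3) bl_mult[OF assms(1,2,4), of "-1"]] by simp

lemma bl_zero: "bl s p q (\<lambda>_. 0) 0"
  by (simp add: bl_def lq_le_def)

lemma bl_sum:
  assumes "1 \<le> p" "1 \<le> q" "\<And>a. a \<in> S \<Longrightarrow> bl s p q (f a) (K a)"
  shows "bl s p q (\<lambda>x. \<Sum>a\<in>S. f a x) (\<Sum>a\<in>S. K a)"
  using assms
proof (induction S rule: infinite_finite_induct)
  case (insert a S)
  then have "bl s p q (\<lambda>x. f a x + (\<Sum>a\<in>S. f a x)) (K a + (\<Sum>a\<in>S. K a))"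
    by (intro bl_add) auto
  then show ?case using insert by simp
qed (auto simp: bl_zero)

text \<open>Single levels converge along L^1 limits, and \<open>lq_le_limit\<close> keeps the bound.
  This closedness of balls stands in for completeness of the Besov space when limits are
  formed.\<close>

lemma bl_limit:
  assumes "1 \<le> p" "1 \<le> q" "\<And>n. bl s p q (g n) K" "integrable leb01 f"
    and "(\<lambda>n. L1norm (\<lambda>x. g n x - f x)) \<longlonglongrightarrow> 0"
  shows "bl s p q f K"
proof -
  have "lq_le q (\<lambda>k. 2 powr (real k * s) * lev p k f) K"
  proof (rule lq_le_limit[OF assms(2)])
    show "lq_le q (\<lambda>k. 2 powr (real k * s) * lev p k (g n)) K" for n
      using assms(3) by (simp add: bl_def)
    show "(\<lambda>n. 2 powr (real k * s) * lev p k (g n)) \<longlonglongrightarrow> 2 powr (real k * s) * lev p k f" for k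
      using assms by (intro tendsto_mult tendsto_const lev_tendsto) (auto simp: bl_def)
  qed auto
  then show ?thesis using assms(4) by (simp add: bl_def)
qed

lemma bl_inf:
  assumes "1 \<le> q" "\<And>L. K < L \<Longrightarrow> bl s p q f L" "0 \<le> K"
  shows "bl s p q f K"
proof -
  have "integrable leb01 f" using assms(2)[of "K + 1"] by (simp add: bl_def)
  moreover have "lq_le q (\<lambda>k. 2 powr (real k * s) * lev p k f) K"
  proof (rule lq_le_inf[OF assms(1)])
    show "lq_le q (\<lambda>k. 2 powr (real k * s) * lev p k f) L" if "K < L" for L
      using assms(2)[OF that] by (simp add: bl_def)
  qed (use assms(3) in simp_all)
  ultimately show ?thesis by (simp add: bl_def)
qed

lemma L1norm_powr_le:
  assumes p: "1 \<le> p" and u: "u \<in> borel_measurable leb01" "integrable leb01 (\<lambda>x. cmod (u x) powr p)"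
  shows "integrable leb01 u" "L1norm u \<le> Lp_norm p u"
proof -
  have le: "t \<le> 1 + t powr p" if "0 \<le> t" for t :: real
  proof (cases "t \<le> 1")
    case True
    then show ?thesis by (simp add: add_increasing2)
  next
    case False
    then have "t powr 1 \<le> t powr p" using p by (intro powr_mono) auto
    then show ?thesis using False by simp
  qed
  show i: "integrable leb01 u"
  proof (rule Bochner_Integration.integrable_bound)
    show "integrable leb01 (\<lambda>x. 1 + cmod (u x) powr p)" using u by simp
    show "AE x in leb01. norm (u x) \<le> norm (1 + cmod (u x) powr p)"
      using le by (intro AE_I2) (simp add: add_nonneg_nonneg order_trans[OF _ abs_ge_self])
  qed (use u in auto)
  show "L1norm u \<le> Lp_norm p u"
  proof (cases "L1norm u = 0")
    case True
    then show ?thesis by (simp add: Lp_norm_def)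
  next
    case False
    then have y: "0 < L1norm u" using L1norm_nonneg[of u] by linarith
    let ?y = "L1norm u"
    \<comment> \<open>Jensen on a probability space: the tangent to the p-th power at the mean
      \<open>?y\<close> integrates to \<open>?y powr p\<close>.\<close>
    have "(LINT x|leb01. ?y powr p + p * ?y powr (p - 1) * (cmod (u x) - ?y)) \<le> (LINT x|leb01. cmod (u x) powr p)"
      using p y i u by (intro integral_mono powr_ge_tangent) auto
    also have "(LINT x|leb01. ?y powr p + p * ?y powr (p - 1) * (cmod (u x) - ?y)) = ?y powr p"
      using i by (simp add: L1norm_def[symmetric])
    finally have "(?y powr p) powr (1 / p) \<le> Lp_norm p u"
      unfolding Lp_norm_def using p by (intro powr_mono2) auto
    then show ?thesis using p y by (simp add: powr_powr)
  qed
qed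

lemma powr_add_le:
  fixes a b :: real
  assumes "1 \<le> p" "0 \<le> a" "0 \<le> b"
  shows "(a + b) powr p \<le> 2 powr (p - 1) * (a powr p + b powr p)"
  using sum_powr_jensen[of p "UNIV::bool set" "\<lambda>_. 1" "\<lambda>i. if i then a else b"] assms
  by (simp add: UNIV_bool add.commute)

lemma Lp_fun_diff_bounded:
  assumes p: "1 \<le> p" and f: "Lp_fun p f" and g: "g \<in> borel_measurable leb01" "\<And>x. cmod (g x) \<le> G"
  shows "integrable leb01 (\<lambda>x. cmod (f x - g x) powr p)"
proof (rule Bochner_Integration.integrable_bound)
  have G: "0 \<le> G" using g(2)[of 0] norm_ge_zero order_trans by blast
  show "integrable leb01 (\<lambda>x. 2 powr (p - 1) * (cmod (f x) powr p + G powr p))"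
    using f by (auto simp: Lp_fun_def)
  show "(\<lambda>x. cmod (f x - g x) powr p) \<in> borel_measurable leb01"
  proof -
    have "f \<in> borel_measurable leb01" using f by (simp add: Lp_fun_def)
    then show ?thesis using g(1) by measurable
  qed
  show "AE x in leb01. norm (cmod (f x - g x) powr p) \<le> norm (2 powr (p - 1) * (cmod (f x) powr p + G powr p))"
  proof (rule AE_I2)
    fix x
    have "cmod (f x - g x) powr p \<le> (cmod (f x) + G) powr p"
      using p g(2)[of x] norm_triangle_ineq4[of "f x" "g x"] by (intro powr_mono2) auto
    also have "\<dots> \<le> 2 powr (p - 1) * (cmod (f x) powr p + G powr p)"
      using p G by (intro powr_add_le) auto
    finally show "norm (cmod (f x - g x) powr p) \<le> norm (2 powr (p - 1) * (cmod (f x) powr p + G powr p))"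
      by simp
  qed
qed

section \<open>From canonical coefficients to atoms and back\<close>

lemma atom_dyadic: "atom \<sigma> p (dyadic k j) x = of_real (2 powr (- (real k * (\<sigma> - 1 / p)))) * indicator (dyadic k j) x"
proof -
  have "(1 / 2 ^ k) powr (\<sigma> - 1 / p) = (2 powr (- real k)) powr (\<sigma> - 1 / p)"
    by (simp add: powr_minus powr_realpow divide_inverse)
  then show ?thesis by (simp add: atom_def measure_dyadic powr_powr)
qed

text \<open>For \<open>k \<le> i\<close> the cells of level \<open>i\<close> are disjoint with mass
  \<open>1 / 2 ^ i\<close>, so \<open>lev_powr_le\<close> applies with \<open>H = 2\<close> and
  \<open>G = 2 / 2 ^ i\<close>. For \<open>i < k\<close> the function is constant on all
  parents.\<close>

lemma lev_step_powr_le: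
  assumes p: "1 \<le> p"
  shows "lev p k (\<lambda>x. \<Sum>j<2 ^ i. v j * indicator (dyadic i j) x) powr p
    \<le> (if k \<le> i then 2 powr p * ((\<Sum>j<2 ^ i. cmod (v j) powr p) / 2 ^ i) else 0)"
proof (cases "k \<le> i")
  case True
  have "lev p k (\<lambda>x. \<Sum>j<2 ^ i. v j * indicator (dyadic i j) x) powr p
      \<le> 2 powr (p - 1) * (\<Sum>j<2 ^ i. cmod (v j) powr p * (2 * (1 / 2 ^ i)))"
  proof (rule lev_powr_le[OF p])
    show "(\<Sum>a<2 ^ i. cmod (dco k j (indicator (dyadic i a)))) \<le> 2" if "j < 2 ^ k" for j
      using that dyadic_disjoint by (intro sum_cmod_dco_disjoint) (auto simp: disjoint_family_on_def)
    show "(\<Sum>j<2 ^ k. cmod (dco k j (indicator (dyadic i a)))) / 2 ^ k \<le> 2 * (1 / 2 ^ i)" if "a \<in> {..<2 ^ i}" for a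
      using sum_cmod_dco_le[OF integrable_leb01_indicator[OF dyadic_sets], of a i k] that
      by (simp add: L1norm_indicator measure_leb01_dyadic)
  qed (auto intro!: integrable_leb01_indicator)
  also have "\<dots> = 2 powr p * ((\<Sum>j<2 ^ i. cmod (v j) powr p) / 2 ^ i)"
    by (simp add: powr_diff sum_distrib_left[symmetric] sum_divide_distrib[symmetric] sum_distrib_right[symmetric])
  finally show ?thesis using True by simp
next
  case False
  have "dco k j (\<lambda>x. \<Sum>j<2 ^ i. v j * indicator (dyadic i j) x) = 0" if "j < 2 ^ k" for j
  proof -
    have le: "i \<le> k - 1" using False by simp
    have j2: "j div 2 < 2 ^ (k - 1)" using that False div2_less_pow[of k j] by simp
    show ?thesis
    proof (rule dco_const_on_parent[where v = "v (j div 2 div 2 ^ (k - 1 - i))"])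
      fix x assume x: "x \<in> dyadic (k - 1) (j div 2)"
      then have "x \<in> dyadic i (j div 2 div 2 ^ (k - 1 - i))" using dyadic_refine[OF le] by blast
      moreover have "0 \<le> x" "x < 1" using x dyadic_subset[OF j2] by auto
      ultimately show "(\<Sum>j<2 ^ i. v j * indicator (dyadic i j) x) = v (j div 2 div 2 ^ (k - 1 - i))"
        using sum_indicator_dyadic[of x v i] by (simp add: mem_dyadic_iff del: sum_mult_indicator)
    qed (use False that in auto)
  qed
  then show ?thesis using False by (simp add: lev_def)
qed

definition coeff_lp :: "real \<Rightarrow> (nat \<Rightarrow> nat \<Rightarrow> complex) \<Rightarrow> nat \<Rightarrow> real" where
  "coeff_lp p c k = (\<Sum>j<2 ^ k. cmod (c k j) powr p) powr (1 / p)"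

lemma coeff_lp_nonneg [simp]: "0 \<le> coeff_lp p c k"
  by (simp add: coeff_lp_def)

text \<open>Dictionary between the analytic form of the coefficient norm, a supremum or an infinite
  sum with a root, and the bound \<open>lq_le\<close>.\<close>

lemma coeff_norm_lq:
  assumes q: "1 \<le> q" and p: "1 \<le> p"
  shows "coeff_finite p q c \<Longrightarrow> lq_le q (coeff_lp p c) (coeff_norm p q c)"
    and "lq_le q (coeff_lp p c) K \<Longrightarrow> coeff_finite p q c \<and> coeff_norm p q c \<le> K"
    and "0 \<le> coeff_norm p q c \<or> \<not> coeff_finite p q c"
proof -
  have pw: "(\<Sum>j<2 ^ k. cmod (c k j) powr p) powr (real_of_ereal q / p) = coeff_lp p c k powr real_of_ereal q" for k
    by (simp add: coeff_lp_def powr_powr)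
  have fin1: "coeff_finite p q c \<longleftrightarrow> bdd_above (range (coeff_lp p c))"
    and norm1: "coeff_norm p q c = (SUP k. coeff_lp p c k)" if "q = \<infinity>"
    using that by (simp_all add: coeff_finite_def coeff_norm_def coeff_lp_def)
  have fin2: "coeff_finite p q c \<longleftrightarrow> summable (\<lambda>k. coeff_lp p c k powr real_of_ereal q)"
    and norm2: "coeff_norm p q c = (\<Sum>k. coeff_lp p c k powr real_of_ereal q) powr (1 / real_of_ereal q)" if "q \<noteq> \<infinity>"
    using that by (simp_all add: coeff_finite_def coeff_norm_def pw)
  show "lq_le q (coeff_lp p c) (coeff_norm p q c)" if "coeff_finite p q c"
  proof (cases "q = \<infinity>")
    case True
    have "coeff_lp p c k \<le> coeff_norm p q c" for k
      using that fin1[OF True] norm1[OF True] by (simp add: cSUP_upper)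
    moreover from this[of 0] have "0 \<le> coeff_norm p q c" using coeff_lp_nonneg order_trans by blast
    ultimately show ?thesis using True by (simp add: lq_le_def)
  next
    case False
    note q1 = real_of_ereal_ge_one[OF q False]
    have "(\<Sum>k<n. coeff_lp p c k powr real_of_ereal q) \<le> coeff_norm p q c powr real_of_ereal q" for n
      using that fin2[OF False] norm2[OF False] q1 by (simp add: powr_powr suminf_nonneg sum_le_suminf)
    moreover have "0 \<le> coeff_norm p q c" using norm2[OF False] by simp
    ultimately show ?thesis using False unfolding lq_le_def by simp
  qed
  then show "0 \<le> coeff_norm p q c \<or> \<not> coeff_finite p q c" by (auto simp: lq_le_def)
  show "coeff_finite p q c \<and> coeff_norm p q c \<le> K" if K: "lq_le q (coeff_lp p c) K"
  proof (cases "q = \<infinity>")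
    case True
    then have "coeff_lp p c k \<le> K" for k using K by (simp add: lq_le_def)
    then show ?thesis unfolding fin1[OF True] norm1[OF True] by (auto intro!: cSUP_least bdd_aboveI2)
  next
    case False
    note q1 = real_of_ereal_ge_one[OF q False]
    have b: "(\<Sum>k<n. coeff_lp p c k powr real_of_ereal q) \<le> K powr real_of_ereal q" for n
      using K False by (simp add: lq_le_def)
    have s: "summable (\<lambda>k. coeff_lp p c k powr real_of_ereal q)"
      by (rule summableI_nonneg_bounded[OF _ b]) auto
    have "(\<Sum>k. coeff_lp p c k powr real_of_ereal q) \<le> K powr real_of_ereal q"
      by (rule suminf_le_const[OF s b])
    then have "(\<Sum>k. coeff_lp p c k powr real_of_ereal q) powr (1 / real_of_ereal q)
        \<le> (K powr real_of_ereal q) powr (1 / real_of_ereal q)"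
      using q1 by (intro powr_mono2 suminf_nonneg s) auto
    also have "\<dots> = K" using q1 lq_le_nonneg[OF K] by (simp add: powr_powr)
    finally show ?thesis using s unfolding fin2[OF False] norm2[OF False] by simp
  qed
qed

lemma besov_norm_nonneg:
  assumes "1 \<le> q" "1 \<le> p" "f \<in> besov s p q"
  shows "0 \<le> besov_norm s p q f"
  unfolding besov_norm_def using assms coeff_norm_lq(3)[OF assms(1,2)]
  by (intro cInf_greatest) (auto simp: besov_def)

text \<open>The martingale differences themselves form an admissible atomic representation,
  convergent in L^p by \<open>bl_tail_powr\<close>.\<close>

lemma bl_imp_besov:
  assumes p: "1 \<le> p" and q: "1 \<le> q" and s: "0 < s" and f: "bl s p q f K"
  shows "f \<in> besov s p q" "besov_norm s p q f \<le> K"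
proof -
  \<comment> \<open>On a cell of level \<open>k\<close> the atom takes the constant value
    \<open>2 powr (- k * (s - 1 / p))\<close>; the factor undoes this normalisation.\<close>
  define c where "c k j = dco k j f * of_real (2 powr (real k * (s - 1 / p)))" for k j
  have ca: "c k j * atom s p (dyadic k j) x = dco k j f * indicator (dyadic k j) x" for k j x
    by (simp add: c_def atom_dyadic powr_minus)
  define R where "R = (1 / (1 - 2 powr (- s / 2))) powr (p - 1) * K powr p / (1 - 2 powr (- (s * (p + 1) / 2)))"
  let ?r = "2 powr (- (s * (p + 1) / 2)) :: real"
  have r: "0 < ?r" "?r < 1" using s p by (auto intro!: powr_less_one mult_pos_pos divide_pos_pos)
  note tail = bl_tail_powr[OF p q s f, folded R_def]
  have rep: "besov_rep s p c f"
    unfolding besov_rep_def ca dpart_def[symmetric]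
  proof (rule Lim_null_comparison[OF always_eventually, rotated])
    show "(\<lambda>n. (R * ?r ^ n) powr (1 / p)) \<longlonglongrightarrow> 0"
    proof -
      have "(\<lambda>n. (R * ?r ^ n) powr (1 / p)) \<longlonglongrightarrow> 0 powr (1 / p)"
      proof (rule tendsto_powr'[OF _ tendsto_const])
        show "(\<lambda>n. R * ?r ^ n) \<longlonglongrightarrow> 0"
          using r by (intro tendsto_mult_right_zero LIMSEQ_power_zero) auto
        have "0 \<le> R * ?r ^ n" for n
          by (rule order_trans[OF _ tail(2)[of n]]) simp
        then show "0 \<noteq> (0::real) \<or> 0 < 1 / p \<and> (\<forall>\<^sub>F n in sequentially. 0 \<le> R * ?r ^ n)" using p by auto
      qed
      then show ?thesis by simp
    qed
    show "\<forall>n. norm (Lp_norm p (\<lambda>x. f x - (\<Sum>k<n. dpart k f x))) \<le> (R * ?r ^ n) powr (1 / p)"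
      unfolding Lp_norm_def using tail(2) p by (auto intro!: powr_mono2)
  qed
  have "coeff_lp p c k = 2 powr (real k * s) * lev p k f" for k
  proof -
    have "(\<Sum>j<2 ^ k. cmod (c k j) powr p) = (2 powr (real k * (s - 1 / p))) powr p * (2 ^ k * (lev p k f powr p))"
    proof -
      have "2 ^ k * (lev p k f powr p) = (\<Sum>j<2 ^ k. cmod (dco k j f) powr p)" using p by (simp add: lev_powr)
      then show ?thesis by (simp add: c_def norm_mult powr_mult sum_distrib_left mult.commute)
    qed
    also have "2 ^ k = (2 powr (real k / p)) powr p" using p by (simp add: powr_powr powr_realpow)
    also have "(2 powr (real k * (s - 1 / p))) powr p * ((2 powr (real k / p)) powr p * (lev p k f powr p))
        = (2 powr (real k * (s - 1 / p)) * (2 powr (real k / p)) * lev p k f) powr p"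
      by (simp add: powr_mult)
    also have "2 powr (real k * (s - 1 / p)) * 2 powr (real k / p) = 2 powr (real k * s)"
      by (simp add: powr_add[symmetric] right_diff_distrib)
    finally show ?thesis using p by (simp add: coeff_lp_def powr_powr)
  qed
  then have "coeff_lp p c = (\<lambda>k. 2 powr (real k * s) * lev p k f)" by (rule ext)
  then have "lq_le q (coeff_lp p c) K" using f by (simp add: bl_def)
  then have c: "coeff_finite p q c" "coeff_norm p q c \<le> K" using coeff_norm_lq(2)[OF q p] by auto
  have "integrable leb01 (\<lambda>x. cmod (f x) powr p)" using tail(1)[of 0] by simp
  then have "Lp_fun p f" using f by (auto simp: Lp_fun_def bl_def)
  then show "f \<in> besov s p q" using rep c by (auto simp: besov_def)
  have "besov_norm s p q f \<le> coeff_norm p q c"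
    unfolding besov_norm_def using rep c coeff_norm_lq(3)[OF q p]
    by (intro cInf_lower bdd_belowI[of _ 0]) auto
  then show "besov_norm s p q f \<le> K" using c by simp
qed

text \<open>Atoms of level \<open>i\<close> reach only levels \<open>k \<le> i\<close>, with
  strength \<open>2 * 2 powr ((k - i) * s)\<close>. Young's inequality with this one-sided kernel
  works for every representation, and the total mass of the kernel is the constant.\<close>

lemma besov_rep_imp_bl:
  assumes p: "1 \<le> p" and q: "1 \<le> q" and s: "0 < s"
    and f: "Lp_fun p f" and rep: "besov_rep s p c f" and c: "coeff_finite p q c"
  shows "bl s p q f (2 / (1 - 2 powr (- s)) * coeff_norm p q c)"
proof -
  have lq: "lq_le q (coeff_lp p c) (coeff_norm p q c)" using coeff_norm_lq(1)[OF q p c] .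
  define v where "v k j = c k j * of_real (2 powr (- (real k * (s - 1 / p))))" for k j
  define h where "h k x = (\<Sum>j<2 ^ k. v k j * indicator (dyadic k j) x)" for k x
  define g where "g n x = (\<Sum>k<n. h k x)" for n x
  have hi: "integrable leb01 (h k)" for k unfolding h_def by (rule integrable_dyadic_sum)
  have gi: "integrable leb01 (g n)" for n unfolding g_def using hi by (intro Bochner_Integration.integrable_sum) auto
  have ca: "c k j * atom s p (dyadic k j) x = v k j * indicator (dyadic k j) x" for k j x
    by (simp add: v_def atom_dyadic)
  have gb: "cmod (g n x) \<le> (\<Sum>k<n. \<Sum>j<2 ^ k. cmod (v k j))" for n x
    unfolding g_def h_def by (intro order_trans[OF norm_sum] sum_mono) (auto simp: norm_mult indicator_def)
  have fi: "integrable leb01 f"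
    by (rule L1norm_powr_le(1)[OF p]) (use f in \<open>simp_all add: Lp_fun_def\<close>)
  have lim: "(\<lambda>n. L1norm (\<lambda>x. g n x - f x)) \<longlonglongrightarrow> 0"
  proof (rule Lim_null_comparison[OF always_eventually])
    show "(\<lambda>n. Lp_norm p (\<lambda>x. f x - g n x)) \<longlonglongrightarrow> 0"
      using rep unfolding besov_rep_def ca g_def h_def .
    have "L1norm (\<lambda>x. f x - g n x) \<le> Lp_norm p (\<lambda>x. f x - g n x)" for n
      using fi gi by (intro L1norm_powr_le(2)[OF p] Lp_fun_diff_bounded[OF p f _ gb]) auto
    then show "\<forall>n. norm (L1norm (\<lambda>x. g n x - f x)) \<le> Lp_norm p (\<lambda>x. f x - g n x)"
      by (simp add: L1norm_minus_commute[of "g _"])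
  qed
  define m where "m t = (if t \<le> 0 then 2 * 2 powr (of_int t * s) else 0)" for t :: int
  have lh: "2 powr (real k * s) * lev p k (h i) \<le> m (int k - int i) * coeff_lp p c i" for k i
  proof (cases "k \<le> i")
    case True
    have "lev p k (h i) powr p \<le> 2 powr p * ((\<Sum>j<2 ^ i. cmod (v i j) powr p) / 2 ^ i)"
      using lev_step_powr_le[OF p, where k = k and i = i and v = "v i"] True
      unfolding h_def[abs_def] by (simp del: sum_mult_indicator)
    also have "(\<Sum>j<2 ^ i. cmod (v i j) powr p) = coeff_lp p c i powr p * (2 powr (- (real i * (s - 1 / p)))) powr p"
      using p by (simp add: v_def norm_mult powr_mult sum_distrib_right coeff_lp_def powr_powr sum_nonneg)
    also have "(1 / 2 ^ i :: real) = (2 powr (- (real i / p))) powr p"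
    proof -
      have "(2 powr (- (real i / p))) powr p = 2 powr (- real i)" using p by (simp add: powr_powr)
      then show ?thesis by (simp add: powr_minus powr_realpow divide_inverse)
    qed
    then have "coeff_lp p c i powr p * (2 powr (- (real i * (s - 1 / p)))) powr p / 2 ^ i
        = coeff_lp p c i powr p * ((2 powr (- (real i * (s - 1 / p)))) powr p * (2 powr (- (real i / p))) powr p)"
      by (simp add: divide_inverse)
    also have "\<dots> = (coeff_lp p c i * (2 powr (- (real i * (s - 1 / p))) * 2 powr (- (real i / p)))) powr p"
      by (simp add: powr_mult)
    also have "2 powr (- (real i * (s - 1 / p))) * 2 powr (- (real i / p)) = 2 powr (- (real i * s))"
      by (simp add: powr_add[symmetric] right_diff_distrib)
    finally have "lev p k (h i) powr p \<le> (2 * (coeff_lp p c i * 2 powr (- (real i * s)))) powr p"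
      by (simp add: powr_mult)
    then have le: "lev p k (h i) \<le> 2 * (coeff_lp p c i * 2 powr (- (real i * s)))"
      using p powr_less_mono2[of p "2 * (coeff_lp p c i * 2 powr (- (real i * s)))" "lev p k (h i)"] by force
    have "2 powr (real k * s) * lev p k (h i) \<le> 2 powr (real k * s) * (2 * (coeff_lp p c i * 2 powr (- (real i * s))))"
      using le by (intro mult_left_mono) auto
    also have "\<dots> = 2 * (2 powr (real k * s) * 2 powr (- (real i * s))) * coeff_lp p c i" by simp
    also have "2 powr (real k * s) * 2 powr (- (real i * s)) = 2 powr (of_int (int k - int i) * s)"
      by (simp add: powr_add[symmetric] left_diff_distrib)
    finally show ?thesis using True by (simp add: m_def)
  next
    case False
    then show ?thesis
      using lev_step_powr_le[OF p, where k = k and i = i and v = "v i"]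
      unfolding h_def[abs_def] m_def by (simp del: sum_mult_indicator)
  qed
  have "lq_le q (\<lambda>k. 2 powr (real k * s) * lev p k f) (2 / (1 - 2 powr (- s)) * coeff_norm p q c)"
  proof (rule lq_young[OF q _ lq, where m = m and w = "\<lambda>n k. 2 powr (real k * s) * lev p k (g n)"])
    show "(\<Sum>t\<in>S. m t) \<le> 2 / (1 - 2 powr (- s))" if "finite S" for S
    proof -
      have "(\<Sum>t\<in>S. m t) = 2 * (\<Sum>t\<in>S. if t \<le> 0 then (2 powr (- s)) powr (of_int 0 - of_int t) else 0)"
        unfolding sum_distrib_left by (intro sum.cong) (auto simp: m_def powr_powr mult.commute)
      also have "\<dots> \<le> 2 * (1 / (1 - 2 powr (- s)))"
        using s that by (intro mult_left_mono sum_geometric_int_below) (auto intro: powr_less_one)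
      finally show ?thesis by simp
    qed
    show "2 powr (real k * s) * lev p k (g I) \<le> (\<Sum>i<I. m (int k - int i) * coeff_lp p c i)" for I k
    proof -
      have "2 powr (real k * s) * lev p k (g I) \<le> 2 powr (real k * s) * (\<Sum>i<I. lev p k (h i))"
        unfolding g_def using hi by (intro mult_left_mono lev_sum[OF p]) auto
      also have "\<dots> \<le> (\<Sum>i<I. m (int k - int i) * coeff_lp p c i)"
        unfolding sum_distrib_left by (intro sum_mono lh)
      finally show ?thesis .
    qed
    show "(\<lambda>n. 2 powr (real k * s) * lev p k (g n)) \<longlonglongrightarrow> 2 powr (real k * s) * lev p k f" for k
      by (intro tendsto_mult tendsto_const lev_tendsto[OF p gi fi lim])
  qed (auto simp: m_def)
  then show ?thesis using fi by (simp add: bl_def)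
qed

text \<open>The infimum in the norm may fail to be attained: representations close to it give every
  larger bound \<open>L\<close>, and \<open>bl_inf\<close> closes the gap.\<close>

lemma besov_imp_bl:
  assumes p: "1 \<le> p" and q: "1 \<le> q" and s: "0 < s" and f: "f \<in> besov s p q"
  shows "bl s p q f (2 / (1 - 2 powr (- s)) * besov_norm s p q f)"
proof (rule bl_inf[OF q])
  let ?C = "2 / (1 - 2 powr (- s)) :: real"
  have C: "0 < ?C" using s by (auto intro!: divide_pos_pos powr_less_one)
  show "0 \<le> ?C * besov_norm s p q f"
    using besov_norm_nonneg[OF q p f] C by (intro mult_nonneg_nonneg) auto
  fix L assume L: "?C * besov_norm s p q f < L"
  then have "besov_norm s p q f < L / ?C" using C by (simp add: field_simps)
  then obtain c where c: "besov_rep s p c f" "coeff_finite p q c" "coeff_norm p q c < L / ?C"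
    using f cInf_lessD[of "{coeff_norm p q c | c. besov_rep s p c f \<and> coeff_finite p q c}" "L / ?C"]
    by (auto simp: besov_def besov_norm_def)
  have "Lp_fun p f" using f by (simp add: besov_def)
  from besov_rep_imp_bl[OF p q s this c(1,2)] show "bl s p q f L"
    using c(3) C by (elim bl_mono[OF q]) (simp add: field_simps)
qed

lemma besov_iff_bl:
  assumes "1 \<le> p" "1 \<le> q" "0 < s"
  shows "f \<in> besov s p q \<longleftrightarrow> (\<exists>K. bl s p q f K)"
  using bl_imp_besov[OF assms] besov_imp_bl[OF assms] by blast

section \<open>Bi-Lipschitz branches\<close>

lemma AE_leb01_iff: "(AE x in leb01. P x) \<longleftrightarrow> (AE x in lebesgue. x \<in> {0..1} \<longrightarrow> P x)"
  by (subst AE_restrict_space_iff) auto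

lemma AE_leb01_null:
  assumes "AE x in leb01. P x"
  obtains N where "N \<in> null_sets lborel" "{x \<in> {0..1}. \<not> P x} \<subseteq> N"
proof -
  have "AE x in lborel. x \<in> {0..1} \<longrightarrow> P x"
    using assms unfolding AE_leb01_iff by (simp add: AE_completion_iff)
  then obtain N where N: "N \<in> null_sets lborel" "{x \<in> space lborel. \<not> (x \<in> {0..1} \<longrightarrow> P x)} \<subseteq> N"
    unfolding eventually_ae_filter by auto
  then show thesis by (intro that[of N]) auto
qed

lemma AE_leb01_not_in_null:
  assumes "N \<in> null_sets lborel"
  shows "AE x in leb01. x \<notin> N"
  unfolding AE_leb01_iff using AE_completion[OF AE_not_in[OF assms]] by eventually_elim auto

lemma sets_leb01_null:
  assumes "AE x in leb01. x \<notin> A" "A \<subseteq> {0..1}"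
  shows "A \<in> sets leb01"
proof -
  obtain N where N: "N \<in> null_sets lborel" "{x \<in> {0..1}. \<not> x \<notin> A} \<subseteq> N" using AE_leb01_null[OF assms(1)] .
  then have "A \<subseteq> N" using assms(2) by blast
  with N(1) have "A \<in> sets lebesgue" by (rule sets_completionI_sub)
  then show ?thesis using assms(2) by (simp add: sets_leb01_iff)
qed

lemma sets_leb01_borel_null:
  assumes "A \<in> sets leb01"
  obtains B N where "B \<in> sets borel" "N \<in> null_sets lborel" "B \<subseteq> A" "A \<subseteq> B \<union> N"
proof -
  have "A \<in> sets (completion lborel)" using assms by (simp add: sets_leb01_iff)
  then obtain S N N' where "A = S \<union> N" "N \<subseteq> N'" "N' \<in> null_sets lborel" "S \<in> sets lborel"
    by (elim sets_completionE)
  then show thesis by (intro that[of S N']) auto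
qed

text \<open>A Borel measurable map may fail to pull Lebesgue sets back to Lebesgue sets. It does so
  once preimages of null sets are null, since a Lebesgue set is Borel up to a null set. The constant
  value off \<open>S\<close> accommodates maps that are meaningful only on an interval.\<close>

lemma measurable_leb01_leb01I:
  assumes S: "S \<in> sets leb01" and H: "H \<in> borel_measurable leb01" and H01: "\<And>x. x \<in> {0..1} \<Longrightarrow> H x \<in> {0..1}"
    and null: "\<And>N. N \<in> null_sets lborel \<Longrightarrow> AE x in leb01. x \<in> S \<longrightarrow> H x \<notin> N"
    and const: "\<And>x. x \<in> {0..1} \<Longrightarrow> x \<notin> S \<Longrightarrow> H x = e"
  shows "H \<in> measurable leb01 leb01"
proof (rule measurableI)
  show "H x \<in> space leb01" if "x \<in> space leb01" for x using that H01 by simp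
  fix A assume "A \<in> sets leb01"
  then obtain B N where BN: "B \<in> sets borel" "N \<in> null_sets lborel" "B \<subseteq> A" "A \<subseteq> B \<union> N"
    by (rule sets_leb01_borel_null)
  let ?Z = "{x \<in> S. H x \<in> A - B}"
  have S01: "S \<subseteq> {0..1}" using S by (simp add: sets_leb01_iff)
  have "AE x in leb01. x \<notin> ?Z"
    using null[OF BN(2)] by eventually_elim (use BN in auto)
  then have Z: "?Z \<in> sets leb01" using S01 by (intro sets_leb01_null) auto
  have B: "H -` B \<inter> {0..1} \<in> sets leb01" using measurable_sets[OF H BN(1)] by simp
  have "{0..1} \<in> sets leb01" by (simp add: sets_leb01_iff)
  then have C: "(if e \<in> A then {0..1} - S else {}) \<in> sets leb01" using S by auto
  have "H -` A \<inter> space leb01 = (H -` B \<inter> {0..1} \<union> ?Z) \<union> (if e \<in> A then {0..1} - S else {})"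
    using BN(3) const S01 by auto
  then show "H -` A \<inter> space leb01 \<in> sets leb01" using B Z C by (simp only: sets.Un)
qed

text \<open>One inverse branch, described by its density \<open>w\<close>. The bounds on
  \<open>w\<close> hold only almost everywhere, so the branch may lack a derivative at some points,
  and change of variables is derived from the integral itself.\<close>

locale lip_branch =
  fixes w :: "real \<Rightarrow> real" and a b c d m M :: real
  assumes cd: "0 \<le> c" "c < d" "d \<le> 1" and ab: "0 \<le> a" "b \<le> 1"
    and w_meas: "w \<in> borel_measurable leb01"
    and w_bd: "AE x in leb01. x \<in> {c..d} \<longrightarrow> m \<le> w x \<and> w x \<le> M"
    and m_pos: "0 < m"
    and w_int: "(LINT t:{c..d}|leb01. w t) = b - a"
begin

definition h :: "real \<Rightarrow> real" where
  "h x = a + (LINT t:{c..x}|leb01. w t)"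

lemma Icc_sets: "c \<le> x \<Longrightarrow> y \<le> d \<Longrightarrow> {x..y} \<in> sets leb01" "c \<le> x \<Longrightarrow> y \<le> d \<Longrightarrow> {x<..y} \<in> sets leb01"
  using cd by (auto simp: sets_leb01_iff)

lemma integrable_w:
  assumes "A \<in> sets leb01" "A \<subseteq> {c..d}"
  shows "integrable leb01 (\<lambda>t. indicator A t * w t)"
proof (rule integrable_leb01_bounded)
  show "(\<lambda>t. indicator A t * w t) \<in> borel_measurable leb01" using assms w_meas by measurable
  show "AE x in leb01. norm (indicator A x * w x) \<le> M"
  proof -
    have M0: "0 \<le> M"
    proof (rule ccontr)
      assume "\<not> 0 \<le> M"
      then have ae: "AE x in leb01. x \<notin> {c..d}" using w_bd m_pos by (auto elim: eventually_mono)
      have "measure leb01 {c..d} = d - c" using cd by (subst measure_leb01) auto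
      moreover have "{c..d} \<in> null_sets leb01"
        using ae Icc_sets(1)[of c d] by (simp add: AE_iff_null_sets)
      ultimately show False using cd by (simp add: null_sets_def measure_def)
    qed
    show ?thesis using w_bd by eventually_elim (use M0 assms m_pos in \<open>auto simp: indicator_def\<close>)
  qed
qed

lemma h_diff:
  assumes "c \<le> x" "x \<le> y" "y \<le> d"
  shows "h y - h x = (LINT t|leb01. indicator {x<..y} t * w t)"
proof -
  have i: "integrable leb01 (\<lambda>t. indicator {c..x} t * w t)" "integrable leb01 (\<lambda>t. indicator {c..y} t * w t)"
    using assms by (auto intro!: integrable_w Icc_sets)
  have "h y - h x = (LINT t|leb01. indicator {c..y} t * w t - indicator {c..x} t * w t)"
    using i by (simp add: h_def set_lebesgue_integral_def)
  also have "(\<lambda>t. indicator {c..y} t * w t - indicator {c..x} t * w t) = (\<lambda>t. indicator {x<..y} t * w t)"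
    using assms by (auto simp: indicator_def fun_eq_iff)
  finally show ?thesis .
qed

lemma h_lip:
  assumes "c \<le> x" "x \<le> y" "y \<le> d"
  shows "m * (y - x) \<le> h y - h x" "h y - h x \<le> M * (y - x)"
proof -
  have s: "{x<..y} \<in> sets leb01" using assms by (intro Icc_sets)
  have meas: "measure leb01 {x<..y} = y - x" using assms cd by (subst measure_leb01) auto
  have I: "integrable leb01 (\<lambda>t. indicator {x<..y} t * w t)" using s assms by (intro integrable_w) auto
  have ii: "integrable leb01 (\<lambda>t. indicator {x<..y} t * k)" for k :: real
    using integrable_leb01_indicator[OF s, where 'b = real] by simp
  have sp: "{x<..y} \<inter> {0..1} = {x<..y}" using assms cd by auto
  have v: "(LINT t|leb01. indicator {x<..y} t * k) = k * (y - x)" for k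
    using meas by (simp add: sp)
  have "(LINT t|leb01. indicator {x<..y} t * m) \<le> (LINT t|leb01. indicator {x<..y} t * w t)"
    using I ii w_bd assms by (intro integral_mono_AE) (auto elim!: eventually_mono simp: indicator_def)
  then show "m * (y - x) \<le> h y - h x" unfolding h_diff[OF assms] v .
  have "(LINT t|leb01. indicator {x<..y} t * w t) \<le> (LINT t|leb01. indicator {x<..y} t * M)"
    using I ii w_bd assms by (intro integral_mono_AE) (auto elim!: eventually_mono simp: indicator_def)
  then show "h y - h x \<le> M * (y - x)" unfolding h_diff[OF assms] v .
qed

lemma h_c: "h c = a"
proof -
  have "AE t in leb01. indicator {c..c} t *\<^sub>R w t = 0"
    using AE_leb01_not_in_null[OF finite_imp_null_set_lborel[of "{c}"]] by (auto elim!: eventually_mono)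
  then have "(LINT t:{c..c}|leb01. w t) = 0"
    unfolding set_lebesgue_integral_def by (rule integral_eq_zero_AE)
  then show ?thesis by (simp add: h_def)
qed

lemma h_d: "h d = b"
  using w_int by (simp add: h_def)

lemma h_less: "c \<le> x \<Longrightarrow> x < y \<Longrightarrow> y \<le> d \<Longrightarrow> h x < h y"
  using h_lip(1)[of x y] m_pos by (smt (verit) mult_pos_pos)

lemma h_le: "c \<le> x \<Longrightarrow> x \<le> y \<Longrightarrow> y \<le> d \<Longrightarrow> h x \<le> h y"
  using h_less[of x y] by (cases "x = y") auto

lemma h_less_iff: "x \<in> {c..d} \<Longrightarrow> y \<in> {c..d} \<Longrightarrow> h x < h y \<longleftrightarrow> x < y"
  using h_less[of x y] h_le[of y x] by (auto simp: not_less[symmetric])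

lemma inj_on_h: "inj_on h {c..d}"
  using h_less_iff by (metis inj_onI linorder_neqE_linordered_idom less_irrefl)

lemma M_nonneg: "0 \<le> M"
proof -
  have "m \<le> M" using order_trans[OF h_lip(1)[of c d] h_lip(2)[of c d]] cd by simp
  then show ?thesis using m_pos by simp
qed

lemma continuous_on_h: "continuous_on {c..d} h"
proof (rule lipschitz_on_continuous_on)
  show "M-lipschitz_on {c..d} h"
  proof (rule lipschitz_onI)
    fix x y assume xy: "x \<in> {c..d}" "y \<in> {c..d}"
    show "dist (h x) (h y) \<le> M * dist x y"
      using xy h_lip(2)[of x y] h_lip(2)[of y x] h_le[of x y] h_le[of y x]
      by (cases "x \<le> y") (auto simp: dist_real_def abs_if)
  qed (rule M_nonneg)
qed

lemma h_image: "h ` {c..d} = {a..b}"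
proof
  show "h ` {c..d} \<subseteq> {a..b}" using h_le[of c] h_le[of _ d] h_c h_d by auto
  show "{a..b} \<subseteq> h ` {c..d}"
  proof
    fix y assume "y \<in> {a..b}"
    then obtain x where "c \<le> x" "x \<le> d" "h x = y"
      using IVT'[of h c y d] h_c h_d cd continuous_on_h by auto
    then show "y \<in> h ` {c..d}" by auto
  qed
qed

lemma h_in: "x \<in> {c..d} \<Longrightarrow> h x \<in> {a..b}"
  using h_image by blast

lemma a_less_b: "a < b"
  using h_less[of c d] cd h_c h_d by simp

section \<open>Change of variables along one branch\<close>

definition H :: "real \<Rightarrow> real" where "H x = (if x \<in> {c..d} then h x else 0)"

text \<open>The measure that \<open>h\<close> transports to Lebesgue measure on
  \<open>{a..b}\<close>.\<close>

definition \<nu> :: "real measure" where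
  "\<nu> = density leb01 (\<lambda>x. ennreal (indicator {c..d} x * w x))"

lemma H_borel: "H \<in> borel_measurable leb01"
proof -
  have "(\<lambda>x. indicator {c..d} x *\<^sub>R h x) \<in> borel_measurable borel"
    by (intro borel_measurable_continuous_on_indicator continuous_on_h) auto
  also have "(\<lambda>x. indicator {c..d} x *\<^sub>R h x) = H" by (auto simp: H_def indicator_def)
  finally show ?thesis by (rule measurable_leb01_borel)
qed

lemma emeasure_\<nu>:
  assumes "A \<in> sets leb01"
  shows "emeasure \<nu> A = ennreal (LINT t|leb01. indicator ({c..d} \<inter> A) t * w t)"
proof -
  have J: "{c..d} \<in> sets leb01" by (intro Icc_sets) auto
  have "emeasure \<nu> A = (\<integral>\<^sup>+ x. ennreal (indicator {c..d} x * w x) * indicator A x \<partial>leb01)"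
    unfolding \<nu>_def using assms J w_meas by (intro emeasure_density) auto
  also have "\<dots> = (\<integral>\<^sup>+ x. ennreal (indicator ({c..d} \<inter> A) x * w x) \<partial>leb01)"
    by (intro nn_integral_cong) (auto simp: indicator_def)
  also have "\<dots> = ennreal (LINT t|leb01. indicator ({c..d} \<inter> A) t * w t)"
    using assms J w_bd m_pos
    by (intro nn_integral_eq_integral integrable_w) (auto elim!: eventually_mono simp: indicator_def)
  finally show ?thesis .
qed

text \<open>On \<open>{c..d}\<close>, \<open>h - a\<close> is the distribution function of \<nu>;
  comparing both sides on half-lines therefore gives the change of variables formula without
  derivatives.\<close>

lemma distr_borel: "distr \<nu> borel H = density lborel (indicator {a..b})"
proof (rule measure_eqI_lessThan)
  have Hm: "H \<in> measurable \<nu> borel" using H_borel by (simp add: \<nu>_def)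
  have *: "emeasure (distr \<nu> borel H) {x<..} = ennreal (LINT t|leb01. indicator ({c..d} \<inter> (H -` {x<..} \<inter> {0..1})) t * w t)" for x
  proof -
    have "emeasure (distr \<nu> borel H) {x<..} = emeasure \<nu> (H -` {x<..} \<inter> {0..1})"
      using Hm by (subst emeasure_distr) (auto simp: \<nu>_def)
    also have "H -` {x<..} \<inter> {0..1} \<in> sets leb01" using measurable_sets[OF H_borel, of "{x<..}"] by simp
    then have "emeasure \<nu> (H -` {x<..} \<inter> {0..1}) = ennreal (LINT t|leb01. indicator ({c..d} \<inter> (H -` {x<..} \<inter> {0..1})) t * w t)"
      by (rule emeasure_\<nu>)
    finally show ?thesis .
  qed
  show "emeasure (distr \<nu> borel H) {x<..} < \<infinity>" for x unfolding * by simp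
  show "emeasure (distr \<nu> borel H) {x<..} = emeasure (density lborel (indicator {a..b})) {x<..}" for x
  proof -
    have R: "emeasure (density lborel (indicator {a..b})) {x<..} = emeasure lborel ({a..b} \<inter> {x<..})"
      by (subst emeasure_density) (auto simp: indicator_inter_arith[symmetric])
    consider "x < a" | "a \<le> x" "x \<le> b" | "b < x" by linarith
    then show ?thesis
    proof cases
      case 1
      then have "{c..d} \<inter> (H -` {x<..} \<inter> {0..1}) = {c..d}" using h_in cd by (force simp: H_def)
      moreover have "{a..b} \<inter> {x<..} = {a..b}" using 1 by auto
      ultimately show ?thesis unfolding * R using w_int a_less_b by (simp add: set_lebesgue_integral_def)
    next
      case 2
      then obtain y where y: "y \<in> {c..d}" "x = h y" using h_image by (metis atLeastAtMost_iff imageE)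
      have "{c..d} \<inter> (H -` {x<..} \<inter> {0..1}) = {y<..d}"
      proof (intro subset_antisym subsetI)
        fix t assume "t \<in> {c..d} \<inter> (H -` {x<..} \<inter> {0..1})"
        then have "t \<in> {c..d}" "h y < h t" using y by (auto simp: H_def)
        then show "t \<in> {y<..d}" using h_less_iff[OF y(1)] by auto
      next
        fix t assume "t \<in> {y<..d}"
        then have "t \<in> {c..d}" "y < t" using y by auto
        then show "t \<in> {c..d} \<inter> (H -` {x<..} \<inter> {0..1})"
          using h_less_iff[OF y(1)] y cd by (auto simp: H_def)
      qed
      moreover have "{a..b} \<inter> {x<..} = {x<..b}" using 2 by auto
      ultimately show ?thesis unfolding * R using h_diff[of y d] y 2 by (simp add: h_d)
    next
      case 3
      then have "{c..d} \<inter> (H -` {x<..} \<inter> {0..1}) = {}" using h_in by (force simp: H_def)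
      moreover have "{a..b} \<inter> {x<..} = {}" using 3 by auto
      ultimately show ?thesis unfolding * R by simp
    qed
  qed
qed (auto simp: \<nu>_def)

text \<open>The density of \<nu> is bounded below by \<open>m > 0\<close> on \<open>{c..d}\<close>,
  so \<nu> has no additional null sets there.\<close>

lemma AE_\<nu>_imp:
  assumes "AE x in \<nu>. P x"
  shows "AE x in leb01. x \<in> {c..d} \<longrightarrow> P x"
proof -
  have "AE x in leb01. 0 < ennreal (indicator {c..d} x * w x) \<longrightarrow> P x"
    using assms Icc_sets(1)[of c d] w_meas unfolding \<nu>_def by (subst (asm) AE_density) auto
  with w_bd show ?thesis
    by eventually_elim (use m_pos in \<open>auto simp: indicator_def\<close>)
qed


lemma H_null:
  assumes "N \<in> null_sets lborel"
  shows "AE x in leb01. x \<in> {c..d} \<longrightarrow> H x \<notin> N"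
proof -
  have Nb: "N \<in> sets borel" and "emeasure lborel N = 0" using assms by auto
  have "emeasure (distr \<nu> borel H) N = (\<integral>\<^sup>+ x. indicator {a..b} x * indicator N x \<partial>lborel)"
    unfolding distr_borel using Nb by (subst emeasure_density) auto
  also have "\<dots> \<le> (\<integral>\<^sup>+ x. indicator N x \<partial>lborel)" by (intro nn_integral_mono) (auto simp: indicator_def)
  also have "\<dots> = 0" using Nb \<open>emeasure lborel N = 0\<close> by simp
  finally have "N \<in> null_sets (distr \<nu> borel H)" using Nb by auto
  then have "AE x in distr \<nu> borel H. x \<notin> N" by (rule AE_not_in)
  then have "AE x in \<nu>. H x \<notin> N"
    using H_borel Nb by (subst (asm) AE_distr_iff) (auto simp: \<nu>_def)
  then show ?thesis by (rule AE_\<nu>_imp)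
qed

lemma H_measurable [measurable]: "H \<in> measurable leb01 leb01"
proof (rule measurable_leb01_leb01I[where S = "{c..d}" and e = 0])
  show "{c..d} \<in> sets leb01" by (intro Icc_sets) auto
  show "H x \<in> {0..1}" for x using h_in[of x] ab by (auto simp: H_def)
  show "AE x in leb01. x \<in> {c..d} \<longrightarrow> H x \<notin> N" if "N \<in> null_sets lborel" for N
    using that by (rule H_null)
  show "H x = 0" if "x \<notin> {c..d}" for x using that unfolding H_def by (rule if_not_P)
qed (rule H_borel)

lemma AE_H:
  assumes "AE y in leb01. P y"
  shows "AE x in leb01. x \<in> {c..d} \<longrightarrow> P (h x)"
proof -
  obtain N where N: "N \<in> null_sets lborel" "{x \<in> {0..1}. \<not> P x} \<subseteq> N" using AE_leb01_null[OF assms] .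
  from H_null[OF N(1)] show ?thesis
  proof eventually_elim
    case (elim x)
    show ?case
    proof
      assume x: "x \<in> {c..d}"
      then have "h x \<notin> N" "h x \<in> {0..1}" using elim h_in[OF x] ab by (auto simp: H_def)
      then show "P (h x)" using N(2) by blast
    qed
  qed
qed

text \<open>Passage from Borel to Lebesgue sets: a set differs from its Borel part by a null set,
  whose preimage is null by \<open>H_null\<close>.\<close>

lemma distr_leb01: "distr \<nu> leb01 H = density leb01 (indicator {a..b})"
proof (rule measure_eqI)
  have I: "{a..b} \<in> sets leb01" using ab by (auto simp: sets_leb01_iff)
  have Hm: "H \<in> measurable \<nu> leb01" "H \<in> measurable \<nu> borel" using H_measurable H_borel by (auto simp: \<nu>_def)
  have sp: "space \<nu> = {0..1}" "sets \<nu> = sets leb01" by (auto simp: \<nu>_def)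
  fix A assume "A \<in> sets (distr \<nu> leb01 H)"
  then have A: "A \<in> sets leb01" by simp
  then obtain B N where BN: "B \<in> sets borel" "N \<in> null_sets lborel" "B \<subseteq> A" "A \<subseteq> B \<union> N"
    by (rule sets_leb01_borel_null)
  have B: "B \<in> sets leb01" using BN A by (auto simp: sets_leb01_iff)
  have "emeasure (distr \<nu> leb01 H) A = emeasure \<nu> (H -` A \<inter> {0..1})"
    using Hm A by (subst emeasure_distr) (auto simp: sp)
  also have "\<dots> = emeasure \<nu> (H -` B \<inter> {0..1})"
  proof (rule emeasure_eq_AE)
    have "AE x in leb01. 0 < ennreal (indicator {c..d} x * w x) \<longrightarrow>
        (x \<in> H -` A \<inter> {0..1}) = (x \<in> H -` B \<inter> {0..1})"
      using H_null[OF BN(2)] by eventually_elim (use BN in \<open>auto simp: indicator_def split: if_splits\<close>)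
    then show "AE x in \<nu>. (x \<in> H -` A \<inter> {0..1}) = (x \<in> H -` B \<inter> {0..1})"
      unfolding \<nu>_def using Icc_sets(1)[of c d] w_meas by (subst AE_density) auto
    show "H -` A \<inter> {0..1} \<in> sets \<nu>" "H -` B \<inter> {0..1} \<in> sets \<nu>"
      using measurable_sets[OF Hm(1) A] measurable_sets[OF Hm(1) B] by (auto simp: sp)
  qed
  also have "\<dots> = emeasure (distr \<nu> borel H) B"
    using Hm BN(1) by (subst emeasure_distr) (auto simp: sp)
  also have "\<dots> = emeasure lborel ({a..b} \<inter> B)"
    unfolding distr_borel using BN(1) by (subst emeasure_density) (auto simp: indicator_inter_arith[symmetric])
  also have "\<dots> = emeasure lebesgue ({a..b} \<inter> B)" using BN(1) by simp
  also have "\<dots> = emeasure leb01 ({a..b} \<inter> B)" using ab by (subst emeasure_restrict_space) auto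
  also have "\<dots> = emeasure leb01 ({a..b} \<inter> A)"
    using AE_leb01_not_in_null[OF BN(2)] A B I BN
    by (intro emeasure_eq_AE) (auto elim!: eventually_mono)
  also have "\<dots> = emeasure (density leb01 (indicator {a..b})) A"
    using A I by (subst emeasure_density) (auto simp: indicator_inter_arith[symmetric])
  finally show "emeasure (distr \<nu> leb01 H) A = emeasure (density leb01 (indicator {a..b})) A" .
qed simp

lemma nn_integral_h:
  fixes f :: "real \<Rightarrow> ennreal"
  assumes f: "f \<in> borel_measurable leb01"
  shows "(\<integral>\<^sup>+ x. ennreal (indicator {c..d} x * w x) * f (H x) \<partial>leb01) = (\<integral>\<^sup>+ y. indicator {a..b} y * f y \<partial>leb01)"
proof -
  have I: "{a..b} \<in> sets leb01" using ab by (auto simp: sets_leb01_iff)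
  have "(\<integral>\<^sup>+ y. indicator {a..b} y * f y \<partial>leb01) = (\<integral>\<^sup>+ y. f y \<partial>distr \<nu> leb01 H)"
    unfolding distr_leb01 using I f by (subst nn_integral_density) auto
  also have "\<dots> = (\<integral>\<^sup>+ x. f (H x) \<partial>\<nu>)"
    using f H_measurable by (subst nn_integral_distr) (auto simp: \<nu>_def)
  also have "\<dots> = (\<integral>\<^sup>+ x. ennreal (indicator {c..d} x * w x) * f (H x) \<partial>leb01)"
    unfolding \<nu>_def using Icc_sets(1)[of c d] w_meas f H_measurable by (subst nn_integral_density) auto
  finally show ?thesis by simp
qed

lemma integral_h:
  fixes f :: "real \<Rightarrow> complex"
  assumes f: "integrable leb01 f"
  shows "integrable leb01 (\<lambda>x. indicator {c..d} x * of_real (w x) * f (h x))"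
    and "(LINT x|leb01. indicator {c..d} x * of_real (w x) * f (h x)) = (LINT y|leb01. indicator {a..b} y * f y)"
proof -
  have I: "{a..b} \<in> sets leb01" using ab by (auto simp: sets_leb01_iff)
  have fm: "f \<in> borel_measurable leb01" using f by auto
  have J: "{c..d} \<in> sets leb01" by (intro Icc_sets) auto
  have eq: "(\<lambda>x. indicator {c..d} x * of_real (w x) * f (h x)) = (\<lambda>x. (indicator {c..d} x * w x) *\<^sub>R f (H x))"
    by (auto simp: H_def indicator_def scaleR_conv_of_real)
  have nn: "AE x in leb01. 0 \<le> indicator {c..d} x * w x"
    using w_bd by eventually_elim (use m_pos in \<open>auto simp: indicator_def\<close>)
  have wm: "(\<lambda>x. indicator {c..d} x * w x) \<in> borel_measurable leb01" using J w_meas by measurable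
  have Hm: "H \<in> measurable \<nu> leb01" using H_measurable by (simp add: \<nu>_def)
  have fH: "(\<lambda>x. f (H x)) \<in> borel_measurable leb01" using fm H_measurable by measurable
  have dens: "density leb01 (indicator {a..b}) = density leb01 (\<lambda>x. ennreal (indicator {a..b} x))"
    by (intro arg_cong[where f = "density leb01"]) (auto simp: indicator_def)
  have im: "(indicator {a..b} :: real \<Rightarrow> real) \<in> borel_measurable leb01" using I by measurable
  have "integrable (density leb01 (\<lambda>x. ennreal (indicator {a..b} x))) f"
    using fm im integrable_mult_indicator[OF I f] by (subst integrable_density) auto
  then have "integrable (distr \<nu> leb01 H) f" by (simp only: distr_leb01 dens)
  then have "integrable \<nu> (\<lambda>x. f (H x))" using Hm fm by (subst (asm) integrable_distr_eq) auto
  then show "integrable leb01 (\<lambda>x. indicator {c..d} x * of_real (w x) * f (h x))"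
    unfolding \<nu>_def eq using fH wm nn by (subst (asm) integrable_density) auto
  have "(LINT x|leb01. indicator {c..d} x * of_real (w x) * f (h x)) = (LINT x|\<nu>. f (H x))"
    unfolding \<nu>_def eq using fH wm nn by (subst integral_density) auto
  also have "\<dots> = (LINT y|distr \<nu> leb01 H. f y)" using Hm fm by (subst integral_distr) auto
  also have "\<dots> = (LINT y|leb01. indicator {a..b} y *\<^sub>R f y)"
    unfolding distr_leb01 dens using fm im by (subst integral_density) auto
  also have "(\<lambda>y. indicator {a..b} y *\<^sub>R f y) = (\<lambda>y. indicator {a..b} y * f y)"
    by (auto simp: indicator_def)
  finally show "(LINT x|leb01. indicator {c..d} x * of_real (w x) * f (h x)) = (LINT y|leb01. indicator {a..b} y * f y)" .
qed

lemma integrable_comp_h: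
  fixes f :: "real \<Rightarrow> complex"
  assumes f: "integrable leb01 f"
  shows "integrable leb01 (\<lambda>x. indicator {c..d} x * f (h x))"
    and "L1norm (\<lambda>x. indicator {c..d} x * f (h x)) \<le> (1 / m) * L1norm f"
proof -
  let ?g = "\<lambda>x. indicator {c..d} x * of_real (w x) * f (h x)"
  have J: "{c..d} \<in> sets leb01" by (intro Icc_sets) auto
  have eq: "(\<lambda>x. indicator {c..d} x * f (h x)) = (\<lambda>x. indicator {c..d} x * f (H x))"
    by (auto simp: H_def indicator_def)
  have fm: "f \<in> borel_measurable leb01" using f by auto
  have meas: "(\<lambda>x. indicator {c..d} x * f (h x)) \<in> borel_measurable leb01"
    unfolding eq using J fm H_measurable by measurable
  have gi: "integrable leb01 (\<lambda>x. of_real (1 / m) * ?g x)" using integral_h(1)[OF f] by simp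
  \<comment> \<open>Since \<open>w / m\<close> is at least 1 on \<open>{c..d}\<close>, inserting
    this factor brings the integral into the form of \<open>integral_h\<close>.\<close>
  have bd: "AE x in leb01. cmod (indicator {c..d} x * f (h x)) \<le> cmod (of_real (1 / m) * ?g x)"
    using w_bd
  proof eventually_elim
    case (elim x)
    show ?case
    proof (cases "x \<in> {c..d}")
      case True
      then have "1 \<le> w x / m" using elim m_pos by simp
      then have "1 * cmod (f (h x)) \<le> w x / m * cmod (f (h x))" by (rule mult_right_mono) simp
      then show ?thesis using True elim m_pos by (simp add: norm_mult norm_divide)
    qed simp
  qed
  show i: "integrable leb01 (\<lambda>x. indicator {c..d} x * f (h x))"
    by (rule Bochner_Integration.integrable_bound[OF gi meas bd])
  have "L1norm (\<lambda>x. indicator {c..d} x * f (h x)) \<le> L1norm (\<lambda>x. of_real (1 / m) * ?g x)"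
    by (rule L1norm_mono_AE[OF i gi bd])
  also have "\<dots> = (1 / m) * L1norm ?g" using m_pos by (simp only: L1norm_mult) (simp add: norm_divide)
  also have "L1norm ?g = cmod (LINT x|leb01. indicator {c..d} x * of_real (w x) * of_real (cmod (f (h x))))"
  proof -
    have "L1norm ?g = (LINT x|leb01. indicator {c..d} x * (w x * cmod (f (h x))))"
      unfolding L1norm_def
    proof (rule integral_cong_AE)
      show "AE x in leb01. cmod (?g x) = indicator {c..d} x * (w x * cmod (f (h x)))"
        using w_bd by eventually_elim (use m_pos in \<open>auto simp: indicator_def norm_mult\<close>)
      have "(\<lambda>x. indicator {c..d} x * (w x * cmod (f (H x)))) \<in> borel_measurable leb01"
        using J fm w_meas H_measurable by measurable
      also have "(\<lambda>x. indicator {c..d} x * (w x * cmod (f (H x)))) = (\<lambda>x. indicator {c..d} x * (w x * cmod (f (h x))))"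
        by (auto simp: H_def indicator_def)
      finally show "(\<lambda>x. indicator {c..d} x * (w x * cmod (f (h x)))) \<in> borel_measurable leb01" .
    qed (use integral_h(1)[OF f] in auto)
    also have "\<dots> = cmod (of_real (LINT x|leb01. indicator {c..d} x * (w x * cmod (f (h x)))))"
    proof -
      have "0 \<le> (LINT x|leb01. indicator {c..d} x * (w x * cmod (f (h x))))"
      proof (rule integral_nonneg_AE)
        show "AE x in leb01. 0 \<le> indicator {c..d} x * (w x * cmod (f (h x)))"
          using w_bd by eventually_elim (use m_pos in \<open>auto simp: indicator_def intro!: mult_nonneg_nonneg\<close>)
      qed
      then show ?thesis by (simp only: norm_of_real abs_of_nonneg)
    qed
    also have "of_real (LINT x|leb01. indicator {c..d} x * (w x * cmod (f (h x))))
        = (LINT x|leb01. of_real (indicator {c..d} x * (w x * cmod (f (h x)))) :: complex)"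
      by (rule integral_complex_of_real[symmetric])
    also have "\<dots> = (LINT x|leb01. indicator {c..d} x * of_real (w x) * of_real (cmod (f (h x))))"
      by (intro Bochner_Integration.integral_cong) (auto simp: indicator_def)
    finally show ?thesis .
  qed
  also have "(LINT x|leb01. indicator {c..d} x * of_real (w x) * of_real (cmod (f (h x))))
      = (LINT y|leb01. indicator {a..b} y * (of_real (cmod (f y)) :: complex))"
    using f by (intro integral_h(2)[where f = "\<lambda>y. of_real (cmod (f y))"]) auto
  also have "cmod \<dots> \<le> (LINT y|leb01. cmod (indicator {a..b} y * (of_real (cmod (f y)) :: complex)))"
    by (rule integral_norm_bound)
  also have "\<dots> \<le> L1norm f"
    unfolding L1norm_def
  proof (rule integral_mono)
    have "{a..b} \<in> sets leb01" using ab by (auto simp: sets_leb01_iff)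
    then show "integrable leb01 (\<lambda>y. cmod (indicator {a..b} y * (of_real (cmod (f y)) :: complex)))"
      using f by (intro integrable_norm integrable_leb01_indicator_mult) auto
  qed (use f in \<open>auto simp: indicator_def\<close>)
  finally show "L1norm (\<lambda>x. indicator {c..d} x * f (h x)) \<le> (1 / m) * L1norm f"
    using m_pos by (simp add: divide_right_mono)
qed

definition K :: "real \<Rightarrow> real" where
  "K y = (if y \<in> {a..b} then the_inv_into {c..d} h y else c)"

lemma K_h: "x \<in> {c..d} \<Longrightarrow> K (h x) = x"
  using h_in inj_on_h by (simp add: K_def the_inv_into_f_f)

lemma K_in: "K y \<in> {c..d}"
  using h_image inj_on_h cd the_inv_into_into[of h "{c..d}" y "{c..d}"] by (auto simp: K_def)

lemma K_measurable: "K \<in> measurable leb01 leb01"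
proof (rule measurable_leb01_leb01I[where S = "{a..b}" and e = c])
  show I: "{a..b} \<in> sets leb01" using ab by (auto simp: sets_leb01_iff)
  show "K x \<in> {0..1}" for x using K_in[of x] cd by auto
  show "K x = c" if "x \<notin> {a..b}" for x using that unfolding K_def by (rule if_not_P)
  have cont: "continuous_on {a..b} K"
  proof -
    have "continuous_on (h ` {c..d}) (the_inv_into {c..d} h)"
      by (rule continuous_on_inv_into[OF continuous_on_h compact_Icc inj_on_h])
    then show ?thesis unfolding h_image by (rule continuous_on_eq) (simp add: K_def)
  qed
  have Kb: "K \<in> borel_measurable borel"
  proof -
    have "(\<lambda>x. if x \<in> {a..b} then K x else c) \<in> borel_measurable borel"
      using cont by (intro borel_measurable_continuous_on_if) auto
    also have "(\<lambda>x. if x \<in> {a..b} then K x else c) = K" by (auto simp: K_def)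
    finally show ?thesis .
  qed
  then show "K \<in> borel_measurable leb01" by (rule measurable_leb01_borel)
  fix N :: "real set" assume N: "N \<in> null_sets lborel"
  then have Nb: "N \<in> sets borel" by auto
  \<comment> \<open>This set is null because \<nu> of its preimage under \<open>H\<close> is an
    integral over points of \<open>N\<close>: \<open>K\<close> undoes \<open>h\<close>.\<close>
  let ?E = "{a..b} \<inter> K -` N"
  have E: "?E \<in> sets borel" using measurable_sets[OF Kb Nb] by auto
  have Hm: "H \<in> measurable \<nu> borel" using H_borel by (simp add: \<nu>_def)
  have "emeasure lborel ?E = emeasure (density lborel (indicator {a..b})) ?E"
    using E by (subst emeasure_density) (auto simp: indicator_inter_arith[symmetric] Int_assoc[symmetric])
  also have "\<dots> = emeasure \<nu> (H -` ?E \<inter> {0..1})"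
    unfolding distr_borel[symmetric] using Hm E by (subst emeasure_distr) (auto simp: \<nu>_def)
  also have "\<dots> = ennreal (LINT t|leb01. indicator ({c..d} \<inter> (H -` ?E \<inter> {0..1})) t * w t)"
    using measurable_sets[OF H_borel E] by (intro emeasure_\<nu>) simp
  also have "(LINT t|leb01. indicator ({c..d} \<inter> (H -` ?E \<inter> {0..1})) t * w t) = 0"
    using AE_leb01_not_in_null[OF N]
    by (intro integral_eq_zero_AE) (auto elim!: eventually_mono simp: indicator_def H_def K_h)
  finally have "?E \<in> null_sets lborel" using E by auto
  from AE_leb01_not_in_null[OF this] show "AE x in leb01. x \<in> {a..b} \<longrightarrow> K x \<notin> N"
    by eventually_elim auto
qed

end

section \<open>Operators with piecewise composition kernels, and multipliers\<close>

text \<open>Linearity is demanded pointwise and for all functions: the operators are finite sums of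
  products and compositions, and exact identities can be rewritten inside iterates. \<open>C\<close>
  is some bound, possibly larger than the operator norm.\<close>

definition L1op :: "((real \<Rightarrow> complex) \<Rightarrow> real \<Rightarrow> complex) \<Rightarrow> real \<Rightarrow> bool" where
  "L1op T C \<longleftrightarrow> 0 \<le> C \<and>
     (\<forall>f. integrable leb01 f \<longrightarrow> integrable leb01 (T f) \<and> L1norm (T f) \<le> C * L1norm f) \<and>
     (\<forall>f g x. T (\<lambda>y. f y + g y) x = T f x + T g x) \<and>
     (\<forall>z f x. T (\<lambda>y. z * f y) x = z * T f x)"

section \<open>Algebra of operators bounded on L^1, and reduction to pairs of levels\<close>

lemma L1op_integrable: "L1op T C \<Longrightarrow> integrable leb01 f \<Longrightarrow> integrable leb01 (T f)"
  and L1op_bound: "L1op T C \<Longrightarrow> integrable leb01 f \<Longrightarrow> L1norm (T f) \<le> C * L1norm f"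
  and L1op_add: "L1op T C \<Longrightarrow> T (\<lambda>y. f y + g y) x = T f x + T g x"
  and L1op_mult: "L1op T C \<Longrightarrow> T (\<lambda>y. z * f y) x = z * T f x"
  by (auto simp: L1op_def)

lemma L1op_diff: "L1op T C \<Longrightarrow> T (\<lambda>y. f y - g y) x = T f x - T g x"
  using L1op_add[of T C f "\<lambda>y. - 1 * g y" x] L1op_mult[of T C "-1" g x] by simp

lemma L1op_zero: "L1op T C \<Longrightarrow> T (\<lambda>_. 0) x = 0"
  using L1op_mult[of T C 0 "\<lambda>_. 0" x] by simp

lemma L1op_sum: "L1op T C \<Longrightarrow> T (\<lambda>y. \<Sum>a\<in>S. f a y) x = (\<Sum>a\<in>S. T (f a) x)"
proof (induction S rule: infinite_finite_induct)
  case (insert a S)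
  then show ?case using L1op_add[of T C "f a" "\<lambda>y. \<Sum>a\<in>S. f a y" x] by simp
qed (simp_all add: L1op_zero)

text \<open>Boundedness and linearity make the operator well defined modulo null sets: the
  difference of the arguments has L^1 norm 0.\<close>

lemma L1op_cong_AE:
  assumes T: "L1op T C" and f: "integrable leb01 f" "integrable leb01 g" "AE x in leb01. f x = g x"
  shows "AE x in leb01. T f x = T g x"
proof -
  have i: "integrable leb01 (\<lambda>y. f y - g y)" using f by simp
  have "L1norm (\<lambda>y. f y - g y) = L1norm (\<lambda>_. 0)"
    using f by (intro L1norm_cong_AE) auto
  then have "L1norm (\<lambda>y. f y - g y) = 0" by (simp add: L1norm_def)
  then have "L1norm (T (\<lambda>y. f y - g y)) \<le> 0" using L1op_bound[OF T i] by simp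
  then have "L1norm (T (\<lambda>y. f y - g y)) = 0" by (rule order_antisym[OF _ L1norm_nonneg])
  then have "AE x in leb01. T (\<lambda>y. f y - g y) x = 0"
    by (rule L1norm_eq_0[OF L1op_integrable[OF T i]])
  then show ?thesis by eventually_elim (simp add: L1op_diff[OF T])
qed

lemma L1op_compose:
  assumes S: "L1op S C" and T: "L1op T D"
  shows "L1op (\<lambda>f. S (T f)) (C * D)"
  unfolding L1op_def
proof (intro conjI allI impI)
  have C: "0 \<le> C" "0 \<le> D" using S T by (auto simp: L1op_def)
  then show "0 \<le> C * D" by simp
  fix f :: "real \<Rightarrow> complex" assume f: "integrable leb01 f"
  then show "integrable leb01 (S (T f))" using L1op_integrable[OF S] L1op_integrable[OF T] by blast
  have "L1norm (S (T f)) \<le> C * L1norm (T f)" by (intro L1op_bound[OF S] L1op_integrable[OF T] f)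
  also have "\<dots> \<le> C * (D * L1norm f)" using C by (intro mult_left_mono L1op_bound[OF T] f)
  finally show "L1norm (S (T f)) \<le> C * D * L1norm f" by (simp add: mult.assoc)
next
  fix f g x
  have "T (\<lambda>y. f y + g y) = (\<lambda>y. T f y + T g y)" by (rule ext) (rule L1op_add[OF T])
  then show "S (T (\<lambda>y. f y + g y)) x = S (T f) x + S (T g) x" using L1op_add[OF S] by simp
next
  fix z f x
  have "T (\<lambda>y. z * f y) = (\<lambda>y. z * T f y)" by (rule ext) (rule L1op_mult[OF T])
  then show "S (T (\<lambda>y. z * f y)) x = z * S (T f) x" using L1op_mult[OF S] by simp
qed

lemma L1op_id: "L1op (\<lambda>f. f) 1"
  by (simp add: L1op_def)

lemma L1op_funpow: "L1op T C \<Longrightarrow> L1op (T ^^ n) (C ^ n)"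
proof (induction n)
  case 0
  then show ?case using L1op_id by (simp add: id_def)
next
  case (Suc n)
  then show ?case using L1op_compose[of T C "T ^^ n" "C ^ n"] by (simp add: comp_def)
qed

lemma L1op_add_op:
  assumes S: "L1op S C" and T: "L1op T D"
  shows "L1op (\<lambda>f x. S f x + T f x) (C + D)"
  unfolding L1op_def
proof (intro conjI allI impI)
  show "0 \<le> C + D" using S T by (auto simp: L1op_def)
  fix f :: "real \<Rightarrow> complex" assume f: "integrable leb01 f"
  note i = L1op_integrable[OF S f] L1op_integrable[OF T f]
  then show "integrable leb01 (\<lambda>x. S f x + T f x)" by simp
  have "L1norm (\<lambda>x. S f x + T f x) \<le> L1norm (S f) + L1norm (T f)" by (rule L1norm_add[OF i])
  also have "\<dots> \<le> C * L1norm f + D * L1norm f" by (intro add_mono L1op_bound[OF S f] L1op_bound[OF T f])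
  finally show "L1norm (\<lambda>x. S f x + T f x) \<le> (C + D) * L1norm f" by (simp add: distrib_right)
qed (simp_all add: L1op_add[OF S] L1op_add[OF T] L1op_mult[OF S] L1op_mult[OF T] distrib_left)

lemma L1op_zero_op: "L1op (\<lambda>f x. 0) 0"
  by (simp add: L1op_def L1norm_def)

lemma L1op_sum_op:
  assumes "finite S" "\<And>a. a \<in> S \<Longrightarrow> L1op (T a) (C a)"
  shows "L1op (\<lambda>f x. \<Sum>a\<in>S. T a f x) (\<Sum>a\<in>S. C a)"
  using assms
proof (induction S rule: finite_induct)
  case (insert a S)
  then have "L1op (\<lambda>f x. T a f x + (\<Sum>a\<in>S. T a f x)) (C a + (\<Sum>a\<in>S. C a))"
    by (intro L1op_add_op) auto
  then show ?case using insert by simp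
qed (simp add: L1op_zero_op)

lemma L1op_scale:
  assumes "L1op T C"
  shows "L1op (\<lambda>f x. z * T f x) (cmod z * C)"
  unfolding L1op_def
proof (intro conjI allI impI)
  show "0 \<le> cmod z * C" using assms by (simp add: L1op_def)
  fix f :: "real \<Rightarrow> complex" assume f: "integrable leb01 f"
  show "integrable leb01 (\<lambda>x. z * T f x)" using L1op_integrable[OF assms f] by simp
  show "L1norm (\<lambda>x. z * T f x) \<le> cmod z * C * L1norm f"
    using mult_left_mono[OF L1op_bound[OF assms f], of "cmod z"] by (simp add: mult.assoc)
qed (simp_all add: L1op_add[OF assms] L1op_mult[OF assms] distrib_left)

lemma L1op_multiplier:
  assumes g: "g \<in> borel_measurable leb01" "AE x in leb01. cmod (g x) \<le> B" and B: "0 \<le> B"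
  shows "L1op (\<lambda>f x. g x * f x) B"
  unfolding L1op_def
proof (intro conjI allI impI)
  fix f :: "real \<Rightarrow> complex" assume f: "integrable leb01 f"
  have bi: "integrable leb01 (\<lambda>x. of_real B * f x)" using f by simp
  have bd: "AE x in leb01. cmod (g x * f x) \<le> cmod (of_real B * f x)"
    using g(2) by eventually_elim (use B in \<open>auto simp: norm_mult intro: mult_right_mono\<close>)
  show i: "integrable leb01 (\<lambda>x. g x * f x)"
    using g f by (intro Bochner_Integration.integrable_bound[OF bi _ bd]) auto
  have "L1norm (\<lambda>x. g x * f x) \<le> L1norm (\<lambda>x. of_real B * f x)" by (rule L1norm_mono_AE[OF i bi bd])
  then show "L1norm (\<lambda>x. g x * f x) \<le> B * L1norm f" using B by simp
qed (use B in \<open>simp_all add: distrib_left mult_ac\<close>)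

text \<open>If level \<open>i\<close> of the argument reaches level \<open>k\<close> of the image
  with factor \<open>m (k - i)\<close>, Young's inequality gives the operator bound
  \<open>M\<close>. L^1 continuity of \<open>T\<close> handles the limit, and \<open>n0\<close>
  discards coarse levels, where the kernel estimate may fail.\<close>

lemma bl_of_pieces:
  fixes m :: "int \<Rightarrow> real"
  assumes p: "1 \<le> p" and q: "1 \<le> q" and f: "bl s p q f K" and T: "L1op T C"
    and m: "\<And>t. 0 \<le> m t" "\<And>S. finite S \<Longrightarrow> (\<Sum>t\<in>S. m t) \<le> M"
    and piece: "\<And>i k. n0 \<le> i \<Longrightarrow>
      2 powr (real k * s) * lev p k (T (dpart i f)) \<le> m (int k - int i) * (2 powr (real i * s) * lev p i f)"
  shows "bl s p q (T (\<lambda>x. f x - (\<Sum>i<n0. dpart i f x))) (M * K)"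
proof -
  have fi: "integrable leb01 f" and lq: "lq_le q (\<lambda>k. 2 powr (real k * s) * lev p k f) K"
    using f by (auto simp: bl_def)
  let ?F = "\<lambda>x. f x - (\<Sum>i<n0. dpart i f x)"
  have Fi: "integrable leb01 ?F"
    by (intro Bochner_Integration.integrable_diff Bochner_Integration.integrable_sum fi integrable_dpart)
  define g where "g I x = (\<Sum>i\<in>{n0..<I}. dpart i f x)" for I x
  have gi: "integrable leb01 (g I)" for I
    unfolding g_def[abs_def] by (intro Bochner_Integration.integrable_sum integrable_dpart)
  have lim: "(\<lambda>I. L1norm (\<lambda>x. T (g I) x - T ?F x)) \<longlonglongrightarrow> 0"
  proof (rule Lim_null_comparison[where g = "\<lambda>I. C * L1norm (\<lambda>x. g I x - ?F x)"])
    have "L1norm (\<lambda>x. T (g I) x - T ?F x) \<le> C * L1norm (\<lambda>x. g I x - ?F x)" for I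
    proof -
      have "T (\<lambda>x. g I x - ?F x) = (\<lambda>x. T (g I) x - T ?F x)" by (rule ext) (rule L1op_diff[OF T])
      then show ?thesis
        using L1op_bound[OF T Bochner_Integration.integrable_diff[OF gi[of I] Fi]] by (simp only:)
    qed
    then show "\<forall>\<^sub>F I in sequentially. norm (L1norm (\<lambda>x. T (g I) x - T ?F x)) \<le> C * L1norm (\<lambda>x. g I x - ?F x)"
      by simp
    have "(\<lambda>I. L1norm (\<lambda>x. g I x - ?F x)) \<longlonglongrightarrow> 0"
    proof (rule Lim_transform_eventually)
      \<comment> \<open>\<open>cexp (I - 1)\<close> sums the levels below \<open>I\<close>, hence
        the index shift.\<close>
      show "(\<lambda>I. L1norm (\<lambda>x. f x - cexp (I - 1) f x)) \<longlonglongrightarrow> 0"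
        using LIMSEQ_offset[of "\<lambda>I. L1norm (\<lambda>x. f x - cexp (I - 1) f x)" 1] cexp_tendsto[OF fi] by simp
      show "\<forall>\<^sub>F I in sequentially. L1norm (\<lambda>x. f x - cexp (I - 1) f x) = L1norm (\<lambda>x. g I x - ?F x)"
        using eventually_ge_at_top[of "Suc n0"]
      proof eventually_elim
        case (elim I)
        have "cexp (I - 1) f x = (\<Sum>i<n0. dpart i f x) + g I x" for x
        proof -
          have "{..I - 1} = {0..<I}" using elim by auto
          then show ?thesis
            using sum.atLeastLessThan_concat[of 0 n0 I "\<lambda>k. dpart k f x"] elim
            by (simp add: cexp_def g_def atLeast0LessThan)
        qed
        then have "(\<lambda>x. f x - cexp (I - 1) f x) = (\<lambda>x. ?F x - g I x)" by (auto simp: fun_eq_iff)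
        then show ?case by (simp add: L1norm_minus_commute)
      qed
    qed
    then show "(\<lambda>I. C * L1norm (\<lambda>x. g I x - ?F x)) \<longlonglongrightarrow> 0" by (rule tendsto_mult_right_zero)
  qed
  have "lq_le q (\<lambda>k. 2 powr (real k * s) * lev p k (T ?F)) (M * K)"
  proof (rule lq_young[OF q _ lq m, where w = "\<lambda>I k. 2 powr (real k * s) * lev p k (T (g I))"])
    show "2 powr (real k * s) * lev p k (T (g I)) \<le> (\<Sum>i<I. m (int k - int i) * (2 powr (real i * s) * lev p i f))" for I k
    proof -
      have "T (g I) = (\<lambda>x. \<Sum>i\<in>{n0..<I}. T (dpart i f) x)"
        unfolding g_def[abs_def] by (rule ext) (rule L1op_sum[OF T])
      then have "lev p k (T (g I)) \<le> (\<Sum>i\<in>{n0..<I}. lev p k (T (dpart i f)))"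
        using lev_sum[OF p, of "{n0..<I}" "\<lambda>i. T (dpart i f)" k] L1op_integrable[OF T integrable_dpart] by simp
      then have "2 powr (real k * s) * lev p k (T (g I)) \<le> 2 powr (real k * s) * (\<Sum>i\<in>{n0..<I}. lev p k (T (dpart i f)))"
        by (intro mult_left_mono) auto
      also have "\<dots> \<le> (\<Sum>i\<in>{n0..<I}. m (int k - int i) * (2 powr (real i * s) * lev p i f))"
        unfolding sum_distrib_left by (intro sum_mono piece) auto
      also have "\<dots> \<le> (\<Sum>i<I. m (int k - int i) * (2 powr (real i * s) * lev p i f))"
        using m(1) by (intro sum_mono2) auto
      finally show ?thesis .
    qed
    show "(\<lambda>I. 2 powr (real k * s) * lev p k (T (g I))) \<longlonglongrightarrow> 2 powr (real k * s) * lev p k (T ?F)" for k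
      by (intro tendsto_mult tendsto_const lev_tendsto[OF p _ _ lim] L1op_integrable[OF T] gi Fi)
  qed auto
  then show ?thesis using L1op_integrable[OF T Fi] by (simp add: bl_def)
qed

section \<open>Tails, and sums of weighted compositions with several branches\<close>

lemma dpart_sum_lev:
  assumes "1 \<le> p"
  shows "(\<Sum>j<2 ^ i. cmod (dco i j f) powr p) = 2 ^ i * lev p i f powr p"
  using assms by (simp add: lev_powr)

lemma powr_le_imp_le:
  fixes x y p :: real
  assumes "x powr p \<le> y powr p" "0 < p" "0 \<le> y"
  shows "x \<le> y"
  using powr_less_mono2[of p y x] assms by force

definition besov_const :: "real \<Rightarrow> real" where
  "besov_const s = 2 / (1 - 2 powr (- s))"

lemma besov_const_ge: "0 < s \<Longrightarrow> 2 \<le> besov_const s"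
proof -
  assume "0 < s"
  then have "2 powr (- s) < (1::real)" by (auto intro: powr_less_one)
  then show ?thesis unfolding besov_const_def by (simp add: field_simps)
qed

text \<open>The kernel of \<open>besov_rep_imp_bl\<close> applied to the identity; it is crude for
  martingale differences, but it yields the same constant \<open>besov_const\<close>.\<close>

lemma bl_tail:
  assumes p: "1 \<le> p" and q: "1 \<le> q" and s: "0 < s" and f: "bl s p q f K"
  shows "bl s p q (\<lambda>x. f x - (\<Sum>i<n. dpart i f x)) (besov_const s * K)"
proof (rule bl_of_pieces[OF p q f L1op_id, where m = "\<lambda>t. if t \<le> 0 then 2 * 2 powr (of_int t * s) else 0"])
  show "(\<Sum>t\<in>S. if t \<le> 0 then 2 * 2 powr (of_int t * s) else 0) \<le> besov_const s" if "finite S" for S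
  proof -
    have "(\<Sum>t\<in>S. if t \<le> 0 then 2 * 2 powr (of_int t * s) else 0)
        = 2 * (\<Sum>t\<in>S. if t \<le> 0 then (2 powr (- s)) powr (of_int 0 - of_int t) else 0)"
      unfolding sum_distrib_left by (intro sum.cong) (auto simp: powr_powr mult.commute)
    also have "\<dots> \<le> 2 * (1 / (1 - 2 powr (- s)))"
      using s that by (intro mult_left_mono sum_geometric_int_below) (auto intro: powr_less_one)
    finally show ?thesis by (simp add: besov_const_def)
  qed
  show "2 powr (real k * s) * lev p k (dpart i f)
      \<le> (if int k - int i \<le> 0 then 2 * 2 powr (of_int (int k - int i) * s) else 0) * (2 powr (real i * s) * lev p i f)" for i k
  proof (cases "k \<le> i")
    case True
    have "lev p k (dpart i f) powr p \<le> 2 powr p * ((\<Sum>j<2 ^ i. cmod (dco i j f) powr p) / 2 ^ i)"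
      using lev_step_powr_le[OF p, where k = k and i = i and v = "\<lambda>j. dco i j f"] True
      unfolding dpart_def[abs_def] by (simp del: sum_mult_indicator)
    also have "\<dots> = (2 * lev p i f) powr p" using p by (simp add: dpart_sum_lev powr_mult)
    finally have "lev p k (dpart i f) \<le> 2 * lev p i f" using p by (elim powr_le_imp_le) auto
    then have "2 powr (real k * s) * lev p k (dpart i f) \<le> 2 powr (real k * s) * (2 * lev p i f)"
      by (intro mult_left_mono) auto
    also have "\<dots> = 2 * (2 powr (of_int (int k - int i) * s) * 2 powr (real i * s)) * lev p i f"
      by (simp add: powr_add[symmetric] left_diff_distrib)
    finally show ?thesis using True by (simp add: mult.assoc)
  next
    case False
    then show ?thesis
      using lev_step_powr_le[OF p, where k = k and i = i and v = "\<lambda>j. dco i j f"]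
      unfolding dpart_def[abs_def] by (simp del: sum_mult_indicator)
  qed
qed auto

text \<open>Total mass of the two geometric tails in \<open>kernel_sum\<close>. The numerator of the
  second term compensates for rounding the crossover to an integer level.\<close>

definition kernel_const :: "real \<Rightarrow> real \<Rightarrow> real" where
  "kernel_const p s = 1 / (1 - 2 powr (- s)) + 2 powr (1 / p - s) / (1 - 2 powr (- (1 / p - s)))"

lemma kernel_const_pos: "0 < s \<Longrightarrow> s < 1 / p \<Longrightarrow> 0 < kernel_const p s"
  unfolding kernel_const_def by (intro add_pos_pos divide_pos_pos) (auto intro: powr_less_one)

text \<open>The kernel grows like \<open>2 powr (t * s)\<close> until \<open>2 powr t\<close>
  reaches \<Omega> and then decays like \<open>2 powr (- t * (1 / p - s))\<close>, so its sum is
  comparable to the peak \<open>\<Omega> powr s\<close>. This is the source of the exponent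
  \<open>s\<close> in the contraction rate.\<close>

lemma kernel_sum:
  assumes s: "0 < s" "s < 1 / p" and \<Omega>: "0 < \<Omega>" and S: "finite S"
  shows "(\<Sum>t\<in>S. 2 powr (of_int t * s) * min 1 (\<Omega> * 2 powr (- of_int t)) powr (1 / p)) \<le> \<Omega> powr s * kernel_const p s"
proof -
  have p: "0 < p" using s by (metis less_trans zero_less_divide_1_iff)
  define \<eta> where "\<eta> = 1 / p - s"
  have \<eta>: "0 < \<eta>" using s by (simp add: \<eta>_def)
  define T where "T = \<lfloor>log 2 \<Omega>\<rfloor>"
  have T1: "2 powr of_int T \<le> \<Omega>"
    using \<Omega> by (simp add: T_def powr_le_iff)
  have T2: "\<Omega> < 2 powr (of_int T + 1)"
    using \<Omega> floor_correct[of "log 2 \<Omega>"] by (simp add: T_def less_powr_iff)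
  have bd: "2 powr (of_int t * s) * min 1 (\<Omega> * 2 powr (- of_int t)) powr (1 / p)
      \<le> \<Omega> powr s * (if t \<le> T then (2 powr (- s)) powr (of_int T - of_int t) else 0)
        + \<Omega> powr s * 2 powr \<eta> * (if T \<le> t then (2 powr (- \<eta>)) powr (of_int t - of_int T) else 0)" for t
  proof (cases "t \<le> T")
    case True
    have "2 powr (of_int t * s) * min 1 (\<Omega> * 2 powr (- of_int t)) powr (1 / p) \<le> 2 powr (of_int t * s) * 1 powr (1 / p)"
      using p \<Omega> by (intro mult_left_mono powr_mono2) auto
    also have "\<dots> = (2 powr of_int T) powr s * (2 powr (- s)) powr (of_int T - of_int t)"
      by (simp add: powr_powr powr_add[symmetric] algebra_simps)
    also have "\<dots> \<le> \<Omega> powr s * (2 powr (- s)) powr (of_int T - of_int t)"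
      using T1 s by (intro mult_right_mono powr_mono2) auto
    finally show ?thesis using True by (auto intro!: add_increasing2)
  next
    case False
    have "2 powr (of_int t * s) * min 1 (\<Omega> * 2 powr (- of_int t)) powr (1 / p)
        \<le> 2 powr (of_int t * s) * (\<Omega> * 2 powr (- of_int t)) powr (1 / p)"
      using p \<Omega> by (intro mult_left_mono powr_mono2) auto
    also have "\<dots> = \<Omega> powr s * (\<Omega> powr \<eta> * 2 powr (- \<eta> * of_int t))"
      using \<Omega> by (simp add: powr_mult powr_powr powr_add[symmetric] \<eta>_def algebra_simps)
    also have "\<dots> \<le> \<Omega> powr s * ((2 powr (of_int T + 1)) powr \<eta> * 2 powr (- \<eta> * of_int t))"
      using T2 \<eta> \<Omega> by (intro mult_left_mono mult_right_mono powr_mono2) auto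
    also have "\<dots> = \<Omega> powr s * 2 powr \<eta> * (2 powr (- \<eta>)) powr (of_int t - of_int T)"
      by (simp add: powr_powr powr_add[symmetric] algebra_simps)
    finally show ?thesis using False by simp
  qed
  have "(\<Sum>t\<in>S. 2 powr (of_int t * s) * min 1 (\<Omega> * 2 powr (- of_int t)) powr (1 / p))
      \<le> \<Omega> powr s * (\<Sum>t\<in>S. if t \<le> T then (2 powr (- s)) powr (of_int T - of_int t) else 0)
        + \<Omega> powr s * 2 powr \<eta> * (\<Sum>t\<in>S. if T \<le> t then (2 powr (- \<eta>)) powr (of_int t - of_int T) else 0)"
    unfolding sum_distrib_left sum.distrib[symmetric] by (intro sum_mono bd)
  also have "\<dots> \<le> \<Omega> powr s * (1 / (1 - 2 powr (- s))) + \<Omega> powr s * 2 powr \<eta> * (1 / (1 - 2 powr (- \<eta>)))"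
    using s \<eta> S by (intro add_mono mult_left_mono sum_geometric_int_below sum_geometric_int_above)
      (auto intro: powr_less_one)
  also have "\<dots> = \<Omega> powr s * kernel_const p s" by (simp add: kernel_const_def \<eta>_def distrib_left)
  finally show ?thesis .
qed

text \<open>The preimage of a cell under one branch is an interval, and its coefficients are bounded
  in two ways: by its weighted mass, at most \<open>G / 2 ^ i\<close>, and by the boundary count,
  \<open>\<Omega> * 4 / 2 ^ k\<close>. The minimum of the two is the kernel. Jensen costs
  \<open>card W * \<Omega>\<close> with power \<open>p - 1\<close>, whereas summing over the
  branches that meet one cell costs only the multiplicity \<open>N\<close>.\<close>

lemma family_lev_powr:
  fixes W :: "'w set" and \<omega> :: "'w \<Rightarrow> real" and J :: "'w \<Rightarrow> real set" and g :: "'w \<Rightarrow> real \<Rightarrow> real"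
  assumes p: "1 \<le> p" and W: "finite W" "W \<noteq> {}" and \<omega>: "\<And>w. w \<in> W \<Longrightarrow> 0 \<le> \<omega> w" "\<And>w. w \<in> W \<Longrightarrow> \<omega> w \<le> \<Omega>"
    and sub: "\<And>w. w \<in> W \<Longrightarrow> J w \<subseteq> {0..1}"
    and int: "\<And>w j. w \<in> W \<Longrightarrow> j < 2 ^ i \<Longrightarrow> is_interval {x \<in> J w. g w x \<in> dyadic i j}"
    and meas: "\<And>w j. w \<in> W \<Longrightarrow> j < 2 ^ i \<Longrightarrow> \<omega> w * measure leb01 {x \<in> J w. g w x \<in> dyadic i j} \<le> G / 2 ^ i"
    and G: "2 \<le> G"
    and mult: "\<And>j. j < 2 ^ i \<Longrightarrow> card {w \<in> W. measure leb01 {x \<in> J w. g w x \<in> dyadic i j} \<noteq> 0} \<le> N"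
  shows "lev p k (\<lambda>x. \<Sum>w\<in>W. of_real (\<omega> w) * (indicator (J w) x * (\<Sum>j<2 ^ i. v j * indicator (dyadic i j) (g w x)))) powr p
    \<le> (2 * (real (card W) * \<Omega>)) powr (p - 1) * (real N * (2 * G) * min 1 (\<Omega> * 2 powr (- of_int (int k - int i))))
        * ((\<Sum>j<2 ^ i. cmod (v j) powr p) / 2 ^ i)"
proof -
  define A where "A w j = {x \<in> J w. g w x \<in> dyadic i j}" for w j
  have As: "A w j \<in> sets leb01" if "w \<in> W" "j < 2 ^ i" for w j
    unfolding A_def using int[OF that] sub[OF that(1)] by (intro is_interval_sets_leb01) auto
  define \<phi> where "\<phi> a x = of_real (\<omega> (fst a)) * (indicator (A (fst a) (snd a)) x :: complex)" for a x
  define v' where "v' a = v (snd a)" for a :: "'w \<times> nat"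
  let ?S = "W \<times> {..<(2::nat) ^ i}"
  have eq: "(\<Sum>w\<in>W. of_real (\<omega> w) * (indicator (J w) x * (\<Sum>j<2 ^ i. v j * indicator (dyadic i j) (g w x))))
      = (\<Sum>a\<in>?S. v' a * \<phi> a x)" for x
  proof -
    have "(\<Sum>a\<in>?S. v' a * \<phi> a x) = (\<Sum>w\<in>W. \<Sum>j<2 ^ i. v' (w, j) * \<phi> (w, j) x)"
      by (simp add: sum.cartesian_product split_def)
    also have "\<dots> = (\<Sum>w\<in>W. of_real (\<omega> w) * (indicator (J w) x * (\<Sum>j<2 ^ i. v j * indicator (dyadic i j) (g w x))))"
      unfolding sum_distrib_left by (intro sum.cong) (auto simp: v'_def \<phi>_def A_def indicator_def)
    finally show ?thesis by simp
  qed
  have \<phi>i: "integrable leb01 (\<phi> a)" if "a \<in> ?S" for a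
    unfolding \<phi>_def[abs_def] using that As by (auto intro!: integrable_leb01_indicator)
  have d\<phi>: "cmod (dco k j (\<phi> a)) = \<omega> (fst a) * cmod (dco k j (indicator (A (fst a) (snd a))))" if "a \<in> ?S" "j < 2 ^ k" for a j
    using that As \<omega> unfolding \<phi>_def[abs_def]
    by (subst dco_mult) (auto intro!: integrable_leb01_indicator simp: norm_mult)
  \<comment> \<open>Common bound for the coefficient mass of one piece \<open>(w, j)\<close>. Pieces
    of measure zero contribute nothing, so for cell \<open>j\<close> only the branches in
    \<open>B j\<close> count.\<close>
  define \<mu> where "\<mu> = 2 * G * min 1 (\<Omega> * 2 powr (- of_int (int k - int i))) / 2 ^ i"
  have \<mu>0: "0 \<le> \<mu>"
  proof -
    obtain w where "w \<in> W" using W by blast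
    then have "0 \<le> \<Omega>" using \<omega> order_trans by blast
    then show ?thesis using G by (simp add: \<mu>_def)
  qed
  define B where "B j = {w \<in> W. measure leb01 (A w j) \<noteq> 0}" for j
  have "lev p k (\<lambda>x. \<Sum>a\<in>?S. v' a * \<phi> a x) powr p
      \<le> (2 * (real (card W) * \<Omega>)) powr (p - 1) * (\<Sum>a\<in>?S. cmod (v' a) powr p * (if fst a \<in> B (snd a) then \<mu> else 0))"
  proof (rule lev_powr_le[OF p \<phi>i])
    fix j :: nat assume j: "j < 2 ^ k"
    have "(\<Sum>a\<in>?S. cmod (dco k j (\<phi> a))) = (\<Sum>a\<in>?S. \<omega> (fst a) * cmod (dco k j (indicator (A (fst a) (snd a)))))"
      using d\<phi> j by (intro sum.cong) auto
    also have "\<dots> = (\<Sum>w\<in>W. \<omega> w * (\<Sum>l<2 ^ i. cmod (dco k j (indicator (A w l)))))"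
      by (simp only: sum_distrib_left sum.cartesian_product split_def)
    also have "\<dots> \<le> (\<Sum>w\<in>W. \<Omega> * 2)"
    proof (intro sum_mono mult_mono)
      fix w assume w: "w \<in> W"
      show "(\<Sum>l<2 ^ i. cmod (dco k j (indicator (A w l)))) \<le> 2"
        using w As dyadic_disjoint j by (intro sum_cmod_dco_disjoint) (auto simp: disjoint_family_on_def A_def)
      show "0 \<le> \<Omega>" using \<omega>[OF w] by linarith
    qed (use \<omega> in \<open>auto intro!: sum_nonneg\<close>)
    finally show "(\<Sum>a\<in>?S. cmod (dco k j (\<phi> a))) \<le> 2 * (real (card W) * \<Omega>)" by simp
  next
    fix a assume a: "a \<in> ?S"
    then obtain w l where wl: "a = (w, l)" "w \<in> W" "l < 2 ^ i" by auto
    have eq2: "(\<Sum>j<2 ^ k. cmod (dco k j (\<phi> a))) / 2 ^ k = \<omega> w * ((\<Sum>j<2 ^ k. cmod (dco k j (indicator (A w l)))) / 2 ^ k)"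
      using d\<phi>[OF a] wl by (simp add: sum_distrib_left)
    have b1: "(\<Sum>j<2 ^ k. cmod (dco k j (indicator (A w l)))) / 2 ^ k \<le> 2 * measure leb01 (A w l)"
      using sum_cmod_dco_le[OF integrable_leb01_indicator[OF As[OF wl(2,3)]], of k] by (simp add: L1norm_indicator As wl)
    have b2: "(\<Sum>j<2 ^ k. cmod (dco k j (indicator (A w l)))) / 2 ^ k \<le> 4 / 2 ^ k"
      using int[OF wl(2,3)] sub[OF wl(2)] by (intro sum_cmod_dco_interval) (auto simp: A_def)
    show "(\<Sum>j<2 ^ k. cmod (dco k j (\<phi> a))) / 2 ^ k \<le> (if fst a \<in> B (snd a) then \<mu> else 0)"
    proof (cases "w \<in> B l")
      case True
      have "\<omega> w * ((\<Sum>j<2 ^ k. cmod (dco k j (indicator (A w l)))) / 2 ^ k) \<le> \<omega> w * (2 * measure leb01 (A w l))"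
        using b1 \<omega>[OF wl(2)] by (intro mult_left_mono) auto
      also have "\<dots> \<le> 2 * G / 2 ^ i" using meas[OF wl(2,3)] by (simp add: A_def)
      finally have c1: "\<omega> w * ((\<Sum>j<2 ^ k. cmod (dco k j (indicator (A w l)))) / 2 ^ k) \<le> 2 * G / 2 ^ i" .
      have "\<omega> w * ((\<Sum>j<2 ^ k. cmod (dco k j (indicator (A w l)))) / 2 ^ k) \<le> \<Omega> * (4 / 2 ^ k)"
        using b2 \<omega>[OF wl(2)] by (intro mult_mono) (auto intro!: divide_nonneg_nonneg sum_nonneg)
      also have "\<dots> = 4 * (\<Omega> / 2 ^ k)" by simp
      also have "\<dots> \<le> (2 * G) * (\<Omega> / 2 ^ k)"
        using G \<omega>[OF wl(2)] by (intro mult_right_mono) auto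
      also have "\<dots> = (2 * G) * (\<Omega> * 2 powr (- of_int (int k - int i)) / 2 ^ i)"
        by (simp add: powr_diff powr_minus powr_realpow)
      finally have c2: "\<omega> w * ((\<Sum>j<2 ^ k. cmod (dco k j (indicator (A w l)))) / 2 ^ k)
          \<le> 2 * G * (\<Omega> * 2 powr (- of_int (int k - int i))) / 2 ^ i" by simp
      have "\<mu> = min (2 * G / 2 ^ i) (2 * G * (\<Omega> * 2 powr (- of_int (int k - int i))) / 2 ^ i)"
        unfolding \<mu>_def using G by (auto simp: min_def field_simps)
      then show ?thesis using c1 c2 True wl unfolding eq2 by simp
    next
      case False
      then have "measure leb01 (A w l) = 0" using wl by (simp add: B_def)
      then have "\<omega> w * ((\<Sum>j<2 ^ k. cmod (dco k j (indicator (A w l)))) / 2 ^ k) \<le> \<omega> w * 0"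
        using b1 \<omega>[OF wl(2)] by (intro mult_left_mono) auto
      then show ?thesis using False wl unfolding eq2 by simp
    qed
  qed
  also have "(\<Sum>a\<in>?S. cmod (v' a) powr p * (if fst a \<in> B (snd a) then \<mu> else 0))
      = (\<Sum>w\<in>W. \<Sum>j<2 ^ i. cmod (v j) powr p * (if w \<in> B j then \<mu> else 0))"
    by (simp only: sum.cartesian_product split_def v'_def)
  also have "\<dots> = (\<Sum>j<2 ^ i. cmod (v j) powr p * (\<Sum>w\<in>W. if w \<in> B j then \<mu> else 0))"
    by (subst sum.swap) (simp only: sum_distrib_left)
  also have "\<dots> \<le> (\<Sum>j<2 ^ i. cmod (v j) powr p * (real N * \<mu>))"
  proof (intro sum_mono mult_left_mono)
    fix j assume j: "j \<in> {..<2 ^ i :: nat}"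
    have "(\<Sum>w\<in>W. if w \<in> B j then \<mu> else 0) = real (card (B j)) * \<mu>"
    proof -
      have "W \<inter> {w. w \<in> B j} = B j" by (auto simp: B_def)
      then show ?thesis using W by (simp add: sum.If_cases)
    qed
    also have "\<dots> \<le> real N * \<mu>"
      using mult[of j] j \<mu>0 by (intro mult_right_mono) (auto simp: B_def A_def)
    finally show "(\<Sum>w\<in>W. if w \<in> B j then \<mu> else 0) \<le> real N * \<mu>" .
  qed auto
  finally have "lev p k (\<lambda>x. \<Sum>a\<in>?S. v' a * \<phi> a x) powr p
      \<le> (2 * (real (card W) * \<Omega>)) powr (p - 1) * (\<Sum>j<2 ^ i. cmod (v j) powr p * (real N * \<mu>))"
    by (simp add: mult_left_mono)
  also have "(\<Sum>j<2 ^ i. cmod (v j) powr p * (real N * \<mu>))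
      = (real N * (2 * G) * min 1 (\<Omega> * 2 powr (- of_int (int k - int i)))) * ((\<Sum>j<2 ^ i. cmod (v j) powr p) / 2 ^ i)"
    unfolding \<mu>_def sum_distrib_right[symmetric] by simp
  finally show ?thesis unfolding eq by (simp only: mult.assoc)
qed

text \<open>Taking p-th roots in \<open>family_lev_powr\<close> leaves the kernel of
  \<open>kernel_sum\<close>. Up to constants and the multiplicity the factor is
  \<open>(card W * \<Omega>) powr (1 - 1 / p) * \<Omega> powr s\<close>; for words of length
  \<open>n\<close> it becomes the \<open>n\<close>-th power of the contraction rate.\<close>

lemma family_bl:
  fixes W :: "'w set" and \<omega> :: "'w \<Rightarrow> real" and J :: "'w \<Rightarrow> real set" and g :: "'w \<Rightarrow> real \<Rightarrow> real"
  assumes p: "1 \<le> p" and q: "1 \<le> q" and s: "0 < s" "s < 1 / p" and f: "bl s p q f K" and T: "L1op T C"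
    and Teq: "\<And>f x. x \<in> {0..1} \<Longrightarrow> T f x = (\<Sum>w\<in>W. of_real (\<omega> w) * (indicator (J w) x * f (g w x)))"
    and W: "finite W" "W \<noteq> {}" and \<omega>: "\<And>w. w \<in> W \<Longrightarrow> 0 \<le> \<omega> w" "\<And>w. w \<in> W \<Longrightarrow> \<omega> w \<le> \<Omega>" "0 < \<Omega>"
    and sub: "\<And>w. w \<in> W \<Longrightarrow> J w \<subseteq> {0..1}"
    and int: "\<And>w i j. w \<in> W \<Longrightarrow> j < 2 ^ i \<Longrightarrow> is_interval {x \<in> J w. g w x \<in> dyadic i j}"
    and meas: "\<And>w i j. w \<in> W \<Longrightarrow> j < 2 ^ i \<Longrightarrow> \<omega> w * measure leb01 {x \<in> J w. g w x \<in> dyadic i j} \<le> G / 2 ^ i"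
    and G: "2 \<le> G"
    and mult: "\<And>i j. n0 \<le> i \<Longrightarrow> j < 2 ^ i \<Longrightarrow> card {w \<in> W. measure leb01 {x \<in> J w. g w x \<in> dyadic i j} \<noteq> 0} \<le> N"
  shows "bl s p q (T (\<lambda>x. f x - (\<Sum>i<n0. dpart i f x)))
    (((2 * (real (card W) * \<Omega>)) powr (p - 1) * (real N * (2 * G))) powr (1 / p) * (\<Omega> powr s * kernel_const p s) * K)"
proof (rule bl_of_pieces[OF p q f T])
  let ?D = "((2 * (real (card W) * \<Omega>)) powr (p - 1) * (real N * (2 * G))) powr (1 / p)"
  let ?m = "\<lambda>t::int. ?D * (2 powr (of_int t * s) * min 1 (\<Omega> * 2 powr (- of_int t)) powr (1 / p))"
  show "0 \<le> ?m t" for t by simp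
  show "(\<Sum>t\<in>S. ?m t) \<le> ?D * (\<Omega> powr s * kernel_const p s)" if "finite S" for S
    unfolding sum_distrib_left[symmetric] using kernel_sum[OF s \<omega>(3) that] by (rule mult_left_mono) simp
  fix i k assume i: "n0 \<le> i"
  let ?h = "\<lambda>x. \<Sum>w\<in>W. of_real (\<omega> w) * (indicator (J w) x * (\<Sum>j<2 ^ i. dco i j f * indicator (dyadic i j) (g w x)))"
  let ?mu = "min 1 (\<Omega> * 2 powr (- of_int (int k - int i)))"
  have mu: "0 \<le> ?mu" using \<omega>(3) by simp
  have hT: "T (dpart i f) x = ?h x" if "x \<in> {0..1}" for x
    unfolding Teq[OF that] dpart_def ..
  have "integrable leb01 (T (dpart i f))" by (intro L1op_integrable[OF T] integrable_dpart)
  moreover from this have "integrable leb01 ?h"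
    by (rule iffD1[OF Bochner_Integration.integrable_cong, rotated 2]) (use hT in auto)
  ultimately have "lev p k (T (dpart i f)) = lev p k ?h"
    using hT by (intro lev_cong_AE AE_I2) auto
  moreover have "lev p k ?h powr p
      \<le> (2 * (real (card W) * \<Omega>)) powr (p - 1) * (real N * (2 * G) * ?mu) * ((\<Sum>j<2 ^ i. cmod (dco i j f) powr p) / 2 ^ i)"
    by (rule family_lev_powr[OF p W \<omega>(1,2) sub int meas G mult[OF i]])
  ultimately have "lev p k (T (dpart i f)) powr p
      \<le> (2 * (real (card W) * \<Omega>)) powr (p - 1) * (real N * (2 * G) * ?mu) * ((\<Sum>j<2 ^ i. cmod (dco i j f) powr p) / 2 ^ i)"
    by (simp only:)
  also have "(\<Sum>j<2 ^ i. cmod (dco i j f) powr p) / 2 ^ i = lev p i f powr p" using p by (simp add: dpart_sum_lev)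
  also have "(2 * (real (card W) * \<Omega>)) powr (p - 1) * (real N * (2 * G) * ?mu) * lev p i f powr p
      = (?D * ?mu powr (1 / p) * lev p i f) powr p"
  proof -
    have "?D powr p = (2 * (real (card W) * \<Omega>)) powr (p - 1) * (real N * (2 * G))"
      using p G \<omega>(3) by (simp add: powr_powr)
    moreover have "(?mu powr (1 / p)) powr p = ?mu" using p mu by (simp add: powr_powr)
    ultimately show ?thesis using mu by (simp add: powr_mult mult.assoc)
  qed
  finally have "lev p k (T (dpart i f)) \<le> ?D * ?mu powr (1 / p) * lev p i f"
    using p by (elim powr_le_imp_le) (auto intro!: mult_nonneg_nonneg)
  then have "2 powr (real k * s) * lev p k (T (dpart i f)) \<le> 2 powr (real k * s) * (?D * ?mu powr (1 / p) * lev p i f)"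
    by (intro mult_left_mono) auto
  also have "2 powr (real k * s) * (?D * ?mu powr (1 / p) * lev p i f)
      = ?D * ?mu powr (1 / p) * (2 powr (of_int (int k - int i) * s) * 2 powr (real i * s)) * lev p i f"
    by (simp add: powr_add[symmetric] left_diff_distrib)
  finally show "2 powr (real k * s) * lev p k (T (dpart i f)) \<le> ?m (int k - int i) * (2 powr (real i * s) * lev p i f)"
    by (simp only: mult_ac)
qed

section \<open>Multiplication by functions of critical smoothness\<close>

lemma avg_cong_on:
  assumes "\<And>x. x \<in> dyadic k j \<Longrightarrow> f x = g x"
  shows "avg k j f = avg k j g"
proof -
  have "(\<lambda>x. indicator (dyadic k j) x * f x) = (\<lambda>x. indicator (dyadic k j) x * g x)"
    using assms by (auto simp: indicator_def)
  then show ?thesis by (simp add: avg_def)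
qed

lemma avg_mult: "j < 2 ^ k \<Longrightarrow> integrable leb01 f \<Longrightarrow> avg k j (\<lambda>x. z * f x) = z * avg k j f"
  using avg_sum[of j k "{()}" "\<lambda>_. f" "\<lambda>_. z"] by simp

text \<open>Splitting as in a paraproduct. Levels \<open>k \<le> i\<close> use only the sup bound
  \<open>A\<close>. At levels \<open>k > i\<close> the factor \<open>dpart i f\<close> is constant
  on parents, so the difference falls on \<alpha>; the sup of \<open>dpart i f\<close> costs
  \<open>2 powr (i / p)\<close>, the smoothness of \<alpha> returns \<open>2 powr (- k / p)\<close>,
  and \<open>s < 1 / p\<close> leaves a geometric gain.\<close>

lemma bl_multiplier:
  fixes \<alpha> :: "real \<Rightarrow> real"
  assumes p: "1 \<le> p" and q: "1 \<le> q" and s: "0 < s" "s < 1 / p" and f: "bl s p q f K"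
    and \<alpha>: "\<alpha> \<in> borel_measurable leb01" "AE x in leb01. \<bar>\<alpha> x\<bar> \<le> A" and A: "0 \<le> A" and B: "0 \<le> B"
    and lev\<alpha>: "\<And>k. lev p k (\<lambda>x. of_real (\<alpha> x)) \<le> B * 2 powr (- (real k / p))"
  shows "bl s p q (\<lambda>x. of_real (\<alpha> x) * f x) ((2 * A / (1 - 2 powr (- s)) + B / (1 - 2 powr (- (1 / p - s)))) * K)"
proof -
  let ?a = "\<lambda>x. of_real (\<alpha> x) :: complex"
  define \<eta> where "\<eta> = 1 / p - s"
  have \<eta>: "0 < \<eta>" using s by (simp add: \<eta>_def)
  have T: "L1op (\<lambda>f x. ?a x * f x) A"
    using \<alpha> A by (intro L1op_multiplier) auto
  have ai: "integrable leb01 ?a" using L1op_integrable[OF T, of "\<lambda>_. 1"] by simp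
  let ?m = "\<lambda>t::int. 2 * A * (if t \<le> 0 then (2 powr (- s)) powr (of_int 0 - of_int t) else 0)
      + B * (if 0 \<le> t then (2 powr (- \<eta>)) powr (of_int t - of_int 0) else 0)"
  have "bl s p q (\<lambda>x. ?a x * (f x - (\<Sum>i<0. dpart i f x))) ((2 * A / (1 - 2 powr (- s)) + B / (1 - 2 powr (- \<eta>))) * K)"
  proof (rule bl_of_pieces[OF p q f T])
    show "0 \<le> ?m t" for t using A B by simp
    show "(\<Sum>t\<in>S. ?m t) \<le> 2 * A / (1 - 2 powr (- s)) + B / (1 - 2 powr (- \<eta>))" if "finite S" for S
    proof -
      have "(\<Sum>t\<in>S. ?m t) \<le> 2 * A * (1 / (1 - 2 powr (- s))) + B * (1 / (1 - 2 powr (- \<eta>)))"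
        unfolding sum.distrib sum_distrib_left[symmetric] using A B s \<eta> that
        by (intro add_mono mult_left_mono sum_geometric_int_below sum_geometric_int_above) (auto intro: powr_less_one)
      then show ?thesis by simp
    qed
    fix i k
    let ?u = "\<lambda>x. ?a x * dpart i f x"
    have le: "lev p k ?u \<le> (if k \<le> i then 2 * A else B * 2 powr ((real i - real k) / p)) * lev p i f"
    proof (cases "k \<le> i")
      case True
      define \<phi> where "\<phi> j x = ?a x * indicator (dyadic i j) x" for j x
      have ui: "integrable leb01 (\<phi> j)" if "j < 2 ^ i" for j
        unfolding \<phi>_def using that by (intro L1op_integrable[OF T] integrable_leb01_indicator dyadic_sets)
      have "?u = (\<lambda>x. \<Sum>j<2 ^ i. dco i j f * \<phi> j x)"
        by (auto simp: dpart_def \<phi>_def sum_distrib_left mult_ac simp del: sum_mult_indicator)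
      moreover have "lev p k (\<lambda>x. \<Sum>j<2 ^ i. dco i j f * \<phi> j x) powr p
          \<le> (2 * A) powr (p - 1) * (\<Sum>j<2 ^ i. cmod (dco i j f) powr p * (2 * (A / 2 ^ i)))"
      proof (rule lev_powr_le[OF p])
        show "integrable leb01 (\<phi> a)" if "a \<in> {..<2 ^ i}" for a using ui that by simp
        have avgA: "(\<Sum>a<2 ^ i. cmod (avg k j (\<phi> a))) \<le> A" if j: "j < 2 ^ k" for k j
        proof -
          have "cmod (avg k j (\<phi> a)) \<le> A * cmod (avg k j (indicator (dyadic i a)))" if a: "a < 2 ^ i" for a
          proof -
            have "cmod (avg k j (\<phi> a)) \<le> 2 ^ k * (LINT x|leb01. indicator (dyadic k j) x * cmod (\<phi> a x))"
              by (rule cmod_avg_le[OF j ui[OF a]])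
            also have "\<dots> \<le> 2 ^ k * (LINT x|leb01. A * indicator (dyadic k j \<inter> dyadic i a) x)"
            proof (intro mult_left_mono integral_mono_AE)
              show "integrable leb01 (\<lambda>x. indicator (dyadic k j) x * cmod (\<phi> a x))"
                using integrable_mult_indicator[OF dyadic_sets[OF j] integrable_norm[OF ui[OF a]]] by simp
              show "integrable leb01 (\<lambda>x. A * indicator (dyadic k j \<inter> dyadic i a) x)"
                using j a by (intro Bochner_Integration.integrable_mult_right integrable_leb01_indicator sets.Int dyadic_sets)
              show "AE x in leb01. indicator (dyadic k j) x * cmod (\<phi> a x) \<le> A * indicator (dyadic k j \<inter> dyadic i a) x"
                using \<alpha>(2) by eventually_elim (auto simp: indicator_def \<phi>_def)
            qed simp
            also have "\<dots> = A * (2 ^ k * measure leb01 (dyadic k j \<inter> dyadic i a))"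
            proof -
              have "dyadic k j \<inter> dyadic i a \<inter> space leb01 = dyadic k j \<inter> dyadic i a"
                using dyadic_subset[OF a] by auto
              then show ?thesis by (simp del: space_leb01)
            qed
            also have "2 ^ k * measure leb01 (dyadic k j \<inter> dyadic i a) = cmod (avg k j (indicator (dyadic i a)))"
              using avg_indicator[OF j dyadic_sets[OF a]] by (simp only: norm_of_real) simp
            finally show ?thesis .
          qed
          then have "(\<Sum>a<2 ^ i. cmod (avg k j (\<phi> a))) \<le> (\<Sum>a<2 ^ i. A * cmod (avg k j (indicator (dyadic i a))))"
            by (intro sum_mono) auto
          also have "\<dots> \<le> A * 1"
            unfolding sum_distrib_left[symmetric] using A dyadic_disjoint j
            by (intro mult_left_mono sum_cmod_avg_disjoint) (auto simp: disjoint_family_on_def)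
          finally show ?thesis by simp
        qed
        show "(\<Sum>a<2 ^ i. cmod (dco k j (\<phi> a))) \<le> 2 * A" if j: "j < 2 ^ k" for j
        proof (cases "k = 0")
          case True
          then show ?thesis using avgA[of 0 0] j A by (simp add: dco_def)
        next
          case False
          have "(\<Sum>a<2 ^ i. cmod (dco k j (\<phi> a))) \<le> (\<Sum>a<2 ^ i. cmod (avg k j (\<phi> a)) + cmod (avg (k - 1) (j div 2) (\<phi> a)))"
            using False unfolding dco_def by (intro sum_mono) (auto intro: norm_triangle_ineq4)
          also have "\<dots> \<le> A + A"
            unfolding sum.distrib using False j div2_less_pow[of k j] by (intro add_mono avgA) auto
          finally show ?thesis by simp
        qed
        show "(\<Sum>j<2 ^ k. cmod (dco k j (\<phi> a))) / 2 ^ k \<le> 2 * (A / 2 ^ i)" if "a \<in> {..<2 ^ i}" for a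
        proof -
          have a: "a < 2 ^ i" using that by simp
          have "L1norm (\<phi> a) \<le> A * L1norm (indicator (dyadic i a))"
            unfolding \<phi>_def by (intro L1op_bound[OF T] integrable_leb01_indicator dyadic_sets a)
          then have "L1norm (\<phi> a) \<le> A / 2 ^ i" using a by (simp add: L1norm_indicator measure_leb01_dyadic)
          then show ?thesis using sum_cmod_dco_le[OF ui[OF a], of k] by linarith
        qed
      qed
      moreover have "(2 * A) powr (p - 1) * (\<Sum>j<2 ^ i. cmod (dco i j f) powr p * (2 * (A / 2 ^ i))) = (2 * A * lev p i f) powr p"
      proof (cases "A = 0")
        case False
        then have "(2 * A) powr (p - 1) * (2 * A) = (2 * A) powr p" using A by (simp add: powr_diff)
        moreover have "(2 * A) powr (p - 1) * (\<Sum>j<2 ^ i. cmod (dco i j f) powr p * (2 * (A / 2 ^ i)))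
            = (2 * A) powr (p - 1) * (2 * A) * lev p i f powr p"
          using p unfolding sum_distrib_right[symmetric] by (simp add: lev_powr)
        ultimately show ?thesis using A by (simp add: powr_mult[of "2 * A"])
      qed simp
      ultimately have "lev p k ?u powr p \<le> (2 * A * lev p i f) powr p" by simp
      then have "lev p k ?u \<le> 2 * A * lev p i f" using p A by (elim powr_le_imp_le) auto
      then show ?thesis using True by simp
    next
      case False
      \<comment> \<open>Index of the cell of level \<open>i\<close> that contains the parent of cell
        \<open>j\<close> of level \<open>k\<close>.\<close>
      define an where "an j = j div 2 div 2 ^ (k - 1 - i)" for j :: nat
      have d: "dco k j ?u = dco i (an j) f * dco k j ?a" and anl: "an j < 2 ^ i" if j: "j < 2 ^ k" for j
      proof -
        have le: "i \<le> k - 1" "0 < k" using False by auto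
        have j2: "j div 2 < 2 ^ (k - 1)" using j False div2_less_pow[of k j] by simp
        have "(2::nat) ^ (k - 1) = 2 ^ i * 2 ^ (k - 1 - i)" using le(1) by (metis le_add_diff_inverse power_add)
        then have "j div 2 < 2 ^ i * 2 ^ (k - 1 - i)" using j2 by simp
        then show anl: "an j < 2 ^ i" unfolding an_def by (simp add: less_mult_imp_div_less)
        have v: "dpart i f x = dco i (an j) f" if x: "x \<in> dyadic (k - 1) (j div 2)" for x
        proof -
          have "x \<in> dyadic i (an j)" using x dyadic_refine[OF le(1)] by (auto simp: an_def)
          moreover have "0 \<le> x" "x < 1" using x dyadic_subset[OF j2] by auto
          ultimately show ?thesis
            unfolding dpart_def using sum_indicator_dyadic[of x "\<lambda>j. dco i j f" i] by (simp add: mem_dyadic_iff del: sum_mult_indicator)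
        qed
        have "avg (k - 1) (j div 2) ?u = avg (k - 1) (j div 2) (\<lambda>x. dco i (an j) f * ?a x)"
          using v by (intro avg_cong_on) (simp add: mult.commute)
        moreover have "avg k j ?u = avg k j (\<lambda>x. dco i (an j) f * ?a x)"
          using v dyadic_Suc_subset[of "k - 1" j] le by (intro avg_cong_on) (auto simp: mult.commute)
        ultimately show "dco k j ?u = dco i (an j) f * dco k j ?a"
          using le j j2 ai by (simp add: dco_def avg_mult right_diff_distrib)
      qed
      \<comment> \<open>Each coefficient is bounded by the whole level; this passage from l^p to the
        sup loses the factor \<open>2 ^ i\<close>.\<close>
      have mx: "cmod (dco i l f) powr p \<le> 2 ^ i * lev p i f powr p" if "l < 2 ^ i" for l
        unfolding dpart_sum_lev[OF p, symmetric] using that by (intro member_le_sum) auto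
      have "lev p k ?u powr p = (\<Sum>j<2 ^ k. cmod (dco i (an j) f) powr p * cmod (dco k j ?a) powr p) / 2 ^ k"
        using p d by (simp add: lev_powr norm_mult powr_mult)
      also have "\<dots> \<le> (\<Sum>j<2 ^ k. (2 ^ i * lev p i f powr p) * cmod (dco k j ?a) powr p) / 2 ^ k"
        using mx anl by (intro divide_right_mono sum_mono mult_right_mono) auto
      also have "\<dots> = 2 ^ i * lev p i f powr p * lev p k ?a powr p"
        using p by (simp add: lev_powr[of p k] sum_distrib_left[symmetric])
      also have "\<dots> \<le> 2 ^ i * lev p i f powr p * (B * 2 powr (- (real k / p))) powr p"
        using p lev\<alpha>[of k] by (intro mult_left_mono powr_mono2) auto
      also have "\<dots> = (B * 2 powr ((real i - real k) / p) * lev p i f) powr p"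
      proof -
        have "(2 powr ((real i - real k) / p)) powr p = 2 ^ i * (2 powr (- (real k / p))) powr p"
        proof -
          have "(2 powr ((real i - real k) / p)) powr p = 2 powr (real i - real k)" using p by (simp add: powr_powr)
          moreover have "(2 powr (- (real k / p))) powr p = 2 powr (- real k)" using p by (simp add: powr_powr)
          ultimately show ?thesis by (simp add: powr_diff powr_minus powr_realpow divide_inverse)
        qed
        then show ?thesis using B by (simp add: powr_mult)
      qed
      finally have "lev p k ?u \<le> B * 2 powr ((real i - real k) / p) * lev p i f"
        using p B by (elim powr_le_imp_le) auto
      then show ?thesis using False by simp
    qed
    have "2 powr (real k * s) * lev p k ?u
        \<le> 2 powr (real k * s) * ((if k \<le> i then 2 * A else B * 2 powr ((real i - real k) / p)) * lev p i f)"
      using le by (intro mult_left_mono) auto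
    also have "\<dots> \<le> ?m (int k - int i) * (2 powr (real i * s) * lev p i f)"
    proof (cases "k \<le> i")
      case True
      have "2 powr (real k * s) = (2 powr (- s)) powr (of_int 0 - of_int (int k - int i)) * 2 powr (real i * s)"
        by (simp add: powr_powr powr_add[symmetric] algebra_simps)
      then have "2 powr (real k * s) * ((if k \<le> i then 2 * A else B * 2 powr ((real i - real k) / p)) * lev p i f)
          = 2 * A * (2 powr (- s)) powr (of_int 0 - of_int (int k - int i)) * (2 powr (real i * s) * lev p i f)"
        using True by simp
      also have "\<dots> \<le> ?m (int k - int i) * (2 powr (real i * s) * lev p i f)"
        using True B by (intro mult_right_mono) auto
      finally show ?thesis .
    next
      case False
      have "2 powr (real k * s) * 2 powr ((real i - real k) / p)
          = (2 powr (- \<eta>)) powr (of_int (int k - int i) - of_int 0) * 2 powr (real i * s)"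
        by (simp add: powr_powr powr_add[symmetric] \<eta>_def algebra_simps diff_divide_distrib)
      then have "2 powr (real k * s) * ((if k \<le> i then 2 * A else B * 2 powr ((real i - real k) / p)) * lev p i f)
          = B * (2 powr (- \<eta>)) powr (of_int (int k - int i) - of_int 0) * (2 powr (real i * s) * lev p i f)"
        using False by (simp add: mult_ac)
      also have "\<dots> \<le> ?m (int k - int i) * (2 powr (real i * s) * lev p i f)"
        using False A by (intro mult_right_mono) auto
      finally show ?thesis .
    qed
    finally show "2 powr (real k * s) * lev p k ?u \<le> ?m (int k - int i) * (2 powr (real i * s) * lev p i f)" .
  qed
  then show ?thesis by (simp add: \<eta>_def)
qed

section \<open>The transfer operator\<close>

lemma measure_leb01_diam:
  assumes A: "A \<subseteq> {0..1}" and L: "0 \<le> L" "\<And>x y. x \<in> A \<Longrightarrow> y \<in> A \<Longrightarrow> x \<le> y \<Longrightarrow> y - x \<le> L"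
  shows "measure leb01 A \<le> L"
proof (cases "A = {}")
  case False
  then obtain x0 where x0: "x0 \<in> A" by blast
  have bb: "bdd_below A" "bdd_above A" using A by (auto intro!: bdd_belowI[of _ 0] bdd_aboveI[of _ 1])
  have x01: "0 \<le> x0" "x0 \<le> 1" using x0 A by auto
  have "0 \<le> Inf A" "Sup A \<le> 1" using A False by (auto intro!: cInf_greatest cSup_least)
  moreover have "Inf A \<le> x0" "x0 \<le> Sup A" using x0 bb by (auto intro: cInf_lower cSup_upper)
  ultimately have I: "Inf A \<in> {0..1}" "Sup A \<in> {0..1}" using x01 by auto
  have le: "Inf A \<le> Sup A" using False bb by (intro cInf_le_cSup)
  have sub: "A \<subseteq> {Inf A..Sup A}" using bb by (auto intro: cInf_lower cSup_upper)
  have s: "{Inf A..Sup A} \<in> sets leb01" using I by (auto simp: sets_leb01_iff)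
  have d: "Sup A - Inf A \<le> L"
  proof -
    have "Sup A \<le> Inf A + L"
    proof (rule cSup_least[OF False])
      fix y assume y: "y \<in> A"
      have "y - L \<le> Inf A"
      proof (rule cInf_greatest[OF False])
        fix x assume "x \<in> A"
        then show "y - L \<le> x" using L(2)[of x y] L(1) y by (cases "x \<le> y") auto
      qed
      then show "y \<le> Inf A + L" by simp
    qed
    then show ?thesis by simp
  qed
  have "measure leb01 A \<le> measure leb01 {Inf A..Sup A}"
    using leb01.finite_measure_mono[OF sub s] by simp
  also have "\<dots> = Sup A - Inf A" using I le by (subst measure_leb01) auto
  finally show ?thesis using d by simp
qed (use L in simp)

text \<open>\<open>A r\<close> bounds the perturbation and \<open>\<theta> r - A r\<close> is a
  lower bound for the slope of the inverse branch; \<open>A r \<le> \<theta> r / 2\<close> keeps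
  that slope comparable to \<open>\<theta> r\<close>.\<close>

locale branch_system =
  fixes \<Lambda> :: "nat set" and \<theta> a b c d :: "nat \<Rightarrow> real" and \<alpha> :: "nat \<Rightarrow> real \<Rightarrow> real" and A :: "nat \<Rightarrow> real"
  assumes part: "interval_partition \<Lambda> a b"
    and cd: "\<And>r. r \<in> \<Lambda> \<Longrightarrow> 0 \<le> c r \<and> c r < d r \<and> d r \<le> 1"
    and theta: "\<And>r. r \<in> \<Lambda> \<Longrightarrow> \<theta> r = (b r - a r) / (d r - c r)"
    and theta1: "\<And>r. r \<in> \<Lambda> \<Longrightarrow> \<theta> r < 1"
    and \<alpha>_meas: "\<And>r. r \<in> \<Lambda> \<Longrightarrow> \<alpha> r \<in> borel_measurable leb01"
    and \<alpha>_int: "\<And>r. r \<in> \<Lambda> \<Longrightarrow> (LINT x|leb01. \<alpha> r x) = 0"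
    and \<alpha>_bd: "\<And>r. r \<in> \<Lambda> \<Longrightarrow> AE x in leb01. \<bar>\<alpha> r x\<bar> \<le> A r"
    and A: "\<And>r. r \<in> \<Lambda> \<Longrightarrow> 0 \<le> A r \<and> A r \<le> \<theta> r / 2"
    and \<alpha>_off: "\<And>r x. r \<in> \<Lambda> \<Longrightarrow> x \<in> {0..1} - {c r..d r} \<Longrightarrow> \<alpha> r x = 0"
begin

abbreviation hb :: "nat \<Rightarrow> real \<Rightarrow> real" where
  "hb \<equiv> branch \<alpha> \<theta> a c"

definition G :: "nat \<Rightarrow> (real \<Rightarrow> complex) \<Rightarrow> real \<Rightarrow> complex" where
  "G r f x = indicator {c r..d r} x * f (hb r x)"

definition \<Phi> :: "(real \<Rightarrow> complex) \<Rightarrow> real \<Rightarrow> complex" where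
  "\<Phi> f x = (\<Sum>r\<in>\<Lambda>. of_real (\<alpha> r x + \<theta> r) * G r f x)"

text \<open>\<open>\<Phi> = AA + EE\<close>, where \<open>AA\<close> has constant weights and \<open>EE\<close> carries the small multipliers \<open>\<alpha>\<^sub>r\<close>.\<close>

definition AA :: "(real \<Rightarrow> complex) \<Rightarrow> real \<Rightarrow> complex" where
  "AA f x = (\<Sum>r\<in>\<Lambda>. of_real (\<theta> r) * G r f x)"

definition EE :: "(real \<Rightarrow> complex) \<Rightarrow> real \<Rightarrow> complex" where
  "EE f x = (\<Sum>r\<in>\<Lambda>. of_real (\<alpha> r x) * G r f x)"

section \<open>Single branches and boundedness on L^1\<close>

lemma fin: "finite \<Lambda>"
  using part by (simp add: interval_partition_def)

lemma ab:
  assumes r: "r \<in> \<Lambda>"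
  shows "0 \<le> a r \<and> a r < b r \<and> b r \<le> 1"
proof -
  have lt: "a r < b r" using part r by (auto simp: interval_partition_def)
  have "{a r..b r} \<subseteq> (\<Union>r\<in>\<Lambda>. {a r..b r})" using r by blast
  also have "\<dots> = {0..1}" using part by (simp add: interval_partition_def)
  finally show ?thesis using lt by auto
qed

lemma theta0: "r \<in> \<Lambda> \<Longrightarrow> 0 < \<theta> r"
  using theta[of r] ab[of r] cd[of r] by simp

lemma nonempty: "\<Lambda> \<noteq> {}"
  using part by (auto simp: interval_partition_def)

lemma transfer_op_eq: "transfer_op \<Lambda> \<alpha> \<theta> a c d = \<Phi>"
proof (intro ext)
  fix f x
  have "transfer_op \<Lambda> \<alpha> \<theta> a c d f x = (\<Sum>r\<in>\<Lambda>. if x \<in> {c r..d r} then of_real (\<alpha> r x + \<theta> r) * f (hb r x) else 0)"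
    unfolding transfer_op_def using fin by (rule sum.inter_filter)
  also have "\<dots> = \<Phi> f x" unfolding \<Phi>_def G_def by (intro sum.cong) auto
  finally show "transfer_op \<Lambda> \<alpha> \<theta> a c d f x = \<Phi> f x" .
qed

lemma \<Phi>_eq: "\<Phi> f x = AA f x + EE f x"
  by (simp add: \<Phi>_def AA_def EE_def sum.distrib[symmetric] distrib_right add.commute)

text \<open>Since \<alpha> has mean zero and vanishes off \<open>{c r..d r}\<close>, the total
  increment of the branch is \<open>\<theta> r * (d r - c r) = b r - a r\<close>: it lands exactly
  on its interval of the partition.\<close>

lemma lip:
  assumes r: "r \<in> \<Lambda>"
  shows "lip_branch (\<lambda>x. \<alpha> r x + \<theta> r) (a r) (b r) (c r) (d r) (\<theta> r - A r) (\<theta> r + A r)"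
proof
  show "0 \<le> c r" "c r < d r" "d r \<le> 1" "0 \<le> a r" "b r \<le> 1" using cd[OF r] ab[OF r] by auto
  show "(\<lambda>x. \<alpha> r x + \<theta> r) \<in> borel_measurable leb01" using \<alpha>_meas[OF r] by simp
  show "AE x in leb01. x \<in> {c r..d r} \<longrightarrow> \<theta> r - A r \<le> \<alpha> r x + \<theta> r \<and> \<alpha> r x + \<theta> r \<le> \<theta> r + A r"
    using \<alpha>_bd[OF r] by eventually_elim auto
  show "0 < \<theta> r - A r" using A[OF r] theta0[OF r] by linarith
  have ai: "integrable leb01 (\<alpha> r)"
    using \<alpha>_meas[OF r] \<alpha>_bd[OF r] by (intro integrable_leb01_bounded[where B = "A r"]) auto
  have J: "{c r..d r} \<in> sets leb01" using cd[OF r] by (auto simp: sets_leb01_iff)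
  have "(LINT t:{c r..d r}|leb01. \<alpha> r t + \<theta> r) = (LINT t|leb01. \<alpha> r t + \<theta> r * indicator {c r..d r} t)"
    unfolding set_lebesgue_integral_def
    using \<alpha>_off[OF r] by (intro Bochner_Integration.integral_cong) (auto simp: indicator_def)
  also have "\<dots> = (LINT t|leb01. \<alpha> r t) + (LINT t|leb01. \<theta> r * indicator {c r..d r} t)"
    using ai J by (intro Bochner_Integration.integral_add Bochner_Integration.integrable_mult_right integrable_leb01_indicator)
  also have "(LINT t|leb01. \<theta> r * indicator {c r..d r} t) = \<theta> r * (d r - c r)"
  proof -
    have "{c r..d r} \<inter> {0..1} = {c r..d r}" using cd[OF r] by auto
    moreover have "measure leb01 {c r..d r} = d r - c r" using cd[OF r] by (subst measure_leb01) auto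
    ultimately show ?thesis by (simp del: Int_atLeastAtMost)
  qed
  finally show "(LINT t:{c r..d r}|leb01. \<alpha> r t + \<theta> r) = b r - a r"
    using \<alpha>_int[OF r] theta[OF r] cd[OF r] by simp
qed

lemma hb_eq: "r \<in> \<Lambda> \<Longrightarrow> lip_branch.h (\<lambda>x. \<alpha> r x + \<theta> r) (a r) (c r) = hb r"
  by (auto simp: lip_branch.h_def[OF lip] branch_def)

lemma
  assumes r: "r \<in> \<Lambda>"
  shows hb_lip: "c r \<le> x \<Longrightarrow> x \<le> y \<Longrightarrow> y \<le> d r \<Longrightarrow> (\<theta> r - A r) * (y - x) \<le> hb r y - hb r x"
    and hb_image: "hb r ` {c r..d r} = {a r..b r}"
    and hb_continuous: "continuous_on {c r..d r} (hb r)"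
    and hb_inj: "inj_on (hb r) {c r..d r}"
    and hb_in: "x \<in> {c r..d r} \<Longrightarrow> hb r x \<in> {a r..b r}"
  using lip_branch.h_lip(1)[OF lip[OF r]] lip_branch.h_image[OF lip[OF r]]
    lip_branch.continuous_on_h[OF lip[OF r]] lip_branch.inj_on_h[OF lip[OF r]] lip_branch.h_in[OF lip[OF r]]
  unfolding hb_eq[OF r] by blast+

lemma theta_le_2m: "r \<in> \<Lambda> \<Longrightarrow> 0 < \<theta> r - A r \<and> \<theta> r \<le> 2 * (\<theta> r - A r)"
  using A[of r] theta0[of r] by simp

lemma L1op_G: "r \<in> \<Lambda> \<Longrightarrow> L1op (G r) (1 / (\<theta> r - A r))"
  unfolding L1op_def
proof (intro conjI allI impI)
  assume r: "r \<in> \<Lambda>"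
  show "0 \<le> 1 / (\<theta> r - A r)" using theta_le_2m[OF r] by simp
  fix f :: "real \<Rightarrow> complex" assume f: "integrable leb01 f"
  show "integrable leb01 (G r f)" "L1norm (G r f) \<le> 1 / (\<theta> r - A r) * L1norm f"
    using lip_branch.integrable_comp_h[OF lip[OF r] f] unfolding hb_eq[OF r] G_def[abs_def] by auto
qed (simp_all add: G_def distrib_left)

lemma \<alpha>_multiplier: "r \<in> \<Lambda> \<Longrightarrow> L1op (\<lambda>f x. of_real (\<alpha> r x) * f x) (A r)"
  using \<alpha>_meas[of r] \<alpha>_bd[of r] A[of r] by (intro L1op_multiplier) auto

lemma L1op_AA: "\<exists>C. L1op AA C"
proof -
  have "L1op (\<lambda>f x. \<Sum>r\<in>\<Lambda>. of_real (\<theta> r) * G r f x) (\<Sum>r\<in>\<Lambda>. cmod (of_real (\<theta> r)) * (1 / (\<theta> r - A r)))"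
    by (rule L1op_sum_op[OF fin]) (rule L1op_scale[OF L1op_G])
  then show ?thesis unfolding AA_def[abs_def] by blast
qed

lemma L1op_EE: "\<exists>C. L1op EE C"
proof -
  have "L1op (\<lambda>f x. \<Sum>r\<in>\<Lambda>. of_real (\<alpha> r x) * G r f x) (\<Sum>r\<in>\<Lambda>. A r * (1 / (\<theta> r - A r)))"
    by (rule L1op_sum_op[OF fin]) (rule L1op_compose[OF \<alpha>_multiplier L1op_G])
  then show ?thesis unfolding EE_def[abs_def] by blast
qed

lemma L1op_\<Phi>: "\<exists>C. L1op \<Phi> C"
proof -
  obtain C D where "L1op AA C" "L1op EE D" using L1op_AA L1op_EE by blast
  then have "L1op (\<lambda>f x. AA f x + EE f x) (C + D)" by (rule L1op_add_op)
  then show ?thesis by (auto simp: \<Phi>_eq[abs_def])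
qed

text \<open>Along a word \<open>w\<close>, \<open>hw\<close> is the composed inverse branch, \<open>Jw\<close> its domain, \<open>\<theta>w\<close> its weight in
  \<open>AA\<^sup>n\<close>, and \<open>mw\<close> a lower bound for its derivative.\<close>

definition words :: "nat \<Rightarrow> nat list set" where
  "words n = {w. set w \<subseteq> \<Lambda> \<and> length w = n}"

primrec hw :: "nat list \<Rightarrow> real \<Rightarrow> real" where
  "hw [] x = x"
| "hw (r # w) x = hb r (hw w x)"

primrec Jw :: "nat list \<Rightarrow> real set" where
  "Jw [] = {0..1}"
| "Jw (r # w) = {x \<in> Jw w. hw w x \<in> {c r..d r}}"

primrec \<theta>w :: "nat list \<Rightarrow> real" where
  "\<theta>w [] = 1"
| "\<theta>w (r # w) = \<theta> r * \<theta>w w"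

primrec mw :: "nat list \<Rightarrow> real" where
  "mw [] = 1"
| "mw (r # w) = (\<theta> r - A r) * mw w"

section \<open>Cylinders of words and their multiplicity\<close>

lemma words_Suc: "words (Suc n) = (\<lambda>(r, w). r # w) ` (\<Lambda> \<times> words n)"
  by (auto simp: words_def image_iff length_Suc_conv)

lemma finite_words: "finite (words n)"
  unfolding words_def using fin by (rule finite_lists_length_eq)

lemma card_words: "card (words n) = card \<Lambda> ^ n"
  unfolding words_def using fin by (rule card_lists_length_eq)

lemma sum_words_Suc: "(\<Sum>w\<in>words (Suc n). F w) = (\<Sum>r\<in>\<Lambda>. \<Sum>w\<in>words n. F (r # w))"
  unfolding words_Suc by (subst sum.reindex) (auto simp: inj_on_def sum.cartesian_product split_def)

text \<open>Peeling off the innermost application, \<open>AA ^^ Suc n = (AA ^^ n) o AA\<close>,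
  prepends the new letter, which matches the recursion of \<open>hw\<close> and
  \<open>Jw\<close>.\<close>

lemma AA_funpow:
  "x \<in> {0..1} \<Longrightarrow> (AA ^^ n) f x = (\<Sum>w\<in>words n. of_real (\<theta>w w) * (indicator (Jw w) x * f (hw w x)))"
proof (induction n arbitrary: f)
  case 0
  have "words 0 = {[]}" by (auto simp: words_def)
  then show ?case using 0 by simp
next
  case (Suc n)
  have "(AA ^^ Suc n) f x = (AA ^^ n) (AA f) x" by (simp add: funpow_swap1)
  also have "\<dots> = (\<Sum>w\<in>words n. of_real (\<theta>w w) * (indicator (Jw w) x * AA f (hw w x)))"
    using Suc by blast
  also have "\<dots> = (\<Sum>w\<in>words n. \<Sum>r\<in>\<Lambda>. of_real (\<theta>w (r # w)) * (indicator (Jw (r # w)) x * f (hw (r # w) x)))"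
    unfolding AA_def G_def sum_distrib_left by (intro sum.cong) (auto simp: indicator_def)
  also have "\<dots> = (\<Sum>w\<in>words (Suc n). of_real (\<theta>w w) * (indicator (Jw w) x * f (hw w x)))"
    unfolding sum_words_Suc by (rule sum.swap)
  finally show ?case .
qed

lemma mw_pos: "set w \<subseteq> \<Lambda> \<Longrightarrow> 0 < mw w"
  by (induction w) (auto intro!: mult_pos_pos dest: theta_le_2m)

lemma \<theta>w_pos: "set w \<subseteq> \<Lambda> \<Longrightarrow> 0 < \<theta>w w"
  by (induction w) (auto intro!: mult_pos_pos theta0)

lemma hw_expand:
  "set w \<subseteq> \<Lambda> \<Longrightarrow> x \<in> Jw w \<Longrightarrow> y \<in> Jw w \<Longrightarrow> x \<le> y \<Longrightarrow> mw w * (y - x) \<le> hw w y - hw w x"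
proof (induction w)
  case (Cons r w)
  then have r: "r \<in> \<Lambda>" and xy: "x \<in> Jw w" "y \<in> Jw w" "hw w x \<in> {c r..d r}" "hw w y \<in> {c r..d r}"
    and IH: "mw w * (y - x) \<le> hw w y - hw w x" by auto
  have "0 \<le> mw w * (y - x)" using mw_pos[of w] Cons.prems by (intro mult_nonneg_nonneg) auto
  then have le: "hw w x \<le> hw w y" using IH by linarith
  have "mw (r # w) * (y - x) = (\<theta> r - A r) * (mw w * (y - x))" by simp
  also have "\<dots> \<le> (\<theta> r - A r) * (hw w y - hw w x)"
    using theta_le_2m[OF r] IH by (intro mult_left_mono) auto
  also have "\<dots> \<le> hb r (hw w y) - hb r (hw w x)" using xy le by (intro hb_lip[OF r]) auto
  finally show ?case by simp
qed simp

lemma hw_mono: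
  assumes "set w \<subseteq> \<Lambda>" "x \<in> Jw w" "y \<in> Jw w" "x \<le> y"
  shows "hw w x \<le> hw w y"
proof -
  have "0 \<le> mw w * (y - x)" using mw_pos[of w] assms by (intro mult_nonneg_nonneg) auto
  then show ?thesis using hw_expand[OF assms] by linarith
qed

lemma hw_strict_mono:
  assumes "set w \<subseteq> \<Lambda>" "x \<in> Jw w" "y \<in> Jw w" "x < y"
  shows "hw w x < hw w y"
proof -
  have "0 < mw w * (y - x)" using mw_pos[of w] assms by (intro mult_pos_pos) auto
  then show ?thesis using hw_expand[of w x y] assms by linarith
qed

lemma is_interval_restrict:
  assumes w: "set w \<subseteq> \<Lambda>" and J: "is_interval (Jw w)" and Q: "is_interval Q"
  shows "is_interval {x \<in> Jw w. hw w x \<in> Q}"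
  unfolding is_interval_1
proof (intro ballI allI impI)
  fix x y z assume xy: "x \<in> {x \<in> Jw w. hw w x \<in> Q}" "y \<in> {x \<in> Jw w. hw w x \<in> Q}" and z: "x \<le> z \<and> z \<le> y"
  then have zJ: "z \<in> Jw w" using J mem_is_interval_1_I[of "Jw w" x y z] by auto
  have "hw w x \<le> hw w z" "hw w z \<le> hw w y" using xy z zJ hw_mono[OF w] by auto
  then have "hw w z \<in> Q" using Q xy mem_is_interval_1_I[of Q "hw w x" "hw w y"] by auto
  then show "z \<in> {x \<in> Jw w. hw w x \<in> Q}" using zJ by simp
qed

lemma is_interval_Jw: "set w \<subseteq> \<Lambda> \<Longrightarrow> is_interval (Jw w)"
proof (induction w)
  case (Cons r w)
  then show ?case using is_interval_restrict[of w "{c r..d r}"] by (simp add: is_interval_cc)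
qed (simp add: is_interval_cc)

lemma Jw_subset: "Jw w \<subseteq> {0..1}"
  by (induction w) auto

lemma continuous_on_hw: "set w \<subseteq> \<Lambda> \<Longrightarrow> continuous_on (Jw w) (hw w)"
proof (induction w)
  case (Cons r w)
  then have r: "r \<in> \<Lambda>" by simp
  have "continuous_on (Jw (r # w)) (hw w)" by (rule continuous_on_subset[OF Cons.IH]) (use Cons.prems in auto)
  then have "continuous_on (Jw (r # w)) (\<lambda>x. hb r (hw w x))"
    by (rule continuous_on_compose2[OF hb_continuous[OF r]]) auto
  moreover have "hw (r # w) = (\<lambda>x. hb r (hw w x))" by (rule ext) simp
  ultimately show ?case by simp
qed (simp add: continuous_on_id')

lemma is_interval_image: "set w \<subseteq> \<Lambda> \<Longrightarrow> is_interval (hw w ` Jw w)"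
  using connected_continuous_image[OF continuous_on_hw] is_interval_Jw is_interval_connected_1 by blast

text \<open>Different first letters put the images into two intervals of the partition, which share
  at most endpoints; equal first letters are removed by injectivity of the branch.\<close>

lemma overlap_finite:
  "set w \<subseteq> \<Lambda> \<Longrightarrow> set w' \<subseteq> \<Lambda> \<Longrightarrow> length w = length w' \<Longrightarrow> w \<noteq> w' \<Longrightarrow> finite (hw w ` Jw w \<inter> hw w' ` Jw w')"
proof (induction w w' rule: list_induct2')
  case (4 r w r' w')
  then have r: "r \<in> \<Lambda>" "r' \<in> \<Lambda>" by auto
  show ?case
  proof (cases "r = r'")
    case False
    have "hw (r # w) ` Jw (r # w) \<inter> hw (r' # w') ` Jw (r' # w') \<subseteq> {a r, b r, a r', b r'}"
    proof
      fix y assume "y \<in> hw (r # w) ` Jw (r # w) \<inter> hw (r' # w') ` Jw (r' # w')"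
      then have "y \<in> {a r..b r}" "y \<in> {a r'..b r'}" using hb_in[OF r(1)] hb_in[OF r(2)] by auto
      moreover have "{a r<..<b r} \<inter> {a r'<..<b r'} = {}"
        using part r False by (auto simp: interval_partition_def disjoint_family_on_def)
      ultimately show "y \<in> {a r, b r, a r', b r'}" by force
    qed
    then show ?thesis by (rule finite_subset) simp
  next
    case True
    then have fin: "finite (hw w ` Jw w \<inter> hw w' ` Jw w')" using 4 by auto
    have "hw (r # w) ` Jw (r # w) \<inter> hw (r' # w') ` Jw (r' # w') \<subseteq> hb r ` (hw w ` Jw w \<inter> hw w' ` Jw w')"
    proof
      fix y assume "y \<in> hw (r # w) ` Jw (r # w) \<inter> hw (r' # w') ` Jw (r' # w')"
      then obtain x x' where x: "x \<in> Jw w" "hw w x \<in> {c r..d r}" "y = hb r (hw w x)"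
        and x': "x' \<in> Jw w'" "hw w' x' \<in> {c r..d r}" "y = hb r (hw w' x')" using True by auto
      then have "hw w x = hw w' x'" using hb_inj[OF r(1)] by (auto simp: inj_on_def)
      then have "hw w x \<in> hw w ` Jw w \<inter> hw w' ` Jw w'" using x(1) x'(1) by (metis IntI imageI)
      then show "y \<in> hb r ` (hw w ` Jw w \<inter> hw w' ` Jw w')" unfolding x(3) by (rule imageI)
    qed
    then show ?thesis by (rule finite_subset[OF _ finite_imageI[OF fin]])
  qed
qed auto

text \<open>On fine levels a cell is shorter than every nondegenerate image, so an image meeting it
  substantially sticks out to the left or to the right and covers a one-sided neighbourhood of that
  end of the cell. Two images sticking out on the same side would share an interval, contrary to
  \<open>overlap_finite\<close>; hence one for each side, whatever \<open>n\<close> is.\<close>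

lemma multiplicity:
  "\<exists>n0. \<forall>i\<ge>n0. \<forall>j<2 ^ i. card {w \<in> words n. measure leb01 {x \<in> Jw w. hw w x \<in> dyadic i j} \<noteq> 0} \<le> 2"
proof -
  \<comment> \<open>Words whose domain contains two points; the remaining domains have measure zero
    and are never counted.\<close>
  define W where "W = {w \<in> words n. \<exists>x\<in>Jw w. \<exists>y\<in>Jw w. x < y}"
  have "W \<subseteq> words n" by (auto simp: W_def)
  then have W: "finite W" "\<And>w. w \<in> W \<Longrightarrow> set w \<subseteq> \<Lambda>" using finite_subset[OF _ finite_words] by (auto simp: words_def)
  have "\<exists>e>0. \<exists>x\<in>Jw w. \<exists>y\<in>Jw w. e \<le> hw w y - hw w x" if w: "w \<in> W" for w
  proof -
    obtain x y where "x \<in> Jw w" "y \<in> Jw w" "x < y" using w by (auto simp: W_def)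
    then show ?thesis using hw_strict_mono[OF W(2)[OF w]]
      by (intro exI[of _ "hw w y - hw w x"]) auto
  qed
  then obtain e where e: "\<And>w. w \<in> W \<Longrightarrow> 0 < e w \<and> (\<exists>x\<in>Jw w. \<exists>y\<in>Jw w. e w \<le> hw w y - hw w x)" by metis
  \<comment> \<open>A common lower bound for the spread of finitely many images; the inserted 1
    keeps the minimum defined if \<open>W\<close> is empty.\<close>
  define \<epsilon> where "\<epsilon> = Min (insert 1 (e ` W))"
  have \<epsilon>: "0 < \<epsilon>" "\<And>w. w \<in> W \<Longrightarrow> \<epsilon> \<le> e w" using W(1) e by (auto simp: \<epsilon>_def)
  obtain n0 where n0: "(1 / 2) ^ n0 < \<epsilon>" using real_arch_pow_inv[OF \<epsilon>(1), of "1 / 2"] by auto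
  have "card {w \<in> words n. measure leb01 {x \<in> Jw w. hw w x \<in> dyadic i j} \<noteq> 0} \<le> 2" if i: "n0 \<le> i" and j: "j < 2 ^ i" for i j
  proof -
    define L where "L = real j / 2 ^ i"
    define R where "R = (real j + 1) / 2 ^ i"
    have Q: "dyadic i j = {L..<R}" by (simp add: dyadic_def L_def R_def)
    have RL: "R - L < \<epsilon>"
    proof -
      have "R - L = (1 / 2) ^ i" by (simp add: L_def R_def power_divide diff_divide_distrib[symmetric])
      also have "\<dots> \<le> (1 / 2) ^ n0" using i by (intro power_decreasing) auto
      finally show ?thesis using n0 by simp
    qed
    define B where "B = {w \<in> words n. measure leb01 {x \<in> Jw w. hw w x \<in> dyadic i j} \<noteq> 0}"
    have Bf: "finite B" using finite_words by (auto simp: B_def)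
    have Bw: "set w \<subseteq> \<Lambda>" "length w = n" if "w \<in> B" for w using that by (auto simp: B_def words_def)
    \<comment> \<open>A set with at most one point has measure 0, so a counted word has two distinct
      points over the cell; their images then span an interval inside the cell.\<close>
    have two: "\<exists>x y. x < y \<and> x \<in> Jw w \<and> y \<in> Jw w \<and> hw w x \<in> {L..<R} \<and> hw w y \<in> {L..<R}" if "w \<in> B" for w
    proof (rule ccontr)
      assume "\<not> ?thesis"
      then have no: "\<not> x < y" if "x \<in> Jw w" "y \<in> Jw w" "hw w x \<in> {L..<R}" "hw w y \<in> {L..<R}" for x y
        using that by blast
      have "measure leb01 {x \<in> Jw w. hw w x \<in> dyadic i j} \<le> 0"
      proof (rule measure_leb01_diam)
        fix x y assume "x \<in> {x \<in> Jw w. hw w x \<in> dyadic i j}" "y \<in> {x \<in> Jw w. hw w x \<in> dyadic i j}" "x \<le> y"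
        then show "y - x \<le> 0" using no[of x y] unfolding Q by simp
      qed (use Jw_subset[of w] in auto)
      then show False using that measure_nonneg[of leb01 "{x \<in> Jw w. hw w x \<in> dyadic i j}"]
        by (simp add: B_def)
    qed
    define BL where "BL = {w \<in> B. \<exists>z\<in>hw w ` Jw w. z < L}"
    define BR where "BR = {w \<in> B. \<exists>z\<in>hw w ` Jw w. R \<le> z}"
    have fin: "finite BL" "finite BR" using Bf by (auto simp: BL_def BR_def)
    have cover: "B \<subseteq> BL \<union> BR"
    proof
      fix w assume w: "w \<in> B"
      then have "w \<in> W" using two[OF w] by (auto simp: W_def B_def)
      then obtain x y where xy: "x \<in> Jw w" "y \<in> Jw w" "\<epsilon> \<le> hw w y - hw w x"
        using e[of w] \<epsilon>(2)[of w] by (meson order_trans)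
      then have "hw w x < L \<or> R \<le> hw w y" using RL by linarith
      then show "w \<in> BL \<union> BR" using w xy by (auto simp: BL_def BR_def)
    qed
    have Lint: "\<exists>v>L. {L..v} \<subseteq> hw w ` Jw w" if wL: "w \<in> BL" for w
    proof -
      have w: "w \<in> B" using wL by (simp add: BL_def)
      obtain z where z: "z \<in> hw w ` Jw w" "z < L" using wL by (auto simp: BL_def)
      obtain x y where xy: "x < y" "x \<in> Jw w" "y \<in> Jw w" "hw w x \<in> {L..<R}" "hw w y \<in> {L..<R}" using two[OF w] by blast
      have "hw w x < hw w y" using hw_strict_mono[OF Bw(1)[OF w]] xy by blast
      moreover have "{L..hw w y} \<subseteq> hw w ` Jw w"
      proof
        fix t assume "t \<in> {L..hw w y}"
        then show "t \<in> hw w ` Jw w"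
          using mem_is_interval_1_I[OF is_interval_image[OF Bw(1)[OF w]] z(1), of "hw w y" t] xy z by auto
      qed
      ultimately show ?thesis using xy by (intro exI[of _ "hw w y"]) auto
    qed
    have Rint: "\<exists>v<R. {v..<R} \<subseteq> hw w ` Jw w" if wR: "w \<in> BR" for w
    proof -
      have w: "w \<in> B" using wR by (simp add: BR_def)
      obtain z where z: "z \<in> hw w ` Jw w" "R \<le> z" using wR by (auto simp: BR_def)
      obtain x y where xy: "x < y" "x \<in> Jw w" "y \<in> Jw w" "hw w x \<in> {L..<R}" "hw w y \<in> {L..<R}" using two[OF w] by blast
      have "{hw w x..<R} \<subseteq> hw w ` Jw w"
      proof
        fix t assume "t \<in> {hw w x..<R}"
        then show "t \<in> hw w ` Jw w"
          using mem_is_interval_1_I[OF is_interval_image[OF Bw(1)[OF w]] _ z(1), of "hw w x" t] xy z by auto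
      qed
      then show ?thesis using xy by (intro exI[of _ "hw w x"]) auto
    qed
    have "w = w'" if ww: "w \<in> BL" "w' \<in> BL" for w w'
    proof (rule ccontr)
      assume ne: "w \<noteq> w'"
      have wB: "w \<in> B" "w' \<in> B" using ww by (auto simp: BL_def)
      obtain v v' where v: "L < v" "{L..v} \<subseteq> hw w ` Jw w" "L < v'" "{L..v'} \<subseteq> hw w' ` Jw w'"
        using Lint[OF ww(1)] Lint[OF ww(2)] by blast
      then have "{L..min v v'} \<subseteq> hw w ` Jw w \<inter> hw w' ` Jw w'" by auto
      moreover have "infinite {L..min v v'}" using v by (simp add: infinite_Icc_iff)
      ultimately show False using overlap_finite[of w w'] Bw[OF wB(1)] Bw[OF wB(2)] ne finite_subset by metis
    qed
    then have cL: "card BL \<le> 1" using fin by (auto simp: card_le_Suc0_iff_eq)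
    have "w = w'" if ww: "w \<in> BR" "w' \<in> BR" for w w'
    proof (rule ccontr)
      assume ne: "w \<noteq> w'"
      have wB: "w \<in> B" "w' \<in> B" using ww by (auto simp: BR_def)
      obtain v v' where v: "v < R" "{v..<R} \<subseteq> hw w ` Jw w" "v' < R" "{v'..<R} \<subseteq> hw w' ` Jw w'"
        using Rint[OF ww(1)] Rint[OF ww(2)] by blast
      then have "{max v v'..<R} \<subseteq> hw w ` Jw w \<inter> hw w' ` Jw w'" by auto
      moreover have "infinite {max v v'..<R}" using v by (simp add: infinite_Ico_iff)
      ultimately show False using overlap_finite[of w w'] Bw[OF wB(1)] Bw[OF wB(2)] ne finite_subset by metis
    qed
    then have cR: "card BR \<le> 1" using fin by (auto simp: card_le_Suc0_iff_eq)
    have "card B \<le> card (BL \<union> BR)" using cover fin by (intro card_mono) auto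
    also have "\<dots> \<le> card BL + card BR" by (rule card_Un_le)
    finally show ?thesis using cL cR by (simp add: B_def)
  qed
  then show ?thesis by blast
qed

end

section \<open>Norm estimates for powers, preservation of integrals and positivity\<close>

context branch_system
begin

lemma word_measure:
  assumes w: "set w \<subseteq> \<Lambda>"
  shows "measure leb01 {x \<in> Jw w. hw w x \<in> dyadic i j} \<le> 1 / 2 ^ i / mw w"
proof (rule measure_leb01_diam)
  show "0 \<le> 1 / 2 ^ i / mw w" using mw_pos[OF w] by simp
  fix x y assume xy: "x \<in> {x \<in> Jw w. hw w x \<in> dyadic i j}" "y \<in> {x \<in> Jw w. hw w x \<in> dyadic i j}" "x \<le> y"
  have "mw w * (y - x) \<le> hw w y - hw w x" using xy by (intro hw_expand w) auto
  also have "\<dots> \<le> (real j + 1) / 2 ^ i - real j / 2 ^ i" using xy by (auto simp: dyadic_def)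
  also have "\<dots> = 1 / 2 ^ i" by (simp add: diff_divide_distrib[symmetric])
  finally show "y - x \<le> 1 / 2 ^ i / mw w" using mw_pos[OF w] by (simp add: field_simps)
qed (use Jw_subset in auto)

text \<open>The bound of \<open>family_bl\<close> for the single word \<open>[r]\<close>: \<Omega>
  is 1, the multiplicity is 1, and \<open>G = 2 / \<theta> r\<close> because the slope is at least
  half of \<open>\<theta> r\<close>.\<close>

definition Gc :: "real \<Rightarrow> real \<Rightarrow> nat \<Rightarrow> real" where
  "Gc p s r = (2 powr (p - 1) * (2 * (2 / \<theta> r))) powr (1 / p) * kernel_const p s"

lemma Gc_nonneg: "0 < s \<Longrightarrow> s < 1 / p \<Longrightarrow> 0 \<le> Gc p s r"
  using kernel_const_pos[of s p] by (simp add: Gc_def)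

lemma bl_G:
  assumes p: "1 \<le> p" and q: "1 \<le> q" and s: "0 < s" "s < 1 / p" and f: "bl s p q f K" and r: "r \<in> \<Lambda>"
  shows "bl s p q (G r f) (Gc p s r * K)"
proof -
  have w: "set [r] \<subseteq> \<Lambda>" using r by simp
  have Jr: "Jw [r] = {c r..d r}" using cd[OF r] by auto
  have "bl s p q (G r (\<lambda>x. f x - (\<Sum>i<0. dpart i f x)))
      (((2 * (real (card {[r]}) * 1)) powr (p - 1) * (real 1 * (2 * (2 / \<theta> r)))) powr (1 / p) * (1 powr s * kernel_const p s) * K)"
  proof (rule family_bl[OF p q s f L1op_G[OF r], where W = "{[r]}" and J = Jw and g = hw and \<omega> = "\<lambda>_. 1"])
    show "G r f x = (\<Sum>w\<in>{[r]}. of_real 1 * (indicator (Jw w) x * f (hw w x)))" if "x \<in> {0..1}" for f x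
      using that unfolding sum.insert[OF finite.emptyI empty_iff[THEN iffD1, THEN notI]] by (simp add: G_def Jr del: Jw.simps)
    show "is_interval {x \<in> Jw w. hw w x \<in> dyadic i j}" if "w \<in> {[r]}" for w i j
      using that w is_interval_Jw is_interval_restrict is_interval_dyadic by (metis singletonD)
    show "1 * measure leb01 {x \<in> Jw w. hw w x \<in> dyadic i j} \<le> 2 / \<theta> r / 2 ^ i" if "w \<in> {[r]}" for w i j
    proof -
      have "measure leb01 {x \<in> Jw [r]. hw [r] x \<in> dyadic i j} \<le> 1 / 2 ^ i / mw [r]"
        by (rule word_measure[OF w])
      also have "\<dots> \<le> 2 / \<theta> r / 2 ^ i" using theta_le_2m[OF r] theta0[OF r] by (simp add: field_simps)
      finally show ?thesis using that by simp
    qed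
    show "2 \<le> 2 / \<theta> r" using theta0[OF r] theta1[OF r] by (simp add: field_simps)
    show "card {w \<in> {[r]}. measure leb01 {x \<in> Jw w. hw w x \<in> dyadic i j} \<noteq> 0} \<le> 1" for i j
      by (rule order_trans[OF card_mono[of "{[r]}"]]) auto
    show "Jw w \<subseteq> {0..1}" for w by (rule Jw_subset)
  qed auto
  then show ?thesis by (simp add: Gc_def)
qed

definition MA :: "real \<Rightarrow> real \<Rightarrow> real" where
  "MA p s = (\<Sum>r\<in>\<Lambda>. \<theta> r * Gc p s r)"

lemma MA_nonneg: "0 < s \<Longrightarrow> s < 1 / p \<Longrightarrow> 0 \<le> MA p s"
  unfolding MA_def using Gc_nonneg theta0 by (intro sum_nonneg mult_nonneg_nonneg) (auto intro: less_imp_le)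

lemma bl_AA:
  assumes p: "1 \<le> p" and q: "1 \<le> q" and s: "0 < s" "s < 1 / p" and f: "bl s p q f K"
  shows "bl s p q (AA f) (MA p s * K)"
proof -
  have "bl s p q (\<lambda>x. \<Sum>r\<in>\<Lambda>. of_real (\<theta> r) * G r f x) (\<Sum>r\<in>\<Lambda>. cmod (of_real (\<theta> r)) * (Gc p s r * K))"
    using bl_G[OF p q s f] by (intro bl_sum[OF p q] bl_mult[OF p q])
  also have "(\<Sum>r\<in>\<Lambda>. cmod (of_real (\<theta> r)) * (Gc p s r * K)) = MA p s * K"
    unfolding MA_def sum_distrib_right using theta0 by (intro sum.cong) (auto simp: abs_of_pos)
  finally show ?thesis unfolding AA_def[abs_def] .
qed

text \<open>Linear in the bounds for \<alpha> and its smoothness, hence small together with them,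
  whereas \<open>MA\<close> depends only on the weights \<theta>, on \<open>p\<close> and on
  \<open>s\<close>.\<close>

definition EC :: "real \<Rightarrow> real \<Rightarrow> (nat \<Rightarrow> real) \<Rightarrow> real" where
  "EC p s B = (\<Sum>r\<in>\<Lambda>. (2 * A r / (1 - 2 powr (- s)) + B r / (1 - 2 powr (- (1 / p - s)))) * Gc p s r)"

lemma bl_EE:
  assumes p: "1 \<le> p" and q: "1 \<le> q" and s: "0 < s" "s < 1 / p" and f: "bl s p q f K"
    and B: "\<And>r. r \<in> \<Lambda> \<Longrightarrow> 0 \<le> B r"
      "\<And>r k. r \<in> \<Lambda> \<Longrightarrow> lev p k (\<lambda>x. of_real (\<alpha> r x)) \<le> B r * 2 powr (- (real k / p))"
  shows "bl s p q (EE f) (EC p s B * K)"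
proof -
  have "bl s p q (\<lambda>x. \<Sum>r\<in>\<Lambda>. of_real (\<alpha> r x) * G r f x)
      (\<Sum>r\<in>\<Lambda>. (2 * A r / (1 - 2 powr (- s)) + B r / (1 - 2 powr (- (1 / p - s)))) * (Gc p s r * K))"
    using A B \<alpha>_meas \<alpha>_bd
    by (intro bl_sum[OF p q] bl_multiplier[OF p q s bl_G[OF p q s f]]) auto
  then show ?thesis unfolding EE_def[abs_def] EC_def sum_distrib_right by (simp add: mult.assoc)
qed

lemma EC_nonneg:
  assumes "0 < s" "s < 1 / p" "\<And>r. r \<in> \<Lambda> \<Longrightarrow> 0 \<le> B r"
  shows "0 \<le> EC p s B"
proof -
  have "2 powr (- s) < (1::real)" "2 powr (- (1 / p - s)) < (1::real)" using assms by (auto intro: powr_less_one)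
  then show ?thesis
    unfolding EC_def using assms A Gc_nonneg[OF assms(1,2)]
    by (intro sum_nonneg mult_nonneg_nonneg add_nonneg_nonneg divide_nonneg_nonneg) auto
qed

lemma bl_funpow:
  assumes "\<And>f K. bl s p q f K \<Longrightarrow> bl s p q (T f) (M * K)" "bl s p q f K"
  shows "bl s p q ((T ^^ n) f) (M ^ n * K)"
  using assms(2)
proof (induction n)
  case (Suc n)
  then show ?case using assms(1)[of "(T ^^ n) f" "M ^ n * K"] by (simp add: mult.assoc)
qed simp

lemma bl_\<Phi>:
  assumes p: "1 \<le> p" and q: "1 \<le> q" and s: "0 < s" "s < 1 / p" and f: "bl s p q f K"
    and B: "\<And>r. r \<in> \<Lambda> \<Longrightarrow> 0 \<le> B r"
      "\<And>r k. r \<in> \<Lambda> \<Longrightarrow> lev p k (\<lambda>x. of_real (\<alpha> r x)) \<le> B r * 2 powr (- (real k / p))"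
  shows "bl s p q (\<Phi> f) ((MA p s + EC p s B) * K)"
  using bl_add[OF p q bl_AA[OF p q s f] bl_EE[OF p q s f B]]
  by (simp add: \<Phi>_eq[abs_def] distrib_right)

text \<open>Induction on \<open>\<Phi> ^^ Suc n - AA ^^ Suc n = \<Phi> (\<Phi> ^^ n - AA ^^ n) + EE
  (AA ^^ n)\<close>; the numbers in the bound obey the same recursion and, for fixed
  \<open>n\<close>, tend to 0 with \<open>EC\<close>.\<close>

lemma bl_\<Phi>_diff:
  assumes p: "1 \<le> p" and q: "1 \<le> q" and s: "0 < s" "s < 1 / p" and f: "bl s p q f K"
    and B: "\<And>r. r \<in> \<Lambda> \<Longrightarrow> 0 \<le> B r"
      "\<And>r k. r \<in> \<Lambda> \<Longrightarrow> lev p k (\<lambda>x. of_real (\<alpha> r x)) \<le> B r * 2 powr (- (real k / p))"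
  shows "bl s p q (\<lambda>x. (\<Phi> ^^ n) f x - (AA ^^ n) f x) (((MA p s + EC p s B) ^ n - MA p s ^ n) * K)"
proof (induction n)
  case 0
  then show ?case using bl_zero by simp
next
  case (Suc n)
  let ?M = "MA p s" and ?E = "EC p s B"
  obtain C where C: "L1op \<Phi> C" using L1op_\<Phi> by blast
  have 1: "bl s p q (\<Phi> (\<lambda>x. (\<Phi> ^^ n) f x - (AA ^^ n) f x)) ((?M + ?E) * (((?M + ?E) ^ n - ?M ^ n) * K))"
    by (rule bl_\<Phi>[OF p q s Suc.IH B])
  have 2: "bl s p q (EE ((AA ^^ n) f)) (?E * (?M ^ n * K))"
    by (rule bl_EE[OF p q s bl_funpow[OF bl_AA[OF p q s] f] B])
  have "(\<lambda>x. \<Phi> (\<lambda>x. (\<Phi> ^^ n) f x - (AA ^^ n) f x) x + EE ((AA ^^ n) f) x) = (\<lambda>x. (\<Phi> ^^ Suc n) f x - (AA ^^ Suc n) f x)"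
    by (rule ext) (simp add: L1op_diff[OF C], simp add: \<Phi>_eq)
  moreover have "(?M + ?E) * (((?M + ?E) ^ n - ?M ^ n) * K) + ?E * (?M ^ n * K) = ((?M + ?E) ^ Suc n - ?M ^ Suc n) * K"
    by (simp add: algebra_simps)
  ultimately show ?case using bl_add[OF p q 1 2] by simp
qed

text \<open>Control of distortion: \<rho> compares the weight with the guaranteed slope in one step,
  and \<open>\<rho> ^ n \<le> 2\<close> will make the comparison for words of length
  \<open>n\<close> uniform in \<open>n\<close>.\<close>

lemma \<theta>w_le:
  assumes "\<And>r. r \<in> \<Lambda> \<Longrightarrow> \<theta> r \<le> \<rho> * (\<theta> r - A r)" "set w \<subseteq> \<Lambda>"
  shows "\<theta>w w \<le> \<rho> ^ length w * mw w"
  using assms(2)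
proof (induction w)
  case (Cons r w)
  then have r: "r \<in> \<Lambda>" and IH: "\<theta>w w \<le> \<rho> ^ length w * mw w" by auto
  have "\<theta> r * \<theta>w w \<le> (\<rho> * (\<theta> r - A r)) * (\<rho> ^ length w * mw w)"
    using assms(1)[OF r] IH theta0[OF r] \<theta>w_pos[of w] Cons.prems by (intro mult_mono) auto
  then show ?case by (simp add: mult_ac)
qed simp

lemma \<theta>w_le_Max: "set w \<subseteq> \<Lambda> \<Longrightarrow> \<theta>w w \<le> Max (\<theta> ` \<Lambda>) ^ length w"
proof (induction w)
  case (Cons r w)
  then have r: "r \<in> \<Lambda>" and IH: "\<theta>w w \<le> Max (\<theta> ` \<Lambda>) ^ length w" by auto
  have "\<theta> r \<le> Max (\<theta> ` \<Lambda>)" using r fin by simp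
  then show ?case using IH theta0[OF r] \<theta>w_pos[of w] Cons.prems by (auto intro!: mult_mono)
qed simp

lemma Max_theta_pos: "0 < Max (\<theta> ` \<Lambda>)"
proof -
  obtain r where r: "r \<in> \<Lambda>" using nonempty by blast
  have "\<theta> r \<le> Max (\<theta> ` \<Lambda>)" using r fin by simp
  then show ?thesis using theta0[OF r] by simp
qed

definition kap :: "real \<Rightarrow> real \<Rightarrow> real" where
  "kap p s = real (card \<Lambda>) powr (1 - 1 / p) * Max (\<theta> ` \<Lambda>) powr (1 - 1 / p + s)"

text \<open>\<open>family_bl\<close> for all words of length \<open>n\<close>, with \<Omega> the
  \<open>n\<close>-th power of the largest weight, multiplicity 2, and \<open>G = 2\<close> from the
  distortion bound; the 8 is \<open>2 * (2 * 2)\<close>. The constant before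
  \<open>kap p s ^ n\<close> is independent of \<open>n\<close>; the dependence is confined to the
  level \<open>n0\<close>.\<close>

lemma bl_AA_tail:
  assumes p: "1 \<le> p" and q: "1 \<le> q" and s: "0 < s" "s < 1 / p"
    and \<rho>: "\<And>r. r \<in> \<Lambda> \<Longrightarrow> \<theta> r \<le> \<rho> * (\<theta> r - A r)" "\<rho> ^ n \<le> 2"
  shows "\<exists>n0\<ge>1. \<forall>f K. bl s p q f K \<longrightarrow>
    bl s p q ((AA ^^ n) (\<lambda>x. f x - (\<Sum>i<n0. dpart i f x))) ((2 powr (p - 1) * 8) powr (1 / p) * kernel_const p s * kap p s ^ n * K)"
proof -
  obtain n1 where n1: "\<And>i j. n1 \<le> i \<Longrightarrow> j < 2 ^ i \<Longrightarrow>
      card {w \<in> words n. measure leb01 {x \<in> Jw w. hw w x \<in> dyadic i j} \<noteq> 0} \<le> 2"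
    using multiplicity[of n] by blast
  obtain C where "L1op AA C" using L1op_AA by blast
  then have L: "L1op (AA ^^ n) (C ^ n)" by (rule L1op_funpow)
  let ?T = "Max (\<theta> ` \<Lambda>)" and ?N = "real (card \<Lambda>)"
  have N: "0 < ?N" using nonempty fin by (simp add: card_gt_0_iff)
  have wl: "set w \<subseteq> \<Lambda>" "length w = n" if "w \<in> words n" for w using that by (auto simp: words_def)
  have m1: "bl s p q ((AA ^^ n) (\<lambda>x. f x - (\<Sum>i<Suc n1. dpart i f x)))
      (((2 * (real (card (words n)) * ?T ^ n)) powr (p - 1) * (real 2 * (2 * 2))) powr (1 / p) * ((?T ^ n) powr s * kernel_const p s) * K)"
    if f: "bl s p q f K" for f K
  proof (rule family_bl[OF p q s f L AA_funpow])
    show "finite (words n)" by (rule finite_words)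
    show "words n \<noteq> {}" using card_words[of n] N by (metis card.empty card_gt_0_iff fin nonempty power_not_zero less_irrefl)
    show "0 < ?T ^ n" using Max_theta_pos by simp
    show "0 \<le> \<theta>w w" if "w \<in> words n" for w using \<theta>w_pos[OF wl(1)[OF that]] by simp
    show "\<theta>w w \<le> ?T ^ n" if "w \<in> words n" for w using \<theta>w_le_Max[OF wl(1)[OF that]] wl(2)[OF that] by simp
    show "Jw w \<subseteq> {0..1}" for w by (rule Jw_subset)
    show "is_interval {x \<in> Jw w. hw w x \<in> dyadic i j}" if "w \<in> words n" for w i j
      using wl(1)[OF that] by (intro is_interval_restrict is_interval_Jw is_interval_dyadic)
    show "\<theta>w w * measure leb01 {x \<in> Jw w. hw w x \<in> dyadic i j} \<le> 2 / 2 ^ i" if "w \<in> words n" for w i j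
    proof -
      have m: "0 < mw w" using mw_pos[OF wl(1)[OF that]] .
      have "\<theta>w w \<le> \<rho> ^ n * mw w" using \<theta>w_le[OF \<rho>(1) wl(1)[OF that]] wl(2)[OF that] by simp
      also have "\<dots> \<le> 2 * mw w" using \<rho>(2) m by (intro mult_right_mono) auto
      finally have t: "\<theta>w w \<le> 2 * mw w" .
      have "\<theta>w w * measure leb01 {x \<in> Jw w. hw w x \<in> dyadic i j} \<le> 2 * mw w * (1 / 2 ^ i / mw w)"
        using t word_measure[OF wl(1)[OF that]] m by (intro mult_mono) auto
      also have "\<dots> = 2 / 2 ^ i" using m by simp
      finally show ?thesis .
    qed
    show "card {w \<in> words n. measure leb01 {x \<in> Jw w. hw w x \<in> dyadic i j} \<noteq> 0} \<le> 2" if "Suc n1 \<le> i" "j < 2 ^ i" for i j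
      using n1[of i j] that by simp
  qed auto
  have m2: "((2 * (real (card (words n)) * ?T ^ n)) powr (p - 1) * (real 2 * (2 * 2))) powr (1 / p) * ((?T ^ n) powr s * kernel_const p s)
      = (2 powr (p - 1) * 8) powr (1 / p) * kernel_const p s * kap p s ^ n"
  proof -
    let ?X = "?N * ?T"
    have X: "0 < ?X" using N Max_theta_pos by simp
    have pw: "(y ^ n) powr t = (y powr t) ^ n" if "0 < y" for y t :: real
      using that by (simp add: powr_realpow[symmetric] powr_powr mult.commute)
    have "real (card (words n)) * ?T ^ n = ?X ^ n" by (simp add: card_words power_mult_distrib)
    then have "((2 * (real (card (words n)) * ?T ^ n)) powr (p - 1) * (real 2 * (2 * 2))) powr (1 / p)
        = (2 powr (p - 1) * 8) powr (1 / p) * ((?X ^ n) powr (p - 1)) powr (1 / p)"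
      using X by (simp add: powr_mult mult_ac)
    also have "((?X ^ n) powr (p - 1)) powr (1 / p) = (?X powr (1 - 1 / p)) ^ n"
    proof -
      have "(p - 1) * (1 / p) = 1 - 1 / p" using p by (simp add: field_simps)
      then show ?thesis using pw[OF X, of "1 - 1 / p"] by (simp only: powr_powr)
    qed
    also have "?X powr (1 - 1 / p) = ?N powr (1 - 1 / p) * ?T powr (1 - 1 / p)" using N Max_theta_pos by (simp add: powr_mult)
    finally have e1: "((2 * (real (card (words n)) * ?T ^ n)) powr (p - 1) * (real 2 * (2 * 2))) powr (1 / p)
        = (2 powr (p - 1) * 8) powr (1 / p) * (?N powr (1 - 1 / p) * ?T powr (1 - 1 / p)) ^ n" .
    have e2: "kap p s ^ n = (?N powr (1 - 1 / p) * ?T powr (1 - 1 / p)) ^ n * (?T powr s) ^ n"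
      by (simp add: kap_def powr_add power_mult_distrib)
    show ?thesis unfolding e1 e2 pw[OF Max_theta_pos] by (simp only: mult_ac)
  qed
  show ?thesis
  proof (intro exI conjI allI impI)
    show "1 \<le> Suc n1" by simp
    show "bl s p q ((AA ^^ n) (\<lambda>x. f x - (\<Sum>i<Suc n1. dpart i f x)))
        ((2 powr (p - 1) * 8) powr (1 / p) * kernel_const p s * kap p s ^ n * K)" if "bl s p q f K" for f K
      by (rule m1[OF that, unfolded m2])
  qed
qed

text \<open>The perturbation \<open>\<Phi> ^^ n - AA ^^ n\<close> acts on the tail of
  \<open>f\<close>, which costs the factor \<open>besov_const s\<close> of
  \<open>bl_tail\<close>.\<close>

lemma bl_\<Phi>_tail:
  assumes p: "1 \<le> p" and q: "1 \<le> q" and s: "0 < s" "s < 1 / p"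
    and \<rho>: "\<And>r. r \<in> \<Lambda> \<Longrightarrow> \<theta> r \<le> \<rho> * (\<theta> r - A r)" "\<rho> ^ n \<le> 2"
    and B: "\<And>r. r \<in> \<Lambda> \<Longrightarrow> 0 \<le> B r"
      "\<And>r k. r \<in> \<Lambda> \<Longrightarrow> lev p k (\<lambda>x. of_real (\<alpha> r x)) \<le> B r * 2 powr (- (real k / p))"
  shows "\<exists>n0\<ge>1. \<forall>f K. bl s p q f K \<longrightarrow>
    bl s p q ((\<Phi> ^^ n) (\<lambda>x. f x - (\<Sum>i<n0. dpart i f x)))
      (((2 powr (p - 1) * 8) powr (1 / p) * kernel_const p s * kap p s ^ n
        + besov_const s * ((MA p s + EC p s B) ^ n - MA p s ^ n)) * K)"
proof -
  obtain n0 where n0: "1 \<le> n0" "\<And>f K. bl s p q f K \<Longrightarrow>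
    bl s p q ((AA ^^ n) (\<lambda>x. f x - (\<Sum>i<n0. dpart i f x))) ((2 powr (p - 1) * 8) powr (1 / p) * kernel_const p s * kap p s ^ n * K)"
    using bl_AA_tail[OF p q s \<rho>] by blast
  have "bl s p q ((\<Phi> ^^ n) (\<lambda>x. f x - (\<Sum>i<n0. dpart i f x)))
      (((2 powr (p - 1) * 8) powr (1 / p) * kernel_const p s * kap p s ^ n
        + besov_const s * ((MA p s + EC p s B) ^ n - MA p s ^ n)) * K)" if f: "bl s p q f K" for f K
  proof -
    let ?g = "\<lambda>x. f x - (\<Sum>i<n0. dpart i f x)"
    have g: "bl s p q ?g (besov_const s * K)" by (rule bl_tail[OF p q s(1) f])
    have "bl s p q (\<lambda>x. (AA ^^ n) ?g x + ((\<Phi> ^^ n) ?g x - (AA ^^ n) ?g x))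
       ((2 powr (p - 1) * 8) powr (1 / p) * kernel_const p s * kap p s ^ n * K
        + ((MA p s + EC p s B) ^ n - MA p s ^ n) * (besov_const s * K))"
      by (rule bl_add[OF p q n0(2)[OF f] bl_\<Phi>_diff[OF p q s g B]])
    then show ?thesis by (simp add: algebra_simps)
  qed
  then show ?thesis using n0(1) by blast
qed

text \<open>By change of variables each branch contributes the integral of \<open>f\<close> over
  \<open>{a r..b r}\<close>, and these intervals tile \<open>{0..1}\<close> up to finitely many
  endpoints.\<close>

lemma \<Phi>_mass:
  assumes f: "integrable leb01 f"
  shows "(LINT x|leb01. \<Phi> f x) = (LINT x|leb01. f x)"
proof -
  have G: "(LINT x|leb01. of_real (\<alpha> r x + \<theta> r) * G r f x) = (LINT y|leb01. indicator {a r..b r} y * f y)"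
    "integrable leb01 (\<lambda>x. of_real (\<alpha> r x + \<theta> r) * G r f x)" if r: "r \<in> \<Lambda>" for r
  proof -
    have eq: "(\<lambda>x. of_real (\<alpha> r x + \<theta> r) * G r f x) = (\<lambda>x. indicator {c r..d r} x * of_real (\<alpha> r x + \<theta> r) * f (hb r x))"
      by (auto simp: G_def)
    show "(LINT x|leb01. of_real (\<alpha> r x + \<theta> r) * G r f x) = (LINT y|leb01. indicator {a r..b r} y * f y)"
      "integrable leb01 (\<lambda>x. of_real (\<alpha> r x + \<theta> r) * G r f x)"
      unfolding eq using lip_branch.integral_h[OF lip[OF r] f] unfolding hb_eq[OF r] by auto
  qed
  have I: "{a r..b r} \<in> sets leb01" if "r \<in> \<Lambda>" for r using ab[OF that] by (auto simp: sets_leb01_iff)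
  have "(LINT x|leb01. \<Phi> f x) = (\<Sum>r\<in>\<Lambda>. (LINT y|leb01. indicator {a r..b r} y * f y))"
    unfolding \<Phi>_def using G by (subst Bochner_Integration.integral_sum) auto
  also have "\<dots> = (LINT y|leb01. (\<Sum>r\<in>\<Lambda>. indicator {a r..b r} y * f y))"
    using integrable_leb01_indicator_mult[OF I f] by (intro Bochner_Integration.integral_sum[symmetric])
  also have "\<dots> = (LINT y|leb01. f y)"
  proof (rule integral_cong_AE)
    have "AE y in leb01. y \<notin> a ` \<Lambda> \<union> b ` \<Lambda>"
      using fin by (intro AE_leb01_not_in_null finite_imp_null_set_lborel) auto
    moreover have "AE y in leb01. y \<in> {0..1}" by (rule AE_I2) simp
    ultimately show "AE y in leb01. (\<Sum>r\<in>\<Lambda>. indicator {a r..b r} y * f y) = f y"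
    proof eventually_elim
      case (elim y)
      then obtain r where r: "r \<in> \<Lambda>" "y \<in> {a r..b r}" using part unfolding interval_partition_def by blast
      have "indicator {a r'..b r'} y * f y = (if r' = r then f y else 0)" if r': "r' \<in> \<Lambda>" for r'
      proof (cases "r' = r")
        case False
        have "{a r<..<b r} \<inter> {a r'<..<b r'} = {}"
          using part r r' False by (auto simp: interval_partition_def disjoint_family_on_def)
        moreover have "y \<noteq> a r" "y \<noteq> b r" "y \<noteq> a r'" "y \<noteq> b r'" using elim r r' by auto
        ultimately have "y \<notin> {a r'..b r'}" using r(2) by force
        then show ?thesis using False by (simp add: indicator_def)
      qed (use r in simp)
      then have "(\<Sum>r'\<in>\<Lambda>. indicator {a r'..b r'} y * f y) = (\<Sum>r'\<in>\<Lambda>. if r' = r then f y else 0)"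
        by (intro sum.cong) auto
      then show ?case using r fin by simp
    qed
    show "(\<lambda>y. \<Sum>r\<in>\<Lambda>. indicator {a r..b r} y * f y) \<in> borel_measurable leb01"
      using integrable_leb01_indicator_mult[OF I f] by (intro borel_measurable_sum borel_measurable_integrable)
  qed (use f in auto)
  finally show ?thesis .
qed

lemma \<alpha>_\<theta>_pos: "r \<in> \<Lambda> \<Longrightarrow> AE x in leb01. 0 < \<alpha> r x + \<theta> r"
  using \<alpha>_bd[of r] by (rule eventually_mono) (use theta_le_2m[of r] in auto)

lemma AE_all_branches:
  assumes "AE y in leb01. P y"
  shows "AE x in leb01. \<forall>r\<in>\<Lambda>. x \<in> {c r..d r} \<longrightarrow> P (hb r x)"
proof (rule AE_finite_allI[OF fin])
  fix r assume r: "r \<in> \<Lambda>"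
  show "AE x in leb01. x \<in> {c r..d r} \<longrightarrow> P (hb r x)"
    using lip_branch.AE_H[OF lip[OF r] assms] unfolding hb_eq[OF r] .
qed

text \<open>Positivity adapted to complex scalars: \<open>cmod w \<le> Re w\<close> says that
  \<open>w\<close> is real and nonnegative. It holds because the weights
  \<open>\<alpha> r x + \<theta> r\<close> are positive almost everywhere.\<close>

lemma \<Phi>_dom:
  assumes "AE x in leb01. cmod (f x) \<le> Re (g x)"
  shows "AE x in leb01. cmod (\<Phi> f x) \<le> Re (\<Phi> g x)"
proof -
  have "AE x in leb01. \<forall>r\<in>\<Lambda>. 0 < \<alpha> r x + \<theta> r"
    using \<alpha>_\<theta>_pos by (intro AE_finite_allI fin)
  with AE_all_branches[OF assms] show ?thesis
  proof eventually_elim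
    case (elim x)
    have "cmod (\<Phi> f x) \<le> (\<Sum>r\<in>\<Lambda>. cmod (of_real (\<alpha> r x + \<theta> r) * G r f x))"
      unfolding \<Phi>_def by (rule norm_sum)
    also have "\<dots> \<le> (\<Sum>r\<in>\<Lambda>. (\<alpha> r x + \<theta> r) * Re (G r g x))"
    proof (rule sum_mono)
      fix r assume r: "r \<in> \<Lambda>"
      have "cmod (G r f x) \<le> Re (G r g x)" using elim(1) r by (auto simp: G_def indicator_def)
      then have "(\<alpha> r x + \<theta> r) * cmod (G r f x) \<le> (\<alpha> r x + \<theta> r) * Re (G r g x)"
        using elim(2) r by (intro mult_left_mono) auto
      moreover have "cmod (of_real (\<alpha> r x + \<theta> r)) = \<alpha> r x + \<theta> r" using elim(2) r by (simp only: norm_of_real) auto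
      ultimately show "cmod (of_real (\<alpha> r x + \<theta> r) * G r f x) \<le> (\<alpha> r x + \<theta> r) * Re (G r g x)"
        by (simp only: norm_mult)
    qed
    also have "\<dots> = Re (\<Phi> g x)" by (simp add: \<Phi>_def)
    finally show ?case .
  qed
qed

end

section \<open>Quasi-compactness\<close>

lemma L1norm_dpart_le:
  assumes "1 \<le> p"
  shows "L1norm (dpart k f) \<le> lev p k f"
proof -
  have "L1norm (dpart k f) \<le> Lp_norm p (dpart k f)"
    using integral_dpart_powr(1)[OF assms, of k f] integrable_dpart[of k f] by (intro L1norm_powr_le(2)[OF assms]) auto
  also have "\<dots> = lev p k f"
    using assms by (simp add: Lp_norm_def integral_dpart_powr(2)[OF assms] powr_powr)
  finally show ?thesis .
qed

text \<open>The levels decay geometrically, which bounds every conditional expectation; their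
  convergence in L^1 removes the truncation.\<close>

lemma L1norm_le_bl:
  assumes p: "1 \<le> p" and q: "1 \<le> q" and s: "0 < s" and f: "bl s p q f K"
  shows "L1norm f \<le> K / (1 - 2 powr (- s))"
proof -
  let ?a = "2 powr (- s) :: real"
  have a: "0 < ?a" "?a < 1" using s by (auto intro: powr_less_one)
  have K: "0 \<le> K" by (rule bl_nonneg[OF f])
  have fi: "integrable leb01 f" using f by (simp add: bl_def)
  have c: "L1norm (cexp n f) \<le> K / (1 - ?a)" for n
  proof -
    have "L1norm (cexp n f) \<le> (\<Sum>k\<le>n. L1norm (dpart k f))"
      unfolding cexp_def[abs_def] by (intro L1norm_sum integrable_dpart)
    also have "\<dots> \<le> (\<Sum>k\<le>n. K * ?a ^ k)"
    proof (rule sum_mono)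
      fix k
      have "L1norm (dpart k f) \<le> K * 2 powr (- (real k * s))"
        using L1norm_dpart_le[OF p, of k f] bl_lev_le[OF q f, of k] by linarith
      also have "2 powr (- (real k * s)) = ?a ^ k" by (simp add: powr_realpow[symmetric] powr_powr mult.commute)
      finally show "L1norm (dpart k f) \<le> K * ?a ^ k" .
    qed
    also have "\<dots> = K * (\<Sum>k\<le>n. ?a ^ k)" by (simp add: sum_distrib_left)
    also have "\<dots> \<le> K * (\<Sum>k. ?a ^ k)"
      using a K by (intro mult_left_mono sum_le_suminf) (auto intro!: summable_geometric)
    also have "\<dots> = K / (1 - ?a)" using a by (simp add: suminf_geometric)
    finally show ?thesis .
  qed
  show ?thesis
  proof (rule LIMSEQ_le_const)
    show "(\<lambda>n. L1norm (\<lambda>x. f x - cexp n f x) + K / (1 - ?a)) \<longlonglongrightarrow> K / (1 - ?a)"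
      using tendsto_add[OF cexp_tendsto[OF fi] tendsto_const] by simp
    have "L1norm f \<le> L1norm (\<lambda>x. f x - cexp n f x) + K / (1 - ?a)" for n
    proof -
      have "L1norm (\<lambda>x. (f x - cexp n f x) + cexp n f x) \<le> L1norm (\<lambda>x. f x - cexp n f x) + L1norm (cexp n f)"
        by (intro L1norm_add Bochner_Integration.integrable_diff fi integrable_cexp)
      then show ?thesis using c[of n] by simp
    qed
    then show "\<exists>N. \<forall>n\<ge>N. L1norm f \<le> L1norm (\<lambda>x. f x - cexp n f x) + K / (1 - ?a)" by blast
  qed
qed

lemma L1_series:
  assumes v: "\<And>i. integrable leb01 (v i)" and s: "summable (\<lambda>i. L1norm (v i))"
  obtains u where "integrable leb01 u" "(\<lambda>m. L1norm (\<lambda>x. (\<Sum>i<m. v i x) - u x)) \<longlonglongrightarrow> 0"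
proof -
  have "(\<integral>\<^sup>+ x. (\<Sum>i. ennreal (cmod (v i x))) \<partial>leb01) = (\<Sum>i. (\<integral>\<^sup>+ x. ennreal (cmod (v i x)) \<partial>leb01))"
    using v by (intro nn_integral_suminf) auto
  also have "\<dots> = (\<Sum>i. ennreal (L1norm (v i)))"
    unfolding L1norm_def using v by (intro suminf_cong nn_integral_eq_integral) auto
  also have "\<dots> \<noteq> \<infinity>" using s by (simp add: suminf_ennreal_eq[OF _ summable_sums])
  finally have "AE x in leb01. (\<Sum>i. ennreal (cmod (v i x))) \<noteq> \<infinity>"
    using v by (intro nn_integral_noteq_infinite) auto
  then have sm: "AE x in leb01. summable (\<lambda>i. cmod (v i x))"
    by eventually_elim (auto intro: summable_suminf_not_top)
  define u where "u x = (\<Sum>i. v i x)" for x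
  have sm': "AE x in leb01. summable (\<lambda>i. norm (v i x))" using sm by simp
  have ui: "integrable leb01 u"
    unfolding u_def by (rule integrable_suminf[OF v sm']) (use s in \<open>simp add: L1norm_def\<close>)
  have wi: "integrable leb01 (\<lambda>x. \<Sum>i. cmod (v i x))"
    by (rule integrable_suminf) (use v sm s in \<open>auto simp: L1norm_def\<close>)
  have "(\<lambda>m. LINT x|leb01. cmod ((\<Sum>i<m. v i x) - u x)) \<longlonglongrightarrow> (LINT x|leb01. 0)"
  proof (rule integral_dominated_convergence[where w = "\<lambda>x. 2 * (\<Sum>i. cmod (v i x))"])
    show "AE x in leb01. (\<lambda>m. cmod ((\<Sum>i<m. v i x) - u x)) \<longlonglongrightarrow> 0"
      using sm'
    proof eventually_elim
      case (elim x)
      then have "(\<lambda>m. \<Sum>i<m. v i x) \<longlonglongrightarrow> u x" unfolding u_def by (rule summable_LIMSEQ[OF summable_norm_cancel])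
      then have "(\<lambda>m. (\<Sum>i<m. v i x) - u x) \<longlonglongrightarrow> u x - u x" by (intro tendsto_diff tendsto_const)
      then show ?case by (simp add: tendsto_norm_zero)
    qed
    show "AE x in leb01. norm (cmod ((\<Sum>i<m. v i x) - u x)) \<le> 2 * (\<Sum>i. cmod (v i x))" for m
      using sm'
    proof eventually_elim
      case (elim x)
      have "cmod (\<Sum>i<m. v i x) \<le> (\<Sum>i<m. cmod (v i x))" by (rule norm_sum)
      also have "\<dots> \<le> (\<Sum>i. cmod (v i x))" using elim by (intro sum_le_suminf) auto
      finally have 1: "cmod (\<Sum>i<m. v i x) \<le> (\<Sum>i. cmod (v i x))" .
      have 2: "cmod (u x) \<le> (\<Sum>i. cmod (v i x))" unfolding u_def using elim by (rule summable_norm)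
      show ?case using 1 2 norm_triangle_ineq4[of "\<Sum>i<m. v i x" "u x"] by simp
    qed
  qed (use v ui wi in auto)
  then have "(\<lambda>m. L1norm (\<lambda>x. (\<Sum>i<m. v i x) - u x)) \<longlonglongrightarrow> 0" by (simp add: L1norm_def)
  with ui show thesis by (rule that)
qed

text \<open>The halving step can be iterated, so the bound \<open>K * (1 / 2) ^ i\<close> holds for
  every \<open>i\<close>. It is the source of injectivity of \<open>z - S\<close> below.\<close>

lemma bl_zero_AE:
  assumes p: "1 \<le> p" and q: "1 \<le> q" and s: "0 < s"
    and step: "\<And>K. bl s p q f K \<Longrightarrow> bl s p q f (K / 2)" and f: "bl s p q f K"
  shows "AE x in leb01. f x = 0"
proof -
  have b: "bl s p q f (K * (1 / 2) ^ i)" for i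
  proof (induction i)
    case (Suc i)
    then show ?case using step[OF Suc] by simp
  qed (use f in simp)
  have "L1norm f \<le> 0"
  proof (rule LIMSEQ_le_const)
    show "(\<lambda>i. K / (1 - 2 powr (- s)) * (1 / 2) ^ i) \<longlonglongrightarrow> 0"
      by (intro tendsto_mult_right_zero LIMSEQ_power_zero) simp
    have "L1norm f \<le> K / (1 - 2 powr (- s)) * (1 / 2) ^ i" for i
      using L1norm_le_bl[OF p q s b[of i]] by simp
    then show "\<exists>N. \<forall>i\<ge>N. L1norm f \<le> K / (1 - 2 powr (- s)) * (1 / 2) ^ i" by blast
  qed
  then have "L1norm f = 0" by (rule order_antisym[OF _ L1norm_nonneg])
  then show ?thesis using f by (intro L1norm_eq_0) (auto simp: bl_def)
qed

text \<open>Neumann series: the balls of \<^const>\<open>bl\<close> are closed in \<open>L\<^sup>1\<close>, so the limit may be taken there.\<close>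

lemma neumann:
  assumes p: "1 \<le> p" and q: "1 \<le> q" and s: "0 < s"
    and Pi: "\<And>f. integrable leb01 f \<Longrightarrow> integrable leb01 (P f)"
    and Padd: "\<And>f g x. integrable leb01 f \<Longrightarrow> integrable leb01 g \<Longrightarrow> P (\<lambda>x. f x + g x) x = P f x + P g x"
    and Pdiff: "\<And>f g x. integrable leb01 f \<Longrightarrow> integrable leb01 g \<Longrightarrow> P (\<lambda>x. f x - g x) x = P f x - P g x"
    and Pbd: "\<And>f. integrable leb01 f \<Longrightarrow> L1norm (P f) \<le> D * L1norm f"
    and Pbl: "\<And>f K. bl s p q f K \<Longrightarrow> bl s p q (P f) (K / 2)"
    and g: "bl s p q g K"
  shows "\<exists>u. bl s p q u (2 * K) \<and> (AE x in leb01. u x = P u x + g x)"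
proof -
  define v where "v i = (P ^^ i) g" for i
  have vb: "bl s p q (v i) (K * (1 / 2) ^ i)" for i
  proof (induction i)
    case (Suc i)
    then show ?case using Pbl[OF Suc] by (simp add: v_def)
  qed (use g in \<open>simp add: v_def\<close>)
  then have vi: "integrable leb01 (v i)" for i by (simp add: bl_def)
  have K: "0 \<le> K" by (rule bl_nonneg[OF g])
  have a: "2 powr (- s) < (1::real)" using s by (auto intro: powr_less_one)
  have "summable (\<lambda>i. L1norm (v i))"
  proof (rule summable_comparison_test')
    show "summable (\<lambda>i. K / (1 - 2 powr (- s)) * (1 / 2) ^ i)" by (intro summable_mult summable_geometric) simp
    show "norm (L1norm (v i)) \<le> K / (1 - 2 powr (- s)) * (1 / 2) ^ i" if "0 \<le> i" for i
      using L1norm_le_bl[OF p q s vb[of i]] by simp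
  qed
  with vi obtain u where u: "integrable leb01 u" "(\<lambda>m. L1norm (\<lambda>x. (\<Sum>i<m. v i x) - u x)) \<longlonglongrightarrow> 0"
    by (rule L1_series)
  define U where "U m x = (\<Sum>i<m. v i x)" for m x
  have Ui: "integrable leb01 (U m)" for m unfolding U_def[abs_def] using vi by (intro Bochner_Integration.integrable_sum)
  have Ub: "bl s p q (U m) (2 * K)" for m
  proof -
    have "bl s p q (U m) (\<Sum>i<m. K * (1 / 2) ^ i)" unfolding U_def[abs_def] using vb by (intro bl_sum[OF p q])
    moreover have "(\<Sum>i<m. K * (1 / 2) ^ i) \<le> 2 * K"
    proof -
      have "(\<Sum>i<m. (1 / 2) ^ i) \<le> (\<Sum>i. (1 / 2) ^ i :: real)" by (intro sum_le_suminf) (auto intro!: summable_geometric)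
      also have "\<dots> = 2" by (subst suminf_geometric) auto
      finally show ?thesis using K mult_left_mono[of "\<Sum>i<m. (1 / 2) ^ i" 2 K] by (simp add: sum_distrib_left mult.commute)
    qed
    ultimately show ?thesis by (rule bl_mono[OF q])
  qed
  have lim: "(\<lambda>m. L1norm (\<lambda>x. U m x - u x)) \<longlonglongrightarrow> 0" using u(2) by (simp add: U_def)
  have ub: "bl s p q u (2 * K)" by (rule bl_limit[OF p q Ub u(1) lim])
  have gi: "integrable leb01 g" using g by (simp add: bl_def)
  \<comment> \<open>Partial sums satisfy the equation with a shift by one; L^1 continuity of
    \<open>P\<close> then passes to the limit on both sides.\<close>
  have PU: "P (U m) x + g x = U (Suc m) x" for m x
  proof (induction m arbitrary: x)
    case 0
    have "P (\<lambda>x. g x - g x) x = P g x - P g x" by (rule Pdiff[OF gi gi])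
    then show ?case by (simp add: U_def v_def)
  next
    case (Suc m)
    have "U (Suc m) = (\<lambda>x. U m x + v m x)" by (simp add: U_def fun_eq_iff)
    then have "P (U (Suc m)) x = P (U m) x + P (v m) x" using Padd[OF Ui vi] by simp
    then have "P (U (Suc m)) x + g x = U (Suc m) x + v (Suc m) x" using Suc[of x] by (simp add: v_def)
    moreover have "U (Suc (Suc m)) x = U (Suc m) x + v (Suc m) x" by (simp add: U_def)
    ultimately show ?case by simp
  qed
  have Pu: "integrable leb01 (P u)" by (rule Pi[OF u(1)])
  have "L1norm (\<lambda>x. u x - (P u x + g x)) \<le> 0"
  proof (rule LIMSEQ_le_const)
    show "(\<lambda>m. L1norm (\<lambda>x. U (Suc m) x - u x) + D * L1norm (\<lambda>x. U m x - u x)) \<longlonglongrightarrow> 0"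
      using tendsto_add[OF LIMSEQ_Suc[OF lim] tendsto_mult_right_zero[OF lim, of D]] by simp
    have "L1norm (\<lambda>x. u x - (P u x + g x)) \<le> L1norm (\<lambda>x. U (Suc m) x - u x) + D * L1norm (\<lambda>x. U m x - u x)" for m
    proof -
      have "L1norm (\<lambda>x. u x - (P u x + g x)) = L1norm (\<lambda>x. (u x - U (Suc m) x) + (P (U m) x - P u x))"
        by (intro arg_cong[where f = L1norm] ext) (simp add: PU[symmetric])
      also have "\<dots> \<le> L1norm (\<lambda>x. u x - U (Suc m) x) + L1norm (\<lambda>x. P (U m) x - P u x)"
        using u(1) Ui Pu Pi by (intro L1norm_add Bochner_Integration.integrable_diff) auto
      also have "L1norm (\<lambda>x. P (U m) x - P u x) \<le> D * L1norm (\<lambda>x. U m x - u x)"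
      proof -
        have "P (\<lambda>x. U m x - u x) = (\<lambda>x. P (U m) x - P u x)" by (rule ext) (rule Pdiff[OF Ui u(1)])
        then show ?thesis using Pbd[OF Bochner_Integration.integrable_diff[OF Ui[of m] u(1)]] by (simp only:)
      qed
      finally show ?thesis by (simp add: L1norm_minus_commute[of u])
    qed
    then show "\<exists>N. \<forall>m\<ge>N. L1norm (\<lambda>x. u x - (P u x + g x)) \<le> L1norm (\<lambda>x. U (Suc m) x - u x) + D * L1norm (\<lambda>x. U m x - u x)" by blast
  qed
  then have "L1norm (\<lambda>x. u x - (P u x + g x)) = 0" by (rule order_antisym[OF _ L1norm_nonneg])
  then have "AE x in leb01. u x - (P u x + g x) = 0"
    using u(1) Pu gi by (intro L1norm_eq_0) auto
  then have "AE x in leb01. u x = P u x + g x" by eventually_elim simp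
  with ub show ?thesis by blast
qed

text \<open>For a square matrix, row and column singularity coincide, as the determinant is
  invariant under transposition. The index set is carried to \<open>{0..<card I}\<close> to form the
  determinant.\<close>

lemma left_right_kernel:
  fixes M :: "'a \<Rightarrow> 'a \<Rightarrow> complex"
  assumes I: "finite I" and \<mu>: "b0 \<in> I" "\<mu> b0 \<noteq> 0" and left: "\<And>b. b \<in> I \<Longrightarrow> (\<Sum>a\<in>I. \<mu> a * M a b) = 0"
  shows "\<exists>x. (\<exists>a\<in>I. x a \<noteq> 0) \<and> (\<forall>a\<in>I. (\<Sum>b\<in>I. M a b * x b) = 0)"
proof -
  obtain h where h: "bij_betw h {0..<card I} I" using ex_bij_betw_nat_finite[OF I] by blast
  let ?n = "card I"
  define B where "B = mat ?n ?n (\<lambda>(i, j). M (h i) (h j))"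
  define m where "m = vec ?n (\<lambda>i. \<mu> (h i))"
  have B: "B \<in> carrier_mat ?n ?n" by (simp add: B_def)
  have hI: "h i \<in> I" if "i < ?n" for i using h that by (auto simp: bij_betw_def)
  have hsur: "\<exists>i<?n. h i = b" if "b \<in> I" for b
    using h that unfolding bij_betw_def by (metis atLeastLessThan_iff imageE)
  have re: "(\<Sum>i = 0..<?n. F (h i)) = (\<Sum>a\<in>I. F a)" for F :: "'a \<Rightarrow> complex"
    using sum.reindex_bij_betw[OF h, of F] .
  have "det (transpose_mat B) = 0"
  proof (subst det_0_iff_vec_prod_zero_field[of _ ?n])
    show "transpose_mat B \<in> carrier_mat ?n ?n" using B by simp
    show "\<exists>v. v \<in> carrier_vec ?n \<and> v \<noteq> 0\<^sub>v ?n \<and> transpose_mat B *\<^sub>v v = 0\<^sub>v ?n"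
    proof (intro exI[of _ m] conjI)
      show "m \<in> carrier_vec ?n" by (simp add: m_def)
      obtain i where i: "i < ?n" "h i = b0" using hsur[OF \<mu>(1)] by blast
      then have "m $ i \<noteq> 0" using \<mu>(2) by (simp add: m_def)
      then show "m \<noteq> 0\<^sub>v ?n" using i(1) by auto
      show "transpose_mat B *\<^sub>v m = 0\<^sub>v ?n"
      proof (rule eq_vecI)
        fix j assume "j < dim_vec (0\<^sub>v ?n)"
        then have j: "j < ?n" by simp
        have "(transpose_mat B *\<^sub>v m) $ j = (\<Sum>i = 0..<?n. M (h i) (h j) * \<mu> (h i))"
          using j by (simp add: B_def m_def scalar_prod_def)
        also have "\<dots> = (\<Sum>a\<in>I. \<mu> a * M a (h j))" using re[of "\<lambda>a. \<mu> a * M a (h j)"] by (simp add: mult.commute)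
        finally show "(transpose_mat B *\<^sub>v m) $ j = 0\<^sub>v ?n $ j" using left[OF hI[OF j]] j by simp
      qed (simp add: B_def)
    qed
  qed
  then have "det B = 0" using det_transpose[OF B] by simp
  then obtain v where v: "v \<in> carrier_vec ?n" "v \<noteq> 0\<^sub>v ?n" "B *\<^sub>v v = 0\<^sub>v ?n"
    using det_0_iff_vec_prod_zero_field[OF B] by blast
  define x where "x a = v $ (the_inv_into {0..<?n} h a)" for a
  have xh: "x (h i) = v $ i" if "i < ?n" for i
    using the_inv_into_f_f[of h "{0..<?n}" i] h that by (simp add: x_def bij_betw_def)
  show ?thesis
  proof (intro exI[of _ x] conjI ballI)
    have "\<exists>i<?n. v $ i \<noteq> 0"
    proof (rule ccontr)
      assume "\<not> ?thesis"
      then have "v = 0\<^sub>v ?n" using v(1) by (intro eq_vecI) auto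
      then show False using v(2) by simp
    qed
    then show "\<exists>a\<in>I. x a \<noteq> 0" using hI xh by metis
    fix a assume "a \<in> I"
    then obtain i where i: "i < ?n" "h i = a" using hsur by blast
    have "(\<Sum>b\<in>I. M a b * x b) = (\<Sum>j = 0..<?n. M a (h j) * x (h j))" using re[of "\<lambda>b. M a b * x b"] by simp
    also have "\<dots> = (\<Sum>j = 0..<?n. M (h i) (h j) * v $ j)" using xh i by (intro sum.cong) auto
    also have "\<dots> = (B *\<^sub>v v) $ i" using i v(1) by (simp add: B_def scalar_prod_def)
    finally show "(\<Sum>b\<in>I. M a b * x b) = 0" using v(3) i by simp
  qed
qed

lemma bl_indicator_dyadic:
  assumes p: "1 \<le> p" and q: "1 \<le> q" and j: "j < 2 ^ i"
  shows "\<exists>K. bl s p q (indicator (dyadic i j)) K"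
proof -
  let ?u = "\<lambda>k. 2 powr (real k * s) * lev p k (indicator (dyadic i j))"
  have eq: "(\<lambda>x. \<Sum>l<2 ^ i. (if l = j then 1 else 0) * indicator (dyadic i l) x) = (indicator (dyadic i j) :: real \<Rightarrow> complex)"
  proof
    fix x
    have "(\<Sum>l<2 ^ i. (if l = j then 1 else 0) * indicator (dyadic i l) x) = (\<Sum>l<2 ^ i. if l = j then indicator (dyadic i j) x else (0::complex))"
      by (intro sum.cong) auto
    then show "(\<Sum>l<2 ^ i. (if l = j then 1 else 0) * indicator (dyadic i l) x) = (indicator (dyadic i j) x :: complex)"
      using j by simp
  qed
  have z: "?u k = 0" if "i < k" for k
    using lev_step_powr_le[OF p, where k = k and i = i and v = "\<lambda>l. if l = j then 1 else 0"] that unfolding eq by simp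
  have "lq_le q ?u ((real i + 1) * (\<Sum>k\<le>i. ?u k))"
    using z by (intro lq_le_finite_support[OF q] member_le_sum sum_nonneg) auto
  then show ?thesis using j by (auto simp: bl_def intro!: integrable_leb01_indicator)
qed

text \<open>The assumption \<open>tail\<close> makes \<open>T\<^sup>n\<close> the sum of the contraction \<open>S\<close> below and an operator of finite rank.\<close>

locale qc_op =
  fixes p s M C l :: real and q :: ereal and T :: "(real \<Rightarrow> complex) \<Rightarrow> real \<Rightarrow> complex" and n n0 :: nat
  assumes p: "1 \<le> p" and q: "1 \<le> q" and s: "0 < s"
    and T: "L1op T C"
    and M: "0 \<le> M" "\<And>f K. bl s p q f K \<Longrightarrow> bl s p q (T f) (M * K)"
    and n: "1 \<le> n" and n0: "1 \<le> n0"
    and tail: "\<And>f K. bl s p q f K \<Longrightarrow> bl s p q ((T ^^ n) (\<lambda>x. f x - (\<Sum>i<n0. dpart i f x))) (l * K)"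
    and l: "0 \<le> l" "l * besov_const s \<le> 1 / 2"
    and mass: "\<And>f. integrable leb01 f \<Longrightarrow> (LINT x|leb01. T f x) = (LINT x|leb01. f x)"
    and dom: "\<And>f g. (AE x in leb01. cmod (f x) \<le> Re (g x)) \<Longrightarrow> AE x in leb01. cmod (T f x) \<le> Re (T g x)"
begin

lemma l4: "l \<le> 1 / 4"
proof -
  have "l * 2 \<le> l * besov_const s" using l(1) besov_const_ge[OF s] by (intro mult_left_mono) auto
  then show ?thesis using l(2) by simp
qed

lemma besov_bl: "f \<in> besov s p q \<longleftrightarrow> (\<exists>K. bl s p q f K)"
  by (rule besov_iff_bl[OF p q s])

lemma bl_besov_norm: "f \<in> besov s p q \<Longrightarrow> bl s p q f (besov_const s * besov_norm s p q f)"
  unfolding besov_const_def by (rule besov_imp_bl[OF p q s])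

lemma bl_integrable: "bl s p q f K \<Longrightarrow> integrable leb01 f"
  by (simp add: bl_def)

lemma besov_integrable: "f \<in> besov s p q \<Longrightarrow> integrable leb01 f"
  using besov_bl bl_integrable by blast

abbreviation hd_part :: "(real \<Rightarrow> complex) \<Rightarrow> real \<Rightarrow> complex" where
  "hd_part f x \<equiv> \<Sum>i<n0. dpart i f x"

definition S :: "(real \<Rightarrow> complex) \<Rightarrow> real \<Rightarrow> complex" where
  "S f = (T ^^ n) (\<lambda>x. f x - hd_part f x)"

text \<open>Level and position of all cells coarser than \<open>n0\<close>. Cells of different
  levels overlap, so the functions \<open>cell a\<close> may be linearly dependent; the functionals
  \<open>co a\<close> still reproduce the coarse part and make the finite rank operator
  explicit.\<close>

definition I0 :: "(nat \<times> nat) set" where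
  "I0 = Sigma {..<n0} (\<lambda>k. {..<2 ^ k})"

definition cell :: "nat \<times> nat \<Rightarrow> real \<Rightarrow> complex" where
  "cell a = indicator (dyadic (fst a) (snd a))"

definition co :: "nat \<times> nat \<Rightarrow> (real \<Rightarrow> complex) \<Rightarrow> complex" where
  "co a f = dco (fst a) (snd a) f"

definition e :: "nat \<times> nat \<Rightarrow> real \<Rightarrow> complex" where
  "e a = (T ^^ n) (cell a)"

lemma I0_fin: "finite I0"
  by (simp add: I0_def)

lemma I0_less: "a \<in> I0 \<Longrightarrow> snd a < 2 ^ fst a"
  by (auto simp: I0_def)

section \<open>Resolvent of the contraction part and the Fredholm property\<close>

lemma Tn: "L1op (T ^^ n) (C ^ n)"
  by (rule L1op_funpow[OF T])

lemma hd_part_eq: "hd_part f x = (\<Sum>a\<in>I0. co a f * cell a x)"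
proof -
  have "hd_part f x = (\<Sum>k<n0. \<Sum>j<2 ^ k. co (k, j) f * cell (k, j) x)"
    unfolding dpart_def by (intro sum.cong refl) (simp add: co_def cell_def)
  also have "\<dots> = (\<Sum>a\<in>I0. co a f * cell a x)"
    unfolding I0_def by (subst sum.Sigma) (auto simp: split_def)
  finally show ?thesis .
qed

lemma Tn_hd: "(T ^^ n) (hd_part f) x = (\<Sum>a\<in>I0. co a f * e a x)"
proof -
  have "(T ^^ n) (hd_part f) x = (T ^^ n) (\<lambda>x. \<Sum>a\<in>I0. co a f * cell a x) x"
    by (simp only: hd_part_eq)
  also have "\<dots> = (\<Sum>a\<in>I0. (T ^^ n) (\<lambda>x. co a f * cell a x) x)" by (rule L1op_sum[OF Tn])
  also have "\<dots> = (\<Sum>a\<in>I0. co a f * e a x)" unfolding e_def by (simp add: L1op_mult[OF Tn])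
  finally show ?thesis .
qed

lemma Tn_split: "(T ^^ n) f x = S f x + (\<Sum>a\<in>I0. co a f * e a x)"
  unfolding S_def Tn_hd[symmetric] by (simp add: L1op_diff[OF Tn])

lemma S_eq: "S f x = (T ^^ n) f x - (\<Sum>a\<in>I0. co a f * e a x)"
  by (simp add: Tn_split)

lemma cell_bl: "a \<in> I0 \<Longrightarrow> \<exists>K. bl s p q (cell a) K"
  unfolding cell_def using bl_indicator_dyadic[OF p q I0_less] .

lemma Tn_bl: "bl s p q f K \<Longrightarrow> bl s p q ((T ^^ i) f) (M ^ i * K)"
proof (induction i)
  case (Suc i)
  then show ?case using M(2)[of "(T ^^ i) f" "M ^ i * K"] by (simp add: mult.assoc)
qed simp

lemma e_bl: "a \<in> I0 \<Longrightarrow> \<exists>K. bl s p q (e a) K"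
  unfolding e_def using cell_bl Tn_bl by blast

lemma S_bl: "bl s p q f K \<Longrightarrow> bl s p q (S f) (l * K)"
  unfolding S_def by (rule tail)

lemma co_add: "a \<in> I0 \<Longrightarrow> integrable leb01 f \<Longrightarrow> integrable leb01 g \<Longrightarrow> co a (\<lambda>x. f x + g x) = co a f + co a g"
  and co_diff: "a \<in> I0 \<Longrightarrow> integrable leb01 f \<Longrightarrow> integrable leb01 g \<Longrightarrow> co a (\<lambda>x. f x - g x) = co a f - co a g"
  unfolding co_def by (auto intro: dco_add dco_diff I0_less)

lemma S_add: "integrable leb01 f \<Longrightarrow> integrable leb01 g \<Longrightarrow> S (\<lambda>x. f x + g x) x = S f x + S g x"
  by (simp add: S_eq L1op_add[OF Tn] co_add distrib_right sum.distrib)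

lemma S_diff: "integrable leb01 f \<Longrightarrow> integrable leb01 g \<Longrightarrow> S (\<lambda>x. f x - g x) x = S f x - S g x"
  by (simp add: S_eq L1op_diff[OF Tn] co_diff left_diff_distrib sum_subtractf)

lemma hd_integrable: "integrable leb01 (hd_part f)"
  by (intro Bochner_Integration.integrable_sum integrable_dpart)

lemma hd_L1: "integrable leb01 f \<Longrightarrow> L1norm (hd_part f) \<le> L1norm f"
proof -
  assume f: "integrable leb01 f"
  have "{..n0 - 1} = {..<n0}" using n0 by auto
  then have "cexp (n0 - 1) f = hd_part f" by (intro ext) (simp add: cexp_def)
  then show ?thesis using L1norm_cexp_le[OF f, of "n0 - 1"] by simp
qed

lemma S_integrable: "integrable leb01 f \<Longrightarrow> integrable leb01 (S f)"
  unfolding S_def by (intro L1op_integrable[OF Tn] Bochner_Integration.integrable_diff hd_integrable)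

lemma S_L1: "integrable leb01 f \<Longrightarrow> L1norm (S f) \<le> (C ^ n * 2) * L1norm f"
proof -
  assume f: "integrable leb01 f"
  have "L1norm (S f) \<le> C ^ n * L1norm (\<lambda>x. f x - hd_part f x)"
    unfolding S_def by (intro L1op_bound[OF Tn] Bochner_Integration.integrable_diff hd_integrable f)
  also have "L1norm (\<lambda>x. f x - hd_part f x) \<le> L1norm f + L1norm (hd_part f)"
    using L1norm_add[OF f, of "\<lambda>x. - 1 * hd_part f x"] hd_integrable[of f] by (simp add: L1norm_def)
  also have "\<dots> \<le> 2 * L1norm f" using hd_L1[OF f] by simp
  finally show ?thesis using T by (simp add: L1op_def mult_left_mono)
qed

text \<open>From \<open>l \<le> 1 / 4\<close> and \<open>cmod (1 / z) \<le> 2\<close>: divided by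
  \<open>z\<close>, the operator \<open>S\<close> halves norm bounds, as \<open>neumann\<close> and
  \<open>bl_zero_AE\<close> require.\<close>

lemma scaled_bound:
  assumes "1 / 2 \<le> cmod z" "0 \<le> K"
  shows "cmod (1 / z) * (l * K) \<le> K / 2"
proof -
  have "1 / cmod z \<le> 1 / (1 / 2)" using assms(1) by (intro divide_left_mono) auto
  then have "cmod (1 / z) \<le> 2" by (simp add: norm_divide)
  moreover have "l * K \<le> 1 / 4 * K" using l4 assms(2) by (rule mult_right_mono)
  moreover have "cmod (1 / z) * (l * K) \<le> 2 * (l * K)"
    using \<open>cmod (1 / z) \<le> 2\<close> l(1) assms(2) by (intro mult_right_mono mult_nonneg_nonneg)
  ultimately show ?thesis by linarith
qed

lemma resolvent:
  assumes z: "1 / 2 \<le> cmod z" and g: "bl s p q g K"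
  shows "\<exists>u. (\<exists>L. bl s p q u L) \<and> (AE x in leb01. z * u x = S u x + g x)"
proof -
  have z0: "z \<noteq> 0" using z by auto
  let ?P = "\<lambda>f x. (1 / z) * S f x"
  have gz: "bl s p q (\<lambda>x. (1 / z) * g x) (cmod (1 / z) * K)" by (rule bl_mult[OF p q g])
  have Pbl: "bl s p q (?P f) (K / 2)" if "bl s p q f K" for f K
    by (rule bl_mono[OF q bl_mult[OF p q S_bl[OF that]] scaled_bound[OF z bl_nonneg[OF that]]])
  have "\<exists>u. bl s p q u (2 * (cmod (1 / z) * K)) \<and> (AE x in leb01. u x = ?P u x + (1 / z) * g x)"
  proof (rule neumann[OF p q s _ _ _ _ Pbl gz, where D = "cmod (1 / z) * (C ^ n * 2)"])
    fix f :: "real \<Rightarrow> complex" assume f: "integrable leb01 f"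
    show "integrable leb01 (?P f)" using S_integrable[OF f] by simp
    show "L1norm (?P f) \<le> cmod (1 / z) * (C ^ n * 2) * L1norm f"
      unfolding L1norm_mult mult.assoc[of "cmod (1 / z)"] by (intro mult_left_mono S_L1 f) simp
  qed (simp_all add: S_add S_diff add_divide_distrib diff_divide_distrib)
  then obtain u where u: "bl s p q u (2 * (cmod (1 / z) * K))" "AE x in leb01. u x = ?P u x + (1 / z) * g x" by blast
  from u(2) have "AE x in leb01. z * u x = S u x + g x"
  proof eventually_elim
    case (elim x)
    have "z * u x = z * (1 / z * S u x + 1 / z * g x)" by (rule arg_cong[OF elim])
    then show ?case using z0 by (simp add: distrib_left)
  qed
  with u(1) show ?thesis by blast
qed

lemma resolvent_unique:
  assumes z: "1 / 2 \<le> cmod z" and u: "bl s p q u K" and eq: "AE x in leb01. z * u x = S u x"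
  shows "AE x in leb01. u x = 0"
proof (rule bl_zero_AE[OF p q s _ u])
  fix L assume L: "bl s p q u L"
  have z0: "z \<noteq> 0" using z by auto
  have "bl s p q (\<lambda>x. (1 / z) * S u x) (L / 2)"
    by (rule bl_mono[OF q bl_mult[OF p q S_bl[OF L]] scaled_bound[OF z bl_nonneg[OF L]]])
  moreover have "AE x in leb01. (1 / z) * S u x = u x"
    using eq
  proof eventually_elim
    case (elim x)
    show ?case unfolding elim[symmetric] using z0 by simp
  qed
  ultimately show "bl s p q u (L / 2)" by (rule bl_cong_AE[OF _ bl_integrable[OF u]])
qed

text \<open>The inverse of \<open>z - S\<close> applied to \<open>e a\<close>; it is determined only
  modulo null sets, hence the choice.\<close>

definition R :: "complex \<Rightarrow> nat \<times> nat \<Rightarrow> real \<Rightarrow> complex" where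
  "R z a = (SOME u. (\<exists>L. bl s p q u L) \<and> (AE x in leb01. z * u x = S u x + e a x))"

lemma R:
  assumes "1 / 2 \<le> cmod z" "a \<in> I0"
  shows "\<exists>L. bl s p q (R z a) L" "AE x in leb01. z * R z a x = S (R z a) x + e a x"
proof -
  obtain K where "bl s p q (e a) K" using e_bl[OF assms(2)] by blast
  from someI_ex[OF resolvent[OF assms(1) this]]
  show "\<exists>L. bl s p q (R z a) L" "AE x in leb01. z * R z a x = S (R z a) x + e a x"
    unfolding R_def by blast+
qed

lemma S_sum:
  assumes "\<And>a. a \<in> A \<Longrightarrow> integrable leb01 (f a)"
  shows "S (\<lambda>x. \<Sum>a\<in>A. f a x) x = (\<Sum>a\<in>A. S (f a) x)"
  using assms
proof (induction A rule: infinite_finite_induct)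
  case (insert a A)
  then have "S (\<lambda>x. f a x + (\<Sum>a\<in>A. f a x)) x = S (f a) x + S (\<lambda>x. \<Sum>a\<in>A. f a x) x"
    by (intro S_add) auto
  then show ?case using insert by simp
qed (use S_diff[of "\<lambda>_. 0" "\<lambda>_. 0" x] in simp_all)

lemma S_mult: "integrable leb01 f \<Longrightarrow> S (\<lambda>x. z * f x) x = z * S f x"
proof -
  assume f: "integrable leb01 f"
  have "co a (\<lambda>x. z * f x) = z * co a f" if "a \<in> I0" for a
    unfolding co_def by (rule dco_mult[OF I0_less[OF that] f])
  then show ?thesis by (simp add: S_eq L1op_mult[OF Tn] right_diff_distrib sum_distrib_left mult.assoc)
qed

lemma Rsum:
  assumes z: "1 / 2 \<le> cmod z"
  shows "\<exists>L. bl s p q (\<lambda>x. \<Sum>a\<in>I0. w a * R z a x) L"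
    and "AE x in leb01. z * (\<Sum>a\<in>I0. w a * R z a x) = S (\<lambda>x. \<Sum>a\<in>I0. w a * R z a x) x + (\<Sum>a\<in>I0. w a * e a x)"
proof -
  obtain L where L: "\<And>a. a \<in> I0 \<Longrightarrow> bl s p q (R z a) (L a)" using R(1)[OF z] by metis
  have "bl s p q (\<lambda>x. \<Sum>a\<in>I0. w a * R z a x) (\<Sum>a\<in>I0. cmod (w a) * L a)"
    by (intro bl_sum[OF p q] bl_mult[OF p q] L)
  then show "\<exists>L. bl s p q (\<lambda>x. \<Sum>a\<in>I0. w a * R z a x) L" by blast
  have i: "integrable leb01 (R z a)" if "a \<in> I0" for a using L[OF that] by (rule bl_integrable)
  have Seq: "S (\<lambda>x. \<Sum>a\<in>I0. w a * R z a x) x = (\<Sum>a\<in>I0. w a * S (R z a) x)" for x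
    using i by (subst S_sum) (auto simp: S_mult)
  have "AE x in leb01. \<forall>a\<in>I0. z * R z a x = S (R z a) x + e a x"
    using R(2)[OF z] by (intro AE_finite_allI I0_fin)
  then show "AE x in leb01. z * (\<Sum>a\<in>I0. w a * R z a x) = S (\<lambda>x. \<Sum>a\<in>I0. w a * R z a x) x + (\<Sum>a\<in>I0. w a * e a x)"
  proof eventually_elim
    case (elim x)
    have "z * (\<Sum>a\<in>I0. w a * R z a x) = (\<Sum>a\<in>I0. w a * (z * R z a x))" by (simp add: sum_distrib_left mult.left_commute)
    also have "\<dots> = (\<Sum>a\<in>I0. w a * (S (R z a) x + e a x))" using elim by (intro sum.cong) auto
    also have "\<dots> = S (\<lambda>x. \<Sum>a\<in>I0. w a * R z a x) x + (\<Sum>a\<in>I0. w a * e a x)"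
      unfolding Seq by (simp add: distrib_left sum.distrib)
    finally show ?case .
  qed
qed

text \<open>The eigenvalue equation reads \<open>(z - S) f = (\<Sum>a\<in>I0. co a f * e a)\<close>,
  and \<open>z - S\<close> is injective, so an eigenfunction is determined by its finitely many
  coarse coefficients.\<close>

lemma eigen_kernel:
  assumes z: "1 / 2 \<le> cmod z" and f: "bl s p q f K" and eq: "AE x in leb01. (T ^^ n) f x = z * f x"
  shows "AE x in leb01. f x = (\<Sum>a\<in>I0. co a f * R z a x)"
proof -
  let ?g = "\<lambda>x. \<Sum>a\<in>I0. co a f * R z a x"
  obtain L where L: "bl s p q ?g L" using Rsum(1)[OF z, of "\<lambda>a. co a f"] by blast
  have "AE x in leb01. z * (f x - ?g x) = S (\<lambda>x. f x - ?g x) x"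
    using eq Rsum(2)[OF z, of "\<lambda>a. co a f"]
  proof eventually_elim
    case (elim x)
    have "S (\<lambda>x. f x - ?g x) x = S f x - S ?g x" by (rule S_diff[OF bl_integrable[OF f] bl_integrable[OF L]])
    then show ?case using elim by (simp add: S_eq[of f] right_diff_distrib)
  qed
  then have "AE x in leb01. f x - ?g x = 0" by (rule resolvent_unique[OF z bl_diff[OF p q f L]])
  then show ?thesis by eventually_elim simp
qed

text \<open>\<open>fredholm_on\<close> speaks of finite sets of functions, while families such as
  \<open>e\<close> and \<open>R z\<close> may repeat members; the coefficients of equal members are
  added up.\<close>

lemma sum_image_coeff:
  fixes u :: "'i \<Rightarrow> real \<Rightarrow> complex"
  assumes "finite A"
  shows "\<exists>w. \<forall>x. (\<Sum>a\<in>A. c a * u a x) = (\<Sum>v\<in>u ` A. w v * v x)"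
proof (intro exI allI)
  fix x
  have "(\<Sum>a\<in>A. c a * u a x) = (\<Sum>v\<in>u ` A. \<Sum>a\<in>{a \<in> A. u a = v}. c a * u a x)"
    by (rule sum.image_gen[OF assms])
  also have "\<dots> = (\<Sum>v\<in>u ` A. (\<Sum>a\<in>{a \<in> A. u a = v}. c a) * v x)"
    unfolding sum_distrib_right by (intro sum.cong) auto
  finally show "(\<Sum>a\<in>A. c a * u a x) = (\<Sum>v\<in>u ` A. (\<lambda>v. \<Sum>a\<in>{a \<in> A. u a = v}. c a) v * v x)" .
qed

lemma funpow_eigen:
  assumes f: "integrable leb01 f" and eq: "AE x in leb01. T f x = z * f x"
  shows "AE x in leb01. (T ^^ i) f x = z ^ i * f x"
proof (induction i)
  case (Suc i)
  have i: "integrable leb01 ((T ^^ i) f)" by (rule L1op_integrable[OF L1op_funpow[OF T] f])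
  have "AE x in leb01. T ((T ^^ i) f) x = T (\<lambda>x. z ^ i * f x) x"
    by (rule L1op_cong_AE[OF T i _ Suc]) (use f in simp)
  with eq show ?case by eventually_elim (simp add: L1op_mult[OF T])
qed simp

text \<open>The kernel of \<open>z - T\<close> lies in that of \<open>z ^ n - T ^^ n\<close>, and
  its range contains the range of the latter, which factors through \<open>z - T\<close>. So both
  statements reduce to the power, where \<open>z ^ n - S\<close> can be inverted.\<close>

lemma fredholm:
  assumes z: "1 / 2 \<le> cmod z ^ n"
  shows "fredholm_on (besov s p q) (shifted z T)"
  unfolding fredholm_on_def
proof (intro conjI)
  have zn: "1 / 2 \<le> cmod (z ^ n)" using z by (simp add: norm_power)
  show "\<exists>B. finite B \<and> B \<subseteq> besov s p q \<and> (\<forall>f\<in>besov s p q. (AE x in leb01. shifted z T f x = 0) \<longrightarrow>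
           (\<exists>w. AE x in leb01. f x = (\<Sum>e\<in>B. w e * e x)))"
  proof (intro exI[of _ "R (z ^ n) ` I0"] conjI ballI impI)
    show "finite (R (z ^ n) ` I0)" using I0_fin by simp
    show "R (z ^ n) ` I0 \<subseteq> besov s p q" using R(1)[OF zn] besov_bl by auto
    fix f assume f: "f \<in> besov s p q" and eq: "AE x in leb01. shifted z T f x = 0"
    from f obtain K where K: "bl s p q f K" using besov_bl by blast
    have "AE x in leb01. T f x = z * f x" using eq by eventually_elim (simp add: shifted_def)
    then have "AE x in leb01. (T ^^ n) f x = z ^ n * f x" by (rule funpow_eigen[OF bl_integrable[OF K]])
    then have A: "AE x in leb01. f x = (\<Sum>a\<in>I0. co a f * R (z ^ n) a x)" by (rule eigen_kernel[OF zn K])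
    obtain w where "\<And>x. (\<Sum>a\<in>I0. co a f * R (z ^ n) a x) = (\<Sum>v\<in>R (z ^ n) ` I0. w v * v x)"
      using sum_image_coeff[OF I0_fin, of "\<lambda>a. co a f" "R (z ^ n)"] by blast
    with A show "\<exists>w. AE x in leb01. f x = (\<Sum>e\<in>R (z ^ n) ` I0. w e * e x)" by auto
  qed
  show "\<exists>B. finite B \<and> B \<subseteq> besov s p q \<and>
        (\<forall>g\<in>besov s p q. \<exists>f\<in>besov s p q. \<exists>w. AE x in leb01. g x = shifted z T f x + (\<Sum>e\<in>B. w e * e x))"
  proof (intro exI[of _ "e ` I0"] conjI ballI)
    show "finite (e ` I0)" using I0_fin by simp
    show "e ` I0 \<subseteq> besov s p q" using e_bl besov_bl by auto
    fix g assume "g \<in> besov s p q"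
    then obtain K where K: "bl s p q g K" using besov_bl by blast
    obtain u L where u: "bl s p q u L" "AE x in leb01. z ^ n * u x = S u x + g x" using resolvent[OF zn K] by blast
    \<comment> \<open>The cofactor of \<open>z - T\<close> in \<open>z ^ n - T ^^ n\<close>, applied
      to \<open>u\<close>; the product telescopes.\<close>
    let ?f = "\<lambda>x. \<Sum>i<n. z ^ (n - Suc i) * (T ^^ i) u x"
    have "bl s p q ?f (\<Sum>i<n. cmod (z ^ (n - Suc i)) * (M ^ i * L))"
      by (intro bl_sum[OF p q] bl_mult[OF p q] Tn_bl u)
    then have fX: "?f \<in> besov s p q" using besov_bl by blast
    have tele: "shifted z T ?f x = z ^ n * u x - (T ^^ n) u x" for x
    proof -
      have "T ?f x = (\<Sum>i<n. z ^ (n - Suc i) * (T ^^ Suc i) u x)"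
        by (subst L1op_sum[OF T]) (simp add: L1op_mult[OF T])
      moreover have "z * ?f x = (\<Sum>i<n. z ^ (n - i) * (T ^^ i) u x)"
        unfolding sum_distrib_left
      proof (intro sum.cong refl)
        fix i assume "i \<in> {..<n}"
        then have "z ^ (n - i) = z * z ^ (n - Suc i)" by (simp add: Suc_diff_Suc flip: power_Suc)
        then show "z * (z ^ (n - Suc i) * (T ^^ i) u x) = z ^ (n - i) * (T ^^ i) u x" by simp
      qed
      moreover have "(\<Sum>i<n. z ^ (n - Suc i) * (T ^^ Suc i) u x - z ^ (n - i) * (T ^^ i) u x)
          = z ^ (n - n) * (T ^^ n) u x - z ^ (n - 0) * (T ^^ 0) u x"
        by (rule sum_lessThan_telescope)
      ultimately have "T ?f x - z * ?f x = (T ^^ n) u x - z ^ n * u x"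
        by (simp only: sum_subtractf diff_self_eq_0 power_0 minus_nat.diff_0 funpow_0 mult_1)
      moreover have "B - A = y - x" if "A - B = x - y" for A B x y :: complex
        using that by (simp add: algebra_simps)
      ultimately show ?thesis unfolding shifted_def by blast
    qed
    obtain w where w: "\<And>x. (\<Sum>a\<in>I0. co a u * e a x) = (\<Sum>v\<in>e ` I0. w v * v x)"
      using sum_image_coeff[OF I0_fin, of "\<lambda>a. co a u" e] by blast
    have "AE x in leb01. g x = shifted z T ?f x + (\<Sum>v\<in>e ` I0. w v * v x)"
      using u(2) by eventually_elim (simp add: tele w[symmetric] S_eq)
    then show "\<exists>f\<in>besov s p q. \<exists>w. AE x in leb01. g x = shifted z T f x + (\<Sum>e\<in>e ` I0. w e * e x)"
      using fX by blast
  qed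
qed

section \<open>The eigenvalue 1, contraction in L^1 and invariant densities\<close>

lemma mass_funpow: "integrable leb01 f \<Longrightarrow> (LINT x|leb01. (T ^^ i) f x) = (LINT x|leb01. f x)"
  by (induction i) (auto simp: mass L1op_integrable[OF L1op_funpow[OF T]])

lemma dom_funpow:
  assumes "AE x in leb01. cmod (f x) \<le> Re (g x)"
  shows "AE x in leb01. cmod ((T ^^ i) f x) \<le> Re ((T ^^ i) g x)"
  by (induction i) (use assms dom in auto)

text \<open>The equation \<open>T\<^sup>n f = f\<close> reduces to the singularity of a finite matrix, which has the
  left null vector \<open>\<mu>\<close> because \<open>T\<close> preserves integrals.\<close>

lemma eigenfunction:
  "\<exists>f K. bl s p q f K \<and> \<not> (AE x in leb01. f x = 0) \<and> (AE x in leb01. (T ^^ n) f x = f x)"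
proof -
  have z1: "1 / 2 \<le> cmod 1" by simp
  let ?u = "R 1"
  obtain L where L: "\<And>a. a \<in> I0 \<Longrightarrow> bl s p q (?u a) (L a)" using R(1)[OF z1] by metis
  have ui: "integrable leb01 (?u a)" if "a \<in> I0" for a using L[OF that] by (rule bl_integrable)
  have ei: "integrable leb01 (e a)" if "a \<in> I0" for a using e_bl[OF that] bl_integrable by blast
  have celli: "integrable leb01 (cell a)" if "a \<in> I0" for a using cell_bl[OF that] bl_integrable by blast
  define \<mu> where "\<mu> a = (LINT x|leb01. e a x)" for a
  \<comment> \<open>Integrate \<open>?u b = S (?u b) + e b\<close> and the splitting of
    \<open>(T ^^ n) (?u b)\<close>: preservation of integrals equates the two, and the integral of
    \<open>S (?u b)\<close> cancels.\<close>
  have left: "(\<Sum>a\<in>I0. \<mu> a * (of_bool (a = b) - co a (?u b))) = 0" if b: "b \<in> I0" for b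
  proof -
    have Si: "integrable leb01 (S (?u b))" by (rule S_integrable[OF ui[OF b]])
    have "(LINT x|leb01. ?u b x) = (LINT x|leb01. S (?u b) x + e b x)"
      using R(2)[OF z1 b] ui[OF b] Si ei[OF b] by (intro integral_cong_AE) auto
    then have 1: "(LINT x|leb01. ?u b x) = (LINT x|leb01. S (?u b) x) + \<mu> b"
      using Si ei[OF b] by (simp add: \<mu>_def)
    have "(LINT x|leb01. ?u b x) = (LINT x|leb01. (T ^^ n) (?u b) x)" using mass_funpow[OF ui[OF b]] by simp
    also have "\<dots> = (LINT x|leb01. S (?u b) x + (\<Sum>a\<in>I0. co a (?u b) * e a x))" by (simp only: Tn_split)
    also have "\<dots> = (LINT x|leb01. S (?u b) x) + (\<Sum>a\<in>I0. co a (?u b) * \<mu> a)"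
      using Si ei by (simp add: \<mu>_def)
    finally have "\<mu> b = (\<Sum>a\<in>I0. co a (?u b) * \<mu> a)" using 1 by simp
    moreover have "(\<Sum>a\<in>I0. \<mu> a * of_bool (a = b)) = \<mu> b"
      using b I0_fin by (simp add: of_bool_def if_distrib cong: if_cong)
    ultimately show ?thesis by (simp add: right_diff_distrib sum_subtractf mult.commute)
  qed
  \<comment> \<open>The cell of level 0 is \<open>[0,1)\<close>; its indicator and hence its image
    have integral 1, so \<mu> does not vanish.\<close>
  have b0: "(0, 0) \<in> I0" using n0 by (simp add: I0_def)
  have "\<mu> (0, 0) = (LINT x|leb01. cell (0, 0) x)"
    unfolding \<mu>_def e_def by (rule mass_funpow[OF celli[OF b0]])
  also have "\<dots> = avg 0 0 (\<lambda>_. 1)" by (simp add: avg_def cell_def)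
  also have "\<dots> = 1" by (rule avg_const) auto
  finally have \<mu>0: "\<mu> (0, 0) \<noteq> 0" by simp
  have "\<exists>x. (\<exists>a\<in>I0. x a \<noteq> 0) \<and> (\<forall>a\<in>I0. (\<Sum>b\<in>I0. (of_bool (a = b) - co a (?u b)) * x b) = 0)"
    by (rule left_right_kernel[OF I0_fin b0 \<mu>0 left])
  then obtain x where x: "\<exists>a\<in>I0. x a \<noteq> 0" "\<forall>a\<in>I0. (\<Sum>b\<in>I0. (of_bool (a = b) - co a (?u b)) * x b) = 0"
    by (elim exE conjE)
  let ?f = "\<lambda>y. \<Sum>a\<in>I0. x a * ?u a y"
  obtain K where K: "bl s p q ?f K" using Rsum(1)[OF z1, of x] by blast
  \<comment> \<open>The right null vector is a consistent choice of coefficients: \<open>?f\<close>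
    has exactly the coarse coefficients \<open>x\<close>, which turns the resolvent equation into
    the fixed point equation for \<open>T ^^ n\<close>.\<close>
  have cof: "co a ?f = x a" if a: "a \<in> I0" for a
  proof -
    have "co a ?f = (\<Sum>b\<in>I0. x b * co a (?u b))"
      unfolding co_def using ui by (intro dco_sum I0_less[OF a])
    moreover have "(\<Sum>b\<in>I0. of_bool (a = b) * x b) = x a"
      using a I0_fin by (simp add: of_bool_def if_distrib[of "\<lambda>t. t * _"] cong: if_cong)
    moreover have "(\<Sum>b\<in>I0. of_bool (a = b) * x b) - (\<Sum>b\<in>I0. x b * co a (?u b)) = 0"
      using x(2)[rule_format, OF a] by (simp only: left_diff_distrib sum_subtractf mult.commute[of "co a _"])
    ultimately show ?thesis by simp
  qed
  have "AE y in leb01. (T ^^ n) ?f y = ?f y"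
    using Rsum(2)[OF z1, of x]
  proof eventually_elim
    case (elim y)
    have "(\<Sum>a\<in>I0. co a ?f * e a y) = (\<Sum>a\<in>I0. x a * e a y)" using cof by (intro sum.cong) auto
    then show ?case using elim by (simp only: Tn_split mult_1)
  qed
  moreover have "\<not> (AE y in leb01. ?f y = 0)"
  proof
    assume 0: "AE y in leb01. ?f y = 0"
    obtain a where a: "a \<in> I0" "x a \<noteq> 0" using x(1) by blast
    have "co a ?f = co a (\<lambda>_. 0)"
      unfolding co_def by (rule dco_cong_AE[OF I0_less[OF a(1)] bl_integrable[OF K] _ 0]) simp
    also have "\<dots> = 0" by (simp add: co_def dco_def avg_def)
    finally show False using cof[OF a(1)] a(2) by simp
  qed
  ultimately show ?thesis using K by blast
qed

text \<open>The iterate of \<open>f\<close> is dominated by that of \<open>cmod f\<close>, whose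
  integral is preserved. This is uniform in \<open>i\<close>, whereas powers of the constant
  \<open>C\<close> may grow.\<close>

lemma T_contraction:
  assumes f: "integrable leb01 f"
  shows "L1norm ((T ^^ i) f) \<le> L1norm f"
proof -
  let ?g = "\<lambda>x. of_real (cmod (f x)) :: complex"
  have g: "integrable leb01 ?g" using f by simp
  note Tf = L1op_integrable[OF L1op_funpow[OF T] f] and Tg = L1op_integrable[OF L1op_funpow[OF T] g]
  have "AE x in leb01. cmod ((T ^^ i) f x) \<le> Re ((T ^^ i) ?g x)" by (rule dom_funpow) simp
  then have "L1norm ((T ^^ i) f) \<le> (LINT x|leb01. Re ((T ^^ i) ?g x))"
    unfolding L1norm_def using Tf Tg by (intro integral_mono_AE integrable_Re integrable_norm)
  also have "\<dots> = Re (LINT x|leb01. (T ^^ i) ?g x)" using integral_Re[OF Tg] .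
  also have "\<dots> = Re (LINT x|leb01. ?g x)" by (simp only: mass_funpow[OF g])
  also have "\<dots> = L1norm f" by (simp add: L1norm_def)
  finally show ?thesis .
qed

text \<open>The finite rank part maps L^1 boundedly into the Besov space; the constant enters only
  through its existence, hence the choice.\<close>

definition hd_const :: real where
  "hd_const = (SOME c. 0 \<le> c \<and> (\<forall>f. integrable leb01 f \<longrightarrow> bl s p q ((T ^^ n) (hd_part f)) (c * L1norm f)))"

lemma hd_const: "0 \<le> hd_const" "integrable leb01 f \<Longrightarrow> bl s p q ((T ^^ n) (hd_part f)) (hd_const * L1norm f)"
proof -
  obtain K where K: "\<And>a. a \<in> I0 \<Longrightarrow> bl s p q (e a) (K a)" using e_bl by metis
  let ?c = "\<Sum>a\<in>I0. 2 * 2 ^ fst a * K a"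
  have "0 \<le> ?c" using bl_nonneg[OF K] by (intro sum_nonneg mult_nonneg_nonneg) auto
  moreover have "bl s p q ((T ^^ n) (hd_part f)) (?c * L1norm f)" if f: "integrable leb01 f" for f
  proof -
    have "bl s p q (\<lambda>x. \<Sum>a\<in>I0. co a f * e a x) (\<Sum>a\<in>I0. cmod (co a f) * K a)"
      by (intro bl_sum[OF p q] bl_mult[OF p q] K)
    moreover have "(\<Sum>a\<in>I0. cmod (co a f) * K a) \<le> ?c * L1norm f"
      unfolding sum_distrib_right
    proof (rule sum_mono)
      fix a assume a: "a \<in> I0"
      have "cmod (co a f) * K a \<le> 2 * 2 ^ fst a * L1norm f * K a"
        unfolding co_def using cmod_dco_le[OF I0_less[OF a] f] bl_nonneg[OF K[OF a]] by (intro mult_right_mono)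
      then show "cmod (co a f) * K a \<le> 2 * 2 ^ fst a * K a * L1norm f" by (simp add: mult_ac)
    qed
    ultimately have "bl s p q (\<lambda>x. \<Sum>a\<in>I0. co a f * e a x) (?c * L1norm f)" by (rule bl_mono[OF q])
    moreover have "(T ^^ n) (hd_part f) = (\<lambda>x. \<Sum>a\<in>I0. co a f * e a x)" by (rule ext) (rule Tn_hd)
    ultimately show ?thesis by simp
  qed
  ultimately have "\<exists>c. 0 \<le> c \<and> (\<forall>f. integrable leb01 f \<longrightarrow> bl s p q ((T ^^ n) (hd_part f)) (c * L1norm f))" by blast
  from someI_ex[OF this, folded hd_const_def]
  show "0 \<le> hd_const" "integrable leb01 f \<Longrightarrow> bl s p q ((T ^^ n) (hd_part f)) (hd_const * L1norm f)" by blast+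
qed

lemma ly_bl:
  assumes f: "bl s p q f K"
  shows "bl s p q ((T ^^ n) f) (hd_const * L1norm f + l * K)"
proof -
  have "bl s p q (\<lambda>x. (T ^^ n) (hd_part f) x + S f x) (hd_const * L1norm f + l * K)"
    by (intro bl_add[OF p q] hd_const bl_integrable[OF f] S_bl f)
  moreover have "(T ^^ n) f = (\<lambda>x. (T ^^ n) (hd_part f) x + S f x)"
    by (rule ext) (simp only: Tn_split[of f] Tn_hd add.commute)
  ultimately show ?thesis by simp
qed

text \<open>Apply \<open>A\<^sup>i\<close>, \<open>A = T\<^sup>n\<close>, to \<open>E\<^sub>j g\<close>: the Lasota-Yorke inequality removes the dependence on \<open>j\<close> from the
  bound, and the contraction property in \<open>L\<^sup>1\<close> keeps the distance to \<open>g\<close>.\<close>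

lemma L1_fixed_bl:
  assumes g: "integrable leb01 g" and eq: "AE x in leb01. (T ^^ n) g x = g x"
  shows "bl s p q g (2 * (hd_const * L1norm g) + 1)"
proof -
  define A where "A = T ^^ n"
  have A: "L1op A (C ^ n)" unfolding A_def by (rule Tn)
  have Ai: "L1norm ((A ^^ i) f) \<le> L1norm f" if "integrable leb01 f" for f i
  proof -
    have "A ^^ i = T ^^ (i * n)" unfolding A_def by (simp add: funpow_mult mult.commute)
    then show ?thesis using T_contraction[OF that] by simp
  qed
  have fixed: "AE x in leb01. (A ^^ i) g x = g x" for i
  proof (induction i)
    case (Suc i)
    have "AE x in leb01. A ((A ^^ i) g) x = A g x"
      by (rule L1op_cong_AE[OF A L1op_integrable[OF L1op_funpow[OF A] g] g Suc])
    with eq show ?case unfolding A_def[symmetric] by eventually_elim simp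
  qed simp
  \<comment> \<open>Lasota-Yorke is iterated with the L^1 norm kept by the contraction property.
    Once the L^1 term plus half of twice that term gives twice the term again, and only the
    transient \<open>K * (1 / 2) ^ i\<close> carries the Besov size of \<open>f\<close>.\<close>
  have bound: "bl s p q ((A ^^ i) f) (2 * (hd_const * L1norm f) + K * (1 / 2) ^ i)" if f: "bl s p q f K" for f K i
  proof (induction i)
    case 0
    show ?case using f hd_const(1) by (auto intro: bl_mono[OF q])
  next
    case (Suc i)
    have "bl s p q (A ((A ^^ i) f)) (hd_const * L1norm ((A ^^ i) f) + l * (2 * (hd_const * L1norm f) + K * (1 / 2) ^ i))"
      unfolding A_def by (rule ly_bl[OF Suc[unfolded A_def]])
    moreover have "hd_const * L1norm ((A ^^ i) f) + l * (2 * (hd_const * L1norm f) + K * (1 / 2) ^ i)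
        \<le> hd_const * L1norm f + (1 / 2) * (2 * (hd_const * L1norm f) + K * (1 / 2) ^ i)"
      using hd_const(1) Ai[OF bl_integrable[OF f]] l4 l(1) bl_nonneg[OF f]
      by (intro add_mono mult_left_mono mult_right_mono) auto
    ultimately show ?case by (auto intro: bl_mono[OF q] simp: algebra_simps)
  qed
  have "\<exists>v. bl s p q v (2 * (hd_const * L1norm g) + 1) \<and> L1norm (\<lambda>x. v x - g x) \<le> L1norm (\<lambda>x. g x - cexp j g x)" for j
  proof -
    have "\<exists>K. bl s p q (cexp j g) K"
    proof -
      have "\<exists>K. bl s p q (\<lambda>x. \<Sum>i<2 ^ j. avg j i g * indicator (dyadic j i) x) K"
      proof -
        have "\<forall>i. \<exists>K. i < 2 ^ j \<longrightarrow> bl s p q (indicator (dyadic j i)) K"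
          using bl_indicator_dyadic[OF p q, where s = s and i = j] by blast
        from choice[OF this] obtain K where "\<And>i. i < 2 ^ j \<Longrightarrow> bl s p q (indicator (dyadic j i)) (K i)"
          by blast
        then have "bl s p q (\<lambda>x. \<Sum>i<2 ^ j. avg j i g * indicator (dyadic j i) x) (\<Sum>i<2 ^ j. cmod (avg j i g) * K i)"
          by (intro bl_sum[OF p q] bl_mult[OF p q]) auto
        then show ?thesis by blast
      qed
      moreover have "cexp j g = (\<lambda>x. \<Sum>i<2 ^ j. avg j i g * indicator (dyadic j i) x)" by (rule ext) (rule cexp_eq)
      ultimately show ?thesis by metis
    qed
    then obtain K where K: "bl s p q (cexp j g) K" by blast
    \<comment> \<open>\<open>i\<close> depends on \<open>j\<close> through \<open>K\<close>: the
      transient drops below 1, which is the summand 1 in the uniform bound.\<close>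
    obtain i where i: "(1 / 2) ^ i < 1 / (K + 1)"
      using real_arch_pow_inv[of "1 / (K + 1)" "1 / 2"] bl_nonneg[OF K] by auto
    have Ki: "K * (1 / 2) ^ i \<le> 1"
    proof -
      have "K * (1 / 2) ^ i \<le> K * (1 / (K + 1))" using i bl_nonneg[OF K] by (intro mult_left_mono) auto
      also have "\<dots> \<le> 1" using bl_nonneg[OF K] by (simp add: field_simps)
      finally show ?thesis .
    qed
    have 1: "bl s p q ((A ^^ i) (cexp j g)) (2 * (hd_const * L1norm g) + 1)"
    proof (rule bl_mono[OF q bound[OF K, of i]])
      have "hd_const * L1norm (cexp j g) \<le> hd_const * L1norm g"
        using hd_const(1) L1norm_cexp_le[OF g] by (intro mult_left_mono)
      then show "2 * (hd_const * L1norm (cexp j g)) + K * (1 / 2) ^ i \<le> 2 * (hd_const * L1norm g) + 1"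
        using Ki by linarith
    qed
    have ci: "integrable leb01 (cexp j g)" by (rule integrable_cexp)
    note Li = L1op_funpow[OF A, of i]
    have "L1norm (\<lambda>x. (A ^^ i) (cexp j g) x - g x) = L1norm ((A ^^ i) (\<lambda>x. cexp j g x - g x))"
    proof (rule L1norm_cong_AE)
      show "AE x in leb01. (A ^^ i) (cexp j g) x - g x = (A ^^ i) (\<lambda>x. cexp j g x - g x) x"
        using fixed[of i] by eventually_elim (simp add: L1op_diff[OF Li])
    qed (use g ci L1op_integrable[OF Li] in auto)
    also have "\<dots> \<le> L1norm (\<lambda>x. cexp j g x - g x)" using ci g by (intro Ai) auto
    also have "\<dots> = L1norm (\<lambda>x. g x - cexp j g x)" by (rule L1norm_minus_commute)
    finally show ?thesis using 1 by blast
  qed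
  then have "\<forall>j. \<exists>v. bl s p q v (2 * (hd_const * L1norm g) + 1) \<and>
      L1norm (\<lambda>x. v x - g x) \<le> L1norm (\<lambda>x. g x - cexp j g x)" by (rule allI)
  from choice[OF this] obtain v where v: "\<And>j. bl s p q (v j) (2 * (hd_const * L1norm g) + 1)"
    "\<And>j. L1norm (\<lambda>x. v j x - g x) \<le> L1norm (\<lambda>x. g x - cexp j g x)" by auto
  show ?thesis
  proof (rule bl_limit[OF p q v(1) g])
    show "(\<lambda>j. L1norm (\<lambda>x. v j x - g x)) \<longlonglongrightarrow> 0"
      by (rule Lim_null_comparison[OF _ cexp_tendsto[OF g]]) (use v(2) in \<open>auto intro!: always_eventually\<close>)
  qed
qed

lemma fixed_funpow:
  assumes "integrable leb01 f" "AE x in leb01. T f x = f x"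
  shows "AE x in leb01. (T ^^ i) f x = f x"
  using funpow_eigen[OF assms(1), of 1 i] assms(2) by simp

lemma fixed_besov:
  assumes "integrable leb01 f" "AE x in leb01. T f x = f x"
  shows "f \<in> besov s p q"
  using L1_fixed_bl[OF assms(1) fixed_funpow[OF assms]] besov_bl by blast

text \<open>For a fixed point \<open>f0\<close> of \<open>T ^^ n\<close>, \<open>cmod f0\<close> is
  dominated by its image under \<open>T ^^ n\<close>, and the integrals agree, so equality holds
  almost everywhere. Summing over one period makes the function fixed by \<open>T\<close> itself;
  its mass is \<open>n * N\<close>.\<close>

lemma invariant_density:
  "\<exists>f. integrable leb01 f \<and> (AE x in leb01. T f x = f x) \<and> (AE x in leb01. cmod (f x) \<le> Re (f x)) \<and> (LINT x|leb01. f x) = 1"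
proof -
  obtain f0 K where f0: "bl s p q f0 K" "\<not> (AE x in leb01. f0 x = 0)" "AE x in leb01. (T ^^ n) f0 x = f0 x"
    using eigenfunction by blast
  have f0i: "integrable leb01 f0" by (rule bl_integrable[OF f0(1)])
  let ?g = "\<lambda>x. of_real (cmod (f0 x)) :: complex"
  have g: "integrable leb01 ?g" using f0i by simp
  have Tgi: "integrable leb01 ((T ^^ i) ?g)" for i by (rule L1op_integrable[OF L1op_funpow[OF T] g])
  have d1: "AE x in leb01. cmod ((T ^^ n) f0 x) \<le> Re ((T ^^ n) ?g x)" by (rule dom_funpow) simp
  have d2: "AE x in leb01. cmod ((T ^^ i) ?g x) \<le> Re ((T ^^ i) ?g x)" for i by (rule dom_funpow) simp
  have m: "(LINT x|leb01. Re ((T ^^ i) ?g x)) = L1norm f0" for i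
  proof -
    have "(LINT x|leb01. Re ((T ^^ i) ?g x)) = Re (LINT x|leb01. (T ^^ i) ?g x)" by (rule integral_Re[OF Tgi])
    also have "\<dots> = Re (LINT x|leb01. ?g x)" by (simp only: mass_funpow[OF g])
    finally show ?thesis by (simp add: L1norm_def)
  qed
  have "AE x in leb01. Re ((T ^^ n) ?g x) - cmod (f0 x) = 0"
  proof (subst integral_nonneg_eq_0_iff_AE[symmetric])
    show "integrable leb01 (\<lambda>x. Re ((T ^^ n) ?g x) - cmod (f0 x))" using Tgi f0i by (intro Bochner_Integration.integrable_diff integrable_Re) auto
    show "AE x in leb01. 0 \<le> Re ((T ^^ n) ?g x) - cmod (f0 x)" using d1 f0(3) by eventually_elim simp
    show "(LINT x|leb01. Re ((T ^^ n) ?g x) - cmod (f0 x)) = 0"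
      using m[of n] integrable_Re[OF Tgi[of n]] f0i by (simp add: L1norm_def)
  qed
  then have Tg: "AE x in leb01. (T ^^ n) ?g x = ?g x"
    using d2[of n]
  proof eventually_elim
    case (elim x)
    \<comment> \<open>Modulus at most the real part forces the imaginary part to vanish.\<close>
    have "(Re ((T ^^ n) ?g x))\<^sup>2 + (Im ((T ^^ n) ?g x))\<^sup>2 \<le> (Re ((T ^^ n) ?g x))\<^sup>2"
      using elim(2) power_mono[OF elim(2), of 2] by (simp add: cmod_power2)
    then have "Im ((T ^^ n) ?g x) = 0" by simp
    then show ?case using elim(1) by (simp add: complex_eq_iff)
  qed
  define N where "N = L1norm f0"
  have N: "0 < N"
  proof -
    have "N \<noteq> 0" using L1norm_eq_0[OF f0i] f0(2) by (auto simp: N_def)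
    then show ?thesis using L1norm_nonneg[of f0] unfolding N_def by linarith
  qed
  define h where "h x = (\<Sum>i<n. (T ^^ i) ?g x)" for x
  have hi: "integrable leb01 h" unfolding h_def[abs_def] using Tgi by (intro Bochner_Integration.integrable_sum)
  have Th: "AE x in leb01. T h x = h x"
    using Tg
  proof eventually_elim
    case (elim x)
    have "T h x = (\<Sum>i<n. (T ^^ Suc i) ?g x)" unfolding h_def[abs_def] by (subst L1op_sum[OF T]) simp
    moreover have "(\<Sum>i<n. (T ^^ Suc i) ?g x - (T ^^ i) ?g x) = (T ^^ n) ?g x - (T ^^ 0) ?g x"
      by (rule sum_lessThan_telescope)
    ultimately show ?case using elim by (simp add: h_def sum_subtractf)
  qed
  have hpos: "AE x in leb01. cmod (h x) \<le> Re (h x)"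
  proof -
    have "AE x in leb01. \<forall>i\<in>{..<n}. cmod ((T ^^ i) ?g x) \<le> Re ((T ^^ i) ?g x)" using d2 by (intro AE_finite_allI) auto
    then show ?thesis
    proof eventually_elim
      case (elim x)
      have "cmod (h x) \<le> (\<Sum>i<n. cmod ((T ^^ i) ?g x))" unfolding h_def by (rule norm_sum)
      also have "\<dots> \<le> (\<Sum>i<n. Re ((T ^^ i) ?g x))" using elim by (intro sum_mono) auto
      also have "\<dots> = Re (h x)" by (simp add: h_def)
      finally show ?case .
    qed
  qed
  have hint: "(LINT x|leb01. h x) = of_real (real n * N)"
  proof -
    have "(LINT x|leb01. h x) = (\<Sum>i<n. (LINT x|leb01. (T ^^ i) ?g x))"
      unfolding h_def using Tgi by (intro Bochner_Integration.integral_sum)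
    also have "\<dots> = (\<Sum>i<n. (LINT x|leb01. ?g x))" by (simp only: mass_funpow[OF g])
    also have "(LINT x|leb01. ?g x) = of_real N" unfolding N_def L1norm_def by (rule integral_complex_of_real)
    finally show ?thesis by simp
  qed
  let ?k = "1 / (real n * N)"
  have k: "0 < ?k" using N n by simp
  show ?thesis
  proof (intro exI[of _ "\<lambda>x. of_real ?k * h x"] conjI)
    show "integrable leb01 (\<lambda>x. of_real ?k * h x)" using hi by simp
    show "AE x in leb01. T (\<lambda>x. of_real ?k * h x) x = of_real ?k * h x"
      using Th by eventually_elim (simp only: L1op_mult[OF T])
    show "AE x in leb01. cmod (of_real ?k * h x) \<le> Re (of_real ?k * h x)"
      using hpos
    proof eventually_elim
      case (elim x)
      have "cmod (of_real ?k * h x) = ?k * cmod (h x)" using k by (simp only: norm_mult norm_of_real abs_of_pos)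
      also have "\<dots> \<le> ?k * Re (h x)" using elim k by (intro mult_left_mono) auto
      also have "\<dots> = Re (of_real ?k * h x)" by (simp only: Re_complex_of_real times_complex.sel Im_complex_of_real mult_zero_left diff_zero)
      finally show ?case .
    qed
    have "(LINT x|leb01. of_real ?k * h x) = of_real ?k * of_real (real n * N)" unfolding hint[symmetric] by (rule integral_mult_right_zero)
    also have "\<dots> = of_real (?k * (real n * N))" by (rule of_real_mult[symmetric])
    also have "?k * (real n * N) = 1" using N n by simp
    finally show "(LINT x|leb01. of_real ?k * h x) = 1" by simp
  qed
qed

section \<open>Boundedness, Lasota-Yorke inequality and quasi-compactness\<close>

lemma bounded_operator: "bounded_operator_on (besov s p q) (besov_norm s p q) T"
  unfolding bounded_operator_on_def
proof (intro conjI ballI allI impI)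
  show "T f \<in> besov s p q" if "f \<in> besov s p q" for f
    using that M(2) besov_bl by blast
  show "AE x in leb01. T f x = T g x" if "f \<in> besov s p q" "g \<in> besov s p q" "AE x in leb01. f x = g x" for f g
    using that besov_integrable by (intro L1op_cong_AE[OF T])
  show "AE x in leb01. T (\<lambda>y. f y + g y) x = T f x + T g x" for f g
    by (simp add: L1op_add[OF T])
  show "AE x in leb01. T (\<lambda>y. z * f y) x = z * T f x" for z f
    by (simp add: L1op_mult[OF T])
  show "\<exists>K. \<forall>f\<in>besov s p q. besov_norm s p q (T f) \<le> K * besov_norm s p q f"
  proof (intro exI[of _ "M * besov_const s"] ballI)
    fix f assume "f \<in> besov s p q"
    from bl_imp_besov(2)[OF p q s M(2)[OF bl_besov_norm[OF this]]]
    show "besov_norm s p q (T f) \<le> M * besov_const s * besov_norm s p q f" by (simp add: mult.assoc)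
  qed
qed

lemma lasota_yorke: "lasota_yorke (besov s p q) (besov_norm s p q) T"
  unfolding lasota_yorke_def
\<comment> \<open>\<open>lasota_yorke\<close> asks for a positive constant, and
  \<open>hd_const\<close> is only known to be nonnegative.\<close>
proof (intro exI[of _ n] conjI exI[of _ "hd_const + 1"] bexI[of _ "1 / 2 :: real"] ballI)
  show "1 \<le> n" by (rule n)
  show "0 < hd_const + 1" using hd_const(1) by simp
  fix f assume f: "f \<in> besov s p q"
  note b = ly_bl[OF bl_besov_norm[OF f]]
  show "(T ^^ n) f \<in> besov s p q" using b besov_bl by blast
  have "besov_norm s p q ((T ^^ n) f) \<le> hd_const * L1norm f + l * (besov_const s * besov_norm s p q f)"
    by (rule bl_imp_besov(2)[OF p q s b])
  also have "\<dots> \<le> (hd_const + 1) * L1norm f + (1 / 2) * besov_norm s p q f"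
  proof (intro add_mono)
    show "hd_const * L1norm f \<le> (hd_const + 1) * L1norm f" by (intro mult_right_mono) auto
    show "l * (besov_const s * besov_norm s p q f) \<le> (1 / 2) * besov_norm s p q f"
      unfolding mult.assoc[symmetric] using l(2) besov_norm_nonneg[OF q p f] by (intro mult_right_mono) auto
  qed
  also have "L1norm f = Lp_norm 1 f" using L1norm_nonneg[of f] by (simp add: Lp_norm_def L1norm_def)
  finally show "besov_norm s p q ((T ^^ n) f) \<le> (hd_const + 1) * Lp_norm 1 f + (1 / 2) * besov_norm s p q f" .
qed simp

lemma quasi_compact: "quasi_compact_on (besov s p q) (besov_norm s p q) T"
  unfolding quasi_compact_on_def
proof
  show "bounded_operator_on (besov s p q) (besov_norm s p q) T" by (rule bounded_operator)
  \<comment> \<open>The Fredholm property holds for \<open>1 / 2 \<le> cmod z ^ n\<close>, so the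
    essential spectrum lies in the disc of radius \<open>?r < 1\<close>, while 1 is an
    eigenvalue.\<close>
  let ?r = "(1 / 2) powr (1 / real n) :: real"
  have r: "?r < 1" using n powr_less_mono2[of "1 / real n" "1 / 2" 1] by simp
  have "(SUP z\<in>essential_spectrum_on (besov s p q) T. ennreal (cmod z)) \<le> ennreal ?r"
  proof (rule SUP_least)
    fix z assume "z \<in> essential_spectrum_on (besov s p q) T"
    then have "\<not> 1 / 2 \<le> cmod z ^ n" using fredholm[of z] by (auto simp: essential_spectrum_on_def)
    then have "cmod z ^ n < 1 / 2" by simp
    also have "1 / 2 = ?r ^ n" using n by (simp add: powr_realpow[symmetric] powr_powr)
    finally have "cmod z < ?r" by (rule power_less_imp_less_base) simp
    then show "ennreal (cmod z) \<le> ennreal ?r" by (intro ennreal_leI) simp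
  qed
  also have "ennreal ?r < 1" using r by (simp add: ennreal_less_one_iff)
  also have "1 \<le> (SUP z\<in>spectrum_on (besov s p q) (besov_norm s p q) T. ennreal (cmod z))"
  proof -
    obtain f where f: "integrable leb01 f" "AE x in leb01. T f x = f x" "(LINT x|leb01. f x) = 1"
      using invariant_density by blast
    have "f \<in> besov s p q" by (rule fixed_besov[OF f(1,2)])
    moreover have "AE x in leb01. shifted 1 T f x = 0" using f(2) by eventually_elim (simp add: shifted_def)
    moreover have "\<not> (AE x in leb01. f x = 0)"
    proof
      assume "AE x in leb01. f x = 0"
      then have "(LINT x|leb01. f x) = 0" by (rule integral_eq_zero_AE)
      then show False using f(3) by simp
    qed
    ultimately have "1 \<in> spectrum_on (besov s p q) (besov_norm s p q) T"
      unfolding spectrum_on_def invertible_on_def by blast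
    then show ?thesis by (rule SUP_upper2) simp
  qed
  finally show "(SUP z\<in>essential_spectrum_on (besov s p q) T. ennreal (cmod z))
      < (SUP z\<in>spectrum_on (besov s p q) (besov_norm s p q) T. ennreal (cmod z))" .
qed

end

section \<open>Absolutely continuous invariant probabilities\<close>

lemma finite_sets_leb01: "finite S \<Longrightarrow> S \<subseteq> {0..1} \<Longrightarrow> S \<in> sets leb01"
  by (rule sets_leb01_null[OF AE_leb01_not_in_null[OF finite_imp_null_set_lborel]])

locale piecewise_map = branch_system +
  fixes F :: "real \<Rightarrow> real"
  assumes F: "is_piecewise_map \<Lambda> \<alpha> \<theta> a b c d F"
begin

definition inv_branch :: "nat \<Rightarrow> real \<Rightarrow> real" where
  "inv_branch r = lip_branch.K (\<lambda>x. \<alpha> r x + \<theta> r) (a r) (b r) (c r) (d r)"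

definition endpoints :: "real set" where
  "endpoints = a ` \<Lambda> \<union> b ` \<Lambda>"

lemma inv_branch:
  assumes r: "r \<in> \<Lambda>"
  shows "inv_branch r \<in> measurable leb01 leb01"
    and "x \<in> {c r..d r} \<Longrightarrow> inv_branch r (hb r x) = x"
    and "y \<in> {a r..b r} \<Longrightarrow> inv_branch r y = the_inv_into {c r..d r} (hb r) y"
  unfolding inv_branch_def
  using lip_branch.K_measurable[OF lip[OF r]] lip_branch.K_h[OF lip[OF r]] lip_branch.K_def[OF lip[OF r]]
  unfolding hb_eq[OF r] by auto

lemma inner_unique:
  assumes "x \<notin> endpoints" "r \<in> \<Lambda>" "x \<in> {a r..b r}" "r' \<in> \<Lambda>" "x \<in> {a r'..b r'}"
  shows "r = r'"
proof (rule ccontr)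
  assume "r \<noteq> r'"
  then have "{a r<..<b r} \<inter> {a r'<..<b r'} = {}"
    using part assms(2,4) by (auto simp: interval_partition_def disjoint_family_on_def)
  moreover have "x \<noteq> a r" "x \<noteq> b r" "x \<noteq> a r'" "x \<noteq> b r'" using assms(1,2,4) by (auto simp: endpoints_def)
  then have "x \<in> {a r<..<b r} \<inter> {a r'<..<b r'}" using assms(3,5) by auto
  ultimately show False by blast
qed

lemma F_branch:
  assumes "x \<notin> endpoints" "r \<in> \<Lambda>" "x \<in> {a r..b r}"
  shows "F x = inv_branch r x"
proof -
  have "x \<in> {0..1}" using ab[OF assms(2)] assms(3) by auto
  then obtain r' where r': "r' \<in> \<Lambda>" "x \<in> {a r'..b r'}" "F x = the_inv_into {c r'..d r'} (hb r') x"
    using F unfolding is_piecewise_map_def by blast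
  moreover have "r' = r" by (rule inner_unique[OF assms(1) r'(1,2) assms(2,3)])
  ultimately show ?thesis using inv_branch(3) assms by simp
qed

lemma F_in:
  assumes "x \<in> {0..1}"
  shows "F x \<in> {0..1}"
proof -
  obtain r where r: "r \<in> \<Lambda>" "x \<in> {a r..b r}" "F x = the_inv_into {c r..d r} (hb r) x"
    using F assms unfolding is_piecewise_map_def by blast
  have "the_inv_into {c r..d r} (hb r) x \<in> {c r..d r}"
    by (rule the_inv_into_into[OF hb_inj[OF r(1)]]) (use r hb_image[OF r(1)] in auto)
  then show ?thesis using r(3) cd[OF r(1)] by auto
qed

lemma finite_endpoints: "finite endpoints"
  using fin by (simp add: endpoints_def)

lemma cover:
  assumes "x \<in> {0..1}"
  shows "\<exists>r\<in>\<Lambda>. x \<in> {a r..b r}"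
proof -
  have "x \<in> (\<Union>r\<in>\<Lambda>. {a r..b r})" using part assms unfolding interval_partition_def by simp
  then show ?thesis by (rule UN_E) (rule bexI)
qed

lemma ab_sets: "r \<in> \<Lambda> \<Longrightarrow> {a r..b r} \<in> sets leb01"
  using ab[of r] by (auto simp: sets_leb01_iff)

text \<open>Off the endpoints \<open>F\<close> coincides with measurable inverse branches; its
  values at the finitely many endpoints affect only a finite set.\<close>

lemma F_measurable: "F \<in> measurable leb01 leb01"
proof (rule measurableI)
  show "F x \<in> space leb01" if "x \<in> space leb01" for x using F_in that by simp
  fix E assume E: "E \<in> sets leb01"
  let ?fin = "F -` E \<inter> {0..1} \<inter> endpoints"
  let ?U = "\<Union>r\<in>\<Lambda>. (inv_branch r -` E \<inter> space leb01) \<inter> {a r..b r} - endpoints \<inter> {0..1}"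
  have "F -` E \<inter> space leb01 = ?U \<union> ?fin"
  proof (intro subset_antisym subsetI)
    fix x assume x: "x \<in> F -` E \<inter> space leb01"
    then obtain r where r: "r \<in> \<Lambda>" "x \<in> {a r..b r}" using cover[of x] by auto
    show "x \<in> ?U \<union> ?fin"
    proof (cases "x \<in> endpoints")
      case False
      then have "x \<in> (inv_branch r -` E \<inter> space leb01) \<inter> {a r..b r} - endpoints \<inter> {0..1}"
        using F_branch[OF False r] x r(2) by simp
      then show ?thesis using r(1) by blast
    qed (use x in simp)
  next
    fix x assume "x \<in> ?U \<union> ?fin"
    then show "x \<in> F -` E \<inter> space leb01"
    proof
      assume "x \<in> ?U"
      then obtain r where r: "r \<in> \<Lambda>" "inv_branch r x \<in> E" "x \<in> {0..1}" "x \<in> {a r..b r}" "x \<notin> endpoints" by auto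
      then show ?thesis using F_branch[OF r(5,1,4)] by simp
    qed simp
  qed
  also have "\<dots> \<in> sets leb01"
  proof (rule sets.Un)
    have e: "endpoints \<inter> {0..1} \<in> sets leb01" by (rule finite_sets_leb01) (use finite_endpoints in simp_all)
    have "(inv_branch r -` E \<inter> space leb01) \<inter> {a r..b r} - endpoints \<inter> {0..1} \<in> sets leb01" if "r \<in> \<Lambda>" for r
      by (rule sets.Diff[OF sets.Int[OF measurable_sets[OF inv_branch(1)[OF that] E] ab_sets[OF that]] e])
    then show "?U \<in> sets leb01" by (rule sets.finite_UN[OF fin])
    show "?fin \<in> sets leb01" by (rule finite_sets_leb01) (use finite_endpoints in auto)
  qed
  finally show "F -` E \<inter> space leb01 \<in> sets leb01" .
qed

lemma AE_not_endpoint: "AE x in leb01. x \<notin> endpoints"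
  using finite_endpoints by (intro AE_leb01_not_in_null) (simp add: finite_imp_null_set_lborel)

text \<open>The transfer operator with values in \<open>ennreal\<close>: for nonnegative densities
  the change of variables then holds before integrability is known, and measures can be compared
  directly.\<close>

definition push :: "(real \<Rightarrow> real) \<Rightarrow> real \<Rightarrow> ennreal" where
  "push \<rho> x = (\<Sum>r\<in>\<Lambda>. ennreal (indicator {c r..d r} x * (\<alpha> r x + \<theta> r)) * ennreal (\<rho> (hb r x)))"

lemma push_term:
  assumes r: "r \<in> \<Lambda>"
  defines "H \<equiv> lip_branch.H (\<lambda>x. \<alpha> r x + \<theta> r) (a r) (c r) (d r)"
  shows "ennreal (indicator {c r..d r} x * (\<alpha> r x + \<theta> r)) * g (H x)
      = ennreal (indicator {c r..d r} x * (\<alpha> r x + \<theta> r)) * g (hb r x)"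
    and "H \<in> measurable leb01 leb01"
  using lip_branch.H_measurable[OF lip[OF r]] unfolding H_def
  by (auto simp: lip_branch.H_def[OF lip[OF r]] hb_eq[OF r] indicator_def)

lemma push_term_measurable:
  fixes g :: "real \<Rightarrow> ennreal"
  assumes r: "r \<in> \<Lambda>" and g: "g \<in> borel_measurable leb01"
  shows "(\<lambda>x. ennreal (indicator {c r..d r} x * (\<alpha> r x + \<theta> r)) * g (hb r x)) \<in> borel_measurable leb01"
proof -
  have J: "{c r..d r} \<in> sets leb01" using cd[OF r] by (auto simp: sets_leb01_iff)
  note [measurable] = J \<alpha>_meas[OF r] g push_term(2)[OF r]
  show ?thesis unfolding push_term(1)[OF r, symmetric] by measurable
qed

lemma push_measurable:
  assumes "\<rho> \<in> borel_measurable leb01"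
  shows "push \<rho> \<in> borel_measurable leb01"
  unfolding push_def[abs_def] using assms
  by (intro borel_measurable_sum push_term_measurable[of _ "\<lambda>x. ennreal (\<rho> x)"]) auto

lemma nn_integral_branch:
  fixes g :: "real \<Rightarrow> ennreal"
  assumes r: "r \<in> \<Lambda>" and g: "g \<in> borel_measurable leb01"
  shows "(\<integral>\<^sup>+ x. ennreal (indicator {c r..d r} x * (\<alpha> r x + \<theta> r)) * g (hb r x) \<partial>leb01)
    = (\<integral>\<^sup>+ y. indicator {a r..b r} y * g y \<partial>leb01)"
  using lip_branch.nn_integral_h[OF lip[OF r] g] by (simp only: push_term(1)[OF r])

text \<open>Duality between composition with \<open>F\<close> and the transfer operator. On branch
  \<open>r\<close> the substitution \<open>y = hb r x\<close> turns
  \<open>g (inv_branch r y)\<close> into \<open>g x\<close>.\<close>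

lemma nn_integral_F:
  fixes g :: "real \<Rightarrow> ennreal"
  assumes \<rho>: "\<rho> \<in> borel_measurable leb01" and g: "g \<in> borel_measurable leb01"
  shows "(\<integral>\<^sup>+ y. ennreal (\<rho> y) * g (F y) \<partial>leb01) = (\<integral>\<^sup>+ x. push \<rho> x * g x \<partial>leb01)"
proof -
  have m: "(\<lambda>y. ennreal (\<rho> y) * g (inv_branch r y)) \<in> borel_measurable leb01" if "r \<in> \<Lambda>" for r
    using inv_branch(1)[OF that] \<rho> g by measurable
  have "(\<integral>\<^sup>+ y. ennreal (\<rho> y) * g (F y) \<partial>leb01)
      = (\<integral>\<^sup>+ y. (\<Sum>r\<in>\<Lambda>. indicator {a r..b r} y * (ennreal (\<rho> y) * g (inv_branch r y))) \<partial>leb01)"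
  proof (rule nn_integral_cong_AE)
    have "AE y in leb01. y \<in> {0..1}" using AE_space[of leb01] by simp
    with AE_not_endpoint
    show "AE y in leb01. ennreal (\<rho> y) * g (F y) = (\<Sum>r\<in>\<Lambda>. indicator {a r..b r} y * (ennreal (\<rho> y) * g (inv_branch r y)))"
    proof eventually_elim
      case (elim y)
      obtain r0 where r0: "r0 \<in> \<Lambda>" "y \<in> {a r0..b r0}" using cover[OF elim(2)] by blast
      have "y \<notin> {a r..b r}" if "r \<in> \<Lambda> - {r0}" for r
        using inner_unique[OF elim(1) r0, of r] that by blast
      then have "indicator {a r..b r} y * (ennreal (\<rho> y) * g (inv_branch r y)) = 0" if "r \<in> \<Lambda> - {r0}" for r
        using that by simp
      then have "(\<Sum>r\<in>\<Lambda>. indicator {a r..b r} y * (ennreal (\<rho> y) * g (inv_branch r y)))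
          = (\<Sum>r\<in>{r0}. indicator {a r..b r} y * (ennreal (\<rho> y) * g (inv_branch r y)))"
        using fin r0 by (intro sum.mono_neutral_right ballI) auto
      also have "\<dots> = ennreal (\<rho> y) * g (inv_branch r0 y)" using r0(2) by (simp del: sum_mult_indicator)
      finally show ?case using F_branch[OF elim(1) r0] by simp
    qed
  qed
  also have "\<dots> = (\<Sum>r\<in>\<Lambda>. \<integral>\<^sup>+ y. indicator {a r..b r} y * (ennreal (\<rho> y) * g (inv_branch r y)) \<partial>leb01)"
    by (rule nn_integral_sum) (rule borel_measurable_times_ennreal[OF borel_measurable_indicator[OF ab_sets] m])
  also have "\<dots> = (\<Sum>r\<in>\<Lambda>. \<integral>\<^sup>+ x. ennreal (indicator {c r..d r} x * (\<alpha> r x + \<theta> r)) * ennreal (\<rho> (hb r x)) * g x \<partial>leb01)"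
  proof (intro sum.cong refl)
    fix r assume r: "r \<in> \<Lambda>"
    have "(\<integral>\<^sup>+ y. indicator {a r..b r} y * (ennreal (\<rho> y) * g (inv_branch r y)) \<partial>leb01)
      = (\<integral>\<^sup>+ x. ennreal (indicator {c r..d r} x * (\<alpha> r x + \<theta> r)) * (ennreal (\<rho> (hb r x)) * g (inv_branch r (hb r x))) \<partial>leb01)"
      by (rule nn_integral_branch[OF r m[OF r], symmetric])
    also have "\<dots> = (\<integral>\<^sup>+ x. ennreal (indicator {c r..d r} x * (\<alpha> r x + \<theta> r)) * ennreal (\<rho> (hb r x)) * g x \<partial>leb01)"
      using inv_branch(2)[OF r] by (intro nn_integral_cong) (auto simp: indicator_def mult.assoc)
    finally show "(\<integral>\<^sup>+ y. indicator {a r..b r} y * (ennreal (\<rho> y) * g (inv_branch r y)) \<partial>leb01)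
      = (\<integral>\<^sup>+ x. ennreal (indicator {c r..d r} x * (\<alpha> r x + \<theta> r)) * ennreal (\<rho> (hb r x)) * g x \<partial>leb01)" .
  qed
  also have "\<dots> = (\<integral>\<^sup>+ x. push \<rho> x * g x \<partial>leb01)"
    unfolding push_def sum_distrib_right
    using \<rho> by (intro nn_integral_sum[symmetric] borel_measurable_times_ennreal
        push_term_measurable[of _ "\<lambda>x. ennreal (\<rho> x)"] g) auto
  finally show ?thesis .
qed

lemma distr_density:
  assumes \<rho>: "\<rho> \<in> borel_measurable leb01"
  shows "distr (density leb01 (\<lambda>x. ennreal (\<rho> x))) leb01 F = density leb01 (push \<rho>)"
proof (rule measure_eqI)
  fix E assume "E \<in> sets (distr (density leb01 (\<lambda>x. ennreal (\<rho> x))) leb01 F)"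
  then have E: "E \<in> sets leb01" by simp
  have Fm: "F \<in> measurable (density leb01 (\<lambda>x. ennreal (\<rho> x))) leb01" using F_measurable by simp
  have "emeasure (distr (density leb01 (\<lambda>x. ennreal (\<rho> x))) leb01 F) E
      = emeasure (density leb01 (\<lambda>x. ennreal (\<rho> x))) (F -` E \<inter> space leb01)"
    using emeasure_distr[OF Fm E] by simp
  also have "\<dots> = (\<integral>\<^sup>+ y. ennreal (\<rho> y) * indicator (F -` E \<inter> space leb01) y \<partial>leb01)"
    using \<rho> measurable_sets[OF F_measurable E] by (intro emeasure_density) auto
  also have "\<dots> = (\<integral>\<^sup>+ y. ennreal (\<rho> y) * indicator E (F y) \<partial>leb01)"
    by (intro nn_integral_cong) (auto simp: indicator_def)
  also have "\<dots> = (\<integral>\<^sup>+ x. push \<rho> x * indicator E x \<partial>leb01)"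
    using E by (intro nn_integral_F[OF \<rho>]) auto
  also have "\<dots> = emeasure (density leb01 (push \<rho>)) E"
    using push_measurable[OF \<rho>] E by (intro emeasure_density[symmetric])
  finally show "emeasure (distr (density leb01 (\<lambda>x. ennreal (\<rho> x))) leb01 F) E = emeasure (density leb01 (push \<rho>)) E" .
qed simp

lemma push_eq_\<Phi>:
  assumes \<rho>: "\<And>x. 0 \<le> \<rho> x"
  shows "AE x in leb01. push \<rho> x = ennreal (\<rho> x) \<longleftrightarrow> \<Phi> (\<lambda>x. of_real (\<rho> x)) x = of_real (\<rho> x)"
proof -
  have "AE x in leb01. \<forall>r\<in>\<Lambda>. 0 < \<alpha> r x + \<theta> r" using \<alpha>_\<theta>_pos by (intro AE_finite_allI fin)
  then show ?thesis
  proof eventually_elim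
    case (elim x)
    let ?R = "\<Sum>r\<in>\<Lambda>. indicator {c r..d r} x * (\<alpha> r x + \<theta> r) * \<rho> (hb r x)"
    have nn: "0 \<le> indicator {c r..d r} x * (\<alpha> r x + \<theta> r)" if "r \<in> \<Lambda>" for r
      using elim that by (auto simp: indicator_def less_imp_le)
    have "push \<rho> x = (\<Sum>r\<in>\<Lambda>. ennreal (indicator {c r..d r} x * (\<alpha> r x + \<theta> r) * \<rho> (hb r x)))"
      unfolding push_def using nn \<rho> by (intro sum.cong refl ennreal_mult[symmetric])
    also have "\<dots> = ennreal ?R" by (rule sum_ennreal) (rule mult_nonneg_nonneg[OF nn \<rho>])
    finally have push: "push \<rho> x = ennreal ?R" .
    have "\<Phi> (\<lambda>x. of_real (\<rho> x)) x = of_real ?R"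
      unfolding \<Phi>_def G_def of_real_sum by (intro sum.cong) (auto simp: indicator_def)
    moreover have "0 \<le> ?R" by (rule sum_nonneg) (rule mult_nonneg_nonneg[OF nn \<rho>])
    ultimately show ?case unfolding push using \<rho> by (simp add: ennreal_inj del: of_real_sum sum_mult_indicator)
  qed
qed

text \<open>Densities with respect to Lebesgue measure are unique almost everywhere, so invariance
  becomes a fixed point equation. Pointwise nonnegativity of \<rho> prevents truncation by
  \<open>ennreal\<close>.\<close>

lemma acip_density_iff:
  assumes \<rho>: "\<rho> \<in> borel_measurable leb01" "\<And>x. 0 \<le> \<rho> x"
  shows "acip F (density leb01 (\<lambda>x. ennreal (\<rho> x))) \<longleftrightarrow>
    integrable leb01 \<rho> \<and> (LINT x|leb01. \<rho> x) = 1 \<and> (AE x in leb01. \<Phi> (\<lambda>x. of_real (\<rho> x)) x = of_real (\<rho> x))"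
proof -
  let ?\<mu> = "density leb01 (\<lambda>x. ennreal (\<rho> x))"
  have em: "emeasure ?\<mu> (space ?\<mu>) = (\<integral>\<^sup>+ x. ennreal (\<rho> x) \<partial>leb01)"
  proof -
    have "emeasure ?\<mu> (space leb01) = (\<integral>\<^sup>+ x. ennreal (\<rho> x) * indicator (space leb01) x \<partial>leb01)"
      using \<rho>(1) by (intro emeasure_density) auto
    also have "\<dots> = (\<integral>\<^sup>+ x. ennreal (\<rho> x) \<partial>leb01)" by (rule nn_integral_cong) simp
    finally show ?thesis by simp
  qed
  have "prob_space ?\<mu> \<longleftrightarrow> (\<integral>\<^sup>+ x. ennreal (\<rho> x) \<partial>leb01) = 1"
    using em by (auto intro: prob_spaceI dest: prob_space.emeasure_space_1)
  also have "\<dots> \<longleftrightarrow> integrable leb01 \<rho> \<and> (LINT x|leb01. \<rho> x) = 1"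
  proof (intro iffI)
    assume 1: "(\<integral>\<^sup>+ x. ennreal (\<rho> x) \<partial>leb01) = 1"
    then have "integrable leb01 \<rho>" using \<rho> by (intro integrableI_nonneg) auto
    then show "integrable leb01 \<rho> \<and> (LINT x|leb01. \<rho> x) = 1"
      using nn_integral_eq_integral[of leb01 \<rho>] 1 \<rho>(2) by (simp add: ennreal_eq_1)
  next
    assume "integrable leb01 \<rho> \<and> (LINT x|leb01. \<rho> x) = 1"
    then show "(\<integral>\<^sup>+ x. ennreal (\<rho> x) \<partial>leb01) = 1"
      using nn_integral_eq_integral[of leb01 \<rho>] \<rho>(2) by simp
  qed
  finally have prob: "prob_space ?\<mu> \<longleftrightarrow> integrable leb01 \<rho> \<and> (LINT x|leb01. \<rho> x) = 1" .
  have "distr ?\<mu> ?\<mu> F = distr ?\<mu> leb01 F" by (intro distr_cong) auto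
  also have "\<dots> = density leb01 (push \<rho>)" by (rule distr_density[OF \<rho>(1)])
  finally have "distr ?\<mu> ?\<mu> F = ?\<mu> \<longleftrightarrow> (AE x in leb01. push \<rho> x = ennreal (\<rho> x))"
    using leb01.density_unique_iff[OF push_measurable[OF \<rho>(1)], of "\<lambda>x. ennreal (\<rho> x)"] \<rho>(1) by simp
  also have "\<dots> \<longleftrightarrow> (AE x in leb01. \<Phi> (\<lambda>x. of_real (\<rho> x)) x = of_real (\<rho> x))"
    using push_eq_\<Phi>[of \<rho>, OF \<rho>(2)] by (intro eventually_subst) auto
  finally show ?thesis
    using prob F_measurable absolutely_continuousI_density[of "\<lambda>x. ennreal (\<rho> x)" leb01] \<rho>(1)
    by (simp add: acip_def conj_assoc)
qed

end

lemma Linf_norm_AE: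
  assumes "Linf_fun f"
  shows "0 \<le> Linf_norm f" "AE x in leb01. cmod (f x) \<le> Linf_norm f"
proof -
  let ?e = "esssup leb01 (\<lambda>x. ereal (cmod (f x)))"
  have AE: "AE x in leb01. ereal (cmod (f x)) \<le> ?e" by (rule esssup_AE)
  \<comment> \<open>A negative essential supremum would make the whole space null, contrary to total
    mass 1.\<close>
  have "0 \<le> ?e"
  proof (rule ccontr)
    assume neg: "\<not> 0 \<le> ?e"
    have "AE x in leb01. False"
      using AE
    proof eventually_elim
      case (elim x)
      have "0 \<le> ereal (cmod (f x))" by simp
      then have "0 \<le> ?e" using elim by (rule order_trans)
      then show False using neg by simp
    qed
    then show False by simp
  qed
  moreover have "?e < \<infinity>" using assms by (simp add: Linf_fun_def)
  ultimately obtain e where e: "?e = ereal e" "0 \<le> e" by (cases ?e) auto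
  show "0 \<le> Linf_norm f" using e by (simp add: Linf_norm_def)
  show "AE x in leb01. cmod (f x) \<le> Linf_norm f"
    using AE unfolding Linf_norm_def e(1) by simp
qed

section \<open>Choice of the smallness threshold and assembly\<close>

lemma eventually_pow_diff_less:
  fixes D E :: real
  assumes "0 < \<epsilon>"
  shows "eventually (\<lambda>x. K * ((D + x * E) ^ n - D ^ n) < \<epsilon>) (at_right 0)"
proof -
  have "((\<lambda>x. K * ((D + x * E) ^ n - D ^ n)) \<longlongrightarrow> K * ((D + 0 * E) ^ n - D ^ n)) (at_right 0)"
    by (intro tendsto_intros)
  then show ?thesis using assms by (intro order_tendstoD(2)) auto
qed

text \<open>At 0 all requirements hold with strict inequality, so they persist near 0; finiteness of
  \<Lambda> allows one \<delta> for all branches.\<close>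

lemma exists_small_perturbation:
  fixes \<theta> :: "nat \<Rightarrow> real"
  assumes fin: "finite \<Lambda>" and \<theta>: "\<And>r. r \<in> \<Lambda> \<Longrightarrow> 0 < \<theta> r" and \<rho>: "1 < \<rho>" and \<epsilon>: "0 < \<epsilon>"
  shows "\<exists>\<delta>>0. (\<forall>r\<in>\<Lambda>. \<delta> \<le> \<theta> r / 2 \<and> \<theta> r \<le> \<rho> * (\<theta> r - \<delta>)) \<and> K * ((D + \<delta> * E) ^ n - D ^ n) < \<epsilon>"
proof -
  have 1: "eventually (\<lambda>x. x \<le> \<theta> r / 2 \<and> \<theta> r \<le> \<rho> * (\<theta> r - x)) (at_right 0)" if r: "r \<in> \<Lambda>" for r
  proof -
    have "((\<lambda>x. \<rho> * (\<theta> r - x)) \<longlongrightarrow> \<rho> * (\<theta> r - 0)) (at_right 0)" by (intro tendsto_intros)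
    moreover have "\<theta> r < \<rho> * (\<theta> r - 0)" using \<rho> \<theta>[OF r] by simp
    ultimately have "eventually (\<lambda>x. \<theta> r < \<rho> * (\<theta> r - x)) (at_right 0)" by (rule order_tendstoD(1))
    moreover have "eventually (\<lambda>x::real. x < \<theta> r / 2) (at_right 0)"
      using \<theta>[OF r] by (intro order_tendstoD(2)[OF tendsto_ident_at]) auto
    ultimately show ?thesis by eventually_elim auto
  qed
  have "eventually (\<lambda>x. \<forall>r\<in>\<Lambda>. x \<le> \<theta> r / 2 \<and> \<theta> r \<le> \<rho> * (\<theta> r - x)) (at_right 0)"
    using 1 fin by (intro eventually_ball_finite) auto
  moreover have "eventually (\<lambda>x. K * ((D + x * E) ^ n - D ^ n) < \<epsilon>) (at_right 0)"
    by (rule eventually_pow_diff_less[OF \<epsilon>])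
  moreover have "eventually (\<lambda>x::real. 0 < x) (at_right 0)" by (rule eventually_at_right_less)
  ultimately have "eventually (\<lambda>x. 0 < x \<and> (\<forall>r\<in>\<Lambda>. x \<le> \<theta> r / 2 \<and> \<theta> r \<le> \<rho> * (\<theta> r - x)) \<and> K * ((D + x * E) ^ n - D ^ n) < \<epsilon>) (at_right 0)"
    by eventually_elim auto
  then show ?thesis by (auto dest: eventually_happens)
qed

context piecewise_map
begin

text \<open>The constants stay abstract here: \<open>small\<close> says that the tail is contracted
  by at least the factor \<open>1 / 2\<close> even after multiplication by the norm equivalence
  constant \<open>besov_const s\<close>.\<close>

lemma quasi_compact_and_acip:
  assumes p: "1 \<le> p" and q: "1 \<le> q" and s: "0 < s" "s < 1 / p" and n: "1 \<le> n"
    and \<rho>: "\<And>r. r \<in> \<Lambda> \<Longrightarrow> \<theta> r \<le> \<rho> * (\<theta> r - A r)" "\<rho> ^ n \<le> 2"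
    and B: "\<And>r. r \<in> \<Lambda> \<Longrightarrow> 0 \<le> B r"
      "\<And>r k. r \<in> \<Lambda> \<Longrightarrow> lev p k (\<lambda>x. of_real (\<alpha> r x)) \<le> B r * 2 powr (- (real k / p))"
    and small: "((2 powr (p - 1) * 8) powr (1 / p) * kernel_const p s * kap p s ^ n
        + besov_const s * ((MA p s + EC p s B) ^ n - MA p s ^ n)) * besov_const s \<le> 1 / 2"
  shows "quasi_compact_on (besov s p q) (besov_norm s p q) (transfer_op \<Lambda> \<alpha> \<theta> a c d) \<and>
    lasota_yorke (besov s p q) (besov_norm s p q) (transfer_op \<Lambda> \<alpha> \<theta> a c d) \<and>
    (\<exists>\<mu>. acip F \<mu>) \<and>
    (\<forall>\<mu> \<rho>. acip F \<mu> \<longrightarrow> \<rho> \<in> borel_measurable leb01 \<longrightarrow> (AE x in leb01. 0 \<le> \<rho> x) \<longrightarrow>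
       \<mu> = density leb01 (\<lambda>x. ennreal (\<rho> x)) \<longrightarrow> (\<lambda>x. complex_of_real (\<rho> x)) \<in> besov s p q)"
proof -
  let ?l = "(2 powr (p - 1) * 8) powr (1 / p) * kernel_const p s * kap p s ^ n
        + besov_const s * ((MA p s + EC p s B) ^ n - MA p s ^ n)"
  obtain C where C: "L1op \<Phi> C" using L1op_\<Phi> by blast
  have MA: "0 \<le> MA p s" by (rule MA_nonneg[OF s])
  have EC: "0 \<le> EC p s B" by (rule EC_nonneg[OF s B(1)])
  obtain n0 where n0: "1 \<le> n0" "\<And>f K. bl s p q f K \<Longrightarrow>
      bl s p q ((\<Phi> ^^ n) (\<lambda>x. f x - (\<Sum>i<n0. dpart i f x))) (?l * K)"
    using bl_\<Phi>_tail[OF p q s \<rho> B] by blast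
  have l: "0 \<le> ?l"
  proof (rule add_nonneg_nonneg)
    show "0 \<le> (2 powr (p - 1) * 8) powr (1 / p) * kernel_const p s * kap p s ^ n"
      using kernel_const_pos[OF s] by (simp add: kap_def)
    have "MA p s ^ n \<le> (MA p s + EC p s B) ^ n" using MA EC by (intro power_mono) auto
    then show "0 \<le> besov_const s * ((MA p s + EC p s B) ^ n - MA p s ^ n)"
      using besov_const_ge[OF s(1)] by (intro mult_nonneg_nonneg) auto
  qed
  interpret Q: qc_op p s "MA p s + EC p s B" C ?l q \<Phi> n n0
  proof
    show "0 \<le> MA p s + EC p s B" using MA EC by simp
    show "bl s p q (\<Phi> f) ((MA p s + EC p s B) * K)" if "bl s p q f K" for f K
      by (rule bl_\<Phi>[OF p q s that B])
    show "bl s p q ((\<Phi> ^^ n) (\<lambda>x. f x - (\<Sum>i<n0. dpart i f x))) (?l * K)" if "bl s p q f K" for f K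
      by (rule n0(2)[OF that])
    show "(LINT x|leb01. \<Phi> f x) = (LINT x|leb01. f x)" if "integrable leb01 f" for f
      by (rule \<Phi>_mass[OF that])
    show "AE x in leb01. cmod (\<Phi> f x) \<le> Re (\<Phi> g x)" if "AE x in leb01. cmod (f x) \<le> Re (g x)" for f g
      by (rule \<Phi>_dom[OF that])
  qed (rule p q s(1) C n n0(1) l small)+
  have "\<exists>\<mu>. acip F \<mu>"
  proof -
    obtain f where f: "integrable leb01 f" "AE x in leb01. \<Phi> f x = f x"
      "AE x in leb01. cmod (f x) \<le> Re (f x)" "(LINT x|leb01. f x) = 1"
      using Q.invariant_density by blast
    \<comment> \<open>A representative that is nonnegative everywhere, as
      \<open>acip_density_iff\<close> demands; \<open>f\<close> is real and nonnegative only almost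
      everywhere.\<close>
    let ?r = "\<lambda>x. max 0 (Re (f x))"
    have ri: "integrable leb01 ?r" using f(1) by (intro Bochner_Integration.integrable_max) auto
    have fr: "AE x in leb01. f x = of_real (?r x)"
      using f(3)
    proof eventually_elim
      case (elim x)
      have "0 \<le> Re (f x)" using elim norm_ge_zero order_trans by blast
      moreover have "(Re (f x))\<^sup>2 + (Im (f x))\<^sup>2 \<le> (Re (f x))\<^sup>2"
        using power_mono[OF elim, of 2] by (simp add: cmod_power2)
      ultimately show ?case by (simp add: complex_eq_iff)
    qed
    have rc: "integrable leb01 (\<lambda>x. complex_of_real (?r x))" using ri by simp
    have "AE x in leb01. \<Phi> f x = \<Phi> (\<lambda>x. of_real (?r x)) x" by (rule L1op_cong_AE[OF C f(1) rc fr])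
    with f(2) fr have "AE x in leb01. \<Phi> (\<lambda>x. of_real (?r x)) x = of_real (?r x)"
      by eventually_elim simp
    moreover have "(LINT x|leb01. ?r x) = 1"
    proof -
      have "complex_of_real (LINT x|leb01. ?r x) = (LINT x|leb01. complex_of_real (?r x))"
        by (rule integral_complex_of_real[symmetric])
      also have "\<dots> = (LINT x|leb01. f x)"
        using f(1) rc fr by (intro integral_cong_AE) (auto elim: eventually_mono)
      finally show ?thesis using f(4) by simp
    qed
    ultimately show ?thesis
      using acip_density_iff[of ?r] ri by (intro exI[of _ "density leb01 (\<lambda>x. ennreal (?r x))"]) auto
  qed
  moreover have "(\<lambda>x. complex_of_real (\<rho> x)) \<in> besov s p q"
    if \<mu>: "acip F \<mu>" "\<mu> = density leb01 (\<lambda>x. ennreal (\<rho> x))"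
      and \<rho>: "\<rho> \<in> borel_measurable leb01" "AE x in leb01. 0 \<le> \<rho> x" for \<mu> \<rho>
  proof -
    let ?r = "\<lambda>x. max 0 (\<rho> x)"
    have rm: "?r \<in> borel_measurable leb01" using \<rho>(1) by measurable
    have "(\<lambda>x. ennreal (\<rho> x)) = (\<lambda>x. ennreal (?r x))" by (auto simp: max_def ennreal_neg)
    from \<mu>(1)[unfolded \<mu>(2) this] have ri: "integrable leb01 ?r" and fixed: "AE x in leb01. \<Phi> (\<lambda>x. of_real (?r x)) x = of_real (?r x)"
      using acip_density_iff[OF rm] by auto
    have rc: "integrable leb01 (\<lambda>x. complex_of_real (?r x))" using ri by simp
    have "(\<lambda>x. complex_of_real (?r x)) \<in> besov s p q" by (rule Q.fixed_besov[OF rc fixed])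
    then obtain K where K: "bl s p q (\<lambda>x. complex_of_real (?r x)) K" using Q.besov_bl by blast
    have eq: "AE x in leb01. complex_of_real (?r x) = of_real (\<rho> x)"
      using \<rho>(2) by eventually_elim simp
    have "integrable leb01 (\<lambda>x. complex_of_real (\<rho> x))"
      using rc eq \<rho>(1) by (subst integrable_cong_AE[where g = "\<lambda>x. complex_of_real (?r x)"]) (auto elim: eventually_mono)
    then show ?thesis using bl_cong_AE[OF K _ eq] Q.besov_bl by blast
  qed
  ultimately show ?thesis
    unfolding transfer_op_eq using Q.quasi_compact Q.lasota_yorke by blast
qed

end

theorem theorem9p1:
  shows "\<exists>C>0. \<forall>(\<Lambda> :: nat set) (\<theta> :: nat \<Rightarrow> real) (a :: nat \<Rightarrow> real) (b :: nat \<Rightarrow> real).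
    finite \<Lambda> \<longrightarrow> (\<forall>r\<in>\<Lambda>. 0 < \<theta> r \<and> \<theta> r < 1) \<longrightarrow>
    interval_partition \<Lambda> a b \<longrightarrow> (\<forall>r\<in>\<Lambda>. (b r - a r) / \<theta> r < 1) \<longrightarrow>
    (\<forall>(p :: real) (p' :: real) (s :: real) (q :: ereal) (\<epsilon>\<^sub>0 :: real).
      1 < p \<longrightarrow> 1 / p + 1 / p' = 1 \<longrightarrow> 0 < s \<longrightarrow> s < 1 / p \<longrightarrow> 1 \<le> q \<longrightarrow> 0 < \<epsilon>\<^sub>0 \<longrightarrow>
      real (card \<Lambda>) powr (1 / p') * Max (\<theta> ` \<Lambda>) powr (1 / p' + s - \<epsilon>\<^sub>0) \<le> C \<longrightarrow>
      (\<exists>\<delta>>0. \<forall>(c :: nat \<Rightarrow> real) (d :: nat \<Rightarrow> real)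
                (\<alpha> :: nat \<Rightarrow> real \<Rightarrow> real) (F :: real \<Rightarrow> real).
        (\<forall>r\<in>\<Lambda>. 0 \<le> c r \<and> c r < d r \<and> d r \<le> 1 \<and> \<theta> r = (b r - a r) / (d r - c r)) \<longrightarrow>
        (\<forall>r\<in>\<Lambda>.
           (\<lambda>x. complex_of_real (\<alpha> r x)) \<in> besov (1 / p) p \<infinity> \<and>
           Linf_fun (\<lambda>x. complex_of_real (\<alpha> r x)) \<and>
           (LINT x|leb01. \<alpha> r x) = 0 \<and>
           Linf_norm (\<lambda>x. complex_of_real (\<alpha> r x)) < min (1 - \<theta> r) (\<theta> r) \<and>
           (\<forall>x\<in>{0..1} - {c r..d r}. \<alpha> r x = 0)) \<longrightarrow>
        is_piecewise_map \<Lambda> \<alpha> \<theta> a b c d F \<longrightarrow>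
        Max ((\<lambda>r. besov_norm (1 / p) p \<infinity> (\<lambda>x. complex_of_real (\<alpha> r x))
                 + Linf_norm (\<lambda>x. complex_of_real (\<alpha> r x))) ` \<Lambda>) < \<delta> \<longrightarrow>
        quasi_compact_on (besov s p q) (besov_norm s p q) (transfer_op \<Lambda> \<alpha> \<theta> a c d) \<and>
        lasota_yorke (besov s p q) (besov_norm s p q) (transfer_op \<Lambda> \<alpha> \<theta> a c d) \<and>
        (\<exists>\<mu>. acip F \<mu>) \<and>
        (\<forall>\<mu> \<rho>. acip F \<mu> \<longrightarrow> \<rho> \<in> borel_measurable leb01 \<longrightarrow> (AE x in leb01. 0 \<le> \<rho> x) \<longrightarrow>
           \<mu> = density leb01 (\<lambda>x. ennreal (\<rho> x)) \<longrightarrow>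
           (\<lambda>x. complex_of_real (\<rho> x)) \<in> besov s p q)))"
proof (rule exI[of _ "1 :: real"], rule conjI, simp, (rule allI)+, (rule impI)+, (rule allI)+, (rule impI)+)
  fix \<Lambda> :: "nat set" and \<theta> a b :: "nat \<Rightarrow> real" and p p' s \<epsilon>\<^sub>0 :: real and q :: ereal
  assume fin: "finite \<Lambda>" and \<theta>: "\<forall>r\<in>\<Lambda>. 0 < \<theta> r \<and> \<theta> r < 1" and part: "interval_partition \<Lambda> a b"
    and p1: "1 < p" and pp': "1 / p + 1 / p' = 1" and s: "0 < s" "s < 1 / p" and q: "1 \<le> q" and \<epsilon>\<^sub>0: "0 < \<epsilon>\<^sub>0"
    and hyp: "real (card \<Lambda>) powr (1 / p') * Max (\<theta> ` \<Lambda>) powr (1 / p' + s - \<epsilon>\<^sub>0) \<le> 1"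
  have p: "1 \<le> p" using p1 by simp
  have p': "1 / p' = 1 - 1 / p" using pp' by simp
  have ne: "\<Lambda> \<noteq> {}" using part by (auto simp: interval_partition_def)
  define m where "m = Max (\<theta> ` \<Lambda>)"
  have "m \<in> \<theta> ` \<Lambda>" unfolding m_def using fin ne by (intro Max_in) auto
  then have m: "0 < m" "m < 1" using \<theta> by auto
  define \<kappa> where "\<kappa> = real (card \<Lambda>) powr (1 - 1 / p) * m powr (1 - 1 / p + s)"
  have \<kappa>: "0 \<le> \<kappa>" "\<kappa> < 1"
  proof -
    show "0 \<le> \<kappa>" by (simp add: \<kappa>_def)
    \<comment> \<open>The hypothesis has its exponent lowered by \<open>\<epsilon>\<^sub>0\<close>;
      the factor \<open>m powr \<epsilon>\<^sub>0 < 1\<close> gained in return makes \<kappa>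
      strictly less than 1 although the bound 1 is not strict.\<close>
    have "\<kappa> = real (card \<Lambda>) powr (1 - 1 / p) * m powr (1 - 1 / p + s - \<epsilon>\<^sub>0) * m powr \<epsilon>\<^sub>0"
      by (simp add: \<kappa>_def mult.assoc flip: powr_add)
    also have "\<dots> \<le> 1 * m powr \<epsilon>\<^sub>0" using hyp unfolding p' m_def by (intro mult_right_mono) auto
    also have "\<dots> < 1" using m \<epsilon>\<^sub>0 powr_less_mono2[of \<epsilon>\<^sub>0 m 1] by simp
    finally show "\<kappa> < 1" .
  qed
  let ?c = "(2 powr (p - 1) * 8) powr (1 / p) * kernel_const p s"
  let ?bs = "besov_const s"
  have bs: "2 \<le> ?bs" by (rule besov_const_ge[OF s(1)])
  \<comment> \<open>\<open>qc_op\<close> allows \<open>1 / (2 * ?bs)\<close> for the contraction of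
    the tail; half of it is spent here on \<open>AA ^^ n\<close>, the other half is reserved for the
    perturbation.\<close>
  obtain n where n: "1 \<le> n" "?c * \<kappa> ^ n < 1 / (4 * ?bs)"
  proof -
    have "(\<lambda>n. ?c * \<kappa> ^ n) \<longlonglongrightarrow> ?c * 0" using \<kappa> by (intro tendsto_intros LIMSEQ_power_zero) auto
    then have "eventually (\<lambda>n. ?c * \<kappa> ^ n < 1 / (4 * ?bs)) sequentially"
      using bs by (intro order_tendstoD(2)) auto
    with eventually_ge_at_top[of 1] have "eventually (\<lambda>n. 1 \<le> n \<and> ?c * \<kappa> ^ n < 1 / (4 * ?bs)) sequentially"
      by eventually_elim simp
    then show thesis using that by (auto dest: eventually_happens)
  qed
  \<comment> \<open>Chosen so that the distortion allowed over \<open>n\<close> steps is exactly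
    2.\<close>
  define \<rho> where "\<rho> = (2 :: real) powr (1 / real n)"
  have \<rho>: "1 < \<rho>" "\<rho> ^ n = 2"
    using n(1) powr_less_mono[of 0 "1 / real n" 2] by (auto simp: \<rho>_def powr_realpow[symmetric] powr_powr)
  define g where "g r = (2 powr (p - 1) * (2 * (2 / \<theta> r))) powr (1 / p) * kernel_const p s" for r
  have g: "0 \<le> g r" for r using kernel_const_pos[OF s] by (simp add: g_def)
  define D where "D = (\<Sum>r\<in>\<Lambda>. \<theta> r * g r)"
  \<comment> \<open>Coefficient of \<delta> in the bound for \<open>EC\<close>: 2 belongs to the sup
    bound of \<alpha>, \<open>besov_const (1 / p)\<close> to the passage to its canonical
    coefficients. As \<delta> is fixed before \<alpha>, only \<theta>, \<open>p\<close> and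
    \<open>s\<close> may enter.\<close>
  define k where "k = 2 / (1 - 2 powr (- s)) + besov_const (1 / p) / (1 - 2 powr (- (1 / p - s)))"
  define E where "E = (\<Sum>r\<in>\<Lambda>. k * g r)"
  have D0: "0 \<le> D" unfolding D_def using \<theta> g by (intro sum_nonneg mult_nonneg_nonneg) (auto intro: less_imp_le)
  have pos: "0 < 1 - 2 powr (- s)" "0 < 1 - 2 powr (- (1 / p - s))" using s by (auto intro!: powr_less_one)
  obtain \<delta> where \<delta>: "0 < \<delta>" "\<And>r. r \<in> \<Lambda> \<Longrightarrow> \<delta> \<le> \<theta> r / 2 \<and> \<theta> r \<le> \<rho> * (\<theta> r - \<delta>)"
    "?bs * ((D + \<delta> * E) ^ n - D ^ n) < 1 / (4 * ?bs)"
  proof -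
    have "\<exists>\<delta>>0. (\<forall>r\<in>\<Lambda>. \<delta> \<le> \<theta> r / 2 \<and> \<theta> r \<le> \<rho> * (\<theta> r - \<delta>)) \<and> ?bs * ((D + \<delta> * E) ^ n - D ^ n) < 1 / (4 * ?bs)"
      using \<theta> bs by (intro exists_small_perturbation[OF fin _ \<rho>(1)]) auto
    then show thesis using that by blast
  qed
  show "\<exists>\<delta>>0. \<forall>(c :: nat \<Rightarrow> real) (d :: nat \<Rightarrow> real) (\<alpha> :: nat \<Rightarrow> real \<Rightarrow> real) (F :: real \<Rightarrow> real).
      (\<forall>r\<in>\<Lambda>. 0 \<le> c r \<and> c r < d r \<and> d r \<le> 1 \<and> \<theta> r = (b r - a r) / (d r - c r)) \<longrightarrow>
      (\<forall>r\<in>\<Lambda>.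
         (\<lambda>x. complex_of_real (\<alpha> r x)) \<in> besov (1 / p) p \<infinity> \<and>
         Linf_fun (\<lambda>x. complex_of_real (\<alpha> r x)) \<and>
         (LINT x|leb01. \<alpha> r x) = 0 \<and>
         Linf_norm (\<lambda>x. complex_of_real (\<alpha> r x)) < min (1 - \<theta> r) (\<theta> r) \<and>
         (\<forall>x\<in>{0..1} - {c r..d r}. \<alpha> r x = 0)) \<longrightarrow>
      is_piecewise_map \<Lambda> \<alpha> \<theta> a b c d F \<longrightarrow>
      Max ((\<lambda>r. besov_norm (1 / p) p \<infinity> (\<lambda>x. complex_of_real (\<alpha> r x))
               + Linf_norm (\<lambda>x. complex_of_real (\<alpha> r x))) ` \<Lambda>) < \<delta> \<longrightarrow>
      quasi_compact_on (besov s p q) (besov_norm s p q) (transfer_op \<Lambda> \<alpha> \<theta> a c d) \<and>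
      lasota_yorke (besov s p q) (besov_norm s p q) (transfer_op \<Lambda> \<alpha> \<theta> a c d) \<and>
      (\<exists>\<mu>. acip F \<mu>) \<and>
      (\<forall>\<mu> \<rho>. acip F \<mu> \<longrightarrow> \<rho> \<in> borel_measurable leb01 \<longrightarrow> (AE x in leb01. 0 \<le> \<rho> x) \<longrightarrow>
         \<mu> = density leb01 (\<lambda>x. ennreal (\<rho> x)) \<longrightarrow>
         (\<lambda>x. complex_of_real (\<rho> x)) \<in> besov s p q)"
  proof (rule exI[of _ \<delta>], rule conjI, rule \<delta>(1), (rule allI)+, (rule impI)+)
    fix c d :: "nat \<Rightarrow> real" and \<alpha> :: "nat \<Rightarrow> real \<Rightarrow> real" and F :: "real \<Rightarrow> real"
    assume cd: "\<forall>r\<in>\<Lambda>. 0 \<le> c r \<and> c r < d r \<and> d r \<le> 1 \<and> \<theta> r = (b r - a r) / (d r - c r)"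
      and \<alpha>: "\<forall>r\<in>\<Lambda>.
           (\<lambda>x. complex_of_real (\<alpha> r x)) \<in> besov (1 / p) p \<infinity> \<and>
           Linf_fun (\<lambda>x. complex_of_real (\<alpha> r x)) \<and>
           (LINT x|leb01. \<alpha> r x) = 0 \<and>
           Linf_norm (\<lambda>x. complex_of_real (\<alpha> r x)) < min (1 - \<theta> r) (\<theta> r) \<and>
           (\<forall>x\<in>{0..1} - {c r..d r}. \<alpha> r x = 0)"
      and F: "is_piecewise_map \<Lambda> \<alpha> \<theta> a b c d F"
      and small: "Max ((\<lambda>r. besov_norm (1 / p) p \<infinity> (\<lambda>x. complex_of_real (\<alpha> r x))
                 + Linf_norm (\<lambda>x. complex_of_real (\<alpha> r x))) ` \<Lambda>) < \<delta>"
    define A where "A r = Linf_norm (\<lambda>x. complex_of_real (\<alpha> r x))" for r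
    define N where "N r = besov_norm (1 / p) p \<infinity> (\<lambda>x. complex_of_real (\<alpha> r x))" for r
    define B where "B r = besov_const (1 / p) * N r" for r
    have p0: "0 < 1 / p" using p1 by simp
    have bp: "2 \<le> besov_const (1 / p)" by (rule besov_const_ge[OF p0])
    have A0: "0 \<le> A r" and A_AE: "AE x in leb01. \<bar>\<alpha> r x\<bar> \<le> A r"
      and N0: "0 \<le> N r" and \<alpha>m: "\<alpha> r \<in> borel_measurable leb01" if r: "r \<in> \<Lambda>" for r
    proof -
      have Li: "Linf_fun (\<lambda>x. complex_of_real (\<alpha> r x))" using \<alpha> r by blast
      show "0 \<le> A r" unfolding A_def by (rule Linf_norm_AE(1)[OF Li])
      show "AE x in leb01. \<bar>\<alpha> r x\<bar> \<le> A r" using Linf_norm_AE(2)[OF Li] unfolding A_def by simp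
      show "0 \<le> N r" unfolding N_def using \<alpha> r p by (intro besov_norm_nonneg) auto
      have "(\<lambda>x. complex_of_real (\<alpha> r x)) \<in> borel_measurable leb01" using Li by (simp add: Linf_fun_def)
      then have "(\<lambda>x. Re (complex_of_real (\<alpha> r x))) \<in> borel_measurable leb01" by measurable
      then show "\<alpha> r \<in> borel_measurable leb01" by simp
    qed
    have NA: "N r + A r < \<delta>" if r: "r \<in> \<Lambda>" for r
    proof -
      have "N r + A r \<le> Max ((\<lambda>r. N r + A r) ` \<Lambda>)" using fin r by (intro Max_ge) auto
      then show ?thesis using small unfolding N_def A_def by simp
    qed
    have A\<delta>: "A r \<le> \<delta>" and N\<delta>: "N r \<le> \<delta>" if r: "r \<in> \<Lambda>" for r
      using NA[OF r] N0[OF r] A0[OF r] by simp_all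
    interpret S: piecewise_map \<Lambda> \<theta> a b c d \<alpha> A F
    proof
      show "0 \<le> A r \<and> A r \<le> \<theta> r / 2" if "r \<in> \<Lambda>" for r
        using A0[OF that] A\<delta>[OF that] \<delta>(2)[OF that] by simp
    qed (use part cd \<theta> \<alpha> F \<alpha>m A_AE in auto)
    have B0: "0 \<le> B r" if "r \<in> \<Lambda>" for r using N0[OF that] bp by (simp add: B_def)
    have Bl: "lev p j (\<lambda>x. of_real (\<alpha> r x)) \<le> B r * 2 powr (- (real j / p))" if r: "r \<in> \<Lambda>" for r j
    proof -
      have "bl (1 / p) p \<infinity> (\<lambda>x. complex_of_real (\<alpha> r x)) (B r)"
        unfolding B_def N_def besov_const_def using \<alpha> r p0 p by (intro besov_imp_bl) auto
      then have "lev p j (\<lambda>x. of_real (\<alpha> r x)) \<le> B r * 2 powr (- (real j * (1 / p)))"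
        by (intro bl_lev_le[where q = \<infinity>]) auto
      then show ?thesis by simp
    qed
    have MA: "S.MA p s = D" unfolding S.MA_def S.Gc_def D_def g_def ..
    have EC: "S.EC p s B \<le> \<delta> * E"
    proof -
      have "S.EC p s B \<le> (\<Sum>r\<in>\<Lambda>. \<delta> * (k * g r))"
        unfolding S.EC_def S.Gc_def g_def[symmetric]
      proof (rule sum_mono)
        fix r assume r: "r \<in> \<Lambda>"
        have "2 * A r / (1 - 2 powr (- s)) \<le> 2 * \<delta> / (1 - 2 powr (- s))"
          using A\<delta>[OF r] pos by (intro divide_right_mono) auto
        moreover have "B r / (1 - 2 powr (- (1 / p - s))) \<le> besov_const (1 / p) * \<delta> / (1 - 2 powr (- (1 / p - s)))"
          unfolding B_def using N\<delta>[OF r] pos bp by (intro divide_right_mono mult_left_mono) auto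
        ultimately have "2 * A r / (1 - 2 powr (- s)) + B r / (1 - 2 powr (- (1 / p - s))) \<le> \<delta> * k"
          unfolding k_def by (simp add: distrib_left mult.commute)
        then show "(2 * A r / (1 - 2 powr (- s)) + B r / (1 - 2 powr (- (1 / p - s)))) * g r \<le> \<delta> * (k * g r)"
          unfolding mult.assoc[symmetric] using g by (intro mult_right_mono) auto
      qed
      then show ?thesis by (simp add: E_def sum_distrib_left)
    qed
    have kap: "S.kap p s = \<kappa>" unfolding S.kap_def \<kappa>_def m_def ..
    have "(D + S.EC p s B) ^ n \<le> (D + \<delta> * E) ^ n"
      using EC D0 S.EC_nonneg[OF s B0] by (intro power_mono) auto
    then have "?bs * ((D + S.EC p s B) ^ n - D ^ n) \<le> ?bs * ((D + \<delta> * E) ^ n - D ^ n)"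
      using bs by (intro mult_left_mono) auto
    then have "?c * \<kappa> ^ n + ?bs * ((D + S.EC p s B) ^ n - D ^ n) \<le> 1 / (4 * ?bs) + 1 / (4 * ?bs)"
      using n(2) \<delta>(3) by linarith
    then have "(?c * \<kappa> ^ n + ?bs * ((D + S.EC p s B) ^ n - D ^ n)) * ?bs \<le> (1 / (4 * ?bs) + 1 / (4 * ?bs)) * ?bs"
      using bs by (intro mult_right_mono) auto
    also have "\<dots> = 1 / 2" using bs by simp
    finally have fin_small: "(?c * S.kap p s ^ n + ?bs * ((S.MA p s + S.EC p s B) ^ n - S.MA p s ^ n)) * ?bs \<le> 1 / 2"
      unfolding kap MA .
    have \<rho>A: "\<theta> r \<le> \<rho> * (\<theta> r - A r)" if "r \<in> \<Lambda>" for r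
    proof -
      have "\<rho> * (\<theta> r - \<delta>) \<le> \<rho> * (\<theta> r - A r)" using \<rho>(1) A\<delta>[OF that] by (intro mult_left_mono) auto
      then show ?thesis using \<delta>(2)[OF that] by linarith
    qed
    show "quasi_compact_on (besov s p q) (besov_norm s p q) (transfer_op \<Lambda> \<alpha> \<theta> a c d) \<and>
      lasota_yorke (besov s p q) (besov_norm s p q) (transfer_op \<Lambda> \<alpha> \<theta> a c d) \<and>
      (\<exists>\<mu>. acip F \<mu>) \<and>
      (\<forall>\<mu> \<rho>. acip F \<mu> \<longrightarrow> \<rho> \<in> borel_measurable leb01 \<longrightarrow> (AE x in leb01. 0 \<le> \<rho> x) \<longrightarrow>
         \<mu> = density leb01 (\<lambda>x. ennreal (\<rho> x)) \<longrightarrow>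
         (\<lambda>x. complex_of_real (\<rho> x)) \<in> besov s p q)"
      by (rule S.quasi_compact_and_acip[OF p q s n(1) \<rho>A _ B0 Bl fin_small]) (simp_all add: \<rho>(2))
  qed
qed

end
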